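(* Let $(M=\Gamma\backslash G,J)$ be a nilmanifold of complex dimension $k$ with an invariant complex structure $J$ determined by a basis $\{\eta^1,\dots,\eta^k\}$ of invariant $(1,0)$-forms such that $$d\eta^j=0\quad (j\in\{1,\dots,k-1\}),\qquad d\eta^k\in\mathrm{Span}_{\mathbb C}\langle\eta^{jl},\eta^{j\overline l}\rangle_{j,l=1}^{k-1}.$$ Suppose there exist forms $\alpha=\eta^{i_1\dots i_p\overline j_1\dots\overline j_q}\in\bigwedge^{p,q}\mathfrak g_{\mathbb C}^*$ and $\beta=\eta^{l_1\dots l_r\overline m_1\dots\overline m_s}\in\bigwedge^{r,s}\mathfrak g_{\mathbb C}^*$, and a unique (up to constant) form $\tilde\gamma=c\,\eta^{t_1\dots t_{p+r-2}\overline v_1\dots\overline v_{q+s-2}}\in\bigwedge^{p+r-2,q+s-2}\mathfrak g_{\mathbb C}^*$, $c\in\mathbb C\setminus\{0\}$, such that (1) $\alpha$ and $\beta$ are Bott-Chern harmonic and $\alpha\wedge\beta\neq0$; (2) $\eta^{k\overline k}\wedge\tilde\gamma$ is a $\partial\overline\partial$-primitive of $\alpha\wedge\beta$ up to sign, i.e. $(-1)^{p+q}\alpha\wedge\beta=\partial\overline\partial(\eta^{k\overline k}\wedge\tilde\gamma)=\partial\overline\partial(\eta^{k\overline k})\wedge\tilde\gamma$, and $\tilde\gamma\wedge\beta\neq0$. Then $(M,J)$ admits a non vanishing $ABC$-Massey product, given by $\langle[\alpha]_{BC},[\beta]_{BC},[\beta]_{BC}\rangle_{ABC}$.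
   Context: A nilmanifold is a compact quotient $M=\Gamma\backslash G$ of a simply connected nilpotent Lie group $G$ with Lie algebra $\mathfrak g$ by a lattice $\Gamma$; invariant objects are those induced from left-invariant ones on $G$. $\bigwedge^{p,q}\mathfrak g^*_{\mathbb C}$ is the space of invariant $(p,q)$-forms. Notation: $\eta^{\overline j}=\overline{\eta^j}$, and $\eta^{i_1\dots i_p\overline j_1\dots\overline j_q}=\eta^{i_1}\wedge\dots\wedge\eta^{i_p}\wedge\eta^{\overline j_1}\wedge\dots\wedge\eta^{\overline j_q}$. Fix the invariant Hermitian metric $g$ with fundamental form $\omega=\frac i2\sum_{j=1}^k\eta^{j\overline j}$. Bott-Chern harmonic is meant with respect to $g$: a $(p,q)$-form $\alpha$ is Bott-Chern harmonic if $d\alpha=0$ and $\partial\overline\partial*_g\alpha=0$. Uniqueness of $\tilde\gamma$ up to constant means: up to a constant, $\tilde\gamma$ is the only $\varphi\in\bigwedge^{p+r-2,q+s-2}\mathfrak g_{\mathbb C}^*$ with $0\neq\partial\overline\partial(\eta^{k\overline k})\wedge\varphi\in\mathrm{Span}_{\mathbb C}\langle\alpha\wedge\beta\rangle$. Triple $ABC$-Massey products: on a compact complex manifold, let $H_{BC}^{p,q}(M)=\frac{\ker\partial\cap\ker\overline\partial}{\mathrm{Im}\,\partial\overline\partial}$ and $H_A^{p,q}(M)=\frac{\ker\partial\overline\partial}{\mathrm{Im}\,\partial+\mathrm{Im}\,\overline\partial}$ in bidegree $(p,q)$; $H_A$ is an $H_{BC}$-module via wedge. If $[a]\in H_{BC}^{p,q}(M)$,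 $[b]\in H_{BC}^{r,s}(M)$, $[c]\in H_{BC}^{u,v}(M)$ satisfy $a\wedge b=(-1)^{p+q}\partial\overline\partial f_{ab}$ and $b\wedge c=(-1)^{r+s}\partial\overline\partial f_{bc}$, then $$\langle[a],[b],[c]\rangle_{ABC}=\big[(-1)^{p+q}a\wedge f_{bc}-(-1)^{r+s}f_{ab}\wedge c\big]\in\frac{H_A^{p+r+u-1,q+s+v-1}(M)}{[a]\cup H_A^{r+u-1,s+v-1}(M)+[c]\cup H_A^{p+r-1,q+s-1}(M)};$$ it is non vanishing if it is nonzero in this quotient. *)

theory Defs
  imports
    "HOL-Analysis.Analysis"
    "HOL-Algebra.Coset"
    "HOL-Algebra.Generated_Groups"
    "HOL-Library.Function_Algebras"
begin

section \<open>Smooth structures\<close>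

text \<open>Meant for open \<open>S\<close>: the map \<open>f\<close> is of class \<open>C\<^sup>n\<close>, resp. \<open>C\<^sup>\<infinity>\<close>, on \<open>S\<close>.\<close>

primrec Ck_on ::
  "nat \<Rightarrow> ('a::euclidean_space \<Rightarrow> 'b::real_normed_vector) \<Rightarrow> 'a set \<Rightarrow> bool" where
  "Ck_on 0 f S \<longleftrightarrow> continuous_on S f"
| "Ck_on (Suc n) f S \<longleftrightarrow> (\<forall>x\<in>S. f differentiable (at x)) \<and>
     (\<forall>v. Ck_on n (\<lambda>x. frechet_derivative f (at x) v) S)"

definition smooth_on :: "('a::euclidean_space \<Rightarrow> 'b::real_normed_vector) \<Rightarrow> 'a set \<Rightarrow> bool" where
  "smooth_on f S \<longleftrightarrow> (\<forall>n. Ck_on n f S)"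

type_synonym ('g, 'e) atlas = "('g set \<times> ('g \<Rightarrow> 'e)) set"

definition smooth_atlas :: "('g::topological_space, 'e::euclidean_space) atlas \<Rightarrow> bool" where
  "smooth_atlas \<A> \<longleftrightarrow>
     (\<Union>(U, \<phi>)\<in>\<A>. U) = UNIV \<and>
     (\<forall>(U, \<phi>)\<in>\<A>. open U \<and> open (\<phi> ` U) \<and> homeomorphism U (\<phi> ` U) \<phi> (inv_into U \<phi>)) \<and>
     (\<forall>(U, \<phi>)\<in>\<A>. \<forall>(V, \<psi>)\<in>\<A>. smooth_on (\<psi> \<circ> inv_into U \<phi>) (\<phi> ` (U \<inter> V)))"

definition smooth_functions :: "('g, 'e::euclidean_space) atlas \<Rightarrow> ('g \<Rightarrow> complex) set" where
  "smooth_functions \<A> = {f. \<forall>(U, \<phi>)\<in>\<A>. smooth_on (f \<circ> inv_into U \<phi>) (\<phi> ` U)}"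


section \<open>Lie groups, lattices, nilmanifolds\<close>

definition lie_group ::
  "('g::{t2_space,second_countable_topology}) monoid \<Rightarrow> ('g, 'e::euclidean_space) atlas \<Rightarrow> bool" where
  "lie_group G \<A> \<longleftrightarrow>
     group G \<and> carrier G = UNIV \<and> smooth_atlas \<A> \<and>
     continuous_on UNIV (\<lambda>(a, b). a \<otimes>\<^bsub>G\<^esub> b) \<and> continuous_on UNIV (\<lambda>a. inv\<^bsub>G\<^esub> a) \<and>
     (\<forall>(U, \<phi>)\<in>\<A>. \<forall>(V, \<psi>)\<in>\<A>. \<forall>(W, \<xi>)\<in>\<A>.
        smooth_on (\<lambda>(x, y). \<xi> (inv_into U \<phi> x \<otimes>\<^bsub>G\<^esub> inv_into V \<psi> y))
          {(x, y). x \<in> \<phi> ` U \<and> y \<in> \<psi> ` V \<and> inv_into U \<phi> x \<otimes>\<^bsub>G\<^esub> inv_into V \<psi> y \<in> W}) \<and>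
     (\<forall>(U, \<phi>)\<in>\<A>. \<forall>(W, \<xi>)\<in>\<A>.
        smooth_on (\<lambda>x. \<xi> (inv\<^bsub>G\<^esub> (inv_into U \<phi> x)))
          {x \<in> \<phi> ` U. inv\<^bsub>G\<^esub> (inv_into U \<phi> x) \<in> W})"

primrec lower_central_series :: "('g, 'b) monoid_scheme \<Rightarrow> nat \<Rightarrow> 'g set" where
  "lower_central_series G 0 = carrier G"
| "lower_central_series G (Suc n) = generate G
     {a \<otimes>\<^bsub>G\<^esub> b \<otimes>\<^bsub>G\<^esub> inv\<^bsub>G\<^esub> a \<otimes>\<^bsub>G\<^esub> inv\<^bsub>G\<^esub> b | a b. a \<in> lower_central_series G n \<and> b \<in> carrier G}"

definition nilpotent_group :: "('g, 'b) monoid_scheme \<Rightarrow> bool" where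
  "nilpotent_group G \<longleftrightarrow> (\<exists>n. lower_central_series G n = {\<one>\<^bsub>G\<^esub>})"

text \<open>The points of the quotient of \<open>G\<close> by left translations by \<open>\<Gamma>\<close> are the cosets \<open>\<Gamma> x\<close>; the
  preimage in \<open>G\<close> of a set \<open>V\<close> of such cosets is \<open>\<Union>V\<close>.\<close>

definition quotient_topology :: "('g::topological_space) monoid \<Rightarrow> 'g set \<Rightarrow> 'g set topology" where
  "quotient_topology G \<Gamma> = topology (\<lambda>V. V \<subseteq> rcosets\<^bsub>G\<^esub> \<Gamma> \<and> open (\<Union>V))"

definition lattice_subgroup :: "('g::topological_space) monoid \<Rightarrow> 'g set \<Rightarrow> bool" where
  "lattice_subgroup G \<Gamma> \<longleftrightarrow>
     subgroup \<Gamma> G \<and> (\<exists>U. open U \<and> U \<inter> \<Gamma> = {\<one>\<^bsub>G\<^esub>}) \<and> compact_space (quotient_topology G \<Gamma>)"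

definition nilmanifold ::
  "('g::{t2_space,second_countable_topology}) monoid \<Rightarrow> ('g, 'e::euclidean_space) atlas \<Rightarrow>
   'g set \<Rightarrow> bool" where
  "nilmanifold G \<A> \<Gamma> \<longleftrightarrow>
     lie_group G \<A> \<and> simply_connected (UNIV :: 'g set) \<and> nilpotent_group G \<and> lattice_subgroup G \<Gamma>"


section \<open>Vector fields and differential forms\<close>

text \<open>Below, \<open>A\<close> is the algebra of smooth complex valued functions of a manifold. Functions carry
  the pointwise ring operations. A (complex) vector field is a complex linear derivation of \<open>A\<close>,
  extended by \<open>0\<close> outside \<open>A\<close>. A form of degree \<open>n\<close> is an \<open>A\<close>-multilinear alternating map on lists
  of \<open>n\<close> vector fields, extended by \<open>0\<close> to all other lists; in particular the degree need not be
  recorded, and a general element of the form type stands for an inhomogeneous form.\<close>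

type_synonym 'm vf = "('m \<Rightarrow> complex) \<Rightarrow> ('m \<Rightarrow> complex)"
type_synonym 'm form = "'m vf list \<Rightarrow> ('m \<Rightarrow> complex)"

definition vector_fields :: "('m \<Rightarrow> complex) set \<Rightarrow> 'm vf set" where
  "vector_fields A = {X.
     (\<forall>f\<in>A. X f \<in> A) \<and> (\<forall>f. f \<notin> A \<longrightarrow> X f = 0) \<and>
     (\<forall>f\<in>A. \<forall>g\<in>A. X (f + g) = X f + X g) \<and>
     (\<forall>f\<in>A. \<forall>c. X (\<lambda>x. c * f x) = (\<lambda>x. c * X f x)) \<and>
     (\<forall>f\<in>A. \<forall>g\<in>A. X (f * g) = f * X g + g * X f)}"

definition vf_mult :: "('m \<Rightarrow> complex) \<Rightarrow> 'm vf \<Rightarrow> 'm vf" where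
  "vf_mult f X = (\<lambda>g. f * X g)"

definition vf_conj :: "'m vf \<Rightarrow> 'm vf" where
  "vf_conj X = (\<lambda>f x. cnj (X (\<lambda>y. cnj (f y)) x))"

definition lie_bracket :: "'m vf \<Rightarrow> 'm vf \<Rightarrow> 'm vf" where
  "lie_bracket X Y = (\<lambda>f. X (Y f) - Y (X f))"

definition forms :: "('m \<Rightarrow> complex) set \<Rightarrow> nat \<Rightarrow> 'm form set" where
  "forms A n = {\<omega>.
     (\<forall>Xs. set Xs \<subseteq> vector_fields A \<and> length Xs = n \<longrightarrow> \<omega> Xs \<in> A) \<and>
     (\<forall>Xs. \<not> (set Xs \<subseteq> vector_fields A \<and> length Xs = n) \<longrightarrow> \<omega> Xs = 0) \<and>
     (\<forall>Xs i. set Xs \<subseteq> vector_fields A \<and> length Xs = n \<and> i < n \<longrightarrow>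
        (\<forall>Y\<in>vector_fields A. \<forall>Z\<in>vector_fields A.
           \<omega> (Xs[i := Y + Z]) = \<omega> (Xs[i := Y]) + \<omega> (Xs[i := Z])) \<and>
        (\<forall>Y\<in>vector_fields A. \<forall>f\<in>A. \<omega> (Xs[i := vf_mult f Y]) = f * \<omega> (Xs[i := Y]))) \<and>
     (\<forall>Xs i j. set Xs \<subseteq> vector_fields A \<and> length Xs = n \<and> i < j \<and> j < n \<and> Xs ! i = Xs ! j \<longrightarrow>
        \<omega> Xs = 0)}"

definition cscale :: "complex \<Rightarrow> 'm form \<Rightarrow> 'm form" where
  "cscale c \<omega> = (\<lambda>Xs x. c * \<omega> Xs x)"

global_interpretation form: vector_space "cscale :: complex \<Rightarrow> 'm form \<Rightarrow> 'm form"
  by standard (auto simp: cscale_def fun_eq_iff algebra_simps)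

definition form_conj :: "'m form \<Rightarrow> 'm form" where
  "form_conj \<omega> = (\<lambda>Xs x. cnj (\<omega> (map vf_conj Xs) x))"

text \<open>Sum over all \<open>(n, m)\<close>-shuffles, where \<open>S\<close> is the set of positions handed to the first factor;
  thus \<open>(\<alpha> \<and> \<beta>)(X, Y) = \<alpha>(X) \<beta>(Y) - \<alpha>(Y) \<beta>(X)\<close> for 1-forms.\<close>

definition wedge :: "'m form \<Rightarrow> 'm form \<Rightarrow> 'm form"  (infixr "\<and>\<^sub>w" 72) where
  "\<omega> \<and>\<^sub>w \<theta> = (\<lambda>Xs. \<Sum>S\<in>Pow {..<length Xs}.
     (- 1) ^ card {(i, j). i \<in> S \<and> j \<notin> S \<and> j < i} * \<omega> (nths Xs S) * \<theta> (nths Xs (- S)))"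

definition form_one :: "'m form" where
  "form_one = (\<lambda>Xs. if Xs = [] then 1 else 0)"

definition wedge_list :: "'m form list \<Rightarrow> 'm form" where
  "wedge_list \<omega>s = foldr wedge \<omega>s form_one"

text \<open>Koszul's formula for the exterior derivative.\<close>

definition ext_d :: "('m \<Rightarrow> complex) set \<Rightarrow> 'm form \<Rightarrow> 'm form" where
  "ext_d A \<omega> = (\<lambda>Xs. if set Xs \<subseteq> vector_fields A then
     (\<Sum>i<length Xs. (- 1) ^ i * (Xs ! i) (\<omega> (nths Xs (- {i})))) +
     (\<Sum>(i, j)\<in>{(i, j). i < j \<and> j < length Xs}.
        (- 1) ^ (i + j) * \<omega> (lie_bracket (Xs ! i) (Xs ! j) # nths Xs (- {i, j})))
     else 0)"


section \<open>Complex structures and bidegrees\<close>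

text \<open>\<open>J\<close> is extended complex linearly to complex vector fields; it commutes with conjugation
  because it comes from an endomorphism of the real tangent bundle. The last condition is the
  vanishing of the Nijenhuis tensor.\<close>

definition complex_structure :: "('m \<Rightarrow> complex) set \<Rightarrow> ('m vf \<Rightarrow> 'm vf) \<Rightarrow> bool" where
  "complex_structure A J \<longleftrightarrow>
     (\<forall>X\<in>vector_fields A. J X \<in> vector_fields A \<and> J (J X) = - X \<and> J (vf_conj X) = vf_conj (J X)) \<and>
     (\<forall>X\<in>vector_fields A. \<forall>Y\<in>vector_fields A. J (X + Y) = J X + J Y) \<and>
     (\<forall>X\<in>vector_fields A. \<forall>f\<in>A. J (vf_mult f X) = vf_mult f (J X)) \<and>
     (\<forall>X\<in>vector_fields A. \<forall>Y\<in>vector_fields A.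
        lie_bracket (J X) (J Y) - J (lie_bracket (J X) Y) - J (lie_bracket X (J Y))
          - lie_bracket X Y = 0)"

definition proj10 :: "('m vf \<Rightarrow> 'm vf) \<Rightarrow> 'm vf \<Rightarrow> 'm vf" where
  "proj10 J X = (\<lambda>f x. (X f x - \<i> * J X f x) / 2)"

definition proj01 :: "('m vf \<Rightarrow> 'm vf) \<Rightarrow> 'm vf \<Rightarrow> 'm vf" where
  "proj01 J X = (\<lambda>f x. (X f x + \<i> * J X f x) / 2)"

text \<open>The component of bidegree \<open>(p, q)\<close> of a form. Bidegrees are integers, so that shifted
  bidegrees may become negative; the component is then \<open>0\<close>.\<close>

definition bicomponent ::
  "('m \<Rightarrow> complex) set \<Rightarrow> ('m vf \<Rightarrow> 'm vf) \<Rightarrow> int \<Rightarrow> int \<Rightarrow> 'm form \<Rightarrow> 'm form" where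
  "bicomponent A J p q \<omega> = (\<lambda>Xs.
     if set Xs \<subseteq> vector_fields A \<and> int (length Xs) = p + q then
       \<Sum>S\<in>{S. S \<subseteq> {..<length Xs} \<and> int (card S) = p}.
         \<omega> (map (\<lambda>i. if i \<in> S then proj10 J (Xs ! i) else proj01 J (Xs ! i)) [0..<length Xs])
     else 0)"

text \<open>On forms of bidegree \<open>(p, q)\<close>, \<open>\<partial>\<close> is the \<open>(p+1, q)\<close>-component of \<open>d\<close> and \<open>\<partial>\<close>-bar is the
  \<open>(p, q+1)\<close>-component; this is extended additively to inhomogeneous forms. On a list of \<open>n\<close> vector
  fields only the components with \<open>p + q + 1 = n\<close> contribute.\<close>

definition del :: "('m \<Rightarrow> complex) set \<Rightarrow> ('m vf \<Rightarrow> 'm vf) \<Rightarrow> 'm form \<Rightarrow> 'm form" where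
  "del A J \<omega> = (\<lambda>Xs. \<Sum>p<length Xs. let q = int (length Xs) - 1 - int p in
     bicomponent A J (int p + 1) q (ext_d A (bicomponent A J (int p) q \<omega>)) Xs)"

definition delbar :: "('m \<Rightarrow> complex) set \<Rightarrow> ('m vf \<Rightarrow> 'm vf) \<Rightarrow> 'm form \<Rightarrow> 'm form" where
  "delbar A J \<omega> = (\<lambda>Xs. \<Sum>p<length Xs. let q = int (length Xs) - 1 - int p in
     bicomponent A J (int p) (q + 1) (ext_d A (bicomponent A J (int p) q \<omega>)) Xs)"

text \<open>\<open>\<Omega> n\<close> is a given space of forms of degree \<open>n\<close>.\<close>

definition biforms ::
  "('m \<Rightarrow> complex) set \<Rightarrow> ('m vf \<Rightarrow> 'm vf) \<Rightarrow> (nat \<Rightarrow> 'm form set) \<Rightarrow> int \<Rightarrow> int \<Rightarrow> 'm form set" where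
  "biforms A J \<Omega> p q = {\<omega> \<in> \<Omega> (nat (p + q)). bicomponent A J p q \<omega> = \<omega>}"


section \<open>Invariant forms\<close>

text \<open>The push-forward of \<open>X\<close> under the left translation \<open>x \<mapsto> a x\<close>.\<close>

definition vf_translate :: "'g monoid \<Rightarrow> 'g \<Rightarrow> 'g vf \<Rightarrow> 'g vf" where
  "vf_translate G a X = (\<lambda>f x. X (\<lambda>y. f (a \<otimes>\<^bsub>G\<^esub> y)) (inv\<^bsub>G\<^esub> a \<otimes>\<^bsub>G\<^esub> x))"

text \<open>The forms on \<open>G\<close> that are invariant under left translations by the elements of \<open>H\<close>.
  For \<open>H = carrier G\<close> these are the left-invariant forms. For a lattice \<open>H = \<Gamma>\<close> they are, by pull-back
  along the covering from \<open>G\<close> onto its quotient, the differential forms on the quotient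
  manifold: this is how forms on the quotient are represented here. The pull-back is compatible with
  \<open>d\<close>, wedge products, conjugation and types, so that these are computed on \<open>G\<close>; the inclusion of
  the left-invariant forms into the \<open>\<Gamma>\<close>-invariant ones is the passage from left-invariant forms on
  \<open>G\<close> to invariant forms on the nilmanifold.\<close>

definition invariant_forms ::
  "('g \<Rightarrow> complex) set \<Rightarrow> 'g monoid \<Rightarrow> 'g set \<Rightarrow> nat \<Rightarrow> 'g form set" where
  "invariant_forms A G H n = {\<omega> \<in> forms A n. \<forall>a\<in>H. \<forall>Xs. set Xs \<subseteq> vector_fields A \<longrightarrow>
     \<omega> (map (vf_translate G a) Xs) = (\<lambda>x. \<omega> Xs (inv\<^bsub>G\<^esub> a \<otimes>\<^bsub>G\<^esub> x))}"

definition invariant_complex_structure ::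
  "('g \<Rightarrow> complex) set \<Rightarrow> 'g monoid \<Rightarrow> ('g vf \<Rightarrow> 'g vf) \<Rightarrow> bool" where
  "invariant_complex_structure A G J \<longleftrightarrow> complex_structure A J \<and>
     (\<forall>a\<in>carrier G. \<forall>X\<in>vector_fields A. J (vf_translate G a X) = vf_translate G a (J X))"

text \<open>The form \<open>\<eta>\<close> with upper indices \<open>is\<close> followed by barred indices \<open>js\<close>.\<close>

definition eta_monomial :: "(nat \<Rightarrow> 'm form) \<Rightarrow> nat list \<Rightarrow> nat list \<Rightarrow> 'm form" where
  "eta_monomial \<eta> is js = wedge_list (map \<eta> is @ map (\<lambda>j. form_conj (\<eta> j)) js)"


section \<open>Hermitian metrics and Bott-Chern harmonic forms\<close>

definition fundamental_form :: "nat \<Rightarrow> (nat \<Rightarrow> 'm form) \<Rightarrow> 'm form" where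
  "fundamental_form k \<eta> = cscale (\<i> / 2) (\<Sum>j=1..k. \<eta> j \<and>\<^sub>w form_conj (\<eta> j))"

text \<open>The metric is \<open>g(X, Y) = \<omega>(X, J Y)\<close>, extended complex bilinearly.\<close>

definition metric :: "('m vf \<Rightarrow> 'm vf) \<Rightarrow> 'm form \<Rightarrow> 'm vf \<Rightarrow> 'm vf \<Rightarrow> ('m \<Rightarrow> complex)" where
  "metric J \<omega> X Y = \<omega> [X, J Y]"

definition flat ::
  "('m \<Rightarrow> complex) set \<Rightarrow> ('m vf \<Rightarrow> 'm vf) \<Rightarrow> 'm form \<Rightarrow> 'm vf \<Rightarrow> 'm form" where
  "flat A J \<omega> X = (\<lambda>Ys. if length Ys = 1 \<and> set Ys \<subseteq> vector_fields A then metric J \<omega> X (Ys ! 0) else 0)"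

definition volume_form :: "nat \<Rightarrow> 'm form \<Rightarrow> 'm form" where
  "volume_form k \<omega> = cscale (1 / fact k) (wedge_list (replicate k \<omega>))"

text \<open>\<open>\<theta>\<close> is the (complex linear) Hodge star of the \<open>n\<close>-form \<open>\<beta>\<close> in complex dimension \<open>k\<close>. This
  is \<open>\<alpha> \<and> *\<beta> = g(\<alpha>, \<beta>) vol\<close> for all \<open>\<alpha>\<close> of degree \<open>n\<close>, where it suffices to
  take \<open>\<alpha>\<close> to be a product of 1-forms \<open>g(X\<^sub>i, -)\<close>, and where for such a product \<open>g(\<alpha>, \<beta>)\<close> equals
  \<open>\<beta>(X\<^sub>1, ..., X\<^sub>n)\<close> (for \<open>\<beta>\<close> a product of \<open>g(Y\<^sub>j, -)\<close> both are \<open>det (g(X\<^sub>i, Y\<^sub>j))\<close>). With the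
  antilinear star instead, \<open>*\<beta>\<close> is replaced by the star of the conjugate of \<open>\<beta>\<close>, and
  harmonicity is unaffected up to conjugation.\<close>

definition is_hodge_star ::
  "('m \<Rightarrow> complex) set \<Rightarrow> ('m vf \<Rightarrow> 'm vf) \<Rightarrow> nat \<Rightarrow> 'm form \<Rightarrow> nat \<Rightarrow> 'm form \<Rightarrow> 'm form \<Rightarrow> bool" where
  "is_hodge_star A J k \<omega> n \<beta> \<theta> \<longleftrightarrow> \<theta> \<in> forms A (2 * k - n) \<and>
     (\<forall>Xs. set Xs \<subseteq> vector_fields A \<and> length Xs = n \<longrightarrow>
        wedge_list (map (flat A J \<omega>) Xs) \<and>\<^sub>w \<theta> = (\<lambda>Ys. \<beta> Xs * volume_form k \<omega> Ys))"

definition bott_chern_harmonic ::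
  "('m \<Rightarrow> complex) set \<Rightarrow> ('m vf \<Rightarrow> 'm vf) \<Rightarrow> nat \<Rightarrow> 'm form \<Rightarrow> nat \<Rightarrow> 'm form \<Rightarrow> bool" where
  "bott_chern_harmonic A J k \<omega> n \<beta> \<longleftrightarrow> ext_d A \<beta> = 0 \<and>
     (\<exists>\<theta>. is_hodge_star A J k \<omega> n \<beta> \<theta> \<and> del A J (delbar A J \<theta>) = 0)"


section \<open>Bott-Chern and Aeppli cohomology, triple ABC-Massey products\<close>

text \<open>Here \<open>\<Omega>\<close> is the graded space of all smooth forms on the manifold. Cohomology classes are cosets.\<close>

definition bott_chern_cocycles ::
  "('m \<Rightarrow> complex) set \<Rightarrow> ('m vf \<Rightarrow> 'm vf) \<Rightarrow> (nat \<Rightarrow> 'm form set) \<Rightarrow> int \<Rightarrow> int \<Rightarrow> 'm form set" where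
  "bott_chern_cocycles A J \<Omega> p q = {\<omega> \<in> biforms A J \<Omega> p q. del A J \<omega> = 0 \<and> delbar A J \<omega> = 0}"

definition aeppli_cocycles ::
  "('m \<Rightarrow> complex) set \<Rightarrow> ('m vf \<Rightarrow> 'm vf) \<Rightarrow> (nat \<Rightarrow> 'm form set) \<Rightarrow> int \<Rightarrow> int \<Rightarrow> 'm form set" where
  "aeppli_cocycles A J \<Omega> p q = {\<omega> \<in> biforms A J \<Omega> p q. del A J (delbar A J \<omega>) = 0}"

definition aeppli_class ::
  "('m \<Rightarrow> complex) set \<Rightarrow> ('m vf \<Rightarrow> 'm vf) \<Rightarrow> (nat \<Rightarrow> 'm form set) \<Rightarrow> int \<Rightarrow> int \<Rightarrow> 'm form \<Rightarrow> 'm form set" where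
  "aeppli_class A J \<Omega> p q \<omega> = {\<omega> + del A J \<mu> + delbar A J \<nu> | \<mu> \<nu>.
     \<mu> \<in> biforms A J \<Omega> (p - 1) q \<and> \<nu> \<in> biforms A J \<Omega> p (q - 1)}"

text \<open>The subspace \<open>[a] \<union> H\<^sub>A + [c] \<union> H\<^sub>A\<close> of the Aeppli cohomology in bidegree
  \<open>(p+r+u-1, q+s+v-1)\<close>, where \<open>a\<close> has bidegree \<open>(p, q)\<close> and \<open>c\<close> has bidegree \<open>(u, v)\<close>.\<close>

definition massey_indeterminacy ::
  "('m \<Rightarrow> complex) set \<Rightarrow> ('m vf \<Rightarrow> 'm vf) \<Rightarrow> (nat \<Rightarrow> 'm form set) \<Rightarrow> nat \<times> nat \<Rightarrow> nat \<times> nat \<Rightarrow> nat \<times> nat \<Rightarrow>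
   'm form \<Rightarrow> 'm form \<Rightarrow> 'm form set set" where
  "massey_indeterminacy A J \<Omega> = (\<lambda>(p, q) (r, s) (u, v) a c.
     {aeppli_class A J \<Omega> (int p + int r + int u - 1) (int q + int s + int v - 1) (a \<and>\<^sub>w x + c \<and>\<^sub>w y) | x y.
        x \<in> aeppli_cocycles A J \<Omega> (int r + int u - 1) (int s + int v - 1) \<and>
        y \<in> aeppli_cocycles A J \<Omega> (int p + int r - 1) (int q + int s - 1)})"

text \<open>The classes of \<open>a\<close>, \<open>b\<close>, \<open>c\<close> (of bidegrees \<open>(p, q)\<close>, \<open>(r, s)\<close>, \<open>(u, v)\<close>) admit a triple
  ABC-Massey product, witnessed by the primitives \<open>f\<close> of \<open>a b\<close> and \<open>h\<close> of \<open>b c\<close>.\<close>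

definition massey_primitives ::
  "('m \<Rightarrow> complex) set \<Rightarrow> ('m vf \<Rightarrow> 'm vf) \<Rightarrow> (nat \<Rightarrow> 'm form set) \<Rightarrow> nat \<times> nat \<Rightarrow> nat \<times> nat \<Rightarrow> nat \<times> nat \<Rightarrow>
   'm form \<Rightarrow> 'm form \<Rightarrow> 'm form \<Rightarrow> 'm form \<Rightarrow> 'm form \<Rightarrow> bool" where
  "massey_primitives A J \<Omega> = (\<lambda>(p, q) (r, s) (u, v) a b c f h.
     f \<in> biforms A J \<Omega> (int p + int r - 1) (int q + int s - 1) \<and>
     h \<in> biforms A J \<Omega> (int r + int u - 1) (int s + int v - 1) \<and>
     a \<and>\<^sub>w b = cscale ((- 1) ^ (p + q)) (del A J (delbar A J f)) \<and>
     b \<and>\<^sub>w c = cscale ((- 1) ^ (r + s)) (del A J (delbar A J h)))"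

text \<open>The product of \<open>[a]\<close>, \<open>[b]\<close>, \<open>[c]\<close> is defined, and its value is nonzero in the quotient by
  the indeterminacy, whichever primitives are used to compute it.\<close>

definition nonvanishing_ABC_massey ::
  "('m \<Rightarrow> complex) set \<Rightarrow> ('m vf \<Rightarrow> 'm vf) \<Rightarrow> (nat \<Rightarrow> 'm form set) \<Rightarrow> nat \<times> nat \<Rightarrow> nat \<times> nat \<Rightarrow> nat \<times> nat \<Rightarrow>
   'm form \<Rightarrow> 'm form \<Rightarrow> 'm form \<Rightarrow> bool" where
  "nonvanishing_ABC_massey A J \<Omega> = (\<lambda>(p, q) (r, s) (u, v) a b c.
     a \<in> bott_chern_cocycles A J \<Omega> (int p) (int q) \<and>
     b \<in> bott_chern_cocycles A J \<Omega> (int r) (int s) \<and>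
     c \<in> bott_chern_cocycles A J \<Omega> (int u) (int v) \<and>
     (\<exists>f h. massey_primitives A J \<Omega> (p, q) (r, s) (u, v) a b c f h) \<and>
     (\<forall>f h. massey_primitives A J \<Omega> (p, q) (r, s) (u, v) a b c f h \<longrightarrow>
        aeppli_class A J \<Omega> (int p + int r + int u - 1) (int q + int s + int v - 1)
          (cscale ((- 1) ^ (p + q)) (a \<and>\<^sub>w h) - cscale ((- 1) ^ (r + s)) (f \<and>\<^sub>w c))
        \<notin> massey_indeterminacy A J \<Omega> (p, q) (r, s) (u, v) a c))"

end

theory Submission
  imports Defs
begin

text \<open>In the frame dual to \<open>\<eta>\<^sup>1, ..., \<eta>\<^sup>k\<close> and their conjugates the direction of index \<open>k\<close> and its conjugate are
  central, so on invariant forms \<open>\<partial>\<close> \<open>\<partial>\<close>-bar is the contraction with these two directions followed by the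
  product with \<open>\<Psi> = \<partial>\<close> \<open>\<partial>\<close>-bar \<open>\<eta>\<^sup>k\<^sup>k\<close>. Harmonicity of a monomial makes \<open>\<Psi>\<close> vanish on the 4-element subsets of its
  index set, whereas \<open>\<Psi> \<and> \<gamma> = \<plusminus>\<alpha> \<and> \<beta> \<noteq> 0\<close> and \<open>\<gamma> \<and> \<beta> \<noteq> 0\<close>; hence the indices of \<open>\<gamma>\<close> are
  among those of \<open>\<alpha>\<close>, but not all indices of \<open>\<alpha>\<close> are indices of \<open>\<gamma>\<close>, and \<open>\<beta>\<close> has positive degree, which gives
  \<open>\<beta> \<and> \<beta> = 0\<close>. Evaluate a form on the two central directions followed by the indices of \<open>\<gamma>\<close> and of \<open>\<beta>\<close>, and
  average over the nilmanifold. The resulting functional kills the images of \<open>\<partial>\<close> and \<open>\<partial>\<close>-bar, because derivatives have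
  mean 0 and the evaluation contains the central directions; it kills the multiples of \<open>\<alpha>\<close>, because an index of
  \<open>\<alpha>\<close> is missing; and it kills \<open>\<beta> \<and> y\<close> for every Aeppli cocycle \<open>y\<close>, because by the uniqueness of \<open>\<gamma>\<close>
  the symmetrization of \<open>y\<close> has no component along the central directions. On the Massey product its value is
  \<open>\<plusminus>c \<noteq> 0\<close>.

  Only the vanishing of the mean on derivatives along invariant fields is needed, so no invariant measure is
  constructed: an abstract linear functional exists because 1 is not a sum of such derivatives of
  periodic functions. This follows from the amenability of nilpotent groups and the compactness of the quotient.\<close>

section \<open>Smooth functions on open sets\<close>

text \<open>Vector fields are derivations of the whole function algebra and forms act on lists of
  them, so nothing is local by definition. Equations between forms can be checked on a global frame
  only, and that the coframe has a dual frame in which every derivation can be expanded takes bump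
  functions, Hadamard's lemma and the fact that a 1-form sees a field at a point only. Primitives
  and indeterminacy of the Massey product range over all smooth forms on the nilmanifold, whereas
  uniqueness speaks of invariant forms. The mean passes from the former to the latter, which is why
  it has to commute with \<partial> and \<partial>-bar. Uniqueness is applied to \<gamma> plus the
  contracted mean of a cocycle, because the latter alone has product 0 with \<Psi> and is not
  covered by it. As to amenability: if 1 were a sum of derivatives of periodic \<open>F b\<close>
  along the basis fields, then for one small t the sum of the differences
  \<open>F b (x g) - F b x\<close>, with g depending on b, would be at least t/2 for all x, by
  compactness of the quotient; averaged over an almost invariant finite list of points x, the same
  sum is arbitrarily small.\<close>

lemma Ck_on_subset: "Ck_on n f S \<Longrightarrow> T \<subseteq> S \<Longrightarrow> Ck_on n f T"
  by (induction n arbitrary: f) (auto intro: continuous_on_subset)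

lemma Ck_on_lower: "Ck_on (Suc n) f S \<Longrightarrow> Ck_on n f S"
proof (induction n arbitrary: f)
  case 0
  then show ?case
    by (auto intro!: continuous_at_imp_continuous_on differentiable_imp_continuous_within)
next
  case (Suc n)
  then have "Ck_on (Suc n) (\<lambda>x. frechet_derivative f (at x) v) S" for v by simp
  then show ?case using Suc by (simp add: Suc.IH)
qed

text \<open>Openness turns equality on S into equality near each point, so the Frechet derivatives
  agree on S as well and the induction can pass to them.\<close>

lemma Ck_on_cong:
  assumes "open S" "\<And>x. x \<in> S \<Longrightarrow> f x = g x" "Ck_on n f S"
  shows "Ck_on n g S"
  using assms(2,3)
proof (induction n arbitrary: f g)
  case 0
  then show ?case by (metis Ck_on.simps(1) continuous_on_cong)
next
  case (Suc n)
  have g: "(g has_derivative frechet_derivative f (at x)) (at x)" if "x \<in> S" for x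
  proof -
    have "(f has_derivative frechet_derivative f (at x)) (at x)"
      using Suc.prems(2) that by (simp add: frechet_derivative_works)
    then show ?thesis
      by (rule has_derivative_transform_within_open[OF _ assms(1) that]) (use Suc.prems in auto)
  qed
  have eq: "frechet_derivative f (at x) v = frechet_derivative g (at x) v" if "x \<in> S" for x v
    using frechet_derivative_at[OF g[OF that]] by (rule fun_cong)
  have "Ck_on n (\<lambda>x. frechet_derivative g (at x) v) S" for v
  proof (rule Suc.IH[OF eq])
    show "Ck_on n (\<lambda>x. frechet_derivative f (at x) v) S" using Suc.prems(2) by simp
  qed
  moreover have "\<forall>x\<in>S. g differentiable at x" using g unfolding differentiable_def by blast
  ultimately show ?case by simp
qed

text \<open>\<open>frechet_derivative\<close> is a choice operator; by uniqueness of derivatives any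
  explicitly computed family \<open>f'\<close> may replace it, which is how the closure properties
  below are obtained.\<close>

lemma Ck_on_SucI:
  assumes "open S" "\<And>x. x \<in> S \<Longrightarrow> (f has_derivative f' x) (at x)" "\<And>v. Ck_on n (\<lambda>x. f' x v) S"
  shows "Ck_on (Suc n) f S"
proof -
  have eq: "f' x v = frechet_derivative f (at x) v" if "x \<in> S" for x v
    using frechet_derivative_at[OF assms(2)[OF that]] by (rule fun_cong)
  have "Ck_on n (\<lambda>x. frechet_derivative f (at x) v) S" for v
    by (rule Ck_on_cong[OF assms(1) eq assms(3)])
  moreover have "\<forall>x\<in>S. f differentiable at x" using assms(2) unfolding differentiable_def by blast
  ultimately show ?thesis by simp
qed

lemma Ck_on_has_derivative:
  "Ck_on (Suc n) f S \<Longrightarrow> x \<in> S \<Longrightarrow> (f has_derivative frechet_derivative f (at x)) (at x)"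
  by (simp add: frechet_derivative_works)

lemma Ck_on_local:
  assumes "\<And>x. x \<in> S \<Longrightarrow> \<exists>T. open T \<and> x \<in> T \<and> Ck_on n f T"
  shows "Ck_on n f S"
  using assms
proof (induction n arbitrary: f)
  case 0
  have "isCont f x" if "x \<in> S" for x
    using 0[OF that] continuous_on_eq_continuous_at by auto
  then show ?case by (auto intro: continuous_at_imp_continuous_on)
next
  case (Suc n)
  have "f differentiable at x" if "x \<in> S" for x
    using Suc.prems[OF that] by auto
  moreover have "Ck_on n (\<lambda>x. frechet_derivative f (at x) v) S" for v
  proof (rule Suc.IH)
    fix x assume "x \<in> S"
    from Suc.prems[OF this] show "\<exists>T. open T \<and> x \<in> T \<and> Ck_on n (\<lambda>x. frechet_derivative f (at x) v) T" by auto
  qed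
  ultimately show ?case by simp
qed

lemma Ck_on_const: "open S \<Longrightarrow> Ck_on n (\<lambda>_. c) S"
proof (induction n arbitrary: c)
  case (Suc n)
  show ?case by (rule Ck_on_SucI[OF Suc.prems has_derivative_const]) (rule Suc.IH[OF Suc.prems])
qed simp

lemma Ck_on_bounded_linear: "open S \<Longrightarrow> bounded_linear L \<Longrightarrow> Ck_on n L S"
proof (cases n)
  case (Suc m)
  assume S: "open S" and L: "bounded_linear L"
  show ?thesis unfolding Suc
    by (rule Ck_on_SucI[OF S bounded_linear_imp_has_derivative[OF L]]) (rule Ck_on_const[OF S])
qed (simp add: linear_continuous_on)

lemma Ck_on_compose_linear:
  assumes "open S" "bounded_linear L" "Ck_on n f S" shows "Ck_on n (\<lambda>x. L (f x)) S"
  using assms(3)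
proof (induction n arbitrary: f)
  case 0
  then show ?case by (simp add: bounded_linear.continuous_on[OF assms(2)])
next
  case (Suc n)
  show ?case
  proof (rule Ck_on_SucI[OF assms(1)])
    show "((\<lambda>x. L (f x)) has_derivative (\<lambda>v. L (frechet_derivative f (at x) v))) (at x)" if "x \<in> S" for x
      by (rule bounded_linear.has_derivative[OF assms(2) Ck_on_has_derivative[OF Suc.prems that]])
    show "Ck_on n (\<lambda>x. L (frechet_derivative f (at x) v)) S" for v
      using Suc.prems by (intro Suc.IH) simp
  qed
qed

lemma Ck_on_add:
  assumes "open S" "Ck_on n f S" "Ck_on n g S" shows "Ck_on n (\<lambda>x. f x + g x) S"
  using assms(2,3)
proof (induction n arbitrary: f g)
  case 0
  then show ?case by (auto intro: continuous_intros)
next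
  case (Suc n)
  show ?case
  proof (rule Ck_on_SucI[OF assms(1)])
    show "((\<lambda>x. f x + g x) has_derivative (\<lambda>v. frechet_derivative f (at x) v + frechet_derivative g (at x) v)) (at x)"
      if "x \<in> S" for x
      by (intro has_derivative_add Ck_on_has_derivative[OF Suc.prems(1)] Ck_on_has_derivative[OF Suc.prems(2)] that)
    show "Ck_on n (\<lambda>x. frechet_derivative f (at x) v + frechet_derivative g (at x) v) S" for v
      using Suc.prems by (intro Suc.IH) simp_all
  qed
qed

lemma Ck_on_sum:
  assumes "open S" "\<And>i. i \<in> I \<Longrightarrow> Ck_on n (f i) S" shows "Ck_on n (\<lambda>x. \<Sum>i\<in>I. f i x) S"
  using assms(2) by (induction I rule: infinite_finite_induct) (auto intro!: Ck_on_const Ck_on_add assms(1))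

lemma Ck_on_bilinear:
  assumes "open S" "bounded_bilinear P" "Ck_on n f S" "Ck_on n g S"
  shows "Ck_on n (\<lambda>x. P (f x) (g x)) S"
  using assms(3,4)
proof (induction n arbitrary: f g)
  case 0
  then show ?case by (auto intro: bounded_bilinear.continuous_on[OF assms(2)])
next
  case (Suc n)
  show ?case
  proof (rule Ck_on_SucI[OF assms(1)])
    show "((\<lambda>x. P (f x) (g x)) has_derivative
        (\<lambda>v. P (f x) (frechet_derivative g (at x) v) + P (frechet_derivative f (at x) v) (g x))) (at x)"
      if "x \<in> S" for x
      by (intro bounded_bilinear.FDERIV[OF assms(2)] Ck_on_has_derivative[OF Suc.prems(1)]
          Ck_on_has_derivative[OF Suc.prems(2)] that)
    show "Ck_on n (\<lambda>x. P (f x) (frechet_derivative g (at x) v) + P (frechet_derivative f (at x) v) (g x)) S" for v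
      using Suc.prems Ck_on_lower[OF Suc.prems(1)] Ck_on_lower[OF Suc.prems(2)]
      by (intro Ck_on_add assms(1) Suc.IH) simp_all
  qed
qed

text \<open>In the chain rule the direction plugged into the derivative of g varies with x.
  Expanding it in the basis gives a sum of products of maps to which the induction hypothesis and
  the product rule apply.\<close>

lemma Ck_on_compose:
  fixes f :: "'a::euclidean_space \<Rightarrow> 'b::euclidean_space" and g :: "'b \<Rightarrow> 'c::real_normed_vector"
  assumes "open S" "open T" "f ` S \<subseteq> T" "Ck_on n f S" "Ck_on n g T"
  shows "Ck_on n (\<lambda>x. g (f x)) S"
  using assms(4,5)
proof (induction n arbitrary: g)
  case 0
  then show ?case using assms(3) by (auto intro: continuous_on_compose2)
next
  case (Suc n)
  have fx: "f x \<in> T" if "x \<in> S" for x using assms(3) that by auto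
  show ?case
  proof (rule Ck_on_SucI[OF assms(1)])
    show "((\<lambda>x. g (f x)) has_derivative
        (\<lambda>v. frechet_derivative g (at (f x)) (frechet_derivative f (at x) v))) (at x)" if "x \<in> S" for x
      using diff_chain_at[OF Ck_on_has_derivative[OF Suc.prems(1) that] Ck_on_has_derivative[OF Suc.prems(2) fx[OF that]]]
      by (simp add: o_def)
    fix v
    have lin: "frechet_derivative g (at (f x)) w = (\<Sum>b\<in>Basis. (w \<bullet> b) *\<^sub>R frechet_derivative g (at (f x)) b)"
      if "x \<in> S" for x w
    proof -
      have "linear (frechet_derivative g (at (f x)))"
        using has_derivative_linear[OF Ck_on_has_derivative[OF Suc.prems(2) fx[OF that]]] .
      then show ?thesis
        by (subst euclidean_representation[of w, symmetric]) (simp only: linear_sum linear_cmul)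
    qed
    show "Ck_on n (\<lambda>x. frechet_derivative g (at (f x)) (frechet_derivative f (at x) v)) S"
    proof (rule Ck_on_cong[OF assms(1)])
      show "(\<Sum>b\<in>Basis. (frechet_derivative f (at x) v \<bullet> b) *\<^sub>R frechet_derivative g (at (f x)) b) =
          frechet_derivative g (at (f x)) (frechet_derivative f (at x) v)" if "x \<in> S" for x
        by (rule lin[OF that, symmetric])
      have d1: "Ck_on n (\<lambda>x. frechet_derivative g (at (f x)) b) S" for b
      proof (rule Suc.IH[OF Ck_on_lower[OF Suc.prems(1)]])
        show "Ck_on n (\<lambda>y. frechet_derivative g (at y) b) T" using Suc.prems(2) by simp
      qed
      have d2: "Ck_on n (\<lambda>x. frechet_derivative f (at x) v \<bullet> b) S" for b
      proof (rule Ck_on_compose_linear[OF assms(1) bounded_linear_inner_left])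
        show "Ck_on n (\<lambda>x. frechet_derivative f (at x) v) S" using Suc.prems(1) by simp
      qed
      show "Ck_on n (\<lambda>x. \<Sum>b\<in>Basis. (frechet_derivative f (at x) v \<bullet> b) *\<^sub>R frechet_derivative g (at (f x)) b) S"
        by (rule Ck_on_sum[OF assms(1) Ck_on_bilinear[OF assms(1) bounded_bilinear_scaleR d2 d1]])
    qed
  qed
qed

lemma smooth_on_subset: "smooth_on f S \<Longrightarrow> T \<subseteq> S \<Longrightarrow> smooth_on f T"
  by (auto simp: smooth_on_def intro: Ck_on_subset)

lemma smooth_on_cong: "open S \<Longrightarrow> (\<And>x. x \<in> S \<Longrightarrow> f x = g x) \<Longrightarrow> smooth_on f S \<Longrightarrow> smooth_on g S"
  by (auto simp: smooth_on_def intro: Ck_on_cong[of S f g])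

lemma smooth_on_local: "(\<And>x. x \<in> S \<Longrightarrow> \<exists>T. open T \<and> x \<in> T \<and> smooth_on f T) \<Longrightarrow> smooth_on f S"
  unfolding smooth_on_def by (intro allI Ck_on_local) blast

lemma smooth_on_const: "open S \<Longrightarrow> smooth_on (\<lambda>_. c) S"
  by (simp add: smooth_on_def Ck_on_const)

lemma smooth_on_bounded_linear: "open S \<Longrightarrow> bounded_linear L \<Longrightarrow> smooth_on L S"
  by (simp add: smooth_on_def Ck_on_bounded_linear)

lemma smooth_on_compose_linear:
  "open S \<Longrightarrow> bounded_linear L \<Longrightarrow> smooth_on f S \<Longrightarrow> smooth_on (\<lambda>x. L (f x)) S"
  by (simp add: smooth_on_def Ck_on_compose_linear)

lemma smooth_on_add: "open S \<Longrightarrow> smooth_on f S \<Longrightarrow> smooth_on g S \<Longrightarrow> smooth_on (\<lambda>x. f x + g x) S"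
  by (simp add: smooth_on_def Ck_on_add)

lemma smooth_on_bilinear:
  "open S \<Longrightarrow> bounded_bilinear P \<Longrightarrow> smooth_on f S \<Longrightarrow> smooth_on g S \<Longrightarrow> smooth_on (\<lambda>x. P (f x) (g x)) S"
  by (simp add: smooth_on_def Ck_on_bilinear)

lemma smooth_on_compose:
  fixes f :: "'a::euclidean_space \<Rightarrow> 'b::euclidean_space" and g :: "'b \<Rightarrow> 'c::real_normed_vector"
  assumes "open S" "open T" "f ` S \<subseteq> T" "smooth_on f S" "smooth_on g T"
  shows "smooth_on (\<lambda>x. g (f x)) S"
  using assms by (auto simp: smooth_on_def intro: Ck_on_compose[of S T])

lemma smooth_on_derivative: "smooth_on f S \<Longrightarrow> smooth_on (\<lambda>x. frechet_derivative f (at x) v) S"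
  unfolding smooth_on_def
proof
  fix n assume "\<forall>n. Ck_on n f S"
  then have "Ck_on (Suc n) f S" by blast
  then show "Ck_on n (\<lambda>x. frechet_derivative f (at x) v) S" by simp
qed

lemma smooth_on_has_derivative:
  "smooth_on f S \<Longrightarrow> x \<in> S \<Longrightarrow> (f has_derivative frechet_derivative f (at x)) (at x)"
  unfolding smooth_on_def using Ck_on_has_derivative[of 0 f S x] by blast

lemma smooth_on_continuous: "smooth_on f S \<Longrightarrow> continuous_on S f"
  unfolding smooth_on_def using Ck_on.simps(1)[of f S] by blast

lemma smooth_on_Pair:
  fixes f :: "'a::euclidean_space \<Rightarrow> 'b::euclidean_space" and g :: "'a \<Rightarrow> 'c::euclidean_space"
  assumes S: "open S" and f: "smooth_on f S" and g: "smooth_on g S"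
  shows "smooth_on (\<lambda>x. (f x, g x)) S"
proof -
  have "bounded_linear (\<lambda>y. (y, 0) :: 'b \<times> 'c)" "bounded_linear (\<lambda>y. (0, y) :: 'b \<times> 'c)"
    by (intro bounded_linear_Pair bounded_linear_ident bounded_linear_zero)+
  from smooth_on_add[OF S smooth_on_compose_linear[OF S this(1) f] smooth_on_compose_linear[OF S this(2) g]]
  show ?thesis by simp
qed

section \<open>Bump functions built from exp(-1/t)\<close>

text \<open>The powers of \<open>1/t\<close> make the family closed under differentiation.\<close>

definition flat_exp :: "nat \<Rightarrow> real \<Rightarrow> real" where
  "flat_exp m t = (if 0 < t then exp (- (1 / t)) * (1 / t) ^ m else 0)"

text \<open>From the right, substitute the inverse of t: a power is dominated by the exponential at
  infinity.\<close>

lemma flat_exp_tendsto: "((\<lambda>t. flat_exp m t) \<longlongrightarrow> 0) (at 0)"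
proof (rule filterlim_split_at)
  show "(flat_exp m \<longlongrightarrow> 0) (at_left 0)"
    by (rule tendsto_eventually) (auto simp: flat_exp_def eventually_at intro: exI[of _ 1])
  have "((\<lambda>t :: real. inverse t ^ m / exp (inverse t)) \<longlongrightarrow> 0) (at_right 0)"
    by (rule filterlim_compose[OF tendsto_power_div_exp_0 filterlim_inverse_at_top_right])
  then show "(flat_exp m \<longlongrightarrow> 0) (at_right 0)"
  proof (rule Lim_transform_eventually)
    have "\<forall>\<^sub>F t :: real in at_right 0. 0 < t" by (simp add: eventually_at_right_less)
    then show "\<forall>\<^sub>F t in at_right 0. inverse t ^ m / exp (inverse t) = flat_exp m t"
      by eventually_elim (simp add: flat_exp_def exp_minus field_simps)
  qed
qed

lemma flat_exp_derivative:
  "(flat_exp m has_real_derivative flat_exp (m + 2) t - real m * flat_exp (m + 1) t) (at t)"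
proof (cases t "0 :: real" rule: linorder_cases)
  case less
  have "((\<lambda>_. 0) has_real_derivative 0) (at t)" by simp
  then have "(flat_exp m has_real_derivative 0) (at t)"
    by (rule has_field_derivative_transform_within_open[of _ _ _ "{..<0}"]) (use less in \<open>auto simp: flat_exp_def\<close>)
  then show ?thesis using less by (simp add: flat_exp_def)
next
  case equal
  \<comment> \<open>The difference quotient of \<open>flat_exp m\<close> at 0 is
    \<open>flat_exp (Suc m)\<close>, whose limit is known.\<close>
  have "((\<lambda>h. flat_exp m h / h) \<longlongrightarrow> 0) (at 0)"
    by (rule Lim_transform_eventually[OF flat_exp_tendsto[of "Suc m"]]) (auto simp: flat_exp_def eventually_at intro!: exI[of _ 1])
  then show ?thesis by (simp add: equal has_field_derivative_iff flat_exp_def)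
next
  case greater
  have "((\<lambda>t. exp (- (1 / t)) * (1 / t) ^ m) has_real_derivative
      flat_exp (m + 2) t - real m * flat_exp (m + 1) t) (at t)"
  proof -
    have "((\<lambda>t. exp (- (1 / t)) * (1 / t) ^ m) has_real_derivative
        exp (- (1 / t)) * (1 / t\<^sup>2) * (1 / t) ^ m + exp (- (1 / t)) * (real m * (1 / t) ^ (m - 1) * (- (1 / t\<^sup>2)))) (at t)"
    proof -
      have "((\<lambda>t. 1 / t) has_real_derivative - (1 / t\<^sup>2)) (at t)"
        using greater by (auto intro!: derivative_eq_intros simp: power2_eq_square)
      note 1 = DERIV_power[OF this, of m]
      have "((\<lambda>t. exp (- (1 / t))) has_real_derivative exp (- (1 / t)) * (1 / t\<^sup>2)) (at t)"
        using greater by (auto intro!: derivative_eq_intros simp: power2_eq_square)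
      from DERIV_mult[OF this 1] show ?thesis by (simp add: algebra_simps)
    qed
    moreover have "exp (- (1 / t)) * (1 / t\<^sup>2) * (1 / t) ^ m + exp (- (1 / t)) * (real m * (1 / t) ^ (m - 1) * (- (1 / t\<^sup>2)))
        = flat_exp (m + 2) t - real m * flat_exp (m + 1) t"
    proof -
      have "real m * (1 / t) ^ (m - 1) * (- (1 / t\<^sup>2)) = - (real m * (1 / t) ^ (m + 1))"
        using greater by (cases m) (simp_all add: power2_eq_square field_simps)
      moreover have "(1 / t\<^sup>2) * (1 / t) ^ m = (1 / t) ^ (m + 2)"
        by (simp add: power_add power_divide power2_eq_square)
      ultimately show ?thesis using greater by (simp only: flat_exp_def if_True mult.assoc) (simp add: mult_ac)
    qed
    ultimately show ?thesis by simp
  qed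
  then show ?thesis
    by (rule has_field_derivative_transform_within_open[of _ _ _ "{0<..}"]) (use greater in \<open>auto simp: flat_exp_def\<close>)
qed

lemma Ck_on_flat_exp: "Ck_on n (flat_exp m) UNIV"
proof (induction n arbitrary: m)
  case 0
  then show ?case
    by (auto intro!: continuous_at_imp_continuous_on DERIV_isCont flat_exp_derivative)
next
  case (Suc n)
  show ?case
  proof (rule Ck_on_SucI)
    show "(flat_exp m has_derivative (\<lambda>v. (flat_exp (m + 2) t - real m * flat_exp (m + 1) t) * v)) (at t)" for t
      using flat_exp_derivative[of m t] by (simp add: has_field_derivative_def)
    fix v
    have "Ck_on n (\<lambda>t. v * flat_exp (m + 2) t + (- v * real m) * flat_exp (m + 1) t) UNIV"
      by (intro Ck_on_add Ck_on_compose_linear[OF _ bounded_linear_mult_right] Suc.IH) auto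
    then show "Ck_on n (\<lambda>t. (flat_exp (m + 2) t - real m * flat_exp (m + 1) t) * v) UNIV"
      by (simp add: algebra_simps)
  qed simp
qed

text \<open>Squared distances make the argument a polynomial, which avoids the singularity of the
  norm at the centre.\<close>

definition bump :: "'e::euclidean_space \<Rightarrow> real \<Rightarrow> 'e \<Rightarrow> complex" where
  "bump z r x = complex_of_real (flat_exp 0 (r\<^sup>2 - (x - z) \<bullet> (x - z)))"

lemma bump_smooth: "smooth_on (bump z r) S" if "open S"
proof -
  have id: "smooth_on (\<lambda>x. x - z) S"
    using smooth_on_add[OF that smooth_on_bounded_linear[OF that bounded_linear_ident] smooth_on_const[OF that, of "- z"]] by simp
  have "smooth_on (\<lambda>x. r\<^sup>2 + - ((x - z) \<bullet> (x - z))) S"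
    by (intro smooth_on_add smooth_on_const smooth_on_compose_linear[OF that bounded_linear_minus[OF bounded_linear_ident]]
        smooth_on_bilinear[OF that bounded_bilinear_inner] id that)
  from smooth_on_compose[OF that open_UNIV _ this, of "flat_exp 0"]
  have "smooth_on (\<lambda>x. flat_exp 0 (r\<^sup>2 + - ((x - z) \<bullet> (x - z)))) S"
    by (simp add: smooth_on_def Ck_on_flat_exp)
  then show ?thesis
    unfolding bump_def using smooth_on_compose_linear[OF that bounded_linear_of_real] by simp
qed

lemma bump_outside: "dist z x \<ge> r \<Longrightarrow> 0 < r \<Longrightarrow> bump z r x = 0"
proof -
  assume "dist z x \<ge> r" "0 < r"
  then have "r\<^sup>2 \<le> (norm (x - z))\<^sup>2" by (intro power_mono) (auto simp: dist_norm norm_minus_commute)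
  then show ?thesis by (simp add: bump_def flat_exp_def power2_norm_eq_inner)
qed

lemma bump_center: "0 < r \<Longrightarrow> bump z r z \<noteq> 0"
  by (simp add: bump_def flat_exp_def)

section \<open>Hadamard's lemma with smooth coefficients\<close>

lemma Ck_on_param_integral:
  fixes h :: "'e::euclidean_space \<Rightarrow> 'c::banach"
  assumes S: "open S" "convex S" and z: "z \<in> S" and h: "Ck_on n h S"
  shows "Ck_on n (\<lambda>x. integral {0..1} (\<lambda>t. t ^ m *\<^sub>R h (z + t *\<^sub>R (x - z)))) S"
  using h
proof (induction n arbitrary: h m)
  case 0
  have mem: "z + t *\<^sub>R (x - z) \<in> S" if "t \<in> {0..1}" "x \<in> S" for t x
  proof -
    have "z + t *\<^sub>R (x - z) = (1 - t) *\<^sub>R z + t *\<^sub>R x" by (simp add: algebra_simps)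
    then show ?thesis using convexD_alt[OF S(2) z that(2), of t] that(1) by simp
  qed
  have "continuous_on (S \<times> cbox 0 1) (\<lambda>(x, t). t ^ m *\<^sub>R h (z + t *\<^sub>R (x - z)))"
    unfolding case_prod_unfold
    using 0 mem by (auto intro!: continuous_intros continuous_on_compose2[of S h])
  from integral_continuous_on_param[OF this] show ?case by simp
next
  case (Suc n)
  have mem: "z + t *\<^sub>R (x - z) \<in> S" if "t \<in> {0..1}" "x \<in> S" for t x
  proof -
    have "z + t *\<^sub>R (x - z) = (1 - t) *\<^sub>R z + t *\<^sub>R x" by (simp add: algebra_simps)
    then show ?thesis using convexD_alt[OF S(2) z that(2), of t] that(1) by simp
  qed
  let ?D = "\<lambda>y. frechet_derivative h (at y)"
  have D: "(h has_derivative ?D y) (at y)" if "y \<in> S" for y by (rule Ck_on_has_derivative[OF Suc.prems that])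
  have bl: "bounded_linear (?D y)" if "y \<in> S" for y using D[OF that] by (rule has_derivative_bounded_linear)
  have Dc: "continuous_on S (\<lambda>y. ?D y v)" for v
  proof -
    have "Ck_on n (\<lambda>y. ?D y v) S" using Suc.prems by simp
    then show ?thesis by (induction n) (use Ck_on_lower in auto)
  qed
  \<comment> \<open>The derivative in x as a bounded linear operator: the Leibniz rule asks for
    continuity in operator norm, which in finite dimension may be checked on basis vectors.\<close>
  define fx where "fx = (\<lambda>x t. t ^ Suc m *\<^sub>R Blinfun (?D (z + t *\<^sub>R (x - z))))"
  have fx: "blinfun_apply (fx x t) v = t ^ Suc m *\<^sub>R ?D (z + t *\<^sub>R (x - z)) v" if "t \<in> {0..1}" "x \<in> S" for t x v
    using bl[OF mem[OF that]] by (simp add: fx_def scaleR_blinfun.rep_eq bounded_linear_Blinfun_apply)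
  have hc: "continuous_on S h" using Ck_on_has_derivative[OF Suc.prems]
    by (meson continuous_at_imp_continuous_on has_derivative_continuous)
  have cfx: "continuous_on (S \<times> cbox 0 1) (\<lambda>(x, t). fx x t)"
  proof (rule continuous_on_blinfun_componentwise)
    fix i :: 'e
    have "continuous_on (S \<times> cbox 0 1) (\<lambda>(x, t). t ^ Suc m *\<^sub>R ?D (z + t *\<^sub>R (x - z)) i)"
      unfolding case_prod_unfold
      using mem by (auto intro!: continuous_intros continuous_on_compose2[OF Dc[of i]])
    then show "continuous_on (S \<times> cbox 0 1) (\<lambda>p. blinfun_apply (case p of (x, t) \<Rightarrow> fx x t) i)"
      by (rule continuous_on_eq) (auto simp: fx)
  qed
  have der: "((\<lambda>x. integral (cbox 0 1) (\<lambda>t. t ^ m *\<^sub>R h (z + t *\<^sub>R (x - z)))) has_derivative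
      blinfun_apply (integral (cbox 0 1) (fx x))) (at x within S)" if x: "x \<in> S" for x
  proof (rule leibniz_rule[OF _ _ cfx x S(2)])
    fix x t assume xt: "x \<in> S" "t \<in> cbox (0::real) 1"
    then have t: "t \<in> {0..1}" by simp
    have "((\<lambda>x. z + t *\<^sub>R (x - z)) has_derivative (\<lambda>v. t *\<^sub>R v)) (at x)"
      by (auto intro!: derivative_eq_intros)
    from diff_chain_at[OF this D[OF mem[OF t xt(1)]]]
    have "((\<lambda>x. h (z + t *\<^sub>R (x - z))) has_derivative (\<lambda>v. ?D (z + t *\<^sub>R (x - z)) (t *\<^sub>R v))) (at x)"
      by (simp add: o_def)
    then have "((\<lambda>x. t ^ m *\<^sub>R h (z + t *\<^sub>R (x - z))) has_derivative (\<lambda>v. t ^ m *\<^sub>R ?D (z + t *\<^sub>R (x - z)) (t *\<^sub>R v))) (at x)"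
      by (rule has_derivative_scaleR_right)
    moreover have "(\<lambda>v. t ^ m *\<^sub>R ?D (z + t *\<^sub>R (x - z)) (t *\<^sub>R v)) = blinfun_apply (fx x t)"
      using bounded_linear.linear[OF bl[OF mem[OF t xt(1)]]] by (auto simp: fx[OF t xt(1)] linear_cmul)
    ultimately show "((\<lambda>x. t ^ m *\<^sub>R h (z + t *\<^sub>R (x - z))) has_derivative blinfun_apply (fx x t)) (at x within S)"
      by (simp add: has_derivative_at_withinI)
  next
    fix x assume x: "x \<in> S"
    show "(\<lambda>t. t ^ m *\<^sub>R h (z + t *\<^sub>R (x - z))) integrable_on cbox 0 1"
      using mem x by (intro integrable_continuous) (auto intro!: continuous_intros continuous_on_compose2[OF hc])
  qed
  show ?case
  proof (rule Ck_on_SucI[OF S(1)])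
    show "((\<lambda>x. integral {0..1} (\<lambda>t. t ^ m *\<^sub>R h (z + t *\<^sub>R (x - z)))) has_derivative
        blinfun_apply (integral (cbox 0 1) (fx x))) (at x)" if "x \<in> S" for x
      using der[OF that] at_within_open[OF that S(1)] by simp
    fix v
    \<comment> \<open>Differentiating under the integral sign pulls out one more factor t; the
      weight \<open>t ^ m\<close> is in the statement so that the induction hypothesis covers
      this.\<close>
    have "Ck_on n (\<lambda>x. integral {0..1} (\<lambda>t. t ^ Suc m *\<^sub>R ?D (z + t *\<^sub>R (x - z)) v)) S"
      using Suc.prems by (intro Suc.IH) simp
    then show "Ck_on n (\<lambda>x. blinfun_apply (integral (cbox 0 1) (fx x)) v) S"
    proof (rule Ck_on_cong[OF S(1), rotated])
      fix x assume x: "x \<in> S"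
      have "continuous_on (cbox 0 1) (\<lambda>t :: real. (x, t))" by (intro continuous_intros)
      then have "continuous_on (cbox 0 1) (fx x)"
        using continuous_on_compose2[OF cfx, of "cbox 0 1" "\<lambda>t. (x, t)"] x
        by (simp add: image_subset_iff)
      then have "fx x integrable_on cbox 0 1" by (rule integrable_continuous)
      note bi = blinfun_apply_integral[OF this, of v]
      show "integral {0..1} (\<lambda>t. t ^ Suc m *\<^sub>R ?D (z + t *\<^sub>R (x - z)) v) = blinfun_apply (integral (cbox 0 1) (fx x)) v"
        unfolding bi unfolding cbox_interval by (rule integral_cong) (simp only: fx[OF _ x])
    qed
  qed
qed

text \<open>Integrate the derivative of F along the segment from z to x. The coefficients depend
  smoothly on x, so that a derivation can later be applied to the products on the right-hand
  side.\<close>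

lemma hadamard:
  fixes F :: "'e::euclidean_space \<Rightarrow> complex"
  assumes S: "open S" "convex S" and z: "z \<in> S" and F: "smooth_on F S"
  obtains g where "\<And>b. smooth_on (g b) S" "\<And>b. g b z = frechet_derivative F (at z) b"
    "\<And>x. x \<in> S \<Longrightarrow> F x - F z = (\<Sum>b\<in>Basis. complex_of_real ((x - z) \<bullet> b) * g b x)"
proof -
  let ?D = "\<lambda>y. frechet_derivative F (at y)"
  define g where "g = (\<lambda>b x. integral {0..1} (\<lambda>t. ?D (z + t *\<^sub>R (x - z)) b))"
  have mem: "z + t *\<^sub>R (x - z) \<in> S" if "t \<in> {0..1}" "x \<in> S" for t x
  proof -
    have "z + t *\<^sub>R (x - z) = (1 - t) *\<^sub>R z + t *\<^sub>R x" by (simp add: algebra_simps)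
    then show ?thesis using convexD_alt[OF S(2) z that(2), of t] that(1) by simp
  qed
  have D: "(F has_derivative ?D y) (at y)" if "y \<in> S" for y by (rule smooth_on_has_derivative[OF F that])
  have g1: "smooth_on (g b) S" for b
    using Ck_on_param_integral[OF S z, of _ "\<lambda>y. ?D y b" 0] smooth_on_derivative[OF F, of b]
    unfolding smooth_on_def g_def by simp
  have g2: "g b z = ?D z b" for b by (simp add: g_def)
  have g3: "F x - F z = (\<Sum>b\<in>Basis. complex_of_real ((x - z) \<bullet> b) * g b x)" if x: "x \<in> S" for x
  proof -
    have "((\<lambda>t. ?D (z + t *\<^sub>R (x - z)) (x - z)) has_integral F (z + 1 *\<^sub>R (x - z)) - F (z + 0 *\<^sub>R (x - z))) {0..1}"
    proof (rule fundamental_theorem_of_calculus)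
      fix t :: real assume t: "t \<in> {0..1}"
      have "((\<lambda>t. z + t *\<^sub>R (x - z)) has_derivative (\<lambda>s. s *\<^sub>R (x - z))) (at t)"
        by (auto intro!: derivative_eq_intros)
      from diff_chain_at[OF this D[OF mem[OF t x]]]
      have "((\<lambda>t. F (z + t *\<^sub>R (x - z))) has_derivative (\<lambda>s. ?D (z + t *\<^sub>R (x - z)) (s *\<^sub>R (x - z)))) (at t)"
        by (simp add: o_def)
      then show "((\<lambda>t. F (z + t *\<^sub>R (x - z))) has_vector_derivative ?D (z + t *\<^sub>R (x - z)) (x - z)) (at t within {0..1})"
        using has_derivative_linear[OF D[OF mem[OF t x]]]
        by (simp add: has_vector_derivative_def has_derivative_at_withinI linear_cmul)
    qed simp
    then have "F x - F z = integral {0..1} (\<lambda>t. ?D (z + t *\<^sub>R (x - z)) (x - z))"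
      by (simp add: integral_unique)
    also have "\<dots> = integral {0..1} (\<lambda>t. \<Sum>b\<in>Basis. complex_of_real ((x - z) \<bullet> b) * ?D (z + t *\<^sub>R (x - z)) b)"
    proof (rule integral_cong)
      fix t :: real assume t: "t \<in> {0..1}"
      have "linear (?D (z + t *\<^sub>R (x - z)))" using has_derivative_linear[OF D[OF mem[OF t x]]] .
      then have "?D (z + t *\<^sub>R (x - z)) (\<Sum>b\<in>Basis. ((x - z) \<bullet> b) *\<^sub>R b) =
          (\<Sum>b\<in>Basis. ((x - z) \<bullet> b) *\<^sub>R ?D (z + t *\<^sub>R (x - z)) b)"
        by (simp only: linear_sum linear_cmul)
      then show "?D (z + t *\<^sub>R (x - z)) (x - z) = (\<Sum>b\<in>Basis. complex_of_real ((x - z) \<bullet> b) * ?D (z + t *\<^sub>R (x - z)) b)"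
        by (simp add: euclidean_representation scaleR_conv_of_real)
    qed
    also have "\<dots> = (\<Sum>b\<in>Basis. complex_of_real ((x - z) \<bullet> b) * g b x)"
    proof -
      have "(\<lambda>t. ?D (z + t *\<^sub>R (x - z)) b) integrable_on {0..1}" for b
        using mem x smooth_on_continuous[OF smooth_on_derivative[OF F, of b]]
        by (intro integrable_continuous_interval) (auto intro!: continuous_intros continuous_on_compose2[of S "\<lambda>y. ?D y b"])
      then show ?thesis
        unfolding g_def
        by (subst integral_sum) (auto intro!: integrable_on_mult_right)
    qed
    finally show ?thesis .
  qed
  show ?thesis by (rule that[OF g1 g2 g3])
qed

section \<open>The exterior algebra\<close>

definition contr :: "'m vf \<Rightarrow> 'm form \<Rightarrow> 'm form" where
  "contr X \<omega> = (\<lambda>Xs. \<omega> (X # Xs))"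

text \<open>The grading involution. Forms do not record their degree, so the sign in the
  antiderivation law is read off the number of arguments.\<close>

definition grade_sign :: "'m form \<Rightarrow> 'm form" where
  "grade_sign \<omega> = (\<lambda>Xs. (- 1) ^ length Xs * \<omega> Xs)"

definition fscale :: "('m \<Rightarrow> complex) \<Rightarrow> 'm form \<Rightarrow> 'm form" where
  "fscale f \<omega> = (\<lambda>Xs. f * \<omega> Xs)"

abbreviation inversions :: "nat set \<Rightarrow> (nat \<times> nat) set" where
  "inversions S \<equiv> {(i, j). i \<in> S \<and> j \<notin> S \<and> j < i}"

lemma contr_apply: "contr X \<omega> Xs = \<omega> (X # Xs)"
  by (simp add: contr_def)

lemma finite_inversions: "finite S \<Longrightarrow> finite (inversions S)"
  by (rule finite_subset[of _ "\<Union>i\<in>S. {i} \<times> {..<i}"]) auto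

section \<open>Recursion for the wedge product on the list of arguments\<close>

lemma Pow_lessThan_Suc_shift:
  "Pow {..<Suc n} = (\<lambda>S. insert 0 (Suc ` S)) ` Pow {..<n} \<union> (\<lambda>S. Suc ` S) ` Pow {..<n}"
  (is "?L = ?R")
proof
  show "?L \<subseteq> ?R"
  proof
    fix S assume S: "S \<in> ?L"
    define T where "T = {j. Suc j \<in> S}"
    have T: "T \<in> Pow {..<n}" using S by (auto simp: T_def)
    have "S = (if 0 \<in> S then insert 0 (Suc ` T) else Suc ` T)"
    proof (rule Set.set_eqI)
      fix x show "x \<in> S \<longleftrightarrow> x \<in> (if 0 \<in> S then insert 0 (Suc ` T) else Suc ` T)"
        by (cases x) (auto simp: T_def)
    qed
    then show "S \<in> ?R" using T by (cases "0 \<in> S") auto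
  qed
qed auto

lemma wedge_Nil [simp]: "(\<omega> \<and>\<^sub>w \<theta>) [] = \<omega> [] * \<theta> []"
  by (simp add: wedge_def)

text \<open>The shuffles split according to the factor that receives the first argument. If it is
  the second factor, this argument jumps over all arguments of the first, and the sign so produced
  is \<open>grade_sign\<close>. The algebra laws below are inductions along this recursion.\<close>

lemma wedge_Cons:
  "(\<omega> \<and>\<^sub>w \<theta>) (X # Xs) = (contr X \<omega> \<and>\<^sub>w \<theta>) Xs + (grade_sign \<omega> \<and>\<^sub>w contr X \<theta>) Xs"
proof -
  let ?n = "length Xs"
  let ?F = "\<lambda>S. (- 1) ^ card (inversions S) * \<omega> (nths (X # Xs) S) * \<theta> (nths (X # Xs) (- S))"
  have inj1: "inj_on (\<lambda>S. insert 0 (Suc ` S)) (Pow {..<?n})"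
  proof (rule inj_onI)
    fix S T :: "nat set" assume "insert 0 (Suc ` S) = insert 0 (Suc ` T)"
    then have "Suc ` S = Suc ` T" by (auto simp: set_eq_iff image_iff)
    then show "S = T" by (simp add: inj_image_eq_iff)
  qed
  have inj2: "inj_on (\<lambda>S. Suc ` S) (Pow {..<?n})"
    by (auto intro!: inj_onI simp: inj_image_eq_iff)
  have disj: "(\<lambda>S. insert 0 (Suc ` S)) ` Pow {..<?n} \<inter> (\<lambda>S. Suc ` S) ` Pow {..<?n} = {}"
    by auto
  have "(\<omega> \<and>\<^sub>w \<theta>) (X # Xs) = sum ?F (Pow {..<Suc ?n})"
    by (simp add: wedge_def)
  also have "\<dots> = (\<Sum>S\<in>Pow {..<?n}. ?F (insert 0 (Suc ` S))) + (\<Sum>S\<in>Pow {..<?n}. ?F (Suc ` S))"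
    unfolding Pow_lessThan_Suc_shift
    by (subst sum.union_disjoint) (auto simp: sum.reindex[OF inj1] sum.reindex[OF inj2] disj)
  also have "(\<Sum>S\<in>Pow {..<?n}. ?F (insert 0 (Suc ` S))) = (contr X \<omega> \<and>\<^sub>w \<theta>) Xs"
    unfolding wedge_def
  proof (rule sum.cong[OF refl])
    fix S assume "S \<in> Pow {..<?n}"
    have "inversions (insert 0 (Suc ` S)) = map_prod Suc Suc ` inversions S"
    proof (rule Set.set_eqI)
      fix z :: "nat \<times> nat" obtain a b where z: "z = (a, b)" by (cases z)
      show "z \<in> inversions (insert 0 (Suc ` S)) \<longleftrightarrow> z \<in> map_prod Suc Suc ` inversions S"
        unfolding z by (cases a; cases b) auto
    qed
    then have "card (inversions (insert 0 (Suc ` S))) = card (inversions S)"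
      by (simp only:) (rule card_image, auto simp: inj_on_def)
    moreover have "{j. Suc j \<in> insert 0 (Suc ` S)} = S" "{j. Suc j \<in> - insert 0 (Suc ` S)} = - S"
      by auto
    ultimately show "?F (insert 0 (Suc ` S)) =
        (- 1) ^ card (inversions S) * contr X \<omega> (nths Xs S) * \<theta> (nths Xs (- S))"
      by (simp add: nths_Cons contr_def)
  qed
  also have "(\<Sum>S\<in>Pow {..<?n}. ?F (Suc ` S)) = (grade_sign \<omega> \<and>\<^sub>w contr X \<theta>) Xs"
    unfolding wedge_def
  proof (rule sum.cong[OF refl])
    fix S assume S: "S \<in> Pow {..<?n}"
    then have fin: "finite S" using finite_subset by auto
    \<comment> \<open>The additional pairs are those of position 0 with each element of S; their
      number, \<open>card S\<close>, is the number of arguments of the first factor.\<close>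
    have "inversions (Suc ` S) = map_prod Suc Suc ` inversions S \<union> (\<lambda>i. (Suc i, 0)) ` S"
    proof (rule Set.set_eqI)
      fix z :: "nat \<times> nat" obtain a b where z: "z = (a, b)" by (cases z)
      show "z \<in> inversions (Suc ` S) \<longleftrightarrow> z \<in> map_prod Suc Suc ` inversions S \<union> (\<lambda>i. (Suc i, 0)) ` S"
        unfolding z by (cases a; cases b) auto
    qed
    then have "card (inversions (Suc ` S)) = card (map_prod Suc Suc ` inversions S) + card ((\<lambda>i. (Suc i, 0::nat)) ` S)"
      by (simp only:) (rule card_Un_disjoint, auto simp: fin finite_inversions)
    also have "\<dots> = card (inversions S) + card S"
      by (subst card_image, force simp: inj_on_def)+ simp
    finally have c: "card (inversions (Suc ` S)) = card (inversions S) + card S" .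
    have "card S = length (nths Xs S)"
      using S by (auto simp: length_nths intro!: arg_cong[where f = card])
    moreover have "{j. Suc j \<in> Suc ` S} = S" "{j. Suc j \<in> - Suc ` S} = - S"
      by auto
    ultimately show "?F (Suc ` S) =
        (- 1) ^ card (inversions S) * grade_sign \<omega> (nths Xs S) * contr X \<theta> (nths Xs (- S))"
      using c by (simp add: nths_Cons contr_def grade_sign_def power_add mult.assoc)
  qed
  finally show ?thesis .
qed

lemma contr_wedge:
  "contr X (\<omega> \<and>\<^sub>w \<theta>) = contr X \<omega> \<and>\<^sub>w \<theta> + grade_sign \<omega> \<and>\<^sub>w contr X \<theta>"
  by (rule ext) (simp add: contr_apply wedge_Cons plus_fun_def)

lemma contr_grade_sign: "contr X (grade_sign \<omega>) = - grade_sign (contr X \<omega>)"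
  by (auto simp: contr_def grade_sign_def fun_eq_iff)

lemma contr_add [simp]: "contr X (\<omega> + \<theta>) = contr X \<omega> + contr X \<theta>"
  and contr_uminus [simp]: "contr X (- \<omega>) = - contr X \<omega>"
  and contr_zero [simp]: "contr X 0 = 0"
  and contr_diff [simp]: "contr X (\<omega> - \<theta>) = contr X \<omega> - contr X \<theta>"
  and contr_cscale [simp]: "contr X (cscale c \<omega>) = cscale c (contr X \<omega>)"
  and contr_fscale [simp]: "contr X (fscale f \<omega>) = fscale f (contr X \<omega>)"
  by (auto simp: contr_def fun_eq_iff cscale_def fscale_def)

lemma wedge_add_left: "(\<omega> + \<omega>') \<and>\<^sub>w \<theta> = \<omega> \<and>\<^sub>w \<theta> + \<omega>' \<and>\<^sub>w \<theta>"
  and wedge_add_right: "\<omega> \<and>\<^sub>w (\<theta> + \<theta>') = \<omega> \<and>\<^sub>w \<theta> + \<omega> \<and>\<^sub>w \<theta>'"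
  and wedge_fscale_left: "fscale f \<omega> \<and>\<^sub>w \<theta> = fscale f (\<omega> \<and>\<^sub>w \<theta>)"
  and wedge_fscale_right: "\<omega> \<and>\<^sub>w fscale f \<theta> = fscale f (\<omega> \<and>\<^sub>w \<theta>)"
  by (rule ext; simp add: wedge_def sum.distrib algebra_simps fscale_def sum_distrib_left)+

lemma cscale_eq_fscale: "cscale c = fscale (\<lambda>_. c)"
  by (auto simp: cscale_def fscale_def fun_eq_iff)

lemma wedge_cscale_left: "cscale c \<omega> \<and>\<^sub>w \<theta> = cscale c (\<omega> \<and>\<^sub>w \<theta>)"
  and wedge_cscale_right: "\<omega> \<and>\<^sub>w cscale c \<theta> = cscale c (\<omega> \<and>\<^sub>w \<theta>)"
  by (simp_all add: cscale_eq_fscale wedge_fscale_left wedge_fscale_right)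

lemma wedge_uminus_left: "(- \<omega>) \<and>\<^sub>w \<theta> = - (\<omega> \<and>\<^sub>w \<theta>)"
  and wedge_uminus_right: "\<omega> \<and>\<^sub>w (- \<theta>) = - (\<omega> \<and>\<^sub>w \<theta>)"
  and wedge_zero_left [simp]: "0 \<and>\<^sub>w \<theta> = 0"
  and wedge_zero_right [simp]: "\<omega> \<and>\<^sub>w 0 = 0"
  by (rule ext; simp add: wedge_def sum_negf)+

lemma wedge_diff_left: "(\<omega> - \<omega>') \<and>\<^sub>w \<theta> = \<omega> \<and>\<^sub>w \<theta> - \<omega>' \<and>\<^sub>w \<theta>"
  by (rule ext) (simp add: wedge_def sum_subtractf algebra_simps)

lemma grade_sign_invol [simp]: "grade_sign (grade_sign \<omega>) = \<omega>"
  by (rule ext) (simp add: grade_sign_def)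

lemma grade_sign_add: "grade_sign (\<omega> + \<theta>) = grade_sign \<omega> + grade_sign \<theta>"
  by (auto simp: grade_sign_def fun_eq_iff algebra_simps)

lemma grade_sign_wedge: "grade_sign (\<omega> \<and>\<^sub>w \<theta>) = grade_sign \<omega> \<and>\<^sub>w grade_sign \<theta>"
proof -
  have "grade_sign (\<omega> \<and>\<^sub>w \<theta>) Xs = (grade_sign \<omega> \<and>\<^sub>w grade_sign \<theta>) Xs" for Xs
  proof (induction Xs arbitrary: \<omega> \<theta>)
    case Nil then show ?case by (simp add: grade_sign_def)
  next
    case (Cons X Xs)
    have "grade_sign (\<omega> \<and>\<^sub>w \<theta>) (X # Xs) = contr X (grade_sign (\<omega> \<and>\<^sub>w \<theta>)) Xs"
      by (simp add: contr_def)
    also have "\<dots> = - (grade_sign (contr X \<omega> \<and>\<^sub>w \<theta>) Xs + grade_sign (grade_sign \<omega> \<and>\<^sub>w contr X \<theta>) Xs)"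
      by (simp add: contr_grade_sign contr_wedge grade_sign_add)
    also have "\<dots> = contr X (grade_sign \<omega> \<and>\<^sub>w grade_sign \<theta>) Xs"
      by (simp add: Cons contr_wedge contr_grade_sign wedge_uminus_left wedge_uminus_right)
    finally show ?case by (simp add: contr_def)
  qed
  then show ?thesis by (rule ext)
qed

text \<open>Peeling off the first argument gives the same recursion on both sides, so shuffles of
  three blocks never have to be compared.\<close>

lemma wedge_assoc: "(\<omega> \<and>\<^sub>w \<theta>) \<and>\<^sub>w \<rho> = \<omega> \<and>\<^sub>w (\<theta> \<and>\<^sub>w \<rho>)"
proof -
  have "((\<omega> \<and>\<^sub>w \<theta>) \<and>\<^sub>w \<rho>) Xs = (\<omega> \<and>\<^sub>w (\<theta> \<and>\<^sub>w \<rho>)) Xs" for Xs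
  proof (induction Xs arbitrary: \<omega> \<theta> \<rho>)
    case Nil then show ?case by (simp add: mult.assoc)
  next
    case (Cons X Xs)
    then show ?case
      by (simp add: wedge_Cons contr_wedge grade_sign_wedge wedge_add_left wedge_add_right add.assoc)
  qed
  then show ?thesis by (rule ext)
qed

lemma grade_sign_contr:
  assumes "grade_sign \<omega> = cscale ((- 1) ^ a) \<omega>"
  shows "grade_sign (contr X \<omega>) = cscale ((- 1) ^ Suc a) (contr X \<omega>)"
proof -
  have "- grade_sign (contr X \<omega>) = cscale ((- 1) ^ a) (contr X \<omega>)"
    using arg_cong[OF assms, of "contr X"] by (simp add: contr_grade_sign)
  then have "grade_sign (contr X \<omega>) = - cscale ((- 1) ^ a) (contr X \<omega>)"
    by (metis minus_minus)
  also have "\<dots> = cscale ((- 1) ^ Suc a) (contr X \<omega>)"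
    by (simp add: cscale_def fun_eq_iff)
  finally show ?thesis .
qed

text \<open>A form of degree \<open>n\<close> is an eigenvector of \<open>grade_sign\<close> for \<open>(-1)\<^sup>n\<close>; this is the only way
  in which the degree enters commutativity.\<close>

lemma wedge_commute_sign:
  assumes "grade_sign \<omega> = cscale ((- 1) ^ a) \<omega>" "grade_sign \<theta> = cscale ((- 1) ^ b) \<theta>"
  shows "\<omega> \<and>\<^sub>w \<theta> = cscale ((- 1) ^ (a * b)) (\<theta> \<and>\<^sub>w \<omega>)"
proof -
  have "(\<omega> \<and>\<^sub>w \<theta>) Xs = cscale ((- 1) ^ (a * b)) (\<theta> \<and>\<^sub>w \<omega>) Xs" for Xs
    using assms
  proof (induction Xs arbitrary: \<omega> \<theta> a b)
    case Nil
    have "(- 1) ^ (a * b) * \<theta> [] x * \<omega> [] x = \<omega> [] x * \<theta> [] x" for x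
    proof -
      have "\<omega> [] x = (- 1) ^ a * \<omega> [] x" "\<theta> [] x = (- 1) ^ b * \<theta> [] x"
        using Nil[THEN fun_cong, of "[]"] by (auto simp: grade_sign_def cscale_def fun_eq_iff)
      then show ?thesis by (cases "even a"; cases "even b") auto
    qed
    then show ?case by (auto simp: cscale_def fun_eq_iff mult.assoc)
  next
    case (Cons X Xs)
    have 1: "grade_sign (contr X \<omega>) = cscale ((- 1) ^ Suc a) (contr X \<omega>)"
      by (rule grade_sign_contr[OF Cons.prems(1)])
    have 2: "grade_sign (contr X \<theta>) = cscale ((- 1) ^ Suc b) (contr X \<theta>)"
      by (rule grade_sign_contr[OF Cons.prems(2)])
    have "(\<omega> \<and>\<^sub>w \<theta>) (X # Xs)
        = (contr X \<omega> \<and>\<^sub>w \<theta>) Xs + cscale ((- 1) ^ a) (\<omega> \<and>\<^sub>w contr X \<theta>) Xs"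
      by (simp add: wedge_Cons Cons.prems wedge_cscale_left)
    also have "\<dots> = cscale ((- 1) ^ (Suc a * b)) (\<theta> \<and>\<^sub>w contr X \<omega>) Xs
        + cscale ((- 1) ^ a) (cscale ((- 1) ^ (a * Suc b)) (contr X \<theta> \<and>\<^sub>w \<omega>)) Xs"
      using Cons.IH[OF 1 Cons.prems(2)] Cons.IH[OF Cons.prems(1) 2] by (simp add: cscale_def)
    also have "\<dots> = cscale ((- 1) ^ (a * b)) (\<theta> \<and>\<^sub>w \<omega>) (X # Xs)"
    proof -
      have R: "(\<theta> \<and>\<^sub>w \<omega>) (X # Xs)
          = (contr X \<theta> \<and>\<^sub>w \<omega>) Xs + cscale ((- 1) ^ b) (\<theta> \<and>\<^sub>w contr X \<omega>) Xs"
        by (simp add: wedge_Cons Cons.prems wedge_cscale_left)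
      show ?thesis
        by (rule ext) (simp add: cscale_def R algebra_simps power_add)
    qed
    finally show ?case .
  qed
  then show ?thesis by (rule ext)
qed

text \<open>The source of all support arguments below: if a product does not vanish on a list, some
  splitting of the list makes both factors nonzero.\<close>

lemma wedge_nonzeroE:
  assumes "(\<omega> \<and>\<^sub>w \<theta>) Xs \<noteq> 0"
  obtains S where "\<omega> (nths Xs S) \<noteq> 0" "\<theta> (nths Xs (- S)) \<noteq> 0"
proof -
  have "\<exists>S. (- 1) ^ card (inversions S) * \<omega> (nths Xs S) * \<theta> (nths Xs (- S)) \<noteq> 0"
    using assms unfolding wedge_def by (rule contrapos_np) simp
  then obtain S where "(- 1) ^ card (inversions S) * \<omega> (nths Xs S) * \<theta> (nths Xs (- S)) \<noteq> 0" ..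
  then have "\<omega> (nths Xs S) \<noteq> 0" "\<theta> (nths Xs (- S)) \<noteq> 0" by auto
  then show ?thesis by (rule that)
qed

lemma form_one_wedge [simp]: "form_one \<and>\<^sub>w \<omega> = \<omega>"
proof -
  have "(form_one \<and>\<^sub>w \<omega>) Xs = \<omega> Xs" for Xs
  proof (induction Xs arbitrary: \<omega>)
    case Nil then show ?case by (simp add: form_one_def)
  next
    case (Cons X Xs)
    have "contr X form_one = 0" "grade_sign (form_one :: 'a form) = form_one"
      by (auto simp: contr_def form_one_def grade_sign_def fun_eq_iff)
    then show ?case by (simp add: wedge_Cons Cons) (simp add: contr_apply)
  qed
  then show ?thesis by (rule ext)
qed

lemma wedge_form_one [simp]: "\<omega> \<and>\<^sub>w form_one = \<omega>"
proof -
  have "(\<omega> \<and>\<^sub>w form_one) Xs = \<omega> Xs" for Xs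
  proof (induction Xs arbitrary: \<omega>)
    case Nil then show ?case by (simp add: form_one_def)
  next
    case (Cons X Xs)
    have "contr X form_one = 0" by (auto simp: contr_def form_one_def fun_eq_iff)
    with Cons show ?case by (simp add: wedge_Cons contr_apply)
  qed
  then show ?thesis by (rule ext)
qed

lemma wedge_list_append: "wedge_list (\<omega>s @ \<theta>s) = wedge_list \<omega>s \<and>\<^sub>w wedge_list \<theta>s"
  by (induction \<omega>s) (simp_all add: wedge_list_def wedge_assoc)

lemma wedge_list_Cons: "wedge_list (\<omega> # \<omega>s) = \<omega> \<and>\<^sub>w wedge_list \<omega>s"
  and wedge_list_Nil: "wedge_list [] = form_one"
  by (simp_all add: wedge_list_def)

text \<open>The simplifier may introduce eta-expanded zero functions; this undoes that.\<close>

declare zero_fun_def [symmetric, simp]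

section \<open>Alternating forms over an algebra of functions\<close>

locale function_algebra =
  fixes A :: "('m \<Rightarrow> complex) set"
  assumes const_mem: "(\<lambda>_. c) \<in> A"
    and add_mem: "f \<in> A \<Longrightarrow> g \<in> A \<Longrightarrow> f + g \<in> A"
    and mult_mem: "f \<in> A \<Longrightarrow> g \<in> A \<Longrightarrow> f * g \<in> A"
    and cnj_mem: "f \<in> A \<Longrightarrow> (\<lambda>x. cnj (f x)) \<in> A"
begin

abbreviation "VF \<equiv> vector_fields A"

lemma zero_mem: "0 \<in> A" and one_mem: "1 \<in> A"
  using const_mem[of 0] const_mem[of 1] by (simp_all add: one_fun_def)

lemma cmult_mem: "f \<in> A \<Longrightarrow> (\<lambda>x. c * f x) \<in> A"
  using mult_mem[OF const_mem, of f c] by (simp add: times_fun_def)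

lemma uminus_mem: "f \<in> A \<Longrightarrow> - f \<in> A"
  using cmult_mem[of f "-1"] by (simp add: fun_Compl_def)

lemma diff_mem: "f \<in> A \<Longrightarrow> g \<in> A \<Longrightarrow> f - g \<in> A"
  using add_mem[OF _ uminus_mem, of f g] by simp

lemma sum_mem: "(\<And>i. i \<in> I \<Longrightarrow> f i \<in> A) \<Longrightarrow> sum f I \<in> A"
  by (induction I rule: infinite_finite_induct) (auto simp: zero_mem add_mem)

lemma vf_mem: "X \<in> VF \<Longrightarrow> f \<in> A \<Longrightarrow> X f \<in> A"
  and vf_outside: "X \<in> VF \<Longrightarrow> f \<notin> A \<Longrightarrow> X f = 0"
  and vf_add: "X \<in> VF \<Longrightarrow> f \<in> A \<Longrightarrow> g \<in> A \<Longrightarrow> X (f + g) = X f + X g"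
  and vf_cmult: "X \<in> VF \<Longrightarrow> f \<in> A \<Longrightarrow> X (\<lambda>x. c * f x) = (\<lambda>x. c * X f x)"
  and vf_times: "X \<in> VF \<Longrightarrow> f \<in> A \<Longrightarrow> g \<in> A \<Longrightarrow> X (f * g) = f * X g + g * X f"
  by (auto simp: vector_fields_def)

lemma vf_range: "X \<in> VF \<Longrightarrow> X f \<in> A"
  by (cases "f \<in> A") (auto simp: vf_mem vf_outside zero_mem)

lemma vf_const: assumes "X \<in> VF" shows "X (\<lambda>_. c) = 0"
proof -
  have "X (1 * 1) = 1 * X 1 + 1 * X 1" using vf_times[OF assms one_mem one_mem] .
  then have "X 1 = 0" by simp
  then have "X (\<lambda>x. c * (1 :: 'm \<Rightarrow> complex) x) = (\<lambda>x. c * 0)"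
    using vf_cmult[OF assms one_mem, of c] by (simp add: fun_eq_iff)
  then show ?thesis by simp
qed

lemma vf_zero: "X \<in> VF \<Longrightarrow> X 0 = 0"
  using vf_const[of X 0] by simp

lemma vf_uminus: "X \<in> VF \<Longrightarrow> f \<in> A \<Longrightarrow> X (- f) = - X f"
  using vf_cmult[of X f "-1"] by (simp add: fun_Compl_def)

lemma vf_diff: "X \<in> VF \<Longrightarrow> f \<in> A \<Longrightarrow> g \<in> A \<Longrightarrow> X (f - g) = X f - X g"
  using vf_add[of X f "- g"] by (simp only: uminus_mem vf_uminus diff_conv_add_uminus)

lemma vf_sum: "X \<in> VF \<Longrightarrow> (\<And>i. i \<in> I \<Longrightarrow> f i \<in> A) \<Longrightarrow> X (sum f I) = (\<Sum>i\<in>I. X (f i))"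
  by (induction I rule: infinite_finite_induct) (auto simp: vf_zero vf_add sum_mem)

lemma VF_zero: "0 \<in> VF"
  by (auto simp: vector_fields_def zero_mem fun_eq_iff)

lemma VF_add: "X \<in> VF \<Longrightarrow> Y \<in> VF \<Longrightarrow> X + Y \<in> VF"
  unfolding vector_fields_def mem_Collect_eq
  by (intro conjI ballI allI impI) (simp_all add: add_mem algebra_simps, simp add: fun_eq_iff algebra_simps)

lemma VF_mult: "X \<in> VF \<Longrightarrow> f \<in> A \<Longrightarrow> vf_mult f X \<in> VF"
  unfolding vector_fields_def mem_Collect_eq vf_mult_def
  by (intro conjI ballI allI impI) (simp_all add: mult_mem algebra_simps, simp add: fun_eq_iff algebra_simps)

lemma VF_cscale: "X \<in> VF \<Longrightarrow> (\<lambda>f x. c * X f x) \<in> VF"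
  using VF_mult[OF _ const_mem, of X c] by (simp add: vf_mult_def times_fun_def)

lemma VF_uminus: "X \<in> VF \<Longrightarrow> - X \<in> VF"
  using VF_cscale[of X "-1"] by (simp add: fun_Compl_def)

lemma VF_diff: "X \<in> VF \<Longrightarrow> Y \<in> VF \<Longrightarrow> X - Y \<in> VF"
  using VF_add[OF _ VF_uminus, of X Y] by simp

lemma VF_sum: "(\<And>i. i \<in> I \<Longrightarrow> X i \<in> VF) \<Longrightarrow> sum X I \<in> VF"
  by (induction I rule: infinite_finite_induct) (auto simp: VF_zero VF_add)

lemma VF_conj: "X \<in> VF \<Longrightarrow> vf_conj X \<in> VF"
proof -
  assume X: "X \<in> VF"
  have iff: "(\<lambda>y. cnj (f y)) \<in> A \<longleftrightarrow> f \<in> A" for f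
    using cnj_mem[of f] cnj_mem[of "\<lambda>y. cnj (f y)"] by auto
  have 1: "X (\<lambda>y. cnj (f y) + cnj (g y)) = X (\<lambda>y. cnj (f y)) + X (\<lambda>y. cnj (g y))" if "f \<in> A" "g \<in> A" for f g
    using vf_add[OF X, of "\<lambda>y. cnj (f y)" "\<lambda>y. cnj (g y)"] that by (simp add: iff plus_fun_def)
  have 2: "X (\<lambda>y. cnj (f y) * cnj (g y)) = (\<lambda>y. cnj (f y)) * X (\<lambda>y. cnj (g y)) + (\<lambda>y. cnj (g y)) * X (\<lambda>y. cnj (f y))" if "f \<in> A" "g \<in> A" for f g
    using vf_times[OF X, of "\<lambda>y. cnj (f y)" "\<lambda>y. cnj (g y)"] that by (simp add: iff times_fun_def)
  show ?thesis
    unfolding vector_fields_def mem_Collect_eq vf_conj_def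
    by (intro conjI ballI allI impI)
       (auto simp: vf_range[OF X] cnj_mem fun_eq_iff vf_outside[OF X] iff vf_cmult[OF X] 1 2)
qed

lemma VF_lie_bracket: assumes X: "X \<in> VF" and Y: "Y \<in> VF" shows "lie_bracket X Y \<in> VF"
  unfolding vector_fields_def mem_Collect_eq lie_bracket_def
  by (intro conjI ballI allI impI)
     (simp_all add: vf_range[OF X] vf_range[OF Y] diff_mem vf_outside[OF X] vf_outside[OF Y] vf_zero[OF X]
       vf_zero[OF Y] vf_add[OF X] vf_add[OF Y] vf_times[OF X] vf_times[OF Y] vf_cmult[OF X] vf_cmult[OF Y]
       mult_mem, simp_all add: fun_eq_iff algebra_simps)

lemma lie_bracket_add_right: "X \<in> VF \<Longrightarrow> Y \<in> VF \<Longrightarrow> Z \<in> VF \<Longrightarrow>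
    lie_bracket X (Y + Z) = lie_bracket X Y + lie_bracket X Z"
  by (rule ext, rule ext) (simp add: lie_bracket_def vf_add vf_range)

lemma lie_bracket_add_left: "X \<in> VF \<Longrightarrow> Y \<in> VF \<Longrightarrow> Z \<in> VF \<Longrightarrow>
    lie_bracket (X + Y) Z = lie_bracket X Z + lie_bracket Y Z"
  by (rule ext, rule ext) (simp add: lie_bracket_def vf_add vf_range)

lemma lie_bracket_mult_right: "X \<in> VF \<Longrightarrow> Y \<in> VF \<Longrightarrow> f \<in> A \<Longrightarrow>
    lie_bracket X (vf_mult f Y) = vf_mult f (lie_bracket X Y) + vf_mult (X f) Y"
  by (rule ext, rule ext) (simp add: lie_bracket_def vf_mult_def vf_times vf_range algebra_simps)

lemma lie_bracket_mult_left: "X \<in> VF \<Longrightarrow> Y \<in> VF \<Longrightarrow> f \<in> A \<Longrightarrow>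
    lie_bracket (vf_mult f X) Y = vf_mult f (lie_bracket X Y) + vf_mult (- Y f) X"
  by (rule ext, rule ext) (simp add: lie_bracket_def vf_mult_def vf_times vf_range algebra_simps)

lemma formsD:
  assumes "\<omega> \<in> forms A n"
  shows form_mem: "set Xs \<subseteq> VF \<Longrightarrow> length Xs = n \<Longrightarrow> \<omega> Xs \<in> A"
    and form_outside: "\<not> set Xs \<subseteq> VF \<or> length Xs \<noteq> n \<Longrightarrow> \<omega> Xs = 0"
    and form_add: "set Xs \<subseteq> VF \<Longrightarrow> length Xs = n \<Longrightarrow> i < n \<Longrightarrow> Y \<in> VF \<Longrightarrow> Z \<in> VF \<Longrightarrow>
      \<omega> (Xs[i := Y + Z]) = \<omega> (Xs[i := Y]) + \<omega> (Xs[i := Z])"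
    and form_mult: "set Xs \<subseteq> VF \<Longrightarrow> length Xs = n \<Longrightarrow> i < n \<Longrightarrow> Y \<in> VF \<Longrightarrow> f \<in> A \<Longrightarrow>
      \<omega> (Xs[i := vf_mult f Y]) = f * \<omega> (Xs[i := Y])"
    and form_alt: "set Xs \<subseteq> VF \<Longrightarrow> length Xs = n \<Longrightarrow> i < j \<Longrightarrow> j < n \<Longrightarrow> Xs ! i = Xs ! j \<Longrightarrow> \<omega> Xs = 0"
  using assms unfolding forms_def by blast+

lemma form_range: "\<omega> \<in> forms A n \<Longrightarrow> \<omega> Xs \<in> A"
  using form_mem form_outside zero_mem by metis

lemma set_list_update_VF: "set Xs \<subseteq> VF \<Longrightarrow> Y \<in> VF \<Longrightarrow> set (Xs[i := Y]) \<subseteq> VF"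
  by (meson insert_subset order_trans set_update_subset_insert)

text \<open>Polarization: put the sum of the two arguments into both slots and expand.\<close>

lemma form_swap:
  assumes \<omega>: "\<omega> \<in> forms A n" and Xs: "set Xs \<subseteq> VF" "length Xs = n" and ij: "i < j" "j < n"
  shows "\<omega> (Xs[i := Xs ! j, j := Xs ! i]) = - \<omega> Xs"
proof -
  define a where "a = Xs ! i"
  define b where "b = Xs ! j"
  have ab: "a \<in> VF" "b \<in> VF" using Xs ij by (auto simp: a_def b_def)
  define F where "F = (\<lambda>u v. \<omega> (Xs[i := u, j := v]))"
  have l: "F (u + u') v = F u v + F u' v" if "u \<in> VF" "u' \<in> VF" "v \<in> VF" for u u' v
    using form_add[OF \<omega>, of "Xs[j := v]" i u u'] that Xs ij
    by (simp add: F_def set_list_update_VF list_update_swap)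
  have r: "F u (v + v') = F u v + F u v'" if "u \<in> VF" "v' \<in> VF" "v \<in> VF" for u v v'
    using form_add[OF \<omega>, of "Xs[i := u]" j v v'] that Xs ij
    by (simp add: F_def set_list_update_VF)
  have d: "F u u = 0" if "u \<in> VF" for u
    unfolding F_def using that Xs ij
    by (intro form_alt[OF \<omega>, of _ i j]) (auto simp: set_list_update_VF)
  have "0 = F (a + b) (a + b)" using d ab VF_add by simp
  also have "\<dots> = F a b + F b a"
    using d[OF ab(1)] d[OF ab(2)] by (simp add: l r ab VF_add)
  finally have "F b a = - F a b" by (metis add.commute eq_neg_iff_add_eq_0)
  then show ?thesis by (simp add: F_def a_def b_def)
qed

lemma forms_0_iff: "\<omega> \<in> forms A 0 \<longleftrightarrow> \<omega> [] \<in> A \<and> (\<forall>Xs. Xs \<noteq> [] \<longrightarrow> \<omega> Xs = 0)"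
proof
  assume w: "\<omega> \<in> forms A 0"
  show "\<omega> [] \<in> A \<and> (\<forall>Xs. Xs \<noteq> [] \<longrightarrow> \<omega> Xs = 0)"
    using form_mem[OF w, of "[]"] form_outside[OF w] by auto
next
  assume w: "\<omega> [] \<in> A \<and> (\<forall>Xs. Xs \<noteq> [] \<longrightarrow> \<omega> Xs = 0)"
  show "\<omega> \<in> forms A 0"
    unfolding forms_def mem_Collect_eq
  proof (intro conjI allI impI)
    fix Xs assume "\<not> (set Xs \<subseteq> VF \<and> length Xs = 0)"
    then have "Xs \<noteq> []" by auto
    with w show "\<omega> Xs = 0" by blast
  qed (use w in auto)
qed

lemma forms_SucD:
  assumes \<omega>: "\<omega> \<in> forms A (Suc n)"
  shows form_Suc_Nil: "\<omega> [] = 0"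
    and contr_outside: "X \<notin> VF \<Longrightarrow> contr X \<omega> = 0"
    and contr_forms: "X \<in> VF \<Longrightarrow> contr X \<omega> \<in> forms A n"
    and contr_twice: "X \<in> VF \<Longrightarrow> contr X (contr X \<omega>) = 0"
    and contr_add_vf: "X \<in> VF \<Longrightarrow> Y \<in> VF \<Longrightarrow> contr (X + Y) \<omega> = contr X \<omega> + contr Y \<omega>"
    and contr_mult_vf: "X \<in> VF \<Longrightarrow> f \<in> A \<Longrightarrow> contr (vf_mult f X) \<omega> = fscale f (contr X \<omega>)"
proof -
  show "\<omega> [] = 0" using form_outside[OF \<omega>, of "[]"] by simp
  show "contr X \<omega> = 0" if "X \<notin> VF"
    using form_outside[OF \<omega>] that by (auto simp: contr_def fun_eq_iff)
  show "contr X (contr X \<omega>) = 0" if "X \<in> VF"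
  proof
    fix Xs
    show "contr X (contr X \<omega>) Xs = 0 Xs"
    proof (cases "set Xs \<subseteq> VF \<and> Suc (length Xs) = n")
      case True
      with that show ?thesis
        using form_alt[OF \<omega>, of "X # X # Xs" 0 1] by (auto simp: contr_def)
    qed (use form_outside[OF \<omega>, of "X # X # Xs"] in \<open>auto simp: contr_def\<close>)
  qed
  show "contr (X + Y) \<omega> = contr X \<omega> + contr Y \<omega>" if "X \<in> VF" "Y \<in> VF"
  proof
    fix Xs
    show "contr (X + Y) \<omega> Xs = (contr X \<omega> + contr Y \<omega>) Xs"
    proof (cases "set Xs \<subseteq> VF \<and> length Xs = n")
      case True
      with that show ?thesis
        using form_add[OF \<omega>, of "X # Xs" 0 X Y] by (auto simp: contr_def)
    qed (use form_outside[OF \<omega>, of "_ # Xs"] in \<open>auto simp: contr_def\<close>)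
  qed
  show "contr (vf_mult f X) \<omega> = fscale f (contr X \<omega>)" if "X \<in> VF" "f \<in> A"
  proof
    fix Xs
    show "contr (vf_mult f X) \<omega> Xs = fscale f (contr X \<omega>) Xs"
    proof (cases "set Xs \<subseteq> VF \<and> length Xs = n")
      case True
      with that show ?thesis
        using form_mult[OF \<omega>, of "X # Xs" 0 X f] by (auto simp: contr_def fscale_def)
    qed (use form_outside[OF \<omega>, of "_ # Xs"] in \<open>auto simp: contr_def fscale_def\<close>)
  qed
  show "contr X \<omega> \<in> forms A n" if X: "X \<in> VF"
    unfolding forms_def mem_Collect_eq
  proof (intro conjI allI impI ballI)
    fix Xs
    show "contr X \<omega> Xs \<in> A" by (simp add: contr_def form_range[OF \<omega>])
    show "contr X \<omega> Xs = 0" if "\<not> (set Xs \<subseteq> VF \<and> length Xs = n)"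
      using form_outside[OF \<omega>, of "X # Xs"] that by (auto simp: contr_def)
    show "contr X \<omega> (Xs[i := Y + Z]) = contr X \<omega> (Xs[i := Y]) + contr X \<omega> (Xs[i := Z])"
      if "set Xs \<subseteq> VF \<and> length Xs = n \<and> i < n" "Y \<in> VF" "Z \<in> VF" for i Y Z
      using form_add[OF \<omega>, of "X # Xs" "Suc i" Y Z] that X by (auto simp: contr_def)
    show "contr X \<omega> (Xs[i := vf_mult f Y]) = f * contr X \<omega> (Xs[i := Y])"
      if "set Xs \<subseteq> VF \<and> length Xs = n \<and> i < n" "Y \<in> VF" "f \<in> A" for i Y f
      using form_mult[OF \<omega>, of "X # Xs" "Suc i" Y f] that X by (auto simp: contr_def)
    show "contr X \<omega> Xs = 0"
      if "set Xs \<subseteq> VF \<and> length Xs = n \<and> i < j \<and> j < n \<and> Xs ! i = Xs ! j" for i j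
      using form_alt[OF \<omega>, of "X # Xs" "Suc i" "Suc j"] that X by (auto simp: contr_def)
  qed
qed

text \<open>Contractions are alternating by assumption, so alternation is left to be checked only
  for repetitions of the first argument, and of these only for the first two slots. Together with
  \<open>forms_SucD\<close> this turns membership in \<open>forms\<close> into a recursion on the
  degree.\<close>

lemma forms_SucI:
  assumes nil: "\<omega> [] = 0"
    and out: "\<And>X. X \<notin> VF \<Longrightarrow> contr X \<omega> = 0"
    and c: "\<And>X. X \<in> VF \<Longrightarrow> contr X \<omega> \<in> forms A n"
    and tw: "\<And>X. X \<in> VF \<Longrightarrow> contr X (contr X \<omega>) = 0"
    and add: "\<And>X Y. X \<in> VF \<Longrightarrow> Y \<in> VF \<Longrightarrow> contr (X + Y) \<omega> = contr X \<omega> + contr Y \<omega>"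
    and mult: "\<And>X f. X \<in> VF \<Longrightarrow> f \<in> A \<Longrightarrow> contr (vf_mult f X) \<omega> = fscale f (contr X \<omega>)"
  shows "\<omega> \<in> forms A (Suc n)"
  unfolding forms_def mem_Collect_eq
proof (intro conjI allI impI ballI)
  fix Xs
  have eq: "\<omega> (X # Ys) = contr X \<omega> Ys" for X Ys by (simp add: contr_def)
  show "\<omega> Xs \<in> A" if "set Xs \<subseteq> VF \<and> length Xs = Suc n"
    using that by (cases Xs) (auto simp: eq form_range[OF c])
  show "\<omega> Xs = 0" if a: "\<not> (set Xs \<subseteq> VF \<and> length Xs = Suc n)"
  proof (cases Xs)
    case (Cons X Ys)
    show ?thesis
    proof (cases "X \<in> VF")
      case True
      then show ?thesis using a form_outside[OF c[OF True], of Ys] Cons by (auto simp: eq)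
    qed (simp add: Cons eq out)
  qed (simp add: nil)
  show "\<omega> (Xs[i := Y + Z]) = \<omega> (Xs[i := Y]) + \<omega> (Xs[i := Z])"
    if a: "set Xs \<subseteq> VF \<and> length Xs = Suc n \<and> i < Suc n" and Y: "Y \<in> VF" and Z: "Z \<in> VF" for i Y Z
  proof -
    obtain X Ys where X: "Xs = X # Ys" using a by (cases Xs) auto
    show ?thesis
    proof (cases i)
      case 0 then show ?thesis by (simp add: X eq add Y Z)
    next
      case (Suc j)
      then show ?thesis using form_add[OF c, of X Ys j Y Z] a Y Z by (auto simp: X eq)
    qed
  qed
  show "\<omega> (Xs[i := vf_mult f Y]) = f * \<omega> (Xs[i := Y])"
    if a: "set Xs \<subseteq> VF \<and> length Xs = Suc n \<and> i < Suc n" and Y: "Y \<in> VF" and f: "f \<in> A" for i Y f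
  proof -
    obtain X Ys where X: "Xs = X # Ys" using a by (cases Xs) auto
    show ?thesis
    proof (cases i)
      case 0 then show ?thesis by (simp add: X eq mult Y f) (simp add: fscale_def)
    next
      case (Suc j)
      then show ?thesis using form_mult[OF c, of X Ys j Y f] a Y f by (auto simp: X eq)
    qed
  qed
  show "\<omega> Xs = 0"
    if a: "set Xs \<subseteq> VF \<and> length Xs = Suc n \<and> i < j \<and> j < Suc n \<and> Xs ! i = Xs ! j" for i j
  proof -
    obtain X Ys where X: "Xs = X # Ys" using a by (cases Xs) auto
    have XV: "X \<in> VF" and Ys: "set Ys \<subseteq> VF" "length Ys = n" using a X by auto
    obtain j' where j: "j = Suc j'" using a by (cases j) auto
    have j': "j' < n" using a j by simp
    show ?thesis
    proof (cases i)
      case (Suc i')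
      then show ?thesis using form_alt[OF c[OF XV] Ys, of i' j'] a j X by (simp add: eq)
    next
      case 0
      then have Xj: "Ys ! j' = X" using a X j by simp
      obtain Y Zs where YZ: "Ys = Y # Zs" using Ys j' by (cases Ys) auto
      show ?thesis
      proof (cases j')
        case 0
        then have "Y = X" using Xj YZ by simp
        then show ?thesis using tw[OF XV] by (simp add: X YZ) (simp add: contr_def fun_eq_iff)
      next
        case (Suc l)
        \<comment> \<open>The second copy of X sits at a later position; the swap brings it next to
          the first copy.\<close>
        have "contr X \<omega> Ys = - contr X \<omega> (Ys[0 := Ys ! j', j' := Ys ! 0])"
          using form_swap[OF c[OF XV] Ys, of 0 j'] Suc j' by simp
        also have "Ys[0 := Ys ! j', j' := Ys ! 0] = X # (Zs[l := Y])"
          using Xj Suc by (simp add: YZ)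
        also have "contr X \<omega> \<dots> = 0" using tw[OF XV] by (simp add: contr_def fun_eq_iff)
        finally show ?thesis by (simp add: X eq)
      qed
    qed
  qed
qed

lemma zero_forms: "0 \<in> forms A n"
  by (auto simp: forms_def zero_mem)

lemma add_forms: "\<omega> \<in> forms A n \<Longrightarrow> \<theta> \<in> forms A n \<Longrightarrow> \<omega> + \<theta> \<in> forms A n"
  unfolding forms_def mem_Collect_eq
  by (intro conjI allI impI ballI) (simp_all add: add_mem algebra_simps, metis add_0)

lemma fscale_forms: "\<omega> \<in> forms A n \<Longrightarrow> f \<in> A \<Longrightarrow> fscale f \<omega> \<in> forms A n"
  unfolding forms_def mem_Collect_eq fscale_def
  by (intro conjI allI impI ballI) (simp_all add: mult_mem algebra_simps, metis mult_zero_right)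

lemma cscale_forms: "\<omega> \<in> forms A n \<Longrightarrow> cscale c \<omega> \<in> forms A n"
  by (simp add: cscale_eq_fscale fscale_forms const_mem)

lemma uminus_forms: "\<omega> \<in> forms A n \<Longrightarrow> - \<omega> \<in> forms A n"
  using cscale_forms[of \<omega> n "-1"] by (simp add: cscale_def fun_Compl_def)

lemma diff_forms: "\<omega> \<in> forms A n \<Longrightarrow> \<theta> \<in> forms A n \<Longrightarrow> \<omega> - \<theta> \<in> forms A n"
  using add_forms[OF _ uminus_forms, of \<omega> n \<theta>] by simp

lemma sum_forms: "(\<And>i. i \<in> I \<Longrightarrow> \<omega> i \<in> forms A n) \<Longrightarrow> sum \<omega> I \<in> forms A n"
  by (induction I rule: infinite_finite_induct) (auto simp: zero_forms add_forms)

lemma grade_sign_form: "\<omega> \<in> forms A n \<Longrightarrow> grade_sign \<omega> = cscale ((- 1) ^ n) \<omega>"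
proof
  fix Xs assume w: "\<omega> \<in> forms A n"
  have "(- 1 :: 'm \<Rightarrow> complex) ^ n = (\<lambda>_. (- 1) ^ n)" by (induction n) (auto simp: fun_eq_iff)
  then show "grade_sign \<omega> Xs = cscale ((- 1) ^ n) \<omega> Xs"
    using form_outside[OF w, of Xs]
    by (cases "length Xs = n") (auto simp: grade_sign_def cscale_def times_fun_def)
qed

lemma contr_anticomm:
  assumes w: "\<omega> \<in> forms A n" and X: "X \<in> VF" and Y: "Y \<in> VF"
  shows "contr X (contr Y \<omega>) = - contr Y (contr X \<omega>)"
proof
  fix Xs
  show "contr X (contr Y \<omega>) Xs = (- contr Y (contr X \<omega>)) Xs"
  proof (cases "set Xs \<subseteq> VF \<and> Suc (Suc (length Xs)) = n")
    case True
    then show ?thesis using form_swap[OF w, of "X # Y # Xs" 0 1] X Y by (auto simp: contr_def)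
  qed (use form_outside[OF w, of "_ # _ # Xs"] in \<open>auto simp: contr_def\<close>)
qed

lemma contr_zero_vf: "\<omega> \<in> forms A n \<Longrightarrow> contr 0 \<omega> = 0"
proof (cases n)
  case (Suc m)
  assume "\<omega> \<in> forms A n"
  then have w: "\<omega> \<in> forms A (Suc m)" by (simp add: Suc)
  have "vf_mult 0 0 = (0 :: 'm vf)" by (auto simp: vf_mult_def fun_eq_iff)
  then show ?thesis using contr_mult_vf[OF w VF_zero zero_mem] by (simp only:) (simp add: fscale_def fun_eq_iff)
qed (auto simp: forms_0_iff contr_def fun_eq_iff)

lemma contr_uminus_vf: "\<omega> \<in> forms A n \<Longrightarrow> X \<in> VF \<Longrightarrow> contr (- X) \<omega> = - contr X \<omega>"
proof (cases n)
  case (Suc m)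
  assume "\<omega> \<in> forms A n" and X: "X \<in> VF"
  then have w: "\<omega> \<in> forms A (Suc m)" by (simp add: Suc)
  have "contr (X + - X) \<omega> = contr X \<omega> + contr (- X) \<omega>"
    by (rule contr_add_vf[OF w X VF_uminus[OF X]])
  then show ?thesis using contr_zero_vf[OF w] by (simp add: eq_neg_iff_add_eq_0 add.commute)
qed (auto simp: forms_0_iff contr_def fun_eq_iff)

lemma form_move_front:
  assumes "\<omega> \<in> forms A n" "set us \<subseteq> VF" "X \<in> VF"
  shows "\<omega> (us @ X # vs) = (- 1) ^ length us * \<omega> (X # us @ vs)"
  using assms
proof (induction us arbitrary: \<omega> n)
  case (Cons u us)
  show ?case
  proof (cases n)
    case 0 with Cons.prems show ?thesis by (simp add: forms_0_iff)
  next
    case (Suc m)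
    with Cons.prems have w: "\<omega> \<in> forms A (Suc m)" and u: "u \<in> VF" by auto
    have "\<omega> ((u # us) @ X # vs) = contr u \<omega> (us @ X # vs)" by (simp add: contr_def)
    also have "\<dots> = (- 1) ^ length us * contr X (contr u \<omega>) (us @ vs)"
    proof -
      have "contr u \<omega> (us @ X # vs) = (- 1) ^ length us * contr u \<omega> (X # us @ vs)"
        by (rule Cons.IH[OF contr_forms[OF w u]]) (use Cons.prems in auto)
      then show ?thesis by (simp only: contr_def)
    qed
    also have "contr X (contr u \<omega>) = - contr u (contr X \<omega>)"
      by (rule contr_anticomm[OF w]) (use Cons.prems in auto)
    also have "(- 1) ^ length us * (- contr u (contr X \<omega>)) (us @ vs) =
        (- 1) ^ length (u # us) * \<omega> (X # (u # us) @ vs)"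
      by (simp only: contr_def uminus_apply list.size(4) power_Suc mult_minus_left mult_minus_right
          mult_1 append_Cons add_Suc_right add_0_right)
    finally show ?thesis .
  qed
qed simp

text \<open>Only vanishing is transported, so the sign of the permutation never has to be
  computed.\<close>

lemma form_perm:
  assumes "\<omega> \<in> forms A n" "set Xs \<subseteq> VF" "mset Xs = mset Ys" "\<omega> Xs = 0"
  shows "\<omega> Ys = 0"
  using assms
proof (induction Xs arbitrary: Ys \<omega> n)
  case (Cons X Xs)
  have "X \<in> set Ys" using Cons.prems(3) by (metis list.set_intros(1) set_mset_mset)
  then obtain us vs where Ys: "Ys = us @ X # vs" by (meson split_list)
  have "set Ys \<subseteq> VF" using Cons.prems(2,3) by (metis set_mset_mset)
  then have us: "set us \<subseteq> VF" and X: "X \<in> VF" by (auto simp: Ys)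
  have m: "mset Xs = mset (us @ vs)" using Cons.prems(3) Ys by simp
  have "\<omega> (X # us @ vs) = 0"
  proof (cases n)
    case (Suc m')
    have w: "contr X \<omega> \<in> forms A m'" using contr_forms[of \<omega> m' X] Cons.prems(1) X Suc by simp
    show ?thesis
      using Cons.IH[OF w _ m] Cons.prems by (simp add: contr_def)
  qed (use Cons.prems in \<open>simp add: forms_0_iff\<close>)
  then show ?case unfolding Ys form_move_front[OF Cons.prems(1) us X] by simp
qed simp

lemma form_not_distinct:
  assumes "\<omega> \<in> forms A n" "\<not> distinct Xs"
  shows "\<omega> Xs = 0"
proof -
  obtain i j where "i < j" "j < length Xs" "Xs ! i = Xs ! j"
    using assms(2) by (metis distinct_conv_nth linorder_neqE_nat)
  then show ?thesis
    using form_alt[OF assms(1), of Xs i j] form_outside[OF assms(1), of Xs] by blast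
qed

text \<open>By the antiderivation law a contraction of the product is a sum of products of total
  degree one less, so \<open>forms_SucI\<close> reduces the claim to the induction hypothesis; the
  factors of degree 0 have contraction 0 and are treated apart.\<close>

lemma wedge_forms:
  assumes "\<omega> \<in> forms A n" "\<theta> \<in> forms A m"
  shows "\<omega> \<and>\<^sub>w \<theta> \<in> forms A (n + m)"
proof -
  have "\<forall>n m \<omega> \<theta>. n + m = N \<longrightarrow> \<omega> \<in> forms A n \<longrightarrow> \<theta> \<in> forms A m \<longrightarrow> \<omega> \<and>\<^sub>w \<theta> \<in> forms A N" for N
  proof (induction N)
    case 0
    have "\<omega> \<and>\<^sub>w \<theta> \<in> forms A 0" if w: "\<omega> \<in> forms A 0" and t: "\<theta> \<in> forms A 0" for \<omega> \<theta>
      unfolding forms_0_iff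
    proof (intro conjI allI impI)
      show "(\<omega> \<and>\<^sub>w \<theta>) [] \<in> A" using w t by (simp add: forms_0_iff mult_mem)
      have "contr X \<omega> = 0" "contr X \<theta> = 0" for X
        using w t by (auto simp: forms_0_iff contr_def fun_eq_iff)
      then show "(\<omega> \<and>\<^sub>w \<theta>) Xs = 0" if "Xs \<noteq> []" for Xs
        using that by (cases Xs) (simp_all add: wedge_Cons)
    qed
    then show ?case by simp
  next
    case (Suc N)
    have *: "contr X \<omega> \<and>\<^sub>w \<theta> \<in> forms A N"
      if "n + m = Suc N" "\<omega> \<in> forms A n" "\<theta> \<in> forms A m" "X \<in> VF" for X n m \<omega> \<theta>
    proof (cases n)
      case 0
      then have "contr X \<omega> = 0" using that by (auto simp: forms_0_iff contr_def fun_eq_iff)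
      then show ?thesis by (simp add: zero_forms)
    next
      case (Suc n')
      then have "contr X \<omega> \<in> forms A n'" "n' + m = N" using that contr_forms[of \<omega> n' X] by auto
      then show ?thesis using Suc.IH that by blast
    qed
    have **: "\<omega> \<and>\<^sub>w contr X \<theta> \<in> forms A N"
      if "n + m = Suc N" "\<omega> \<in> forms A n" "\<theta> \<in> forms A m" "X \<in> VF" for X n m \<omega> \<theta>
    proof (cases m)
      case 0
      then have "contr X \<theta> = 0" using that by (auto simp: forms_0_iff contr_def fun_eq_iff)
      then show ?thesis by (simp add: zero_forms)
    next
      case (Suc m')
      then have "contr X \<theta> \<in> forms A m'" "n + m' = N" using that contr_forms[of \<theta> m' X] by auto
      then show ?thesis using Suc.IH that by blast
    qed
    have lin: "contr (X + Y) \<omega> = contr X \<omega> + contr Y \<omega>" "contr (vf_mult f X) \<omega> = fscale f (contr X \<omega>)"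
      "contr X (contr X \<omega>) = 0"
      if "\<omega> \<in> forms A n" "X \<in> VF" "Y \<in> VF" "f \<in> A" for X Y f n \<omega>
    proof -
      have "contr (X + Y) \<omega> = contr X \<omega> + contr Y \<omega> \<and> contr (vf_mult f X) \<omega> = fscale f (contr X \<omega>) \<and>
        contr X (contr X \<omega>) = 0"
      proof (cases n)
        case 0
        then have "contr X \<omega> = 0" for X using that by (auto simp: forms_0_iff contr_def fun_eq_iff)
        then show ?thesis by (simp add: fscale_def)
      next
        case (Suc n')
        then have "\<omega> \<in> forms A (Suc n')" using that by simp
        from contr_add_vf[OF this] contr_mult_vf[OF this] contr_twice[OF this] that
        show ?thesis by blast
      qed
      then show "contr (X + Y) \<omega> = contr X \<omega> + contr Y \<omega>" "contr (vf_mult f X) \<omega> = fscale f (contr X \<omega>)"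
        "contr X (contr X \<omega>) = 0" by auto
    qed
    have "\<omega> \<and>\<^sub>w \<theta> \<in> forms A (Suc N)"
      if nm: "n + m = Suc N" and w: "\<omega> \<in> forms A n" and t: "\<theta> \<in> forms A m" for n m \<omega> \<theta>
    proof (rule forms_SucI)
      have gw: "grade_sign \<omega> \<in> forms A n" by (simp add: grade_sign_form[OF w] cscale_forms w)
      show "(\<omega> \<and>\<^sub>w \<theta>) [] = 0"
        using form_outside[OF w, of "[]"] form_outside[OF t, of "[]"] nm by (cases n) auto
      show "contr X (\<omega> \<and>\<^sub>w \<theta>) = 0" if "X \<notin> VF" for X
      proof -
        have "contr X \<omega> = 0" "contr X \<theta> = 0"
          using form_outside[OF w] form_outside[OF t] that by (auto simp: contr_def fun_eq_iff)
        then show ?thesis by (simp add: contr_wedge)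
      qed
      show "contr X (\<omega> \<and>\<^sub>w \<theta>) \<in> forms A N" if "X \<in> VF" for X
        unfolding contr_wedge by (intro add_forms *[OF nm w t that] **[OF nm gw t that])
      show "contr X (contr X (\<omega> \<and>\<^sub>w \<theta>)) = 0" if "X \<in> VF" for X
        using lin(3)[OF w that that one_mem] lin(3)[OF t that that one_mem]
        by (simp add: contr_wedge contr_grade_sign wedge_uminus_left)
      show "contr (X + Y) (\<omega> \<and>\<^sub>w \<theta>) = contr X (\<omega> \<and>\<^sub>w \<theta>) + contr Y (\<omega> \<and>\<^sub>w \<theta>)" if "X \<in> VF" "Y \<in> VF" for X Y
        using lin(1)[OF w that one_mem] lin(1)[OF t that one_mem]
        by (simp add: contr_wedge wedge_add_left wedge_add_right)
      show "contr (vf_mult f X) (\<omega> \<and>\<^sub>w \<theta>) = fscale f (contr X (\<omega> \<and>\<^sub>w \<theta>))" if "X \<in> VF" "f \<in> A" for X f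
      proof -
        have "fscale f (a + b) = fscale f a + fscale f b" for a b :: "'m form"
          by (auto simp: fscale_def fun_eq_iff algebra_simps)
        then show ?thesis
          using lin(2)[OF w that(1,1,2)] lin(2)[OF t that(1,1,2)]
          by (simp add: contr_wedge wedge_fscale_left wedge_fscale_right)
      qed
    qed
    then show ?case by blast
  qed
  then show ?thesis using assms by blast
qed

lemma form_one_forms: "form_one \<in> forms A 0"
  by (simp add: forms_0_iff form_one_def one_mem)

end

section \<open>The exterior derivative\<close>

lemma nths_remove_one: "j < length Xs \<Longrightarrow> nths Xs (- {j}) = take j Xs @ drop (Suc j) Xs"
proof (induction Xs arbitrary: j)
  case (Cons X Xs)
  have 1: "{i. Suc i \<in> - {0}} = UNIV" and 2: "{i. Suc i \<in> - {Suc l}} = - {l}" for l by auto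
  show ?case using Cons by (cases j) (auto simp: nths_Cons nths_all 1[simplified] 2[simplified])
qed simp

lemma nths_Cons_remove:
  "nths (X # Xs) (- {0}) = Xs" "nths (X # Xs) (- {Suc i}) = X # nths Xs (- {i})"
  "nths (X # Xs) (- {0, Suc i}) = nths Xs (- {i})"
  "nths (X # Xs) (- {Suc i, Suc j}) = X # nths Xs (- {i, j})"
proof -
  have "{j. Suc j \<in> - {0}} = UNIV" "{j. Suc j \<in> - {Suc i}} = - {i}" "{j. Suc j \<in> - {0, Suc i}} = - {i}"
    "{l. Suc l \<in> - {Suc i, Suc j}} = - {i, j}" by auto
  note sets = this
  show "nths (X # Xs) (- {0}) = Xs" "nths (X # Xs) (- {Suc i}) = X # nths Xs (- {i})"
    "nths (X # Xs) (- {0, Suc i}) = nths Xs (- {i})"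
    "nths (X # Xs) (- {Suc i, Suc j}) = X # nths Xs (- {i, j})"
    unfolding nths_Cons sets by (simp_all add: nths_all)
qed

section \<open>Lie derivative, Cartan's formula, and the exterior derivative of a form\<close>

context function_algebra
begin

definition lie_deriv :: "'m vf \<Rightarrow> 'm form \<Rightarrow> 'm form" where
  "lie_deriv X \<omega> = (\<lambda>Xs. if set Xs \<subseteq> VF
     then X (\<omega> Xs) - (\<Sum>j<length Xs. \<omega> (Xs[j := lie_bracket X (Xs ! j)])) else 0)"

lemma form_update_move_front:
  assumes "\<omega> \<in> forms A n" "set Xs \<subseteq> VF" "X \<in> VF" "j < length Xs"
  shows "\<omega> (Xs[j := X]) = (- 1) ^ j * \<omega> (X # nths Xs (- {j}))"
proof -
  have "set (take j Xs) \<subseteq> VF" using assms(2) set_take_subset by fastforce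
  from form_move_front[OF assms(1) this assms(3), of "drop (Suc j) Xs"]
  show ?thesis using assms(4) by (simp only: upd_conv_take_nth_drop nths_remove_one) simp
qed

text \<open>The commutator rule for Lie derivative and contraction: the two sides differ by the term
  in which the bracket with X hits the contracted argument.\<close>

lemma contr_lie_deriv:
  assumes w: "\<omega> \<in> forms A n" and X: "X \<in> VF" and Y: "Y \<in> VF"
  shows "contr Y (lie_deriv X \<omega>) = lie_deriv X (contr Y \<omega>) - contr (lie_bracket X Y) \<omega>"
proof
  fix Ys
  show "contr Y (lie_deriv X \<omega>) Ys = (lie_deriv X (contr Y \<omega>) - contr (lie_bracket X Y) \<omega>) Ys"
  proof (cases "set Ys \<subseteq> VF")
    case True
    then show ?thesis using Y
      by (simp add: contr_def lie_deriv_def sum.lessThan_Suc_shift algebra_simps del: sum.lessThan_Suc)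
  next
    case False
    then show ?thesis using form_outside[OF w, of "lie_bracket X Y # Ys"]
      by (simp add: contr_def lie_deriv_def)
  qed
qed

lemma lie_deriv_add:
  assumes "\<omega> \<in> forms A n" "\<theta> \<in> forms A n" "X \<in> VF"
  shows "lie_deriv X (\<omega> + \<theta>) = lie_deriv X \<omega> + lie_deriv X \<theta>"
  by (rule ext, rule ext) (simp add: lie_deriv_def vf_add assms form_range[OF assms(1)] form_range[OF assms(2)] sum.distrib algebra_simps)

lemma lie_deriv_fscale:
  assumes "\<omega> \<in> forms A n" "f \<in> A" "X \<in> VF"
  shows "lie_deriv X (fscale f \<omega>) = fscale f (lie_deriv X \<omega>) + fscale (X f) \<omega>"
proof
  fix Xs
  show "lie_deriv X (fscale f \<omega>) Xs = (fscale f (lie_deriv X \<omega>) + fscale (X f) \<omega>) Xs"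
  proof (cases "set Xs \<subseteq> VF")
    case True
    then show ?thesis
      by (intro ext) (simp add: lie_deriv_def fscale_def vf_times assms form_range[OF assms(1)] sum_distrib_left[symmetric] algebra_simps)
  next
    case False
    then show ?thesis using form_outside[OF assms(1), of Xs]
      by (simp add: lie_deriv_def fscale_def)
  qed
qed

lemma lie_deriv_zero: "X \<in> VF \<Longrightarrow> lie_deriv X 0 = 0"
  by (rule ext) (simp add: lie_deriv_def vf_zero)

lemma lie_deriv_forms:
  assumes "\<omega> \<in> forms A n" "X \<in> VF"
  shows "lie_deriv X \<omega> \<in> forms A n"
  using assms(1)
proof (induction n arbitrary: \<omega>)
  case 0
  note w = 0[unfolded forms_0_iff]
  have "\<omega> (Xs[j := Z]) = 0" if "Xs \<noteq> []" for Xs j Z using w that by simp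
  then show ?case
    using w assms(2) by (auto simp: forms_0_iff lie_deriv_def vf_range vf_zero)
next
  case (Suc n)
  note w = Suc.prems
  show ?case
  proof (rule forms_SucI)
    show "lie_deriv X \<omega> [] = 0" using form_Suc_Nil[OF w] by (simp add: lie_deriv_def vf_zero assms)
    show "contr Y (lie_deriv X \<omega>) = 0" if "Y \<notin> VF" for Y
      using that by (auto simp: contr_def lie_deriv_def fun_eq_iff)
    show "contr Y (lie_deriv X \<omega>) \<in> forms A n" if "Y \<in> VF" for Y
      unfolding contr_lie_deriv[OF w assms(2) that]
      by (intro diff_forms Suc.IH contr_forms[OF w] that VF_lie_bracket assms)
    show "contr Y (contr Y (lie_deriv X \<omega>)) = 0" if Y: "Y \<in> VF" for Y
    proof -
      have b: "lie_bracket X Y \<in> VF" by (rule VF_lie_bracket[OF assms(2) Y])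
      have "contr Y (contr Y (lie_deriv X \<omega>)) =
          lie_deriv X (contr Y (contr Y \<omega>)) - contr (lie_bracket X Y) (contr Y \<omega>) - contr Y (contr (lie_bracket X Y) \<omega>)"
        by (simp add: contr_lie_deriv[OF w assms(2) Y] contr_lie_deriv[OF contr_forms[OF w Y] assms(2) Y])
      also have "\<dots> = 0"
        by (simp add: contr_twice[OF w Y] lie_deriv_zero[OF assms(2)] contr_anticomm[OF w b Y])
      finally show ?thesis .
    qed
    show "contr (Y + Z) (lie_deriv X \<omega>) = contr Y (lie_deriv X \<omega>) + contr Z (lie_deriv X \<omega>)"
      if Y: "Y \<in> VF" and Z: "Z \<in> VF" for Y Z
      by (simp add: contr_lie_deriv[OF w assms(2)] VF_add Y Z contr_add_vf[OF w] lie_bracket_add_right[OF assms(2)]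
          VF_lie_bracket assms(2) lie_deriv_add[OF contr_forms[OF w Y] contr_forms[OF w Z] assms(2)])
    show "contr (vf_mult f Y) (lie_deriv X \<omega>) = fscale f (contr Y (lie_deriv X \<omega>))"
      if Y: "Y \<in> VF" and f: "f \<in> A" for Y f
    proof -
      have b: "lie_bracket X Y \<in> VF" by (rule VF_lie_bracket[OF assms(2) Y])
      have m: "vf_mult f (lie_bracket X Y) \<in> VF" "vf_mult (X f) Y \<in> VF"
        by (simp_all add: VF_mult b f Y vf_range assms(2))
      have "contr (vf_mult f Y) (lie_deriv X \<omega>) =
         lie_deriv X (fscale f (contr Y \<omega>)) - (fscale f (contr (lie_bracket X Y) \<omega>) + fscale (X f) (contr Y \<omega>))"
        by (simp add: contr_lie_deriv[OF w assms(2)] VF_mult Y f contr_mult_vf[OF w] lie_bracket_mult_right[OF assms(2)]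
            contr_add_vf[OF w m] b vf_range assms(2))
      also have "\<dots> = fscale f (lie_deriv X (contr Y \<omega>)) - fscale f (contr (lie_bracket X Y) \<omega>)"
        by (simp add: lie_deriv_fscale[OF contr_forms[OF w Y] f assms(2)])
      also have "\<dots> = fscale f (contr Y (lie_deriv X \<omega>))"
        by (simp add: contr_lie_deriv[OF w assms(2) Y]) (simp add: fscale_def fun_eq_iff algebra_simps)
      finally show ?thesis .
    qed
  qed
qed

lemma lie_deriv_add_vf:
  assumes w: "\<omega> \<in> forms A n" and "X \<in> VF" "Y \<in> VF"
  shows "lie_deriv (X + Y) \<omega> = lie_deriv X \<omega> + lie_deriv Y \<omega>"
proof
  fix Xs
  show "lie_deriv (X + Y) \<omega> Xs = (lie_deriv X \<omega> + lie_deriv Y \<omega>) Xs"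
  proof (cases "set Xs \<subseteq> VF \<and> length Xs = n")
    case True
    have "\<omega> (Xs[j := lie_bracket (X + Y) (Xs ! j)]) =
        \<omega> (Xs[j := lie_bracket X (Xs ! j)]) + \<omega> (Xs[j := lie_bracket Y (Xs ! j)])" if "j < n" for j
    proof -
      have "Xs ! j \<in> VF" using True that by auto
      then show ?thesis
        using form_add[OF w, of Xs j] True that assms by (simp add: lie_bracket_add_left VF_lie_bracket)
    qed
    then have "(\<Sum>j<n. \<omega> (Xs[j := lie_bracket (X + Y) (Xs ! j)])) =
      (\<Sum>j<n. \<omega> (Xs[j := lie_bracket X (Xs ! j)])) + (\<Sum>j<n. \<omega> (Xs[j := lie_bracket Y (Xs ! j)]))"
      by (simp add: sum.distrib)
    then show ?thesis using True by (simp add: lie_deriv_def algebra_simps)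
  next
    case False
    then show ?thesis using form_outside[OF w] assms by (auto simp: lie_deriv_def vf_zero)
  qed
qed

text \<open>The rule \<open>L_(fX) \<omega> = f L_X \<omega> + df \<and> i_X \<omega>\<close>, with
  the last term written as a sum over the slot into which X is put.\<close>

lemma lie_deriv_mult_vf:
  assumes w: "\<omega> \<in> forms A n" and X: "X \<in> VF" and f: "f \<in> A" and Xs: "set Xs \<subseteq> VF" "length Xs = n"
  shows "lie_deriv (vf_mult f X) \<omega> Xs = f * lie_deriv X \<omega> Xs + (\<Sum>j<n. (Xs ! j) f * \<omega> (Xs[j := X]))"
proof -
  have "\<omega> (Xs[j := lie_bracket (vf_mult f X) (Xs ! j)]) =
      f * \<omega> (Xs[j := lie_bracket X (Xs ! j)]) - (Xs ! j) f * \<omega> (Xs[j := X])" if j: "j < n" for j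
  proof -
    have V: "Xs ! j \<in> VF" using Xs j by auto
    have b: "lie_bracket X (Xs ! j) \<in> VF" by (rule VF_lie_bracket[OF X V])
    have a: "- (Xs ! j) f \<in> A" by (intro uminus_mem vf_range V)
    show ?thesis
      using form_add[OF w Xs j VF_mult[OF b f] VF_mult[OF X a]] form_mult[OF w Xs j b f] form_mult[OF w Xs j X a]
      by (simp add: lie_bracket_mult_left X V f)
  qed
  then have "(\<Sum>j<n. \<omega> (Xs[j := lie_bracket (vf_mult f X) (Xs ! j)])) =
      f * (\<Sum>j<n. \<omega> (Xs[j := lie_bracket X (Xs ! j)])) - (\<Sum>j<n. (Xs ! j) f * \<omega> (Xs[j := X]))"
    by (simp add: sum_subtractf sum_distrib_left)
  then show ?thesis using Xs by (simp add: lie_deriv_def vf_mult_def algebra_simps)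
qed

lemma ext_d_outside: "\<not> set Xs \<subseteq> VF \<Longrightarrow> ext_d A \<omega> Xs = 0"
  by (simp add: ext_d_def)

text \<open>Cartan's formula turns Koszul's formula into a recursion on the list of arguments.\<close>

lemma contr_ext_d:
  assumes w: "\<omega> \<in> forms A n" and X: "X \<in> VF"
  shows "contr X (ext_d A \<omega>) = lie_deriv X \<omega> - ext_d A (contr X \<omega>)"
proof
  fix Xs
  show "contr X (ext_d A \<omega>) Xs = (lie_deriv X \<omega> - ext_d A (contr X \<omega>)) Xs"
  proof (cases "set Xs \<subseteq> VF")
    case Xs: True
    let ?N = "length Xs"
    let ?P = "\<lambda>N. {(i :: nat, j). i < j \<and> j < N}"
    let ?g = "\<lambda>(i, j). (- 1) ^ (i + j) * \<omega> (lie_bracket ((X # Xs) ! i) ((X # Xs) ! j) # nths (X # Xs) (- {i, j}))"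
    have fin: "finite (?P N)" for N
      by (rule finite_subset[of _ "{..<N} \<times> {..<N}"]) auto
    \<comment> \<open>Pairs containing position 0 give the bracket terms of the Lie derivative; the
      others give, up to sign, the bracket terms of Koszul's formula for the contracted
      form.\<close>
    have P: "?P (Suc ?N) = (\<lambda>j. (0, Suc j)) ` {..<?N} \<union> map_prod Suc Suc ` ?P ?N"
    proof (rule Set.set_eqI)
      fix z :: "nat \<times> nat" obtain a b where z: "z = (a, b)" by (cases z)
      show "z \<in> ?P (Suc ?N) \<longleftrightarrow> z \<in> (\<lambda>j. (0, Suc j)) ` {..<?N} \<union> map_prod Suc Suc ` ?P ?N"
        unfolding z by (cases a; cases b) auto
    qed
    have "sum ?g (?P (Suc ?N)) = sum ?g ((\<lambda>j. (0, Suc j)) ` {..<?N}) + sum ?g (map_prod Suc Suc ` ?P ?N)"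
      unfolding P by (rule sum.union_disjoint) (auto simp: fin)
    also have "sum ?g ((\<lambda>j. (0, Suc j)) ` {..<?N}) = (\<Sum>j<?N. ?g (0, Suc j))"
      by (subst sum.reindex) (auto simp: inj_on_def)
    also have "sum ?g (map_prod Suc Suc ` ?P ?N) = (\<Sum>z\<in>?P ?N. ?g (map_prod Suc Suc z))"
      by (subst sum.reindex) (auto simp: inj_on_def)
    finally have S2: "sum ?g (?P (Suc ?N)) = (\<Sum>j<?N. ?g (0, Suc j)) + (\<Sum>z\<in>?P ?N. ?g (map_prod Suc Suc z))" .
    have "?g (0, Suc j) = - \<omega> (Xs[j := lie_bracket X (Xs ! j)])" if j: "j < ?N" for j
    proof -
      have "Xs ! j \<in> VF" using Xs j by auto
      then show ?thesis
        unfolding form_update_move_front[OF w Xs VF_lie_bracket[OF X \<open>Xs ! j \<in> VF\<close>] j]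
        by (simp only: prod.case nth_Cons_0 nth_Cons_Suc nths_Cons_remove add_0 power_Suc mult_minus_left mult_1)
    qed
    then have S2a: "(\<Sum>j<?N. ?g (0, Suc j)) = - (\<Sum>j<?N. \<omega> (Xs[j := lie_bracket X (Xs ! j)]))"
      by (simp only: sum_negf[symmetric]) (rule sum.cong, auto)
    have "?g (map_prod Suc Suc z) = - (case z of (i, j) \<Rightarrow> (- 1) ^ (i + j) * contr X \<omega> (lie_bracket (Xs ! i) (Xs ! j) # nths Xs (- {i, j})))"
      if z: "z \<in> ?P ?N" for z
    proof -
      obtain i j where ij: "z = (i, j)" "i < j" "j < ?N" using z by auto
      have b: "lie_bracket (Xs ! i) (Xs ! j) \<in> VF" using ij Xs by (intro VF_lie_bracket) auto
      have "\<omega> (lie_bracket (Xs ! i) (Xs ! j) # X # nths Xs (- {i, j})) =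
         - contr X \<omega> (lie_bracket (Xs ! i) (Xs ! j) # nths Xs (- {i, j}))"
        using contr_anticomm[OF w X b, THEN fun_cong, of "nths Xs (- {i, j})"]
        by (simp only: contr_def uminus_apply minus_minus)
      then show ?thesis
        by (simp only: ij(1) map_prod_simp prod.case nth_Cons_Suc nths_Cons_remove add_Suc add_Suc_right
            power_Suc mult_minus_left mult_minus_right mult_1 minus_minus)
    qed
    then have S2b: "(\<Sum>z\<in>?P ?N. ?g (map_prod Suc Suc z)) =
       - (\<Sum>(i, j)\<in>?P ?N. (- 1) ^ (i + j) * contr X \<omega> (lie_bracket (Xs ! i) (Xs ! j) # nths Xs (- {i, j})))"
      by (simp only: sum_negf[symmetric]) (rule sum.cong, auto)
    have S1: "(\<Sum>i<Suc ?N. (- 1) ^ i * ((X # Xs) ! i) (\<omega> (nths (X # Xs) (- {i})))) =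
        X (\<omega> Xs) - (\<Sum>i<?N. (- 1) ^ i * (Xs ! i) (contr X \<omega> (nths Xs (- {i}))))"
      by (simp only: sum.lessThan_Suc_shift nth_Cons_0 nth_Cons_Suc nths_Cons_remove power_0 power_Suc
          mult_1 mult_minus_left sum_negf contr_def diff_conv_add_uminus)
    have "contr X (ext_d A \<omega>) Xs = (\<Sum>i<Suc ?N. (- 1) ^ i * ((X # Xs) ! i) (\<omega> (nths (X # Xs) (- {i})))) + sum ?g (?P (Suc ?N))"
      using Xs X by (simp add: contr_def ext_d_def del: sum.lessThan_Suc)
    also have "\<dots> = (lie_deriv X \<omega> - ext_d A (contr X \<omega>)) Xs"
      using Xs unfolding S1 S2 S2a S2b by (simp add: lie_deriv_def ext_d_def)
    finally show ?thesis .
  qed (simp add: contr_def ext_d_def lie_deriv_def)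
qed

lemma ext_d_zero: "ext_d A 0 = 0"
proof
  fix Xs
  have "set Xs \<subseteq> VF \<Longrightarrow> i < length Xs \<Longrightarrow> (Xs ! i) 0 = 0" for i
    by (metis nth_mem subsetD vf_zero)
  then show "ext_d A 0 Xs = 0 Xs" by (simp add: ext_d_def case_prod_unfold)
qed

lemma ext_d_Nil: "ext_d A \<omega> [] = 0"
  by (simp add: ext_d_def)

lemma ext_d_add:
  assumes w: "\<omega> \<in> forms A n" and t: "\<theta> \<in> forms A n"
  shows "ext_d A (\<omega> + \<theta>) = ext_d A \<omega> + ext_d A \<theta>"
proof
  fix Xs
  show "ext_d A (\<omega> + \<theta>) Xs = (ext_d A \<omega> + ext_d A \<theta>) Xs"
  proof (cases "set Xs \<subseteq> VF")
    case True
    then have "(Xs ! i) (\<omega> Ys + \<theta> Ys) = (Xs ! i) (\<omega> Ys) + (Xs ! i) (\<theta> Ys)" if "i < length Xs" for i Ys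
      using that by (intro vf_add form_range[OF w] form_range[OF t]) auto
    then have "(\<Sum>i<length Xs. (- 1) ^ i * (Xs ! i) ((\<omega> + \<theta>) (nths Xs (- {i})))) =
        (\<Sum>i<length Xs. (- 1) ^ i * (Xs ! i) (\<omega> (nths Xs (- {i})))) + (\<Sum>i<length Xs. (- 1) ^ i * (Xs ! i) (\<theta> (nths Xs (- {i}))))"
      by (simp add: sum.distrib distrib_left)
    then show ?thesis using True
      by (simp add: ext_d_def case_prod_unfold sum.distrib distrib_left del: sum.lessThan_Suc)
  qed (simp add: ext_d_def)
qed

text \<open>The second summand is the value of \<open>df \<and> \<omega>\<close>; it stays as a sum
  because it has to be matched with the corresponding sum in
  \<open>lie_deriv_mult_vf\<close>.\<close>

lemma ext_d_fscale:
  assumes w: "\<omega> \<in> forms A n" and f: "f \<in> A" and Xs: "set Xs \<subseteq> VF"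
  shows "ext_d A (fscale f \<omega>) Xs = f * ext_d A \<omega> Xs + (\<Sum>i<length Xs. (- 1) ^ i * (Xs ! i) f * \<omega> (nths Xs (- {i})))"
proof -
  have "(Xs ! i) (f * \<omega> Ys) = f * (Xs ! i) (\<omega> Ys) + \<omega> Ys * (Xs ! i) f" if "i < length Xs" for i Ys
    using that Xs by (intro vf_times f form_range[OF w]) auto
  then have 1: "(\<Sum>i<length Xs. (- 1) ^ i * (Xs ! i) (fscale f \<omega> (nths Xs (- {i})))) =
      f * (\<Sum>i<length Xs. (- 1) ^ i * (Xs ! i) (\<omega> (nths Xs (- {i})))) + (\<Sum>i<length Xs. (- 1) ^ i * (Xs ! i) f * \<omega> (nths Xs (- {i})))"
    unfolding sum_distrib_left sum.distrib[symmetric]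
    by (intro sum.cong) (simp_all add: fscale_def distrib_left mult_ac)
  have 2: "(\<Sum>(i, j)\<in>{(i, j). i < j \<and> j < length Xs}.
        (- 1) ^ (i + j) * fscale f \<omega> (lie_bracket (Xs ! i) (Xs ! j) # nths Xs (- {i, j}))) =
     f * (\<Sum>(i, j)\<in>{(i, j). i < j \<and> j < length Xs}.
        (- 1) ^ (i + j) * \<omega> (lie_bracket (Xs ! i) (Xs ! j) # nths Xs (- {i, j})))"
    unfolding sum_distrib_left by (intro sum.cong) (simp_all add: fscale_def mult_ac case_prod_unfold)
  show ?thesis
    using Xs unfolding ext_d_def by (simp only: if_True 1 2 distrib_left) (simp only: add_ac)
qed

lemma contr_forms_cases:
  assumes "\<omega> \<in> forms A n" "X \<in> VF"
  obtains "n = 0" "contr X \<omega> = 0" | m where "n = Suc m" "contr X \<omega> \<in> forms A m"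
proof (cases n)
  case 0
  then have "contr X \<omega> = 0" using assms by (auto simp: forms_0_iff contr_def fun_eq_iff)
  then show ?thesis using 0 that by blast
next
  case (Suc m)
  then show ?thesis using that contr_forms[of \<omega> m X] assms by blast
qed

text \<open>Uniform in the degree: a form of degree 0 has all contractions 0, and the other degrees
  are successors.\<close>

lemma contr_anyform:
  assumes w: "\<omega> \<in> forms A n" and X: "X \<in> VF"
  shows "contr X (contr X \<omega>) = 0" and "Y \<in> VF \<Longrightarrow> contr (X + Y) \<omega> = contr X \<omega> + contr Y \<omega>"
    and "f \<in> A \<Longrightarrow> contr (vf_mult f X) \<omega> = fscale f (contr X \<omega>)"
proof -
  have z: "contr Z \<omega> = 0" if "n = 0" for Z using that w by (auto simp: forms_0_iff contr_def fun_eq_iff)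
  have f0: "fscale f 0 = 0" by (simp add: fscale_def)
  show "contr X (contr X \<omega>) = 0" using z[of X] contr_twice[of \<omega> _ X] w X by (cases n) auto
  show "contr (X + Y) \<omega> = contr X \<omega> + contr Y \<omega>" if "Y \<in> VF"
    using z contr_add_vf[of \<omega> _ X Y] w X that by (cases n) auto
  show "contr (vf_mult f X) \<omega> = fscale f (contr X \<omega>)" if "f \<in> A"
    using z contr_mult_vf[of \<omega> _ X f] w X that f0 by (cases n) auto
qed

text \<open>Through Cartan's formula every condition of \<open>forms_SucI\<close> becomes one about
  the Lie derivative and about the exterior derivative of a contraction, which has lower
  degree.\<close>

lemma ext_d_forms:
  assumes "\<omega> \<in> forms A n"
  shows "ext_d A \<omega> \<in> forms A (Suc n)"
  using assms
proof (induction n arbitrary: \<omega>)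
  case (0 \<omega>)
  have c: "contr X \<omega> = 0" for X using 0 by (auto simp: forms_0_iff contr_def fun_eq_iff)
  have d: "contr X (ext_d A \<omega>) = lie_deriv X \<omega>" if "X \<in> VF" for X
    using contr_ext_d[OF 0 that] by (simp add: c ext_d_zero)
  show ?case
  proof (rule forms_SucI)
    show "contr (X + Y) (ext_d A \<omega>) = contr X (ext_d A \<omega>) + contr Y (ext_d A \<omega>)" if "X \<in> VF" "Y \<in> VF" for X Y
      by (simp add: d that VF_add lie_deriv_add_vf[OF 0])
    show "contr (vf_mult f X) (ext_d A \<omega>) = fscale f (contr X (ext_d A \<omega>))" if "X \<in> VF" "f \<in> A" for X f
    proof
      fix Xs
      show "contr (vf_mult f X) (ext_d A \<omega>) Xs = fscale f (contr X (ext_d A \<omega>)) Xs"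
        using form_outside[OF lie_deriv_forms[OF 0], of _ Xs] lie_deriv_mult_vf[OF 0 that, of Xs]
        by (cases "Xs = []") (simp_all add: d that VF_mult fscale_def)
    qed
    show "contr X (contr X (ext_d A \<omega>)) = 0" if "X \<in> VF" for X
    proof -
      have "contr X (lie_deriv X \<omega>) = 0"
        using lie_deriv_forms[OF 0 that] by (auto simp: forms_0_iff contr_def fun_eq_iff)
      then show ?thesis by (simp add: d that)
    qed
    show "contr X (ext_d A \<omega>) = 0" if "X \<notin> VF" for X
      using that by (auto simp: contr_def ext_d_outside fun_eq_iff)
  qed (simp_all add: ext_d_Nil d lie_deriv_forms[OF 0])
next
  case (Suc n \<omega>)
  note w = Suc.prems
  note c = contr_ext_d[OF w]
  note cf = contr_forms[OF w]
  show ?case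
  proof (rule forms_SucI)
    show "ext_d A \<omega> [] = 0" by (rule ext_d_Nil)
    show "contr X (ext_d A \<omega>) = 0" if "X \<notin> VF" for X
      using that by (auto simp: contr_def ext_d_outside fun_eq_iff)
    show "contr X (ext_d A \<omega>) \<in> forms A (Suc n)" if "X \<in> VF" for X
      unfolding c[OF that] by (intro diff_forms lie_deriv_forms w that Suc.IH cf)
    show "contr X (contr X (ext_d A \<omega>)) = 0" if X: "X \<in> VF" for X
    proof -
      have "lie_bracket X X = 0" by (simp add: lie_bracket_def fun_eq_iff)
      then show ?thesis
        by (simp add: c[OF X] contr_lie_deriv[OF w X X] contr_ext_d[OF cf[OF X] X] contr_twice[OF w X]
            ext_d_zero contr_zero_vf[OF w])
    qed
    show "contr (X + Y) (ext_d A \<omega>) = contr X (ext_d A \<omega>) + contr Y (ext_d A \<omega>)" if X: "X \<in> VF" and Y: "Y \<in> VF" for X Y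
      by (simp add: c X Y VF_add lie_deriv_add_vf[OF w] contr_add_vf[OF w] ext_d_add[OF cf[OF X] cf[OF Y]])
    show "contr (vf_mult f X) (ext_d A \<omega>) = fscale f (contr X (ext_d A \<omega>))" if X: "X \<in> VF" and f: "f \<in> A" for X f
    proof
      fix Xs
      show "contr (vf_mult f X) (ext_d A \<omega>) Xs = fscale f (contr X (ext_d A \<omega>)) Xs"
      proof (cases "set Xs \<subseteq> VF \<and> length Xs = Suc n")
        case True
        \<comment> \<open>The derivatives of f from the Lie derivative along \<open>f X\<close>
          equal those from the exterior derivative of \<open>f\<close> times the contraction; their
          difference is 0, which leaves a function-linear expression.\<close>
        have "(\<Sum>j<Suc n. (Xs ! j) f * \<omega> (Xs[j := X])) = (\<Sum>j<Suc n. (- 1) ^ j * (Xs ! j) f * contr X \<omega> (nths Xs (- {j})))"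
        proof (rule sum.cong[OF refl])
          fix j assume "j \<in> {..<Suc n}"
          then have "\<omega> (Xs[j := X]) = (- 1) ^ j * \<omega> (X # nths Xs (- {j}))"
            using True by (intro form_update_move_front[OF w _ X]) auto
          then show "(Xs ! j) f * \<omega> (Xs[j := X]) = (- 1) ^ j * (Xs ! j) f * contr X \<omega> (nths Xs (- {j}))"
            by (simp only: contr_def mult_ac)
        qed
        then have "lie_deriv (vf_mult f X) \<omega> Xs - ext_d A (fscale f (contr X \<omega>)) Xs =
           f * (lie_deriv X \<omega> Xs - ext_d A (contr X \<omega>) Xs)"
          using lie_deriv_mult_vf[OF w X f, of Xs] ext_d_fscale[OF cf[OF X] f, of Xs] True
          by (simp only: right_diff_distrib) simp
        then show ?thesis by (simp add: c X f VF_mult contr_mult_vf[OF w]) (simp add: fscale_def)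
      next
        case False
        have a: "contr (vf_mult f X) (ext_d A \<omega>) Xs = 0"
          using form_outside[OF diff_forms[OF lie_deriv_forms[OF w VF_mult[OF X f]] Suc.IH[OF cf[OF VF_mult[OF X f]]]], of Xs] False
          unfolding c[OF VF_mult[OF X f]] by blast
        have b: "contr X (ext_d A \<omega>) Xs = 0"
          using form_outside[OF diff_forms[OF lie_deriv_forms[OF w X] Suc.IH[OF cf[OF X]]], of Xs] False
          unfolding c[OF X] by blast
        show ?thesis by (simp add: fscale_def a b)
      qed
    qed
  qed
qed

end

lemma (in function_algebra) contr_sum_vf:
  assumes w: "\<omega> \<in> forms A n" and "finite I" "\<And>i. i \<in> I \<Longrightarrow> f i \<in> A" "\<And>i. i \<in> I \<Longrightarrow> X i \<in> VF"
  shows "contr (\<Sum>i\<in>I. vf_mult (f i) (X i)) \<omega> = (\<Sum>i\<in>I. fscale (f i) (contr (X i) \<omega>))"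
  using assms(2-4)
proof (induction I rule: finite_induct)
  case (insert i I)
  have "contr (vf_mult (f i) (X i) + (\<Sum>i\<in>I. vf_mult (f i) (X i))) \<omega> =
      contr (vf_mult (f i) (X i)) \<omega> + contr (\<Sum>i\<in>I. vf_mult (f i) (X i)) \<omega>"
    by (rule contr_anyform(2)[OF w]) (auto intro!: VF_mult VF_sum insert.prems)
  also have "contr (vf_mult (f i) (X i)) \<omega> = fscale (f i) (contr (X i) \<omega>)"
    by (rule contr_anyform(3)[OF w]) (auto intro: insert.prems)
  also have "contr (\<Sum>i\<in>I. vf_mult (f i) (X i)) \<omega> = (\<Sum>i\<in>I. fscale (f i) (contr (X i) \<omega>))"
    by (rule insert.IH) (auto intro: insert.prems)
  finally show ?case by (simp only: sum.insert[OF insert.hyps] if_False)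
qed (simp add: contr_zero_vf[OF w])

section \<open>Bidegrees\<close>

lemma fun_sum_apply: "(\<Sum>i\<in>I. f i) x = (\<Sum>i\<in>I. f i x)"
  by (induction I rule: infinite_finite_induct) auto

locale complex_algebra = function_algebra A for A :: "('m \<Rightarrow> complex) set" +
  fixes J :: "'m vf \<Rightarrow> 'm vf"
  assumes J: "complex_structure A J"
begin

abbreviation "T \<equiv> bicomponent A J"
abbreviation "d \<equiv> ext_d A"

lemma J_VF: "X \<in> VF \<Longrightarrow> J X \<in> VF"
  and J_J: "X \<in> VF \<Longrightarrow> J (J X) = - X"
  and J_conj: "X \<in> VF \<Longrightarrow> J (vf_conj X) = vf_conj (J X)"
  and J_add: "X \<in> VF \<Longrightarrow> Y \<in> VF \<Longrightarrow> J (X + Y) = J X + J Y"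
  and J_mult: "X \<in> VF \<Longrightarrow> f \<in> A \<Longrightarrow> J (vf_mult f X) = vf_mult f (J X)"
  using J unfolding complex_structure_def by blast+

lemma proj10_eq: "proj10 J X = vf_mult (\<lambda>_. 1 / 2) X + vf_mult (\<lambda>_. - \<i> / 2) (J X)"
  and proj01_eq: "proj01 J X = vf_mult (\<lambda>_. 1 / 2) X + vf_mult (\<lambda>_. \<i> / 2) (J X)"
  by (auto simp: proj10_def proj01_def vf_mult_def fun_eq_iff diff_divide_distrib add_divide_distrib)

lemma proj10_VF: "X \<in> VF \<Longrightarrow> proj10 J X \<in> VF" and proj01_VF: "X \<in> VF \<Longrightarrow> proj01 J X \<in> VF"
  by (simp_all add: proj10_eq proj01_eq VF_add VF_mult const_mem J_VF)

lemma vf_mult_add: "vf_mult f (X + Y) = vf_mult f X + vf_mult f Y"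
  by (auto simp: vf_mult_def fun_eq_iff algebra_simps)

lemma vf_mult_commute: "vf_mult f (vf_mult g X) = vf_mult g (vf_mult f X)"
  by (auto simp: vf_mult_def fun_eq_iff)

lemma proj10_add: "X \<in> VF \<Longrightarrow> Y \<in> VF \<Longrightarrow> proj10 J (X + Y) = proj10 J X + proj10 J Y"
  and proj01_add: "X \<in> VF \<Longrightarrow> Y \<in> VF \<Longrightarrow> proj01 J (X + Y) = proj01 J X + proj01 J Y"
  by (simp_all add: proj10_eq proj01_eq J_add vf_mult_add)

lemma proj10_mult: "X \<in> VF \<Longrightarrow> f \<in> A \<Longrightarrow> proj10 J (vf_mult f X) = vf_mult f (proj10 J X)"
  and proj01_mult: "X \<in> VF \<Longrightarrow> f \<in> A \<Longrightarrow> proj01 J (vf_mult f X) = vf_mult f (proj01 J X)"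
  by (simp_all add: proj10_eq proj01_eq J_mult vf_mult_add vf_mult_commute)

text \<open>The first argument is either projected to type (1,0) and counted in p, or to type (0,1)
  and counted in q. This is the recursion for types that \<open>wedge_Cons\<close> is for
  products.\<close>

lemma contr_bicomponent:
  assumes X: "X \<in> VF"
  shows "contr X (T p q \<omega>) = T (p - 1) q (contr (proj10 J X) \<omega>) + T p (q - 1) (contr (proj01 J X) \<omega>)"
proof
  fix Xs :: "'m vf list"
  let ?N = "length Xs"
  let ?h = "\<lambda>Xs S i. if i \<in> S then proj10 J (Xs ! i) else proj01 J (Xs ! i)"
  let ?P = "\<lambda>(N :: nat) (p :: int). {S. S \<subseteq> {..<N} \<and> int (card S) = p}"
  have fin: "finite (?P N p)" for N p
    by (rule finite_subset[of _ "Pow {..<N}"]) auto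
  have c0: "int (card (insert 0 (Suc ` S))) = int (card S) + 1" if "S \<subseteq> {..<N}" for S and N :: nat
    using that finite_subset[of S "{..<N}"] by (simp add: card_image)
  have P: "?P (Suc ?N) p = (\<lambda>S. insert 0 (Suc ` S)) ` ?P ?N (p - 1) \<union> (\<lambda>S. Suc ` S) ` ?P ?N p"
  proof -
    have "?P (Suc ?N) p = {S \<in> Pow {..<Suc ?N}. int (card S) = p}" by auto
    also have "\<dots> = (\<lambda>S. insert 0 (Suc ` S)) ` {S \<in> Pow {..<?N}. int (card S) + 1 = p} \<union> (\<lambda>S. Suc ` S) ` ?P ?N p"
      unfolding Pow_lessThan_Suc_shift by (auto simp: c0 card_image)
    finally show ?thesis by (auto simp: algebra_simps)
  qed
  have inj1: "inj_on (\<lambda>S. insert 0 (Suc ` S)) (?P ?N (p - 1))"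
  proof (rule inj_onI)
    fix S T :: "nat set" assume "insert 0 (Suc ` S) = insert 0 (Suc ` T)"
    then have "Suc ` S = Suc ` T" by (auto simp: set_eq_iff image_iff)
    then show "S = T" by (simp add: inj_image_eq_iff)
  qed
  have inj2: "inj_on (\<lambda>S. Suc ` S) (?P ?N p)"
    by (auto intro!: inj_onI simp: inj_image_eq_iff)
  have upt: "[0..<Suc ?N] = 0 # map Suc [0..<?N]" by (simp add: map_Suc_upt upt_conv_Cons del: upt_Suc)
  have m1: "map (?h (X # Xs) (insert 0 (Suc ` S))) [0..<Suc ?N] = proj10 J X # map (?h Xs S) [0..<?N]"
   and m2: "map (?h (X # Xs) (Suc ` S)) [0..<Suc ?N] = proj01 J X # map (?h Xs S) [0..<?N]" for S
    unfolding upt by (auto simp del: upt_Suc)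
  have split: "(\<Sum>S\<in>?P (Suc ?N) p. \<omega> (map (?h (X # Xs) S) [0..<Suc ?N])) =
      (\<Sum>S\<in>?P ?N (p - 1). \<omega> (proj10 J X # map (?h Xs S) [0..<?N])) +
      (\<Sum>S\<in>?P ?N p. \<omega> (proj01 J X # map (?h Xs S) [0..<?N]))"
  proof -
    let ?A = "(\<lambda>S. insert 0 (Suc ` S)) ` ?P ?N (p - 1)" and ?B = "(\<lambda>S. Suc ` S) ` ?P ?N p"
    let ?f = "\<lambda>S. \<omega> (map (?h (X # Xs) S) [0..<Suc ?N])"
    have "?A \<inter> ?B = {}" by blast
    then have "sum ?f (?A \<union> ?B) = sum ?f ?A + sum ?f ?B"
      by (intro sum.union_disjoint finite_imageI fin)
    also have "sum ?f ?A = (\<Sum>S\<in>?P ?N (p - 1). \<omega> (proj10 J X # map (?h Xs S) [0..<?N]))"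
      unfolding sum.reindex[OF inj1] o_def m1 ..
    also have "sum ?f ?B = (\<Sum>S\<in>?P ?N p. \<omega> (proj01 J X # map (?h Xs S) [0..<?N]))"
      unfolding sum.reindex[OF inj2] o_def m2 ..
    finally show ?thesis unfolding P .
  qed
  show "contr X (T p q \<omega>) Xs = (T (p - 1) q (contr (proj10 J X) \<omega>) + T p (q - 1) (contr (proj01 J X) \<omega>)) Xs"
  proof (cases "set Xs \<subseteq> VF \<and> int (length Xs) + 1 = p + q")
    case True
    then have "contr X (T p q \<omega>) Xs = (\<Sum>S\<in>?P (Suc ?N) p. \<omega> (map (?h (X # Xs) S) [0..<Suc ?N]))"
      using X by (simp add: contr_def bicomponent_def del: upt_Suc)
    then show ?thesis unfolding split using True by (simp add: bicomponent_def contr_def)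
  next
    case False
    then show ?thesis using X by (auto simp: contr_def bicomponent_def)
  qed
qed

lemma bicomponent_Nil: "T p q \<omega> [] = (if p = 0 \<and> q = 0 then \<omega> [] else 0)"
proof -
  have "{S :: nat set. S = {} \<and> int (card S) = p} = (if p = 0 then {{}} else {})" by auto
  then show ?thesis by (auto simp: bicomponent_def)
qed

lemma bicomponent_outside: "\<not> set Xs \<subseteq> VF \<Longrightarrow> T p q \<omega> Xs = 0"
  by (simp add: bicomponent_def)

lemma bicomponent_length: "int (length Xs) \<noteq> p + q \<Longrightarrow> T p q \<omega> Xs = 0"
  by (simp add: bicomponent_def)

lemma bicomponent_zero: "T p q 0 = 0"
  by (rule ext) (simp add: bicomponent_def)

lemma bicomponent_add: "T p q (\<omega> + \<theta>) = T p q \<omega> + T p q \<theta>"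
  by (rule ext) (simp add: bicomponent_def sum.distrib)

lemma bicomponent_fscale: "T p q (fscale f \<omega>) = fscale f (T p q \<omega>)"
  by (rule ext) (simp add: bicomponent_def fscale_def sum_distrib_left)

lemma bicomponent_cscale: "T p q (cscale c \<omega>) = cscale c (T p q \<omega>)"
  by (simp add: cscale_eq_fscale bicomponent_fscale)

lemma bicomponent_forms:
  assumes "\<omega> \<in> forms A n"
  shows "T p q \<omega> \<in> forms A n"
  using assms
proof (induction n arbitrary: \<omega> p q)
  case 0
  have "contr X \<omega> = 0" for X using 0 by (auto simp: forms_0_iff contr_def fun_eq_iff)
  then have "X \<in> VF \<Longrightarrow> contr X (T p q \<omega>) = 0" for X
    by (simp add: contr_bicomponent bicomponent_zero)
  then have "T p q \<omega> (X # Xs) = 0" for X Xs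
    using bicomponent_outside[of "X # Xs"] by (cases "X \<in> VF") (auto simp: contr_def fun_eq_iff)
  then have "Xs \<noteq> [] \<Longrightarrow> T p q \<omega> Xs = 0" for Xs by (cases Xs) auto
  then show ?case using 0 by (auto simp: forms_0_iff bicomponent_Nil zero_mem)
next
  case (Suc n)
  note w = Suc.prems
  show ?case
  proof (rule forms_SucI)
    show "T p q \<omega> [] = 0" using form_Suc_Nil[OF w] by (simp add: bicomponent_Nil)
    show "contr X (T p q \<omega>) = 0" if "X \<notin> VF" for X
      using that bicomponent_outside by (auto simp: contr_def fun_eq_iff)
    show "contr X (T p q \<omega>) \<in> forms A n" if "X \<in> VF" for X
      unfolding contr_bicomponent[OF that]
      by (intro add_forms Suc.IH contr_forms[OF w] proj10_VF proj01_VF that)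
    \<comment> \<open>The two pure double contractions vanish; the two mixed ones have the same
      bidegree and cancel by anticommutation.\<close>
    show "contr X (contr X (T p q \<omega>)) = 0" if X: "X \<in> VF" for X
      using contr_anticomm[OF w proj10_VF[OF X] proj01_VF[OF X]]
      by (simp add: contr_bicomponent[OF X] contr_twice[OF w] proj10_VF[OF X] proj01_VF[OF X] bicomponent_zero
           bicomponent_add[symmetric])
    show "contr (X + Y) (T p q \<omega>) = contr X (T p q \<omega>) + contr Y (T p q \<omega>)" if "X \<in> VF" "Y \<in> VF" for X Y
      by (simp add: contr_bicomponent that VF_add proj10_add proj01_add contr_add_vf[OF w] proj10_VF proj01_VF
           bicomponent_add)
    show "contr (vf_mult f X) (T p q \<omega>) = fscale f (contr X (T p q \<omega>))" if "X \<in> VF" "f \<in> A" for X f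
      by (simp add: contr_bicomponent that VF_mult proj10_mult proj01_mult contr_mult_vf[OF w] proj10_VF proj01_VF
           bicomponent_fscale) (simp add: fscale_def fun_eq_iff algebra_simps)
  qed
qed

lemma bicomponent_degree:
  assumes w: "\<omega> \<in> forms A n" and "p + q \<noteq> int n"
  shows "T p q \<omega> = 0"
proof
  fix Xs
  show "T p q \<omega> Xs = 0 Xs"
    using form_outside[OF bicomponent_forms[OF w], of Xs p q] bicomponent_length[of Xs p q \<omega>] assms(2)
    by (cases "length Xs = n") auto
qed

text \<open>For a form of degree n the bidegrees can be fixed in advance: on a list of a length
  other than n + 1, every component used by \<open>del\<close> and \<open>delbar\<close> is
  0.\<close>

lemma del_eq:
  assumes w: "\<omega> \<in> forms A n"
  shows "del A J \<omega> = (\<Sum>p<Suc n. T (int p + 1) (int n - int p) (d (T (int p) (int n - int p) \<omega>)))"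
    and "delbar A J \<omega> = (\<Sum>p<Suc n. T (int p) (int n - int p + 1) (d (T (int p) (int n - int p) \<omega>)))"
proof -
  have z: "T (int p) (int (length Xs) - 1 - int p) \<omega> = 0" if "length Xs \<noteq> Suc n" for Xs p
    using bicomponent_degree[OF w, of "int p" "int (length Xs) - 1 - int p"] that by simp
  show "del A J \<omega> = (\<Sum>p<Suc n. T (int p + 1) (int n - int p) (d (T (int p) (int n - int p) \<omega>)))"
  proof
    fix Xs
    show "del A J \<omega> Xs = (\<Sum>p<Suc n. T (int p + 1) (int n - int p) (d (T (int p) (int n - int p) \<omega>))) Xs"
    proof (cases "length Xs = Suc n")
      case True
      then show ?thesis by (simp add: del_def fun_sum_apply Let_def del: sum.lessThan_Suc)
    next
      case False
      then show ?thesis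
        by (simp add: del_def fun_sum_apply Let_def z[OF False] ext_d_zero bicomponent_zero bicomponent_length
             del: sum.lessThan_Suc)
    qed
  qed
  show "delbar A J \<omega> = (\<Sum>p<Suc n. T (int p) (int n - int p + 1) (d (T (int p) (int n - int p) \<omega>)))"
  proof
    fix Xs
    show "delbar A J \<omega> Xs = (\<Sum>p<Suc n. T (int p) (int n - int p + 1) (d (T (int p) (int n - int p) \<omega>))) Xs"
    proof (cases "length Xs = Suc n")
      case True
      then have "int (length Xs) - 1 = int n" by simp
      then show ?thesis using True
        by (simp only: delbar_def fun_sum_apply Let_def)
    next
      case False
      then show ?thesis
        by (simp add: delbar_def fun_sum_apply Let_def z[OF False] ext_d_zero bicomponent_zero bicomponent_length
             del: sum.lessThan_Suc)
    qed
  qed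
qed

lemma del_forms: "\<omega> \<in> forms A n \<Longrightarrow> del A J \<omega> \<in> forms A (Suc n)"
  and delbar_forms: "\<omega> \<in> forms A n \<Longrightarrow> delbar A J \<omega> \<in> forms A (Suc n)"
  by (simp_all only: del_eq) (intro sum_forms bicomponent_forms ext_d_forms; assumption)+

lemma del_zero: "del A J 0 = 0" and delbar_zero: "delbar A J 0 = 0"
  by (rule ext; simp add: del_def delbar_def Let_def bicomponent_zero ext_d_zero)+

end

section \<open>Coframes with abelian derived directions\<close>

text \<open>The values of a left-invariant form on left-invariant fields are of this kind; such
  functions are killed by every vector field.\<close>

definition const_fun :: "('m \<Rightarrow> complex) \<Rightarrow> bool" where
  "const_fun f \<longleftrightarrow> (\<exists>c. f = (\<lambda>_. c))"

lemma const_fun_intros: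
  "const_fun 0" "const_fun 1" "const_fun (\<lambda>_. c)"
  "const_fun f \<Longrightarrow> const_fun g \<Longrightarrow> const_fun (f + g)"
  "const_fun f \<Longrightarrow> const_fun g \<Longrightarrow> const_fun (f * g)"
  "const_fun f \<Longrightarrow> const_fun g \<Longrightarrow> const_fun (f - g)"
  "const_fun f \<Longrightarrow> const_fun (- f)"
  by (auto simp: const_fun_def fun_eq_iff)

lemma const_fun_sum: "(\<And>i. i \<in> I \<Longrightarrow> const_fun (f i)) \<Longrightarrow> const_fun (sum f I)"
  by (induction I rule: infinite_finite_induct) (auto intro: const_fun_intros)

lemma const_fun_power: "const_fun f \<Longrightarrow> const_fun (f ^ n)"
  by (induction n) (auto intro: const_fun_intros)

text \<open>In multiindices, \<open>(j, False)\<close> stands for \<open>\<eta>\<^sup>j\<close> and \<open>(j, True)\<close> for its conjugate.\<close>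

definition unbarred :: "(nat \<times> bool) list \<Rightarrow> nat" where
  "unbarred bs = length (filter (\<lambda>b. \<not> snd b) bs)"

lemma mset_nths_split: "mset (nths xs S) + mset (nths xs (- S)) = mset xs"
proof (induction xs arbitrary: S)
  case (Cons x xs)
  have "{j. Suc j \<in> - S} = - {j. Suc j \<in> S}" by auto
  then show ?case using Cons[of "{j. Suc j \<in> S}"] by (auto simp: nths_Cons)
qed simp

lemma unbarred_mset: "unbarred bs = size (filter_mset (\<lambda>b. \<not> snd b) (mset bs))"
  by (simp add: unbarred_def flip: mset_filter)

lemma unbarred_nths: "unbarred (nths bs S) + unbarred (nths bs (- S)) = unbarred bs"
  unfolding unbarred_mset size_union[symmetric] filter_union_mset[symmetric] mset_nths_split ..

lemma length_nths_split: "length (nths bs S) + length (nths bs (- S)) = length bs"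
  unfolding size_mset[symmetric] size_union[symmetric] mset_nths_split ..

text \<open>What left invariance contributes to the exterior calculus: a global frame Z dual to the
  forms \<eta> and their conjugates, with J and conjugation acting on it by constants and by
  exchange. The group itself reappears only in the locale that adds a lattice and a mean.\<close>

locale frame = complex_algebra A J for A :: "('m \<Rightarrow> complex) set" and J +
  fixes k :: nat and E :: "nat \<times> bool \<Rightarrow> 'm form" and Z :: "nat \<times> bool \<Rightarrow> 'm vf"
  assumes k: "1 \<le> k"
    and E_forms: "b \<in> {1..k} \<times> UNIV \<Longrightarrow> E b \<in> forms A 1"
    and Z_VF: "b \<in> {1..k} \<times> UNIV \<Longrightarrow> Z b \<in> vector_fields A"
    and E_Z: "b \<in> {1..k} \<times> UNIV \<Longrightarrow> c \<in> {1..k} \<times> UNIV \<Longrightarrow> E b [Z c] = (if b = c then 1 else 0)"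
    and expand: "X \<in> vector_fields A \<Longrightarrow> X = (\<Sum>b\<in>{1..k} \<times> UNIV. vf_mult (E b [X]) (Z b))"
    and J_Z: "j \<in> {1..k} \<Longrightarrow> J (Z (j, e)) = vf_mult (\<lambda>_. if e then - \<i> else \<i>) (Z (j, e))"
    and conj_Z: "j \<in> {1..k} \<Longrightarrow> vf_conj (Z (j, e)) = Z (j, \<not> e)"
    and conj_E: "j \<in> {1..k} \<Longrightarrow> form_conj (E (j, e)) = E (j, \<not> e)"
    and dE_lower: "j \<in> {1..k - 1} \<Longrightarrow> ext_d A (E (j, False)) = 0"
    and dE_k: "ext_d A (E (k, False)) \<in> form.span
      ({E (j, False) \<and>\<^sub>w E (l, False) | j l. j \<in> {1..k - 1} \<and> l \<in> {1..k - 1}} \<union>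
       {E (j, False) \<and>\<^sub>w E (l, True) | j l. j \<in> {1..k - 1} \<and> l \<in> {1..k - 1}})"
begin

abbreviation "idx \<equiv> {1..k} \<times> (UNIV :: bool set)"
abbreviation "\<iota> b \<equiv> contr (Z b)"

lemma finite_idx: "finite idx" by simp

lemma k_idx: "(k, b) \<in> idx" using k by auto

lemma map_Z_VF: "set bs \<subseteq> idx \<Longrightarrow> set (map Z bs) \<subseteq> VF"
  using Z_VF by auto

lemma contr_expand:
  assumes "\<omega> \<in> forms A n" "X \<in> VF"
  shows "contr X \<omega> = (\<Sum>b\<in>idx. fscale (E b [X]) (\<iota> b \<omega>))"
proof -
  have "contr X \<omega> = contr (\<Sum>b\<in>idx. vf_mult (E b [X]) (Z b)) \<omega>"
    using expand[OF assms(2)] by simp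
  also have "\<dots> = (\<Sum>b\<in>idx. fscale (E b [X]) (\<iota> b \<omega>))"
    by (rule contr_sum_vf[OF assms(1) finite_idx form_range[OF E_forms] Z_VF])
  finally show ?thesis .
qed

lemma forms_eq_contr:
  assumes w: "\<omega> \<in> forms A (Suc n)" and t: "\<theta> \<in> forms A (Suc n)"
    and eq: "\<And>b. b \<in> idx \<Longrightarrow> \<iota> b \<omega> = \<iota> b \<theta>"
  shows "\<omega> = \<theta>"
proof
  fix Xs show "\<omega> Xs = \<theta> Xs"
  proof (cases Xs)
    case Nil
    then show ?thesis using form_Suc_Nil[OF w] form_Suc_Nil[OF t] by simp
  next
    case (Cons X Ys)
    have "contr X \<omega> = contr X \<theta>"
    proof (cases "X \<in> VF")
      case True
      show ?thesis unfolding contr_expand[OF w True] contr_expand[OF t True]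
        by (rule sum.cong) (simp_all add: eq)
    qed (simp add: contr_outside[OF w] contr_outside[OF t])
    then show ?thesis using Cons by (auto simp: contr_def fun_eq_iff)
  qed
qed

lemma forms_eqI:
  assumes "\<omega> \<in> forms A n" "\<theta> \<in> forms A n"
    and "\<And>bs. set bs \<subseteq> idx \<Longrightarrow> length bs = n \<Longrightarrow> \<omega> (map Z bs) = \<theta> (map Z bs)"
  shows "\<omega> = \<theta>"
  using assms
proof (induction n arbitrary: \<omega> \<theta>)
  case 0
  then show ?case using 0(3)[of "[]"] by (auto simp: forms_0_iff) (metis (no_types) ext)
next
  case (Suc n)
  show ?case
  proof (rule forms_eq_contr[OF Suc.prems(1,2)])
    fix b assume b: "b \<in> idx"
    show "\<iota> b \<omega> = \<iota> b \<theta>"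
    proof (rule Suc.IH)
      show "\<iota> b \<omega> (map Z bs) = \<iota> b \<theta> (map Z bs)" if "set bs \<subseteq> idx" "length bs = n" for bs
        using Suc.prems(3)[of "b # bs"] that b by (simp add: contr_def)
    qed (use contr_forms Suc.prems Z_VF b in auto)
  qed
qed

lemma forms_nonzeroE:
  assumes "\<omega> \<in> forms A n" "\<omega> \<noteq> 0"
  obtains bs where "set bs \<subseteq> idx" "length bs = n" "\<omega> (map Z bs) \<noteq> 0"
  using forms_eqI[OF assms(1) zero_forms] assms(2) by auto

text \<open>The left-invariant forms, described without reference to a group.\<close>

definition const_form :: "nat \<Rightarrow> 'm form \<Rightarrow> bool" where
  "const_form n \<omega> \<longleftrightarrow> \<omega> \<in> forms A n \<and> (\<forall>bs. set bs \<subseteq> idx \<longrightarrow> const_fun (\<omega> (map Z bs)))"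

lemma const_form_forms: "const_form n \<omega> \<Longrightarrow> \<omega> \<in> forms A n"
  by (simp add: const_form_def)

lemma const_form_E: "b \<in> idx \<Longrightarrow> const_form 1 (E b)"
  unfolding const_form_def
proof (intro conjI allI impI)
  assume b: "b \<in> idx"
  fix bs assume bs: "set bs \<subseteq> idx"
  show "const_fun (E b (map Z bs))"
  proof (cases "length bs = 1")
    case True
    then obtain c where c: "bs = [c]" by (auto simp: length_Suc_conv)
    have "c \<in> idx" using bs c by simp
    then show ?thesis using E_Z[OF b \<open>c \<in> idx\<close>] c by (auto intro: const_fun_intros)
  next
    case False
    then show ?thesis using form_outside[OF E_forms[OF b], of "map Z bs"] by (auto intro: const_fun_intros)
  qed
qed (rule E_forms)

lemma const_form_intros:
  "const_form n 0"
  "const_form n \<omega> \<Longrightarrow> const_form n \<theta> \<Longrightarrow> const_form n (\<omega> + \<theta>)"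
  "const_form n \<omega> \<Longrightarrow> const_form n \<theta> \<Longrightarrow> const_form n (\<omega> - \<theta>)"
  "const_form n \<omega> \<Longrightarrow> const_form n (- \<omega>)"
  "const_form n \<omega> \<Longrightarrow> const_form n (cscale c \<omega>)"
  unfolding const_form_def
  by (auto intro: add_forms diff_forms uminus_forms cscale_forms const_fun_intros zero_forms)
     (metis cscale_eq_fscale fscale_def const_fun_intros(3,5))

lemma const_form_wedge:
  assumes "const_form n \<omega>" "const_form m \<theta>"
  shows "const_form (n + m) (\<omega> \<and>\<^sub>w \<theta>)"
  unfolding const_form_def
proof (intro conjI allI impI)
  show "\<omega> \<and>\<^sub>w \<theta> \<in> forms A (n + m)" using assms by (simp add: const_form_def wedge_forms)
  fix bs assume bs: "set bs \<subseteq> idx"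
  have "set (nths bs S) \<subseteq> idx" for S using set_nths_subset bs by fastforce
  then have "const_fun (\<omega> (nths (map Z bs) S))" "const_fun (\<theta> (nths (map Z bs) S))" for S
    using assms by (simp_all add: const_form_def nths_map)
  then show "const_fun ((\<omega> \<and>\<^sub>w \<theta>) (map Z bs))"
    unfolding wedge_def by (intro const_fun_sum const_fun_intros const_fun_power)
qed

lemma const_form_contr: "const_form (Suc n) \<omega> \<Longrightarrow> b \<in> idx \<Longrightarrow> const_form n (\<iota> b \<omega>)"
  unfolding const_form_def
  by (auto simp: contr_forms Z_VF) (auto simp: contr_def simp flip: list.map(2))

lemma const_form_one: "const_form 0 form_one"
  unfolding const_form_def by (simp add: form_one_forms) (auto simp: form_one_def intro: const_fun_intros)

lemma const_form_wedge_list: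
  "set bs \<subseteq> idx \<Longrightarrow> const_form (length bs) (wedge_list (map E bs))"
proof (induction bs)
  case (Cons b bs)
  then show ?case using const_form_wedge[OF const_form_E, of b "length bs" "wedge_list (map E bs)"]
    by (simp add: wedge_list_Cons)
qed (simp add: wedge_list_Nil const_form_one)

lemma proj_Z:
  assumes "j \<in> {1..k}"
  shows "proj10 J (Z (j, False)) = Z (j, False)" "proj01 J (Z (j, False)) = 0"
    "proj10 J (Z (j, True)) = 0" "proj01 J (Z (j, True)) = Z (j, True)"
  using J_Z[OF assms] by (auto simp: proj10_def proj01_def vf_mult_def fun_eq_iff field_simps)

lemma contr_bicomponent_Z:
  assumes "\<omega> \<in> forms A n" "j \<in> {1..k}"
  shows "\<iota> (j, False) (T p q \<omega>) = T (p - 1) q (\<iota> (j, False) \<omega>)"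
    and "\<iota> (j, True) (T p q \<omega>) = T p (q - 1) (\<iota> (j, True) \<omega>)"
  using Z_VF[of "(j, False)"] Z_VF[of "(j, True)"] assms
  by (simp_all add: contr_bicomponent proj_Z contr_zero_vf[OF assms(1)] bicomponent_zero)

text \<open>Frame fields have pure type, so of the subsets summed over in \<open>bicomponent\<close>
  only the set of unbarred positions can contribute.\<close>

lemma bicomponent_Z:
  assumes "\<omega> \<in> forms A n" "set bs \<subseteq> idx"
  shows "T p q \<omega> (map Z bs) = (if int (unbarred bs) = p \<and> int (length bs) = p + q then \<omega> (map Z bs) else 0)"
  using assms
proof (induction bs arbitrary: n \<omega> p q)
  case Nil
  then show ?case by (auto simp: bicomponent_Nil unbarred_def)
next
  case (Cons b bs)
  obtain j c where b: "b = (j, c)" "j \<in> {1..k}" using Cons.prems by (cases b) auto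
  have ZV: "Z b \<in> VF" using Cons.prems Z_VF by simp
  have "\<exists>m. \<iota> b \<omega> \<in> forms A m"
    using contr_forms_cases[OF Cons.prems(1) ZV] zero_forms by metis
  then obtain m where m: "\<iota> b \<omega> \<in> forms A m" by blast
  have "T p q \<omega> (map Z (b # bs)) = \<iota> b (T p q \<omega>) (map Z bs)" by (simp add: contr_def)
  also have "\<dots> = (if c then T p (q - 1) (\<iota> b \<omega>) (map Z bs) else T (p - 1) q (\<iota> b \<omega>) (map Z bs))"
    using contr_bicomponent_Z[OF Cons.prems(1) b(2)] by (cases c) (simp_all add: b(1))
  also have "\<dots> = (if int (unbarred (b # bs)) = p \<and> int (length (b # bs)) = p + q then \<iota> b \<omega> (map Z bs) else 0)"
  proof (cases c)
    case True
    with b have bT: "b = (j, True)" by simp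
    show ?thesis using Cons.prems True by (auto simp: Cons.IH[OF m[unfolded bT]] unbarred_def bT)
  next
    case False
    with b have bF: "b = (j, False)" by simp
    show ?thesis using Cons.prems False by (auto simp: Cons.IH[OF m[unfolded bF]] unbarred_def bF)
  qed
  finally show ?case by (simp add: contr_def)
qed

lemma const_form_bicomponent: "const_form n \<omega> \<Longrightarrow> const_form n (T p q \<omega>)"
  unfolding const_form_def by (auto simp: bicomponent_forms bicomponent_Z const_fun_intros)

text \<open>Wherever the product is nonzero on the frame, the index list splits into two lists of
  the prescribed types, and numbers of unbarred indices add up.\<close>

lemma bicomponent_wedge:
  assumes w: "\<omega> \<in> forms A n" and t: "\<theta> \<in> forms A m"
  shows "T p q (T a b \<omega> \<and>\<^sub>w T a' b' \<theta>) =
    (if p = a + a' \<and> q = b + b' then T a b \<omega> \<and>\<^sub>w T a' b' \<theta> else 0)"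
proof (rule forms_eqI)
  show wt: "T p q (T a b \<omega> \<and>\<^sub>w T a' b' \<theta>) \<in> forms A (n + m)"
    by (intro bicomponent_forms wedge_forms w t)
  show "(if p = a + a' \<and> q = b + b' then T a b \<omega> \<and>\<^sub>w T a' b' \<theta> else 0) \<in> forms A (n + m)"
    by (auto intro!: bicomponent_forms wedge_forms w t zero_forms)
  fix bs assume bs: "set bs \<subseteq> idx" "length bs = n + m"
  let ?w = "T a b \<omega> \<and>\<^sub>w T a' b' \<theta>"
  have w': "?w \<in> forms A (n + m)" by (intro bicomponent_forms wedge_forms w t)
  have "int (unbarred bs) = a + a' \<and> int (length bs) = a + a' + (b + b')" if "?w (map Z bs) \<noteq> 0"
  proof -
    obtain S where S: "T a b \<omega> (nths (map Z bs) S) \<noteq> 0" "T a' b' \<theta> (nths (map Z bs) (- S)) \<noteq> 0"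
      using wedge_nonzeroE[OF \<open>?w (map Z bs) \<noteq> 0\<close>] by blast
    have "set (nths bs S) \<subseteq> idx" "set (nths bs (- S)) \<subseteq> idx"
      using set_nths_subset bs(1) by fastforce+
    then have "int (unbarred (nths bs S)) = a \<and> int (length (nths bs S)) = a + b"
      "int (unbarred (nths bs (- S))) = a' \<and> int (length (nths bs (- S))) = a' + b'"
      using S by (auto simp: nths_map bicomponent_Z[OF w] bicomponent_Z[OF t] split: if_splits)
    then show ?thesis using unbarred_nths[of bs S] length_nths_split[of bs S] by linarith
  qed
  then show "T p q ?w (map Z bs) = (if p = a + a' \<and> q = b + b' then ?w else 0) (map Z bs)"
    by (auto simp: bicomponent_Z[OF w' bs(1)])
qed

text \<open>The bound m may exceed the degree because the surplus components, of negative second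
  index, vanish; one of the shifted sums in \<open>del_const_form\<close> has this surplus.\<close>

lemma bicomponent_sum:
  assumes w: "\<omega> \<in> forms A n" and m: "n \<le> m"
  shows "(\<Sum>p<Suc m. T (int p) (int n - int p) \<omega>) = \<omega>"
proof (rule forms_eqI[OF _ w])
  show "(\<Sum>p<Suc m. T (int p) (int n - int p) \<omega>) \<in> forms A n"
    by (intro sum_forms bicomponent_forms w)
  fix bs assume bs: "set bs \<subseteq> idx" "length bs = n"
  have "unbarred bs \<le> n" using bs by (auto simp: unbarred_def)
  then have "(\<Sum>p<Suc m. if unbarred bs = p then \<omega> (map Z bs) else 0) = \<omega> (map Z bs)"
    using m by (subst sum.delta') auto
  then show "(\<Sum>p<Suc m. T (int p) (int n - int p) \<omega>) (map Z bs) = \<omega> (map Z bs)"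
    using bs by (simp add: fun_sum_apply bicomponent_Z[OF w] del: sum.lessThan_Suc)
qed

end

lemma vf_conj_invol [simp]: "vf_conj (vf_conj X) = X"
  by (simp add: vf_conj_def fun_eq_iff)

lemma form_conj_invol [simp]: "form_conj (form_conj \<omega>) = \<omega>"
  by (simp add: form_conj_def o_def fun_eq_iff)

lemma lie_bracket_conj: "lie_bracket (vf_conj X) (vf_conj Y) = vf_conj (lie_bracket X Y)"
  by (auto simp: lie_bracket_def vf_conj_def fun_eq_iff)

lemma power_minus_one_apply: "((- 1 :: 'm \<Rightarrow> complex) ^ n) x = (- 1) ^ n"
  by (induction n) auto

lemma form_conj_wedge: "form_conj (\<omega> \<and>\<^sub>w \<theta>) = form_conj \<omega> \<and>\<^sub>w form_conj \<theta>"
  by (intro ext) (simp add: form_conj_def wedge_def fun_sum_apply nths_map power_minus_one_apply)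

lemma form_conj_add: "form_conj (\<omega> + \<theta>) = form_conj \<omega> + form_conj \<theta>"
  and form_conj_diff: "form_conj (\<omega> - \<theta>) = form_conj \<omega> - form_conj \<theta>"
  and form_conj_zero: "form_conj 0 = 0"
  by (auto simp: form_conj_def cscale_def fun_eq_iff)

lemma wedge_sum_right: "\<omega> \<and>\<^sub>w (\<Sum>i\<in>I. \<theta> i) = (\<Sum>i\<in>I. \<omega> \<and>\<^sub>w \<theta> i)"
proof (induction I rule: infinite_finite_induct)
  case (insert i I)
  then show ?case by (simp only: sum.insert[OF insert.hyps] wedge_add_right)
qed (simp_all only: sum.infinite sum.empty wedge_zero_right not_False_eq_True)

context function_algebra
begin

lemma VF_conj_iff: "vf_conj X \<in> VF \<longleftrightarrow> X \<in> VF"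
  using VF_conj[of X] VF_conj[of "vf_conj X"] by auto

text \<open>Conjugation of vector fields respects brackets, so Koszul's formula is conjugated term
  by term. This yields the differentials of the barred coframe from those of the unbarred
  one.\<close>

lemma ext_d_conj: "ext_d A (form_conj \<omega>) = form_conj (ext_d A \<omega>)"
proof
  fix Xs
  have VF: "set (map vf_conj Xs) \<subseteq> VF \<longleftrightarrow> set Xs \<subseteq> VF" using VF_conj_iff by auto
  let ?C = "map vf_conj Xs"
  have 1: "(Xs ! i) (form_conj \<omega> Ys) x = cnj ((?C ! i) (\<omega> (map vf_conj Ys)) x)" if "i < length Xs" for i Ys x
    using that by (simp add: form_conj_def vf_conj_def)
  have 2: "form_conj \<omega> (lie_bracket (Xs ! i) (Xs ! j) # Ys) x =
      cnj (\<omega> (lie_bracket (?C ! i) (?C ! j) # map vf_conj Ys) x)" if "i < j" "j < length Xs" for i j Ys x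
    using that by (simp add: form_conj_def lie_bracket_conj)
  show "ext_d A (form_conj \<omega>) Xs = form_conj (ext_d A \<omega>) Xs"
  proof (cases "set Xs \<subseteq> VF")
    case True
    show ?thesis
    proof
      fix x
      have S1: "(\<Sum>i<length Xs. (- 1) ^ i * (Xs ! i) (form_conj \<omega> (nths Xs (- {i})))) x =
          cnj ((\<Sum>i<length ?C. (- 1) ^ i * (?C ! i) (\<omega> (nths ?C (- {i})))) x)"
        unfolding fun_sum_apply cnj_sum length_map
        by (rule sum.cong) (simp_all add: 1 nths_map power_minus_one_apply)
      have S2: "(\<Sum>(i, j)\<in>{(i, j). i < j \<and> j < length Xs}.
          (- 1) ^ (i + j) * form_conj \<omega> (lie_bracket (Xs ! i) (Xs ! j) # nths Xs (- {i, j}))) x =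
        cnj ((\<Sum>(i, j)\<in>{(i, j). i < j \<and> j < length ?C}.
          (- 1) ^ (i + j) * \<omega> (lie_bracket (?C ! i) (?C ! j) # nths ?C (- {i, j}))) x)"
        unfolding fun_sum_apply cnj_sum length_map
        by (rule sum.cong) (auto simp del: nth_map simp add: 2 nths_map power_minus_one_apply)
      have "ext_d A (form_conj \<omega>) Xs x =
          (\<Sum>i<length Xs. (- 1) ^ i * (Xs ! i) (form_conj \<omega> (nths Xs (- {i})))) x +
          (\<Sum>(i, j)\<in>{(i, j). i < j \<and> j < length Xs}.
          (- 1) ^ (i + j) * form_conj \<omega> (lie_bracket (Xs ! i) (Xs ! j) # nths Xs (- {i, j}))) x"
        using True by (simp only: ext_d_def if_True plus_fun_apply)
      also have "\<dots> = cnj (ext_d A \<omega> ?C x)"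
        using True unfolding S1 S2 by (simp only: VF ext_d_def if_True plus_fun_apply complex_cnj_add)
      finally show "ext_d A (form_conj \<omega>) Xs x = form_conj (ext_d A \<omega>) Xs x"
        by (simp add: form_conj_def)
    qed
  next
    case False
    then have "ext_d A \<omega> ?C = 0" using VF by (intro ext_d_outside) simp
    then show ?thesis using False by (simp add: ext_d_outside form_conj_def)
  qed
qed

lemma form_conj_forms: "\<omega> \<in> forms A n \<Longrightarrow> form_conj \<omega> \<in> forms A n"
proof (induction n arbitrary: \<omega>)
  case 0
  then show ?case by (auto simp: forms_0_iff form_conj_def cnj_mem)
next
  case (Suc n)
  have c: "contr X (form_conj \<omega>) = form_conj (contr (vf_conj X) \<omega>)" for X and \<omega> :: "'m form"
    by (simp add: contr_def form_conj_def)
  have a: "vf_conj (X + Y) = vf_conj X + vf_conj Y" for X Y :: "'m vf"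
    by (simp add: vf_conj_def fun_eq_iff)
  have m: "vf_conj (vf_mult f X) = vf_mult (\<lambda>x. cnj (f x)) (vf_conj X)" for f and X :: "'m vf"
    by (simp add: vf_conj_def vf_mult_def fun_eq_iff)
  have f: "form_conj (fscale g \<theta>) = fscale (\<lambda>x. cnj (g x)) (form_conj \<theta>)" for g and \<theta> :: "'m form"
    by (simp add: form_conj_def fscale_def fun_eq_iff)
  note w = Suc.prems
  show ?case
  proof (rule forms_SucI)
    show "form_conj \<omega> [] = 0" using form_Suc_Nil[OF w] by (simp add: form_conj_def)
  qed (simp_all add: c a m f form_conj_zero form_conj_add VF_conj VF_conj_iff cnj_mem contr_outside[OF w]
      contr_twice[OF w] contr_add_vf[OF w] contr_mult_vf[OF w] Suc.IH contr_forms[OF w])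
qed

lemma wedge_forms_0: "\<rho> \<in> forms A 0 \<Longrightarrow> \<rho> \<and>\<^sub>w \<omega> = fscale (\<rho> []) \<omega>"
proof
  fix Xs assume r: "\<rho> \<in> forms A 0"
  show "(\<rho> \<and>\<^sub>w \<omega>) Xs = fscale (\<rho> []) \<omega> Xs"
  proof (induction Xs arbitrary: \<omega>)
    case (Cons X Xs)
    have "contr X \<rho> = 0" using r by (auto simp: forms_0_iff contr_def fun_eq_iff)
    moreover have "grade_sign \<rho> = \<rho>" using grade_sign_form[OF r] by (simp add: cscale_def)
    ultimately show ?case using Cons[of "contr X \<omega>"] by (simp add: wedge_Cons) (simp add: contr_def fscale_def)
  qed (simp add: fscale_def)
qed

lemma grade_sign_1: "\<omega> \<in> forms A (Suc 0) \<Longrightarrow> grade_sign \<omega> = - \<omega>"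
  and grade_sign_2: "\<omega> \<in> forms A 2 \<Longrightarrow> grade_sign \<omega> = \<omega>"
  by (frule grade_sign_form, auto simp: cscale_def fun_eq_iff)+

end

section \<open>The differential of invariant forms and its types\<close>

context frame
begin

abbreviation "B \<equiv> d (E (k, False))"
abbreviation "B' \<equiv> d (E (k, True))"
abbreviation "\<sigma> \<equiv> T 2 0 B"
abbreviation "\<tau> \<equiv> T 1 1 B"
abbreviation "\<tau>' \<equiv> T 1 1 B'"
abbreviation "\<sigma>' \<equiv> T 0 2 B'"
abbreviation "\<Psi> \<equiv> \<tau>' \<and>\<^sub>w \<tau> - \<sigma> \<and>\<^sub>w \<sigma>'"

lemma B'_conj: "B' = form_conj B"
  using conj_E[of k False] k by (simp flip: ext_d_conj)

lemma dE_lower': "j \<in> {1..k - 1} \<Longrightarrow> d (E (j, b)) = 0"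
proof (cases b)
  case True
  assume j: "j \<in> {1..k - 1}"
  then have "form_conj (d (E (j, False))) = d (E (j, True))"
    using conj_E[of j False] by (simp flip: ext_d_conj) auto
  then show ?thesis using dE_lower[OF j] True by (simp add: form_conj_zero)
qed (simp add: dE_lower)

lemma contr_E: "b \<in> idx \<Longrightarrow> c \<in> idx \<Longrightarrow> contr (Z b) (E c) = (if b = c then form_one else 0)"
proof
  fix Xs assume b: "b \<in> idx" and c: "c \<in> idx"
  show "contr (Z b) (E c) Xs = (if b = c then form_one else 0) Xs"
    using E_Z[OF c b] form_outside[OF E_forms[OF c], of "Z b # Xs"]
    by (cases Xs) (auto simp: contr_def form_one_def)
qed

text \<open>All three properties are linear, so generators of the span in \<open>dE_k\<close>
  suffice: none of them involves the index k, and each has an unbarred factor, which excludes type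
  (0,2).\<close>

lemma B_props:
  "const_form 2 B" "contr (Z (k, e)) B = 0" "T 0 2 B = 0"
proof -
  let ?S = "{E (j, False) \<and>\<^sub>w E (l, False) | j l. j \<in> {1..k - 1} \<and> l \<in> {1..k - 1}} \<union>
       {E (j, False) \<and>\<^sub>w E (l, True) | j l. j \<in> {1..k - 1} \<and> l \<in> {1..k - 1}}"
  let ?P = "\<lambda>\<omega>. const_form 2 \<omega> \<and> (\<forall>e. contr (Z (k, e)) \<omega> = 0) \<and> T 0 2 \<omega> = 0"
  have gen: "?P (E (j, False) \<and>\<^sub>w E (l, f))" if j: "j \<in> {1..k - 1}" and l: "l \<in> {1..k - 1}" for j l f
  proof (intro conjI allI)
    have jl: "(j, False) \<in> idx" "(l, f) \<in> idx" "j \<in> {1..k}" using j l by auto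
    have "const_form (1 + 1) (E (j, False) \<and>\<^sub>w E (l, f))"
      by (intro const_form_wedge const_form_E jl)
    then show c: "const_form 2 (E (j, False) \<and>\<^sub>w E (l, f))" by (simp add: numeral_2_eq_2)
    show "contr (Z (k, e)) (E (j, False) \<and>\<^sub>w E (l, f)) = 0" for e
    proof -
      have "(k, e) \<noteq> (j, False)" "(k, e) \<noteq> (l, f)" using j l by auto
      then show ?thesis by (simp only: contr_wedge contr_E k_idx jl if_False wedge_zero_left wedge_zero_right add_0)
    qed
    show "T 0 2 (E (j, False) \<and>\<^sub>w E (l, f)) = 0"
    proof (rule forms_eqI[OF _ zero_forms])
      show "T 0 2 (E (j, False) \<and>\<^sub>w E (l, f)) \<in> forms A 2"
        using c by (intro bicomponent_forms const_form_forms)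
      fix bs assume bs: "set bs \<subseteq> idx" "length bs = 2"
      show "T 0 2 (E (j, False) \<and>\<^sub>w E (l, f)) (map Z bs) = 0 (map Z bs)"
      proof (cases "unbarred bs = 0")
        case True
        have "(E (j, False) \<and>\<^sub>w E (l, f)) (map Z bs) = 0"
        proof (rule ccontr)
          assume "(E (j, False) \<and>\<^sub>w E (l, f)) (map Z bs) \<noteq> 0"
          then obtain S where S: "E (j, False) (nths (map Z bs) S) \<noteq> 0" by (rule wedge_nonzeroE)
          have s: "set (nths bs S) \<subseteq> idx" using set_nths_subset bs(1) by fastforce
          have "length (nths bs S) = 1"
            using form_outside[OF E_forms[OF jl(1)], of "nths (map Z bs) S"] S by (auto simp: nths_map)
          then obtain c where c: "nths bs S = [c]" by (auto simp: length_Suc_conv)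
          then have "c = (j, False)"
            using S E_Z[OF jl(1), of c] s by (auto simp: nths_map split: if_splits)
          then have "unbarred (nths bs S) = 1" using c by (simp add: unbarred_def)
          then show False using unbarred_nths[of bs S] True by simp
        qed
        then show ?thesis by (simp add: bicomponent_Z[OF const_form_forms[OF c] bs(1)])
      qed (simp add: bicomponent_Z[OF const_form_forms[OF c] bs(1)])
    qed
  qed
  have gens: "?P \<omega>" if "\<omega> \<in> ?S" for \<omega> using that gen by blast
  have c0: "cscale c 0 = 0" for c :: complex by (simp add: cscale_def)
  have "?P B"
    using dE_k
  proof (induction rule: form.span_induct_alt)
    case base show ?case by (simp add: const_form_intros bicomponent_zero)
  next
    case (step c x y)
    have x: "?P x" by (rule gens[OF step(1)])
    show ?case
    proof (intro conjI allI)
      show "const_form 2 (cscale c x + y)"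
        using x step by (intro const_form_intros) auto
    qed (use x step in \<open>simp_all only: contr_add contr_cscale bicomponent_add bicomponent_cscale c0 add_0\<close>)
  qed
  then show "const_form 2 B" "contr (Z (k, e)) B = 0" "T 0 2 B = 0" by auto
qed

lemma form_conj_Z:
  "set bs \<subseteq> idx \<Longrightarrow> form_conj \<omega> (map Z bs) = (\<lambda>x. cnj (\<omega> (map Z (map (apsnd Not) bs)) x))"
proof -
  assume bs: "set bs \<subseteq> idx"
  have "map vf_conj (map Z bs) = map Z (map (apsnd Not) bs)"
    using bs conj_Z by (auto simp: apsnd_def)
  then show ?thesis by (simp only: form_conj_def)
qed

lemma flip_idx: "set bs \<subseteq> idx \<Longrightarrow> set (map (apsnd Not) bs) \<subseteq> idx"
  by (auto simp: apsnd_def)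

lemma unbarred_flip: "unbarred (map (apsnd Not) bs) + unbarred bs = length bs"
  by (induction bs) (auto simp: unbarred_def)

lemma B_forms: "B \<in> forms A 2" and B'_forms: "B' \<in> forms A 2"
  using ext_d_forms[OF E_forms[OF k_idx], of False] ext_d_forms[OF E_forms[OF k_idx], of True]
  by (simp_all add: numeral_2_eq_2)

text \<open>Flipping the bars of a list of two indices exchanges the numbers of barred and unbarred
  ones, hence the exchange of p and q.\<close>

lemma conj_bicomponent_B: "T q p B' = form_conj (T p q B)"
proof (rule forms_eqI[OF bicomponent_forms[OF B'_forms] form_conj_forms[OF bicomponent_forms[OF B_forms]]])
  fix bs assume bs: "set bs \<subseteq> idx" "length bs = 2"
  have u: "unbarred (map (apsnd Not) bs) + unbarred bs = 2" using unbarred_flip[of bs] bs by simp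
  have "T q p B' (map Z bs) = (if int (unbarred bs) = q \<and> 2 = q + p then (\<lambda>x. cnj (B (map Z (map (apsnd Not) bs)) x)) else 0)"
    using bs unfolding bicomponent_Z[OF B'_forms bs(1)] unfolding B'_conj by (simp add: form_conj_Z)
  also have "\<dots> = (\<lambda>x. cnj (T p q B (map Z (map (apsnd Not) bs)) x))"
    using u bs(2) unfolding bicomponent_Z[OF B_forms flip_idx[OF bs(1)]] by (auto simp del: map_map)
  also have "\<dots> = form_conj (T p q B) (map Z bs)" by (simp only: form_conj_Z[OF bs(1)])
  finally show "T q p B' (map Z bs) = form_conj (T p q B) (map Z bs)" .
qed

lemma \<sigma>'_conj: "\<sigma>' = form_conj \<sigma>" and \<tau>'_conj: "\<tau>' = form_conj \<tau>"
  by (rule conj_bicomponent_B)+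

lemma B'_props: "const_form 2 B'" "contr (Z (k, e)) B' = 0" "T 2 0 B' = 0"
proof -
  show "const_form 2 B'"
    unfolding const_form_def
  proof (intro conjI allI impI B'_forms)
    fix bs assume bs: "set bs \<subseteq> idx"
    then have "const_fun (B (map Z (map (apsnd Not) bs)))"
      using B_props(1) flip_idx[OF bs] unfolding const_form_def by blast
    then show "const_fun (B' (map Z bs))" unfolding B'_conj form_conj_Z[OF bs] by (auto simp: const_fun_def)
  qed
  have "contr (Z (k, e)) B' = form_conj (contr (vf_conj (Z (k, e))) B)"
    unfolding B'_conj by (simp add: contr_def form_conj_def)
  then show "contr (Z (k, e)) B' = 0" using k by (simp add: conj_Z B_props form_conj_zero)
  show "T 2 0 B' = 0" using conj_bicomponent_B[of 2 0] by (simp add: B_props form_conj_zero)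
qed

lemma B_split: "B = \<sigma> + \<tau>" and B'_split: "B' = \<tau>' + \<sigma>'"
  using bicomponent_sum[OF B_forms, of 2] bicomponent_sum[OF B'_forms, of 2]
  by (simp_all add: numeral_2_eq_2 B_props B'_props eval_nat_numeral add_ac)

lemma type_forms: "const_form 2 \<sigma>" "const_form 2 \<tau>" "const_form 2 \<tau>'" "const_form 2 \<sigma>'"
  by (intro const_form_bicomponent B_props B'_props)+

lemma contr_types:
  "contr (Z (k, e)) \<sigma> = 0" "contr (Z (k, e)) \<tau> = 0" "contr (Z (k, e)) \<tau>' = 0" "contr (Z (k, e)) \<sigma>' = 0"
proof -
  have kk: "k \<in> {1..k}" using k by simp
  have "contr (Z (k, e)) (T p q B) = 0 \<and> contr (Z (k, e)) (T p q B') = 0" for p q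
    using contr_bicomponent_Z[OF B_forms kk] contr_bicomponent_Z[OF B'_forms kk]
    by (cases e) (simp_all add: B_props B'_props bicomponent_zero)
  then show "contr (Z (k, e)) \<sigma> = 0" "contr (Z (k, e)) \<tau> = 0" "contr (Z (k, e)) \<tau>' = 0" "contr (Z (k, e)) \<sigma>' = 0"
    by blast+
qed

lemma const_fun_VF: "const_fun f \<Longrightarrow> X \<in> VF \<Longrightarrow> X f = 0"
  by (auto simp: const_fun_def vf_const)

text \<open>A coframe form is constant on frame fields, so Koszul's formula leaves only minus its
  value on the bracket. Since the coframe forms of index below k are closed, the bracket has
  components of index k only.\<close>

lemma lie_bracket_Z:
  assumes b: "b \<in> idx" and c: "c \<in> idx"
  shows "lie_bracket (Z b) (Z c) = vf_mult (- B [Z b, Z c]) (Z (k, False)) + vf_mult (- B' [Z b, Z c]) (Z (k, True))"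
proof -
  let ?V = "lie_bracket (Z b) (Z c)"
  have V: "?V \<in> VF" by (intro VF_lie_bracket Z_VF b c)
  have coef: "E a [?V] = - d (E a) [Z b, Z c]" if a: "a \<in> idx" for a
  proof -
    have Ea: "E a \<in> forms A 1" by (rule E_forms[OF a])
    have r0: "contr (Z b) (E a) \<in> forms A 0" using contr_forms[of "E a" 0 "Z b"] Ea Z_VF[OF b] by simp
    have rc: "contr (Z c) (contr (Z b) (E a)) = 0"
      using r0 by (auto simp: forms_0_iff contr_def fun_eq_iff)
    have "d (E a) [Z b, Z c] = contr (Z b) (d (E a)) [Z c]" by (simp add: contr_def)
    also have "\<dots> = lie_deriv (Z b) (E a) [Z c] - contr (Z c) (d (contr (Z b) (E a))) []"
      unfolding contr_ext_d[OF Ea Z_VF[OF b]] by (simp add: contr_def)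
    also have "contr (Z c) (d (contr (Z b) (E a))) [] = lie_deriv (Z c) (contr (Z b) (E a)) []"
      unfolding contr_ext_d[OF r0 Z_VF[OF c]] rc ext_d_zero by simp
    also have "lie_deriv (Z c) (contr (Z b) (E a)) [] = 0"
      using Z_VF[OF c] E_Z[OF a b] by (simp add: lie_deriv_def contr_def vf_zero const_fun_VF const_fun_intros)
    also have "lie_deriv (Z b) (E a) [Z c] = - E a [?V]"
      using Z_VF[OF b] Z_VF[OF c] E_Z[OF a c] by (simp add: lie_deriv_def vf_zero const_fun_VF const_fun_intros)
    finally show ?thesis by (simp only: diff_zero minus_minus)
  qed
  have "?V = (\<Sum>a\<in>idx. vf_mult (E a [?V]) (Z a))" by (rule expand[OF V])
  also have "\<dots> = (\<Sum>a\<in>{(k, False), (k, True)}. vf_mult (E a [?V]) (Z a))"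
  proof (rule sum.mono_neutral_right)
    show "\<forall>a\<in>idx - {(k, False), (k, True)}. vf_mult (E a [?V]) (Z a) = 0"
    proof
      fix a assume a: "a \<in> idx - {(k, False), (k, True)}"
      obtain j e where ae: "a = (j, e)" by (cases a)
      then have "j \<in> {1..k - 1}" using a by (cases e) auto
      then have "E a [?V] = 0" using coef[of a] a dE_lower'[of j e] ae by simp
      then show "vf_mult (E a [?V]) (Z a) = 0" by (simp add: vf_mult_def fun_eq_iff)
    qed
  qed (use k in auto)
  also have "\<dots> = vf_mult (E (k, False) [?V]) (Z (k, False)) + vf_mult (E (k, True) [?V]) (Z (k, True))"
    by (subst sum.insert) (simp_all only: sum.insert sum.empty finite.intros add_0_right insert_iff empty_iff prod.inject simp_thms bool_simps)
  finally show ?thesis by (simp only: coef[OF k_idx])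
qed

lemma contr_Z_zero: "\<omega> \<in> forms A 0 \<Longrightarrow> contr X \<omega> = 0"
  by (auto simp: forms_0_iff contr_def fun_eq_iff)

text \<open>The values on the frame are constants, so only the bracket terms survive, and all
  brackets point in the two directions of index k. The sum over the slots is then a product with a
  contraction of \<open>B\<close> or \<open>B'\<close>; contracting both sides with the frame proves
  this by induction.\<close>

lemma lie_deriv_Z:
  assumes "const_form n \<omega>" "b \<in> idx"
  shows "lie_deriv (Z b) \<omega> = \<iota> b B \<and>\<^sub>w \<iota> (k, False) \<omega> + \<iota> b B' \<and>\<^sub>w \<iota> (k, True) \<omega>"
  using assms(1)
proof (induction n arbitrary: \<omega>)
  case 0
  then have w: "\<omega> \<in> forms A 0" and c: "const_fun (\<omega> [])"
    by (auto simp: const_form_def dest: spec[of _ "[]"])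
  have z: "contr X \<omega> = 0" for X by (rule contr_Z_zero[OF w])
  have "lie_deriv (Z b) \<omega> Xs = 0" for Xs
    using form_outside[OF lie_deriv_forms[OF w Z_VF[OF assms(2)]], of Xs]
    by (cases Xs) (simp_all add: lie_deriv_def const_fun_VF[OF c Z_VF[OF assms(2)]])
  then have "lie_deriv (Z b) \<omega> = 0" by (simp add: fun_eq_iff)
  then show ?case by (simp add: z)
next
  case (Suc n)
  have w: "\<omega> \<in> forms A (Suc n)" using Suc.prems by (rule const_form_forms)
  have ZV: "Z b \<in> VF" by (rule Z_VF[OF assms(2)])
  have bB: "\<iota> b B \<in> forms A 1" "\<iota> b B' \<in> forms A 1"
    using contr_forms[of _ 1 "Z b"] B_forms B'_forms ZV by (simp_all add: numeral_2_eq_2)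
  have zk: "Z (k, e) \<in> VF" for e by (rule Z_VF[OF k_idx])
  show ?case
  proof (rule forms_eq_contr)
    show "lie_deriv (Z b) \<omega> \<in> forms A (Suc n)" by (rule lie_deriv_forms[OF w ZV])
    show "\<iota> b B \<and>\<^sub>w \<iota> (k, False) \<omega> + \<iota> b B' \<and>\<^sub>w \<iota> (k, True) \<omega> \<in> forms A (Suc n)"
      using wedge_forms[OF bB(1) contr_forms[OF w zk]] wedge_forms[OF bB(2) contr_forms[OF w zk]]
      by (simp add: add_forms)
    fix c assume c: "c \<in> idx"
    have Zc: "Z c \<in> VF" by (rule Z_VF[OF c])
    have step: "\<iota> c (\<iota> b F \<and>\<^sub>w \<iota> (k, e) \<omega>) = fscale (F [Z b, Z c]) (\<iota> (k, e) \<omega>) + \<iota> b F \<and>\<^sub>w \<iota> (k, e) (\<iota> c \<omega>)"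
      if F: "F \<in> forms A 2" for F e
    proof -
      have bF: "\<iota> b F \<in> forms A (Suc 0)" using contr_forms[of F 1 "Z b"] F ZV by (simp add: numeral_2_eq_2)
      have cbF: "\<iota> c (\<iota> b F) \<in> forms A 0" by (rule contr_forms[OF bF Zc])
      have "\<iota> c (\<iota> b F) [] = F [Z b, Z c]" by (simp add: contr_def)
      then show ?thesis
        by (simp only: contr_wedge wedge_forms_0[OF cbF] grade_sign_1[OF bF] contr_anticomm[OF w Zc zk]
            wedge_uminus_left wedge_uminus_right minus_minus)
    qed
    have V: "vf_mult (- F [Z b, Z c]) (Z (k, e)) \<in> VF" if "F \<in> forms A 2" for F e
      by (intro VF_mult zk uminus_mem form_range[OF that])
    have br: "contr (lie_bracket (Z b) (Z c)) \<omega> =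
        fscale (- B [Z b, Z c]) (\<iota> (k, False) \<omega>) + fscale (- B' [Z b, Z c]) (\<iota> (k, True) \<omega>)"
      unfolding lie_bracket_Z[OF assms(2) c]
      by (simp only: contr_add_vf[OF w V[OF B_forms] V[OF B'_forms]]
          contr_mult_vf[OF w zk uminus_mem[OF form_range[OF B_forms]]]
          contr_mult_vf[OF w zk uminus_mem[OF form_range[OF B'_forms]]])
    have neg: "fscale (- f) \<theta> = - fscale f \<theta>" for f and \<theta> :: "'m form"
      by (simp add: fscale_def fun_eq_iff)
    show "\<iota> c (lie_deriv (Z b) \<omega>) = \<iota> c (\<iota> b B \<and>\<^sub>w \<iota> (k, False) \<omega> + \<iota> b B' \<and>\<^sub>w \<iota> (k, True) \<omega>)"
      unfolding contr_lie_deriv[OF w ZV Zc] br contr_add step[OF B_forms] step[OF B'_forms]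
        Suc.IH[OF const_form_contr[OF Suc.prems c]] neg
      by (simp only: diff_conv_add_uminus minus_add_distrib minus_minus add_ac)
  qed
qed

text \<open>The right-hand side is the antiderivation that sends the k-th form to \<open>B\<close>,
  its conjugate to \<open>B'\<close> and the remaining coframe to 0. The proof compares contractions
  through Cartan's formula instead of decomposing into monomials.\<close>

theorem ext_d_const_form:
  assumes "const_form n \<omega>"
  shows "d \<omega> = B \<and>\<^sub>w \<iota> (k, False) \<omega> + B' \<and>\<^sub>w \<iota> (k, True) \<omega>"
  using assms
proof (induction n arbitrary: \<omega>)
  case 0
  then have w: "\<omega> \<in> forms A 0" by (rule const_form_forms)
  have z: "contr X \<omega> = 0" for X by (rule contr_Z_zero[OF w])
  have "d \<omega> = 0"
  proof (rule forms_eq_contr[OF ext_d_forms[OF w] zero_forms])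
    fix b assume b: "b \<in> idx"
    show "\<iota> b (d \<omega>) = \<iota> b 0"
      by (simp add: contr_ext_d[OF w Z_VF[OF b]] lie_deriv_Z[OF 0 b] z ext_d_zero)
  qed
  then show ?case by (simp add: z)
next
  case (Suc n)
  have w: "\<omega> \<in> forms A (Suc n)" using Suc.prems by (rule const_form_forms)
  have zk: "Z (k, e) \<in> VF" for e by (rule Z_VF[OF k_idx])
  show ?case
  proof (rule forms_eq_contr)
    show "d \<omega> \<in> forms A (Suc (Suc n))" by (rule ext_d_forms[OF w])
    show "B \<and>\<^sub>w \<iota> (k, False) \<omega> + B' \<and>\<^sub>w \<iota> (k, True) \<omega> \<in> forms A (Suc (Suc n))"
      using wedge_forms[OF B_forms contr_forms[OF w zk]] wedge_forms[OF B'_forms contr_forms[OF w zk]]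
      by (simp add: add_forms)
    fix b assume b: "b \<in> idx"
    show "\<iota> b (d \<omega>) = \<iota> b (B \<and>\<^sub>w \<iota> (k, False) \<omega> + B' \<and>\<^sub>w \<iota> (k, True) \<omega>)"
      unfolding contr_ext_d[OF w Z_VF[OF b]] lie_deriv_Z[OF Suc.prems b] Suc.IH[OF const_form_contr[OF Suc.prems b]]
        contr_add contr_wedge grade_sign_2[OF B_forms] grade_sign_2[OF B'_forms] contr_anticomm[OF w Z_VF[OF b] zk]
      by (simp only: wedge_uminus_right diff_conv_add_uminus minus_add_distrib add_ac)
  qed
qed

lemma bicomponent_neg: "p < 0 \<Longrightarrow> T p q \<omega> = 0"
proof -
  assume "p < 0"
  then have e: "{S. S \<subseteq> {..<length Xs} \<and> int (card S) = p} = {}" for Xs :: "'m vf list" by auto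
  show ?thesis by (rule ext) (simp only: bicomponent_def e sum.empty if_cancel zero_fun_apply)
qed

text \<open>Sort the terms of \<open>ext_d_const_form\<close> by type: \<open>B\<close> has parts of
  type (2,0) and (1,1), \<open>B'\<close> of type (1,1) and (0,2), and contraction with an index-k
  direction lowers the type by one.\<close>

theorem del_const_form:
  assumes "const_form n \<omega>"
  shows "del A J \<omega> = \<sigma> \<and>\<^sub>w \<iota> (k, False) \<omega> + \<tau>' \<and>\<^sub>w \<iota> (k, True) \<omega>" (is ?del)
    and "delbar A J \<omega> = \<tau> \<and>\<^sub>w \<iota> (k, False) \<omega> + \<sigma>' \<and>\<^sub>w \<iota> (k, True) \<omega>" (is ?delbar)
proof -
  have w: "\<omega> \<in> forms A n" by (rule const_form_forms[OF assms])
  have kk: "k \<in> {1..k}" using k by simp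
  have dT: "d (T p q \<omega>) = B \<and>\<^sub>w T (p - 1) q (\<iota> (k, False) \<omega>) + B' \<and>\<^sub>w T p (q - 1) (\<iota> (k, True) \<omega>)" for p q
    by (simp add: ext_d_const_form[OF const_form_bicomponent[OF assms]] contr_bicomponent_Z[OF w kk])
  show ?del ?delbar
  proof (atomize (full), cases n)
    case 0
    then have z: "contr X \<omega> = 0" for X using contr_Z_zero w by simp
    have "del A J \<omega> = 0" "delbar A J \<omega> = 0"
      unfolding del_eq[OF w] dT z by (simp_all add: bicomponent_zero)
    then show "?del \<and> ?delbar" by (simp add: z)
  next
    case (Suc m)
    then have w': "\<omega> \<in> forms A (Suc m)" using w by simp
    let ?r = "\<iota> (k, False) \<omega>" and ?r' = "\<iota> (k, True) \<omega>"
    have r: "?r \<in> forms A m" "?r' \<in> forms A m"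
      by (intro contr_forms[OF w'] Z_VF k_idx)+
    have t1: "T (p + 1) q (d (T p q \<omega>)) = \<sigma> \<and>\<^sub>w T (p - 1) q ?r + \<tau>' \<and>\<^sub>w T p (q - 1) ?r'" for p q
      unfolding dT by (subst B_split, subst B'_split)
        (simp add: wedge_add_left bicomponent_add bicomponent_wedge[OF B_forms r(1)] bicomponent_wedge[OF B'_forms r(2)])
    have t2: "T p (q + 1) (d (T p q \<omega>)) = \<tau> \<and>\<^sub>w T (p - 1) q ?r + \<sigma>' \<and>\<^sub>w T p (q - 1) ?r'" for p q
      unfolding dT by (subst B_split, subst B'_split)
        (simp add: wedge_add_left bicomponent_add bicomponent_wedge[OF B_forms r(1)] bicomponent_wedge[OF B'_forms r(2)])
    \<comment> \<open>The contraction lowers p, so the summand p = 0 has first index -1 and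
      vanishes; the remaining ones form the full type decomposition.\<close>
    have s1: "(\<Sum>p<Suc n. T (int p - 1) (int n - int p) ?r) = ?r"
    proof -
      have "(\<Sum>p<Suc (Suc m). T (int p - 1) (int n - int p) ?r) =
          T (- 1) (int n) ?r + (\<Sum>p<Suc m. T (int p) (int m - int p) ?r)"
        unfolding sum.lessThan_Suc_shift[of _ "Suc m"] by (simp add: Suc del: sum.lessThan_Suc)
      then show ?thesis
        unfolding Suc bicomponent_sum[OF r(1) order_refl] by (simp add: bicomponent_neg)
    qed
    \<comment> \<open>Here q is lowered, and it is the last summand that is surplus: its second
      index is -1.\<close>
    have s2: "(\<Sum>p<Suc n. T (int p) (int n - int p - 1) ?r') = ?r'"
      using bicomponent_sum[OF r(2), of n] by (simp add: Suc diff_diff_eq add.commute del: sum.lessThan_Suc)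
    show "?del \<and> ?delbar"
      unfolding del_eq[OF w] t1 t2 sum.distrib wedge_sum_right[symmetric] s1 s2 by blast
  qed
qed

lemma const_form_delbar: "const_form n \<omega> \<Longrightarrow> const_form (Suc n) (delbar A J \<omega>)"
proof (cases n)
  case 0
  assume w: "const_form n \<omega>"
  then have "contr X \<omega> = 0" for X using contr_Z_zero const_form_forms 0 by blast
  then show ?thesis using del_const_form[OF w] by (simp add: const_form_intros)
next
  case (Suc m)
  assume w: "const_form n \<omega>"
  then have c: "const_form m (\<iota> (k, e) \<omega>)" for e using const_form_contr[of m \<omega>] k_idx Suc by simp
  show ?thesis
    using const_form_wedge[OF type_forms(2) c] const_form_wedge[OF type_forms(4) c]
    by (simp add: del_const_form[OF w] const_form_intros Suc)
qed

text \<open>Since \<open>d \<eta>\<^sup>k\<close> does not involve \<open>\<eta>\<^sup>k\<close>, the operator \<open>\<partial>\<partial>\<close>-bar is the contraction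
  with the two central directions followed by the product with a fixed (2,2)-form.\<close>

theorem del_delbar_const_form:
  assumes "const_form n \<omega>"
  shows "del A J (delbar A J \<omega>) = \<Psi> \<and>\<^sub>w \<iota> (k, True) (\<iota> (k, False) \<omega>)"
proof -
  have w: "\<omega> \<in> forms A n" by (rule const_form_forms[OF assms])
  have zk: "Z (k, e) \<in> VF" for e by (rule Z_VF[OF k_idx])
  have f2: "\<tau> \<in> forms A 2" "\<sigma>' \<in> forms A 2" using type_forms const_form_forms by blast+
  let ?\<phi> = "\<iota> (k, True) (\<iota> (k, False) \<omega>)"
  have "del A J (delbar A J \<omega>) = \<sigma> \<and>\<^sub>w \<iota> (k, False) (delbar A J \<omega>) + \<tau>' \<and>\<^sub>w \<iota> (k, True) (delbar A J \<omega>)"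
    by (rule del_const_form[OF const_form_delbar[OF assms]])
  also have "\<iota> (k, False) (delbar A J \<omega>) = - (\<sigma>' \<and>\<^sub>w ?\<phi>)"
    unfolding del_const_form[OF assms] contr_add contr_wedge contr_types grade_sign_2[OF f2(1)] grade_sign_2[OF f2(2)]
      contr_anyform(1)[OF w zk] contr_anticomm[OF w zk[of False] zk[of True]]
    by (simp add: wedge_uminus_right)
  also have "\<iota> (k, True) (delbar A J \<omega>) = \<tau> \<and>\<^sub>w ?\<phi>"
    unfolding del_const_form[OF assms] contr_add contr_wedge contr_types grade_sign_2[OF f2(1)] grade_sign_2[OF f2(2)]
      contr_anyform(1)[OF w zk]
    by simp
  finally show ?thesis
    unfolding wedge_diff_left wedge_assoc wedge_uminus_right by (simp only: diff_conv_add_uminus add.commute)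
qed

lemma \<Psi>_const_form: "const_form 4 \<Psi>"
  using const_form_intros(3)[OF const_form_wedge[OF type_forms(3,2)] const_form_wedge[OF type_forms(1,4)]] by simp

lemma contr_\<Psi>: "contr (Z (k, e)) \<Psi> = 0"
  using type_forms[THEN const_form_forms]
  by (simp add: contr_wedge contr_types grade_sign_2)

text \<open>Conjugation exchanges the two factors in each of the two products, and 2-forms commute.
  Through this, vanishing on a flipped index set is transferred to the index set itself.\<close>

lemma form_conj_\<Psi>: "form_conj \<Psi> = \<Psi>"
proof -
  note f = type_forms[THEN const_form_forms, THEN grade_sign_form]
  have "\<tau> \<and>\<^sub>w \<tau>' = \<tau>' \<and>\<^sub>w \<tau>" "\<sigma>' \<and>\<^sub>w \<sigma> = \<sigma> \<and>\<^sub>w \<sigma>'"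
    using wedge_commute_sign[OF f(2) f(3)] wedge_commute_sign[OF f(4) f(1)] by (simp_all add: cscale_def)
  then show ?thesis by (simp add: form_conj_diff form_conj_wedge \<sigma>'_conj \<tau>'_conj)
qed

lemma del_delbar_\<eta>kk: "del A J (delbar A J (E (k, False) \<and>\<^sub>w E (k, True))) = \<Psi>"
proof -
  have c: "const_form (1 + 1) (E (k, False) \<and>\<^sub>w E (k, True))"
    by (intro const_form_wedge const_form_E k_idx)
  have "\<iota> (k, True) (\<iota> (k, False) (E (k, False) \<and>\<^sub>w E (k, True))) = form_one"
    using E_forms[OF k_idx] by (simp add: contr_wedge contr_E[OF k_idx k_idx] grade_sign_1 contr_Z_zero[OF form_one_forms])
  then show ?thesis unfolding del_delbar_const_form[OF c] by simp
qed

end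

section \<open>Harmonic monomials\<close>

text \<open>The one shuffle left over keeps the order of the list, so it has no inversions and sign
  1.\<close>

lemma wedge_single:
  assumes "\<And>S. S \<subseteq> {..<length Xs} \<Longrightarrow> S \<noteq> {..<m} \<Longrightarrow> \<omega> (nths Xs S) = 0 \<or> \<theta> (nths Xs (- S)) = 0"
    and "m \<le> length Xs"
  shows "(\<omega> \<and>\<^sub>w \<theta>) Xs = \<omega> (take m Xs) * \<theta> (drop m Xs)"
proof -
  let ?F = "\<lambda>S. (- 1) ^ card (inversions S) * \<omega> (nths Xs S) * \<theta> (nths Xs (- S))"
  have m: "{..<m} \<in> Pow {..<length Xs}" using assms(2) by auto
  have "?F S = 0" if "S \<in> Pow {..<length Xs} - {{..<m}}" for S
  proof -
    have "\<omega> (nths Xs S) = 0 \<or> \<theta> (nths Xs (- S)) = 0" using that by (intro assms(1)) auto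
    then show ?thesis by (elim disjE) (simp_all only: mult_zero_left mult_zero_right)
  qed
  then have z: "sum ?F (Pow {..<length Xs} - {{..<m}}) = 0" by (rule sum.neutral[OF ballI])
  have "sum ?F (Pow {..<length Xs}) = ?F {..<m} + sum ?F (Pow {..<length Xs} - {{..<m}})"
    by (rule sum.remove[OF _ m]) simp
  then have "(\<omega> \<and>\<^sub>w \<theta>) Xs = ?F {..<m}" unfolding wedge_def z by simp
  moreover have "inversions {..<m} = {}" by auto
  moreover have "nths Xs (- {..<m}) = drop m Xs"
  proof -
    have "- {..<m} = {i. m \<le> i}" by auto
    then show ?thesis by (simp only: drop_eq_nths)
  qed
  ultimately show ?thesis by (simp only: nths_upt_eq_take card.empty power_0 mult_1)
qed

lemma nths_eq_appendD:
  assumes "distinct (us @ vs)" "S \<subseteq> {..<length (us @ vs)}"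
    and "set (nths (us @ vs) S) = set us \<or> set (nths (us @ vs) (- S)) = set vs"
  shows "S = {..<length us}"
proof -
  let ?xs = "us @ vs"
  have d: "set us \<inter> set vs = {}" using assms(1) by simp
  have mem: "i \<in> S \<longleftrightarrow> ?xs ! i \<in> set (nths ?xs S)" "i \<notin> S \<longleftrightarrow> ?xs ! i \<in> set (nths ?xs (- S))"
    if "i < length ?xs" for i
    using that assms(1) by (auto simp: set_nths nth_eq_iff_index_eq simp del: length_append nth_append)
  have us: "i < length us \<longleftrightarrow> ?xs ! i \<in> set us" and vs: "\<not> i < length us \<longleftrightarrow> ?xs ! i \<in> set vs"
    if "i < length ?xs" for i
    using that d by (auto simp: nth_append) (meson disjoint_iff nth_mem)+
  have "i \<in> S \<longleftrightarrow> i < length us" if "i < length ?xs" for i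
    using assms(3) mem[OF that] us[OF that] vs[OF that] by blast
  then show ?thesis using assms(2) by (force simp: subset_iff)
qed

section \<open>Monomials in the coframe and the volume form\<close>

context frame
begin

abbreviation "frame_monomial bs \<equiv> wedge_list (map E bs)"

lemma frame_monomial_forms: "set bs \<subseteq> idx \<Longrightarrow> frame_monomial bs \<in> forms A (length bs)"
  by (rule const_form_forms[OF const_form_wedge_list])

lemma E_support:
  assumes "b \<in> idx" "set cs \<subseteq> idx" "E b (map Z cs) \<noteq> 0"
  shows "cs = [b]"
proof -
  have "length cs = 1" using form_outside[OF E_forms[OF assms(1)], of "map Z cs"] assms(3) by auto
  then obtain c where "cs = [c]" by (auto simp: length_Suc_conv)
  then show ?thesis using assms E_Z[OF assms(1), of c] by (auto split: if_splits)
qed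

lemma set_nths_idx: "set bs \<subseteq> idx \<Longrightarrow> set (nths bs S) \<subseteq> idx"
  using set_nths_subset[of bs S] by (rule order_trans)

lemma frame_monomial_support:
  assumes "set bs \<subseteq> idx" "set cs \<subseteq> idx" "frame_monomial bs (map Z cs) \<noteq> 0"
  shows "mset cs = mset bs"
  using assms
proof (induction bs arbitrary: cs)
  case Nil
  then show ?case by (auto simp: wedge_list_Nil form_one_def split: if_splits)
next
  case (Cons b bs)
  then have "(E b \<and>\<^sub>w frame_monomial bs) (map Z cs) \<noteq> 0" by (simp add: wedge_list_Cons)
  then obtain S where S: "E b (nths (map Z cs) S) \<noteq> 0" "frame_monomial bs (nths (map Z cs) (- S)) \<noteq> 0"
    by (rule wedge_nonzeroE)
  have "nths cs S = [b]"
    using S(1) Cons.prems by (intro E_support set_nths_idx) (simp_all add: nths_map)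
  moreover have "mset (nths cs (- S)) = mset bs"
    using S(2) Cons.prems by (intro Cons.IH set_nths_idx) (simp_all add: nths_map)
  ultimately show ?case using mset_nths_split[of cs S] by simp
qed

lemma E_wedge_avoid:
  assumes "b \<in> idx" "set cs \<subseteq> idx" "b \<notin> set cs"
  shows "(E b \<and>\<^sub>w \<rho>) (map Z cs) = 0"
proof (rule ccontr)
  assume "(E b \<and>\<^sub>w \<rho>) (map Z cs) \<noteq> 0"
  then obtain S where "E b (nths (map Z cs) S) \<noteq> 0" by (rule wedge_nonzeroE)
  then have "nths cs S = [b]"
    using assms by (intro E_support set_nths_idx) (simp_all add: nths_map)
  then show False using set_nths_subset[of cs S] assms(3) by simp
qed

text \<open>Contracting with the first index turns its coframe factor into 1. The other term of the
  antiderivation law still contains that factor, but the index does not occur among the remaining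
  arguments, which kills the term.\<close>

lemma frame_monomial_wedge_append:
  assumes "set bs \<subseteq> idx" "set cs \<subseteq> idx" "distinct bs" "set bs \<inter> set cs = {}"
  shows "(frame_monomial bs \<and>\<^sub>w \<theta>) (map Z (bs @ cs)) = \<theta> (map Z cs)"
  using assms
proof (induction bs)
  case Nil then show ?case by (simp add: wedge_list_Nil)
next
  case (Cons b bs)
  have b: "b \<in> idx" and bs: "set (bs @ cs) \<subseteq> idx" "b \<notin> set (bs @ cs)" using Cons.prems by auto
  have gE: "grade_sign (E b) = - E b" using grade_sign_1 E_forms[OF b] by simp
  have "(frame_monomial (b # bs) \<and>\<^sub>w \<theta>) (map Z ((b # bs) @ cs)) = \<iota> b (E b \<and>\<^sub>w (frame_monomial bs \<and>\<^sub>w \<theta>)) (map Z (bs @ cs))"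
    by (simp add: wedge_list_Cons wedge_assoc contr_def)
  also have "\<dots> = (frame_monomial bs \<and>\<^sub>w \<theta>) (map Z (bs @ cs)) - (E b \<and>\<^sub>w \<iota> b (frame_monomial bs \<and>\<^sub>w \<theta>)) (map Z (bs @ cs))"
    unfolding contr_wedge[of "Z b" "E b"] contr_E[OF b b] gE
    by (simp only: if_True simp_thms form_one_wedge wedge_uminus_left plus_fun_apply uminus_apply diff_conv_add_uminus)
  also have "(E b \<and>\<^sub>w \<iota> b (frame_monomial bs \<and>\<^sub>w \<theta>)) (map Z (bs @ cs)) = 0"
    by (rule E_wedge_avoid[OF b bs])
  finally show ?case using Cons by simp
qed

lemma frame_monomial_self: "set bs \<subseteq> idx \<Longrightarrow> distinct bs \<Longrightarrow> frame_monomial bs (map Z bs) = 1"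
proof -
  assume bs: "set bs \<subseteq> idx" "distinct bs"
  have "frame_monomial bs (map Z bs) = (form_one :: 'm form) []"
    using frame_monomial_wedge_append[OF bs(1) _ bs(2), of "[]" form_one] by simp
  then show ?thesis by (simp add: form_one_def)
qed

lemma form_Z_distinct:
  assumes "\<omega> \<in> forms A n" "\<omega> (map Z cs) \<noteq> 0" shows "distinct cs"
  using form_not_distinct[OF assms(1), of "map Z cs"] assms(2) by (auto simp: distinct_map)

lemma form_Z_length: "\<omega> \<in> forms A n \<Longrightarrow> \<omega> (map Z cs) \<noteq> 0 \<Longrightarrow> length cs = n"
  using form_outside[of \<omega> n "map Z cs"] by auto

lemma frame_monomial_nonzero:
  assumes "set bs \<subseteq> idx" shows "frame_monomial bs \<noteq> 0 \<longleftrightarrow> distinct bs"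
proof
  assume "frame_monomial bs \<noteq> 0"
  then obtain cs where cs: "set cs \<subseteq> idx" "frame_monomial bs (map Z cs) \<noteq> 0"
    using forms_nonzeroE[OF frame_monomial_forms[OF assms]] by metis
  have "distinct cs" using form_Z_distinct[OF frame_monomial_forms[OF assms] cs(2)] .
  moreover have "mset cs = mset bs" using frame_monomial_support assms cs by blast
  ultimately show "distinct bs" by (metis mset_eq_imp_distinct_iff)
next
  assume "distinct bs"
  then have "frame_monomial bs (map Z bs) = 1" by (rule frame_monomial_self[OF assms])
  then show "frame_monomial bs \<noteq> 0" by auto
qed

text \<open>The support of \<theta> is tested only on index lists inside \<open>us @ vs\<close>;
  this suffices for a single shuffle to remain, and it is what is known about the star of a
  monomial.\<close>

lemma wedge_append_right:
  assumes "set (us @ vs) \<subseteq> idx" "distinct (us @ vs)"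
    and "\<And>ws. set ws \<subseteq> set (us @ vs) \<Longrightarrow> \<theta> (map Z ws) \<noteq> 0 \<Longrightarrow> set ws = set vs"
  shows "(\<omega> \<and>\<^sub>w \<theta>) (map Z (us @ vs)) = \<omega> (map Z us) * \<theta> (map Z vs)"
proof -
  have "(\<omega> \<and>\<^sub>w \<theta>) (map Z (us @ vs)) = \<omega> (take (length us) (map Z (us @ vs))) * \<theta> (drop (length us) (map Z (us @ vs)))"
  proof (rule wedge_single)
    fix S assume S: "S \<subseteq> {..<length (map Z (us @ vs))}" "S \<noteq> {..<length us}"
    show "\<omega> (nths (map Z (us @ vs)) S) = 0 \<or> \<theta> (nths (map Z (us @ vs)) (- S)) = 0"
    proof (rule ccontr)
      assume "\<not> ?thesis"
      then have "\<theta> (map Z (nths (us @ vs) (- S))) \<noteq> 0" by (simp only: nths_map de_Morgan_disj simp_thms)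
      then have "set (nths (us @ vs) (- S)) = set vs" by (intro assms(3) set_nths_subset)
      then have "S = {..<length us}" using nths_eq_appendD[OF assms(2)] S(1) by simp
      then show False using S(2) by simp
    qed
  qed simp
  then show ?thesis by simp
qed

abbreviation "flip \<equiv> map (apsnd Not) :: (nat \<times> bool) list \<Rightarrow> _"

lemma flip_flip [simp]: "flip (flip bs) = bs"
  by (induction bs) (auto simp: apsnd_def)

lemma distinct_flip [simp]: "distinct (flip bs) = distinct bs"
  by (simp add: distinct_map inj_on_def apsnd_def prod_eq_iff)

section \<open>The fundamental form and its powers\<close>

definition "\<omega>\<^sub>0 = fundamental_form k (\<lambda>j. E (j, False))"

lemma \<omega>\<^sub>0_eq: "\<omega>\<^sub>0 = cscale (\<i> / 2) (\<Sum>j=1..k. E (j, False) \<and>\<^sub>w E (j, True))"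
  unfolding \<omega>\<^sub>0_def fundamental_form_def
  by (rule arg_cong[where f = "cscale (\<i> / 2)"], rule sum.cong) (use conj_E[of _ False] in auto)

lemma const_form_sum: "(\<And>i. i \<in> S \<Longrightarrow> const_form n (f i)) \<Longrightarrow> const_form n (sum f S)"
proof (induction S rule: infinite_finite_induct)
  case (insert i S)
  show ?case unfolding sum.insert[OF insert.hyps] by (intro const_form_intros insert.IH insert.prems) auto
qed (simp_all only: sum.infinite sum.empty const_form_intros not_False_eq_True)

lemma const_form_\<omega>\<^sub>0: "const_form 2 \<omega>\<^sub>0"
proof -
  have "const_form (1 + 1) (E (j, False) \<and>\<^sub>w E (j, True))" if "j \<in> {1..k}" for j
    by (intro const_form_wedge const_form_E) (use that in auto)
  then show ?thesis unfolding \<omega>\<^sub>0_eq by (intro const_form_intros const_form_sum) (simp add: numeral_2_eq_2)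
qed

lemma contr_sum: "contr X (sum f S) = (\<Sum>i\<in>S. contr X (f i))"
proof (induction S rule: infinite_finite_induct)
  case (insert i S)
  show ?case unfolding sum.insert[OF insert.hyps] contr_add insert.IH ..
qed (simp_all only: sum.infinite sum.empty contr_zero not_False_eq_True)

lemma contr_\<omega>\<^sub>0:
  assumes "j \<in> {1..k}"
  shows "\<iota> (j, False) \<omega>\<^sub>0 = cscale (\<i> / 2) (E (j, True))" "\<iota> (j, True) \<omega>\<^sub>0 = cscale (- \<i> / 2) (E (j, False))"
proof -
  have c: "\<iota> (j, e) (E (l, False) \<and>\<^sub>w E (l, True)) = (if l = j then (if e then - E (j, False) else E (j, True)) else 0)"
    if "l \<in> {1..k}" for l e
  proof -
    have l: "(l, f) \<in> idx" and j: "(j, f) \<in> idx" for f using that assms by auto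
    have g: "grade_sign (E (l, False)) = - E (l, False)" using grade_sign_1 E_forms[OF l] by simp
    show ?thesis
      unfolding contr_wedge contr_E[OF j l] g by (cases e; cases "l = j") (simp_all add: wedge_uminus_left)
  qed
  have *: "\<iota> (j, e) (\<Sum>l=1..k. E (l, False) \<and>\<^sub>w E (l, True)) = (if e then - E (j, False) else E (j, True))" for e
  proof -
    have "\<iota> (j, e) (\<Sum>l=1..k. E (l, False) \<and>\<^sub>w E (l, True)) =
        (\<Sum>l=1..k. if l = j then (if e then - E (j, False) else E (j, True)) else 0)"
      unfolding contr_sum by (rule sum.cong[OF refl c])
    also have "\<dots> = (if e then - E (j, False) else E (j, True))"
      using assms by (subst sum.delta) auto
    finally show ?thesis .
  qed
  show "\<iota> (j, False) \<omega>\<^sub>0 = cscale (\<i> / 2) (E (j, True))" "\<iota> (j, True) \<omega>\<^sub>0 = cscale (- \<i> / 2) (E (j, False))"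
    unfolding \<omega>\<^sub>0_eq contr_cscale * by (auto simp: cscale_def fun_eq_iff)
qed

lemma const_form_power: "const_form (2 * m) (wedge_list (replicate m \<omega>\<^sub>0))"
proof (induction m)
  case (Suc m)
  then show ?case using const_form_wedge[OF const_form_\<omega>\<^sub>0 Suc] by (simp add: wedge_list_Cons)
qed (simp add: wedge_list_Nil const_form_one)

lemma grade_sign_cscale: "grade_sign (cscale c \<omega>) = cscale c (grade_sign \<omega>)"
  by (intro ext) (simp add: grade_sign_def cscale_def)

text \<open>Contracting a power of the fundamental form with the j-th direction and its conjugate
  produces \<i>/2 times the next lower power, once per factor, and terms that still contain a
  coframe form of index j; the latter vanish since j does not occur in \<open>vs\<close>.\<close>

lemma contr_power:
  assumes j: "j \<in> {1..k}" and vs: "set vs \<subseteq> idx" "(j, False) \<notin> set vs" "(j, True) \<notin> set vs"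
  shows "wedge_list (replicate m \<omega>\<^sub>0) (map Z ((j, False) # (j, True) # vs)) =
    (\<lambda>x. of_nat m * (\<i> / 2) * wedge_list (replicate (m - 1) \<omega>\<^sub>0) (map Z vs) x)"
  using vs
proof (induction m arbitrary: vs)
  case 0
  then show ?case by (simp add: wedge_list_Nil form_one_def)
next
  case (Suc m)
  let ?P = "wedge_list (replicate m \<omega>\<^sub>0)"
  let ?b = "(j, False)" and ?b' = "(j, True)"
  have b: "?b \<in> idx" "?b' \<in> idx" using j by auto
  have g: "grade_sign \<omega>\<^sub>0 = \<omega>\<^sub>0" by (rule grade_sign_2[OF const_form_forms[OF const_form_\<omega>\<^sub>0]])
  have gE: "grade_sign (E b) = - E b" if "b \<in> idx" for b using grade_sign_1 E_forms[OF that] by simp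
  have "wedge_list (replicate (Suc m) \<omega>\<^sub>0) (map Z (?b # ?b' # vs)) = \<iota> ?b' (\<iota> ?b (\<omega>\<^sub>0 \<and>\<^sub>w ?P)) (map Z vs)"
    by (simp add: wedge_list_Cons contr_def)
  also have "\<iota> ?b' (\<iota> ?b (\<omega>\<^sub>0 \<and>\<^sub>w ?P)) = cscale (\<i> / 2) ?P + \<omega>\<^sub>0 \<and>\<^sub>w \<iota> ?b' (\<iota> ?b ?P)
      - cscale (\<i> / 2) (E ?b' \<and>\<^sub>w \<iota> ?b' ?P) + cscale (- \<i> / 2) (E ?b \<and>\<^sub>w \<iota> ?b ?P)"
  proof -
    have "\<iota> ?b' (E ?b') = form_one" by (simp only: contr_E[OF b(2) b(2)] if_True simp_thms)
    moreover have "grade_sign (cscale (\<i> / 2) (E ?b')) = - cscale (\<i> / 2) (E ?b')"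
      unfolding grade_sign_cscale gE[OF b(2)] by (simp add: cscale_def fun_eq_iff)
    ultimately show ?thesis
      unfolding contr_wedge contr_add g contr_\<omega>\<^sub>0[OF j] contr_cscale
      by (simp only: wedge_cscale_left form_one_wedge wedge_uminus_left diff_conv_add_uminus add_ac)
  qed
  also have "\<dots> (map Z vs) = cscale (\<i> / 2) ?P (map Z vs) + (\<omega>\<^sub>0 \<and>\<^sub>w \<iota> ?b' (\<iota> ?b ?P)) (map Z vs)"
    using E_wedge_avoid[OF b(1) Suc.prems(1,2)] E_wedge_avoid[OF b(2) Suc.prems(1,3)]
    by (simp add: cscale_def fun_eq_iff)
  \<comment> \<open>The induction hypothesis concerns values on lists without the index j, not
    forms, so it is applied inside the shuffle sum, to sublists of \<open>vs\<close>.\<close>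
  also have "(\<omega>\<^sub>0 \<and>\<^sub>w \<iota> ?b' (\<iota> ?b ?P)) (map Z vs) =
      (\<omega>\<^sub>0 \<and>\<^sub>w cscale (of_nat m * (\<i> / 2)) (wedge_list (replicate (m - 1) \<omega>\<^sub>0))) (map Z vs)"
    unfolding wedge_def
  proof (rule sum.cong[OF refl])
    fix S assume "S \<in> Pow {..<length (map Z vs)}"
    have ws: "set (nths vs (- S)) \<subseteq> set vs" by (rule set_nths_subset)
    have "\<iota> ?b' (\<iota> ?b ?P) (map Z (nths vs (- S))) = ?P (map Z (?b # ?b' # nths vs (- S)))"
      by (simp add: contr_def)
    also have "\<dots> = (\<lambda>x. of_nat m * (\<i> / 2) * wedge_list (replicate (m - 1) \<omega>\<^sub>0) (map Z (nths vs (- S))) x)"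
      by (rule Suc.IH) (use ws Suc.prems in auto)
    finally show "(- 1) ^ card (inversions S) * \<omega>\<^sub>0 (nths (map Z vs) S) * \<iota> ?b' (\<iota> ?b ?P) (nths (map Z vs) (- S)) =
       (- 1) ^ card (inversions S) * \<omega>\<^sub>0 (nths (map Z vs) S) *
         cscale (of_nat m * (\<i> / 2)) (wedge_list (replicate (m - 1) \<omega>\<^sub>0)) (nths (map Z vs) (- S))"
      by (simp only: nths_map cscale_def)
  qed
  \<comment> \<open>For m = 0 the exponent m - 1 is truncated to 0, but then the scalar factor is
    0.\<close>
  also have "\<dots> = cscale (of_nat m * (\<i> / 2)) ?P (map Z vs)"
    unfolding wedge_cscale_right by (cases m) (simp_all add: wedge_list_Cons cscale_def)
  finally show ?case by (simp add: cscale_def fun_eq_iff algebra_simps)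
qed

text \<open>With each direction next to its conjugate, every pair contributes a nonzero factor by
  \<open>contr_power\<close>. Any other order of the frame is a permutation of this one, and
  vanishing is invariant under permutations.\<close>

lemma volume_nonzero:
  assumes F: "distinct F" "set F = idx"
  shows "volume_form k \<omega>\<^sub>0 (map Z F) \<noteq> 0"
proof -
  let ?pairs = "\<lambda>js. concat (map (\<lambda>j. [(j, False), (j, True)]) js)"
  have P: "wedge_list (replicate (length js) \<omega>\<^sub>0) (map Z (?pairs js)) \<noteq> 0"
    if "distinct js" "set js \<subseteq> {1..k}" for js
    using that
  proof (induction js)
    case Nil
    then show ?case by (simp add: wedge_list_Nil form_one_def fun_eq_iff)
  next
    case (Cons j js)
    have "wedge_list (replicate (length (j # js)) \<omega>\<^sub>0) (map Z (?pairs (j # js))) =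
      (\<lambda>x. of_nat (length (j # js)) * (\<i> / 2) * wedge_list (replicate (length (j # js) - 1) \<omega>\<^sub>0) (map Z (?pairs js)) x)"
      using contr_power[of j "?pairs js" "length (j # js)"] Cons.prems by auto
    moreover obtain x where "wedge_list (replicate (length js) \<omega>\<^sub>0) (map Z (?pairs js)) x \<noteq> 0"
      using Cons by (auto simp: fun_eq_iff)
    moreover have "complex_of_nat (length (j # js)) \<noteq> 0" by (simp only: of_nat_eq_0_iff) simp
    ultimately have "wedge_list (replicate (length (j # js)) \<omega>\<^sub>0) (map Z (?pairs (j # js))) x \<noteq> 0"
      by (simp del: of_nat_Suc)
    then show ?case by (metis zero_fun_apply)
  qed
  let ?js = "[1..<Suc k]"
  have js: "distinct ?js" "set ?js \<subseteq> {1..k}" "length ?js = k" by auto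
  have dp: "distinct (?pairs js)" if "distinct js" for js using that by (induction js) auto
  have sp: "set (?pairs js) = set js \<times> UNIV" for js :: "nat list" by (induction js) (auto simp: UNIV_bool)
  have "set (?pairs ?js) = idx" unfolding sp set_upt atLeastLessThanSuc_atLeastAtMost ..
  then have m: "mset F = mset (?pairs ?js)"
    using F set_eq_iff_mset_eq_distinct[OF F(1) dp[OF js(1)]] by simp
  have v: "volume_form k \<omega>\<^sub>0 \<in> forms A (2 * k)"
    unfolding volume_form_def by (intro cscale_forms const_form_forms[OF const_form_power])
  have "volume_form k \<omega>\<^sub>0 (map Z (?pairs ?js)) \<noteq> 0"
    using P[OF js(1,2)] unfolding volume_form_def js(3) by (auto simp: cscale_def fun_eq_iff)
  moreover have "set (map Z F) \<subseteq> VF" using F(2) by (intro map_Z_VF) simp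
  moreover have "mset (map Z F) = mset (map Z (?pairs ?js))" using m by (simp only: mset_map)
  ultimately show ?thesis using form_perm[OF v] by blast
qed

end

text \<open>The map \<open>flat\<close> feeds \<open>J Y\<close> into the fundamental form for an
  arbitrary field Y, so the action of J enters here on the side of the coframe.\<close>

locale hermitian_frame = frame A J k E Z for A :: "('m \<Rightarrow> complex) set" and J k E Z +
  assumes E_J: "X \<in> vector_fields A \<Longrightarrow> j \<in> {1..k} \<Longrightarrow>
    E (j, e) [J X] = (\<lambda>x. (if e then - \<i> else \<i>) * E (j, e) [X] x)"
begin

text \<open>The metric pairs each frame field with its conjugate. The constant is the product of
  \<plusminus>\<i>/2 from the contracted fundamental form with the opposite factor \<minusplus>\<i>
  from J, that is 1/2 in both cases.\<close>

lemma flat_Z: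
  assumes j: "j \<in> {1..k}"
  shows "flat A J \<omega>\<^sub>0 (Z (j, e)) = cscale (1 / 2) (E (j, \<not> e))"
proof
  fix Ys
  have idx: "(j, \<not> e) \<in> idx" using j by auto
  show "flat A J \<omega>\<^sub>0 (Z (j, e)) Ys = cscale (1 / 2) (E (j, \<not> e)) Ys"
  proof (cases "length Ys = 1 \<and> set Ys \<subseteq> VF")
    case True
    then obtain Y where Y: "Ys = [Y]" "Y \<in> VF" by (auto simp: length_Suc_conv)
    have "flat A J \<omega>\<^sub>0 (Z (j, e)) Ys = contr (Z (j, e)) \<omega>\<^sub>0 [J Y]"
      using True Y by (simp add: flat_def metric_def contr_def)
    also have "\<dots> = cscale (1 / 2) (E (j, \<not> e)) Ys"
      using E_J[OF Y(2) j] contr_\<omega>\<^sub>0[OF j] by (cases e) (simp_all add: cscale_def Y(1) fun_eq_iff)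
    finally show ?thesis .
  next
    case False
    then have "E (j, \<not> e) Ys = 0" using form_outside[OF E_forms[OF idx], of Ys] by auto
    then show ?thesis using False by (auto simp: flat_def cscale_def)
  qed
qed

lemma wedge_list_flat:
  "set cs \<subseteq> idx \<Longrightarrow>
    wedge_list (map (flat A J \<omega>\<^sub>0) (map Z cs)) = cscale ((1 / 2) ^ length cs) (frame_monomial (flip cs))"
proof (induction cs)
  case Nil
  then show ?case by (simp add: wedge_list_Nil cscale_def)
next
  case (Cons c cs)
  obtain j e where c: "c = (j, e)" "j \<in> {1..k}" using Cons.prems by (cases c) auto
  have IH: "wedge_list (map (flat A J \<omega>\<^sub>0) (map Z cs)) = cscale ((1 / 2) ^ length cs) (frame_monomial (flip cs))"
    by (rule Cons.IH) (use Cons.prems in auto)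
  have "wedge_list (map (flat A J \<omega>\<^sub>0) (map Z (c # cs))) =
      cscale (1 / 2) (E (j, \<not> e)) \<and>\<^sub>w cscale ((1 / 2) ^ length cs) (frame_monomial (flip cs))"
    by (simp only: list.map c(1) flat_Z[OF c(2)] wedge_list_Cons IH)
  also have "\<dots> = cscale ((1 / 2) ^ length (c # cs)) (frame_monomial (flip (c # cs)))"
    by (simp only: wedge_cscale_left wedge_cscale_right list.map c(1) wedge_list_Cons apsnd_conv)
      (simp add: cscale_def fun_eq_iff)
  finally show ?case .
qed

context
  fixes bs :: "(nat \<times> bool) list" and \<theta> :: "'m form"
  assumes bs: "set bs \<subseteq> idx" "distinct bs"
    and star: "is_hodge_star A J k \<omega>\<^sub>0 (length bs) (frame_monomial bs) \<theta>"
begin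

lemma \<theta>_forms: "\<theta> \<in> forms A (2 * k - length bs)"
  using star by (simp add: is_hodge_star_def)

lemma card_idx: "card idx = 2 * k"
  by (simp add: card_cartesian_product)

lemma length_bs: "length bs \<le> 2 * k"
  using card_mono[OF finite_idx bs(1)] distinct_card[OF bs(2)] card_idx by simp

text \<open>Test the identity that defines the star on the fields of \<open>flip D\<close> and
  evaluate at \<open>D @ C\<close>: \<open>flat\<close> turns \<open>flip D\<close> into the
  monomial of D, which consumes the first block and leaves \<theta> on C. As the volume form is
  nonzero on frames, this determines \<theta>.\<close>

lemma \<theta>_value:
  assumes C: "set C \<subseteq> idx" "distinct C" and D: "distinct D" "set D = idx - set C" "length D = length bs"
  shows "(\<lambda>x. (1 / 2) ^ length bs * \<theta> (map Z C) x) =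
    frame_monomial bs (map Z (flip D)) * volume_form k \<omega>\<^sub>0 (map Z (D @ C))"
proof -
  have fD: "set (flip D) \<subseteq> idx" using D(2) by (intro flip_idx) auto
  have "(wedge_list (map (flat A J \<omega>\<^sub>0) (map Z (flip D))) \<and>\<^sub>w \<theta>) (map Z (D @ C)) =
      frame_monomial bs (map Z (flip D)) * volume_form k \<omega>\<^sub>0 (map Z (D @ C))"
    using star D(3) map_Z_VF[OF fD] unfolding is_hodge_star_def by (metis length_map)
  moreover have "(wedge_list (map (flat A J \<omega>\<^sub>0) (map Z (flip D))) \<and>\<^sub>w \<theta>) (map Z (D @ C)) =
      (\<lambda>x. (1 / 2) ^ length bs * \<theta> (map Z C) x)"
  proof -
    have "(frame_monomial D \<and>\<^sub>w \<theta>) (map Z (D @ C)) = \<theta> (map Z C)"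
      by (rule frame_monomial_wedge_append) (use C D in auto)
    then show ?thesis
      unfolding wedge_list_flat[OF fD] flip_flip wedge_cscale_left length_map D(3) by (simp only: cscale_def)
  qed
  ultimately show ?thesis by simp
qed

lemma complement_list:
  assumes "\<theta> (map Z C) \<noteq> 0" "set C \<subseteq> idx"
  obtains D where "distinct C" "distinct D" "set D = idx - set C" "length D = length bs"
proof -
  have dC: "distinct C" using form_Z_distinct[OF \<theta>_forms assms(1)] .
  have lC: "length C = 2 * k - length bs" using form_Z_length[OF \<theta>_forms assms(1)] .
  obtain D where D: "set D = idx - set C" "distinct D"
    using finite_distinct_list[of "idx - set C"] by auto
  have "length D = card idx - card (set C)"
    using D card_Diff_subset[of "set C" idx] assms(2) distinct_card[OF D(2)] by simp
  then have "length D = length bs" using distinct_card[OF dC] lC length_bs card_idx by simp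
  then show ?thesis using that dC D by blast
qed

text \<open>By \<open>\<theta>_value\<close> the monomial must be nonzero on \<open>flip D\<close>,
  where D lists the complement of C; then D is a rearrangement of \<open>flip bs\<close>.\<close>

lemma \<theta>_support:
  assumes "\<theta> (map Z C) \<noteq> 0" "set C \<subseteq> idx"
  shows "set C = idx - set (flip bs)"
proof -
  obtain D where D: "distinct C" "distinct D" "set D = idx - set C" "length D = length bs"
    using complement_list[OF assms] .
  have fD: "set (flip D) \<subseteq> idx" using D(3) by (intro flip_idx) auto
  have "frame_monomial bs (map Z (flip D)) \<noteq> 0"
  proof
    assume "frame_monomial bs (map Z (flip D)) = 0"
    then have "(\<lambda>x. (1 / 2) ^ length bs * \<theta> (map Z C) x) = 0"
      using \<theta>_value[OF assms(2) D] by (simp only: mult_zero_left)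
    then show False using assms(1) by (simp add: fun_eq_iff)
  qed
  then have "mset (flip D) = mset bs" by (intro frame_monomial_support bs fD)
  then have "set (flip (flip D)) = set (flip bs)" by (metis list.set_map set_mset_mset)
  then have "set D = set (flip bs)" by (simp only: flip_flip)
  then show ?thesis using D(3) assms(2) by auto
qed

lemma \<theta>_nonzero:
  assumes "distinct C" "set C = idx - set (flip bs)"
  shows "\<theta> (map Z C) \<noteq> 0"
proof
  assume z: "\<theta> (map Z C) = 0"
  have f: "set (flip bs) \<subseteq> idx" by (rule flip_idx[OF bs(1)])
  have D: "distinct (flip bs)" "set (flip bs) = idx - set C" "length (flip bs) = length bs" and C: "set C \<subseteq> idx"
    using assms bs(2) f by auto
  have "volume_form k \<omega>\<^sub>0 (map Z (flip bs @ C)) = 0"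
    using \<theta>_value[OF C assms(1) D] unfolding flip_flip frame_monomial_self[OF bs] z
    by (simp add: fun_eq_iff)
  moreover have "distinct (flip bs @ C)" "set (flip bs @ C) = idx" using assms D f by auto
  ultimately show False using volume_nonzero by blast
qed

text \<open>Harmonicity provides a star only as some smooth form satisfying the defining identity.
  Its invariance has to be derived before \<open>del_delbar_const_form\<close> applies, and comes
  from \<open>\<theta>_value\<close>.\<close>

lemma const_form_\<theta>: "const_form (2 * k - length bs) \<theta>"
  unfolding const_form_def
proof (intro conjI allI impI \<theta>_forms)
  fix C assume C: "set C \<subseteq> idx"
  show "const_fun (\<theta> (map Z C))"
  proof (cases "\<theta> (map Z C) = 0")
    case False
    obtain D where D: "distinct C" "distinct D" "set D = idx - set C" "length D = length bs"
      using complement_list[OF False C] .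
    have "set (flip D) \<subseteq> idx" "set (D @ C) \<subseteq> idx" using D(3) C by (auto intro: flip_idx[THEN subsetD])
    then have "const_fun (frame_monomial bs (map Z (flip D)))" "const_fun (volume_form k \<omega>\<^sub>0 (map Z (D @ C)))"
      using const_form_wedge_list[OF bs(1)] const_form_intros(5)[OF const_form_power[of k]]
      unfolding const_form_def volume_form_def by blast+
    then have "const_fun (\<lambda>x. (1 / 2) ^ length bs * \<theta> (map Z C) x)"
      unfolding \<theta>_value[OF C D] by (rule const_fun_intros)
    then obtain c where "(\<lambda>x. (1 / 2) ^ length bs * \<theta> (map Z C) x) = (\<lambda>_. c)" by (auto simp: const_fun_def)
    then have "\<theta> (map Z C) = (\<lambda>_. 2 ^ length bs * c)" by (auto simp: fun_eq_iff field_simps)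
    then show ?thesis by (simp add: const_fun_intros)
  qed (simp add: const_fun_intros)
qed

end

text \<open>The star of \<open>\<alpha>\<close> is \<open>\<eta>\<^sup>k \<eta>\<^sup>k\<close>-bar times the monomial complementary to the conjugate of
  \<open>\<alpha>\<close>, so that harmonicity kills the values of the (2,2)-form on the 4-element subsets of the conjugate
  index set; the form is real.\<close>

theorem harmonic_\<Psi>_zero:
  assumes bs: "set bs \<subseteq> {1..k - 1} \<times> UNIV" "distinct bs"
    and harm: "bott_chern_harmonic A J k \<omega>\<^sub>0 (length bs) (frame_monomial bs)"
    and R: "set R \<subseteq> set bs" "distinct R"
  shows "\<Psi> (map Z R) = 0"
proof -
  have bsi: "set bs \<subseteq> idx" using bs(1) by force
  obtain \<theta> where star: "is_hodge_star A J k \<omega>\<^sub>0 (length bs) (frame_monomial bs) \<theta>"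
    and dd: "del A J (delbar A J \<theta>) = 0"
    using harm unfolding bott_chern_harmonic_def by blast
  note \<theta> = bsi bs(2) star
  let ?\<phi> = "\<iota> (k, True) (\<iota> (k, False) \<theta>)"
  have \<phi>: "?\<phi> (map Z ws) = \<theta> (map Z ((k, False) # (k, True) # ws))" for ws by (simp add: contr_def)
  have dd': "\<Psi> \<and>\<^sub>w ?\<phi> = 0" using del_delbar_const_form[OF const_form_\<theta>[OF \<theta>]] dd by simp
  define low where "low = {1..k - 1} \<times> (UNIV :: bool set)"
  have low: "idx = insert (k, False) (insert (k, True) low)" "(k, e) \<notin> low" for e
  proof -
    have "{1..k} = insert k {1..k - 1}" using k by auto
    then show "idx = insert (k, False) (insert (k, True) low)" by (auto simp: low_def)
    show "(k, e) \<notin> low" using k by (auto simp: low_def)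
  qed
  have fl: "set (flip bs) \<subseteq> low" using bs(1) by (auto simp: low_def apsnd_def)
  obtain C where C: "set C = low - set (flip bs)" "distinct C"
    using finite_distinct_list[of "low - set (flip bs)"] by (auto simp: low_def)
  have fR: "set (flip R) \<subseteq> set (flip bs)" using R(1) by auto
  \<comment> \<open>The doubly contracted star is nonzero, among lists of indices below k, only on
    those with index set C; hence only the splitting into \<open>flip R\<close> and C
    survives.\<close>
  have val: "(\<Psi> \<and>\<^sub>w ?\<phi>) (map Z (flip R @ C)) = \<Psi> (map Z (flip R)) * ?\<phi> (map Z C)"
  proof (rule wedge_append_right)
    show "set (flip R @ C) \<subseteq> idx" using fR fl C(1) low(1) by auto
    show "distinct (flip R @ C)" using R(2) C fR by auto
    fix ws assume ws: "set ws \<subseteq> set (flip R @ C)" and nz: "?\<phi> (map Z ws) \<noteq> 0"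
    have wl: "set ws \<subseteq> low" using ws fR fl C(1) by auto
    have "set ((k, False) # (k, True) # ws) = idx - set (flip bs)"
      by (rule \<theta>_support[OF \<theta> nz[unfolded \<phi>]]) (use wl low(1) in auto)
    then have "set ((k, False) # (k, True) # ws) \<inter> low = (idx - set (flip bs)) \<inter> low" by (rule arg_cong)
    then show "set ws = set C" using wl low C(1) by auto
  qed
  have "?\<phi> (map Z C) \<noteq> 0"
    unfolding \<phi> by (rule \<theta>_nonzero[OF \<theta>]) (use C low fl in auto)
  have cl: "const_form (2 * k - length bs) \<theta>" by (rule const_form_\<theta>[OF \<theta>])
  have Rlow: "set (flip R) \<subseteq> idx" "set R \<subseteq> idx" using fR fl low(1) R(1) bsi by auto
  have c1: "const_fun (\<Psi> (map Z (flip R)))" using \<Psi>_const_form Rlow unfolding const_form_def by blast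
  have c2: "const_fun (?\<phi> (map Z C))"
  proof -
    have "set ((k, False) # (k, True) # C) \<subseteq> idx" using C(1) low(1) by auto
    then show ?thesis unfolding \<phi> using cl unfolding const_form_def by blast
  qed
  \<comment> \<open>Both factors are constant functions; for arbitrary functions a zero product
    would not make one factor zero.\<close>
  have "\<Psi> (map Z (flip R)) * ?\<phi> (map Z C) = 0" using val dd' by simp
  then have z: "\<Psi> (map Z (flip R)) = 0"
    using c1 c2 \<open>?\<phi> (map Z C) \<noteq> 0\<close> by (auto simp: const_fun_def fun_eq_iff)
  \<comment> \<open>The star lives on the complement of the conjugate index set, which gives the
    result for \<open>flip R\<close>; reality of \<Psi> removes the flip.\<close>
  have "\<Psi> (map Z R) = form_conj \<Psi> (map Z R)" by (simp only: form_conj_\<Psi>)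
  also have "\<dots> = 0" unfolding form_conj_Z[OF Rlow(2)] z by simp
  finally show ?thesis .
qed

end

section \<open>Symmetrization\<close>

text \<open>\<open>I\<close> stands for the mean over the compact quotient.\<close>

locale nil_frame = hermitian_frame A J k E Z for A :: "('m \<Rightarrow> complex) set" and J k E Z +
  fixes G :: "'m monoid" and \<Gamma> :: "'m set" and I :: "('m \<Rightarrow> complex) \<Rightarrow> complex"
  assumes G: "group G" "carrier G = UNIV" and \<Gamma>: "subgroup \<Gamma> G"
    and E_inv: "b \<in> {1..k} \<times> UNIV \<Longrightarrow> X \<in> vector_fields A \<Longrightarrow>
      E b [vf_translate G a X] = (\<lambda>x. E b [X] (inv\<^bsub>G\<^esub> a \<otimes>\<^bsub>G\<^esub> x))"
    and translate_VF: "X \<in> vector_fields A \<Longrightarrow> vf_translate G a X \<in> vector_fields A"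
    and Z_inv: "b \<in> {1..k} \<times> UNIV \<Longrightarrow> vf_translate G a (Z b) = Z b"
    and I_add: "I (f + g) = I f + I g"
    and I_cmult: "I (\<lambda>x. c * f x) = c * I f"
    and I_const: "I (\<lambda>_. c) = c"
    and I_Z: "b \<in> {1..k} \<times> UNIV \<Longrightarrow> f \<in> A \<Longrightarrow> (\<And>a x. a \<in> \<Gamma> \<Longrightarrow> f (a \<otimes>\<^bsub>G\<^esub> x) = f x) \<Longrightarrow> I (Z b f) = 0"
begin

definition periodic :: "('m \<Rightarrow> complex) \<Rightarrow> bool" where
  "periodic f \<longleftrightarrow> f \<in> A \<and> (\<forall>a\<in>\<Gamma>. \<forall>x. f (a \<otimes>\<^bsub>G\<^esub> x) = f x)"

lemma inv_mult_cancel: "inv\<^bsub>G\<^esub> a \<otimes>\<^bsub>G\<^esub> (a \<otimes>\<^bsub>G\<^esub> x) = x" "a \<otimes>\<^bsub>G\<^esub> (inv\<^bsub>G\<^esub> a \<otimes>\<^bsub>G\<^esub> x) = x"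
  using G by (simp_all add: group.inv_closed group.l_inv group.r_inv monoid.m_assoc[symmetric] group.is_monoid monoid.l_one)

lemma periodic_const: "const_fun f \<Longrightarrow> periodic f"
  by (auto simp: periodic_def const_fun_def const_mem)

lemma periodic_zero: "periodic 0"
  by (rule periodic_const[OF const_fun_intros(1)])

lemma periodic_closed:
  "periodic f \<Longrightarrow> periodic g \<Longrightarrow> periodic (f + g)" "periodic f \<Longrightarrow> periodic g \<Longrightarrow> periodic (f - g)"
  "periodic f \<Longrightarrow> periodic g \<Longrightarrow> periodic (f * g)" "periodic f \<Longrightarrow> periodic (- f)"
  by (auto simp: periodic_def add_mem diff_mem mult_mem uminus_mem)

lemma periodic_Z:
  assumes f: "periodic f" and b: "b \<in> idx"
  shows "periodic (Z b f)"
  unfolding periodic_def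
proof (intro conjI ballI allI)
  show "Z b f \<in> A" by (rule vf_range[OF Z_VF[OF b]])
  fix a x assume a: "a \<in> \<Gamma>"
  have "Z b f (a \<otimes>\<^bsub>G\<^esub> x) = vf_translate G a (Z b) f (a \<otimes>\<^bsub>G\<^esub> x)" by (simp add: Z_inv[OF b])
  also have "\<dots> = Z b (\<lambda>y. f (a \<otimes>\<^bsub>G\<^esub> y)) x" by (simp add: vf_translate_def inv_mult_cancel)
  also have "(\<lambda>y. f (a \<otimes>\<^bsub>G\<^esub> y)) = f" using f a by (auto simp: periodic_def)
  finally show "Z b f (a \<otimes>\<^bsub>G\<^esub> x) = Z b f x" .
qed

lemma I_zero: "I 0 = 0" using I_const[of 0] by simp

lemma I_uminus: "I (- f) = - I f"
  using I_cmult[of "-1" f] by (simp add: fun_Compl_def)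

lemma I_diff: "I (f - g) = I f - I g"
  using I_add[of f "- g"] by (simp add: I_uminus)

lemma I_periodic_Z: "periodic f \<Longrightarrow> b \<in> idx \<Longrightarrow> I (Z b f) = 0"
  by (rule I_Z) (auto simp: periodic_def)

definition periodic_form :: "nat \<Rightarrow> 'm form \<Rightarrow> bool" where
  "periodic_form n \<omega> \<longleftrightarrow> \<omega> \<in> forms A n \<and> (\<forall>bs. set bs \<subseteq> idx \<longrightarrow> periodic (\<omega> (map Z bs)))"

lemma periodic_form_forms: "periodic_form n \<omega> \<Longrightarrow> \<omega> \<in> forms A n"
  by (simp add: periodic_form_def)

text \<open>Translations fix the frame fields, so invariance of the form under the lattice becomes
  periodicity of its values on the frame.\<close>

lemma invariant_periodic: "\<omega> \<in> invariant_forms A G \<Gamma> n \<Longrightarrow> periodic_form n \<omega>"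
  unfolding periodic_form_def
proof (intro conjI allI impI)
  assume w: "\<omega> \<in> invariant_forms A G \<Gamma> n"
  then show wf: "\<omega> \<in> forms A n" by (simp add: invariant_forms_def)
  fix bs assume bs: "set bs \<subseteq> idx"
  show "periodic (\<omega> (map Z bs))"
    unfolding periodic_def
  proof (intro conjI ballI allI form_range[OF wf])
    fix a x assume a: "a \<in> \<Gamma>"
    have tr: "map (vf_translate G a) (map Z bs) = map Z bs" using bs by (auto simp: Z_inv)
    have "\<omega> (map (vf_translate G a) (map Z bs)) = (\<lambda>x. \<omega> (map Z bs) (inv\<^bsub>G\<^esub> a \<otimes>\<^bsub>G\<^esub> x))"
      using w a map_Z_VF[OF bs] unfolding invariant_forms_def by blast
    then have "\<omega> (map Z bs) = (\<lambda>x. \<omega> (map Z bs) (inv\<^bsub>G\<^esub> a \<otimes>\<^bsub>G\<^esub> x))"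
      unfolding tr .
    then have "\<omega> (map Z bs) (a \<otimes>\<^bsub>G\<^esub> x) = \<omega> (map Z bs) (inv\<^bsub>G\<^esub> a \<otimes>\<^bsub>G\<^esub> (a \<otimes>\<^bsub>G\<^esub> x))"
      by (rule fun_cong)
    then show "\<omega> (map Z bs) (a \<otimes>\<^bsub>G\<^esub> x) = \<omega> (map Z bs) x" by (simp only: inv_mult_cancel)
  qed
qed

text \<open>Expanding each argument in the frame reduces the claim to \<open>E_inv\<close>. As the
  set H is arbitrary, one and the same form counts as an invariant form and as a form on the
  nilmanifold.\<close>

lemma const_form_invariant:
  assumes "const_form n \<omega>"
  shows "\<omega> \<in> invariant_forms A G H n"
proof -
  have "\<omega> (map (vf_translate G a) Xs) = (\<lambda>x. \<omega> Xs (inv\<^bsub>G\<^esub> a \<otimes>\<^bsub>G\<^esub> x))" if "set Xs \<subseteq> VF" for a Xs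
    using assms that
  proof (induction Xs arbitrary: n \<omega>)
    case Nil
    then have "const_fun (\<omega> (map Z []))" unfolding const_form_def by (metis empty_set empty_subsetI)
    then show ?case by (auto simp: const_fun_def)
  next
    case (Cons X Xs)
    have X: "X \<in> VF" "vf_translate G a X \<in> VF" using Cons.prems translate_VF by auto
    note w = const_form_forms[OF Cons.prems(1)]
    show ?case
    proof (cases n)
      case 0
      then show ?thesis using w by (auto simp: forms_0_iff)
    next
      case (Suc m)
      have IH: "\<iota> b \<omega> (map (vf_translate G a) Xs) = (\<lambda>x. \<iota> b \<omega> Xs (inv\<^bsub>G\<^esub> a \<otimes>\<^bsub>G\<^esub> x))" if "b \<in> idx" for b
        using Cons.IH[OF const_form_contr[of m \<omega> b]] Cons.prems that Suc by auto
      have "\<omega> (map (vf_translate G a) (X # Xs)) = contr (vf_translate G a X) \<omega> (map (vf_translate G a) Xs)"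
        by (simp add: contr_def)
      also have "\<dots> = (\<lambda>x. contr X \<omega> Xs (inv\<^bsub>G\<^esub> a \<otimes>\<^bsub>G\<^esub> x))"
        unfolding contr_expand[OF w X(1)] contr_expand[OF w X(2)] fun_sum_apply
        by (rule ext, rule sum.cong) (auto simp: fscale_def E_inv[OF _ X(1)] IH)
      finally show ?thesis by (simp add: contr_def)
    qed
  qed
  then show ?thesis using const_form_forms[OF assms] by (simp add: invariant_forms_def)
qed

lemma periodic_form_contr: "periodic_form (Suc n) \<omega> \<Longrightarrow> b \<in> idx \<Longrightarrow> periodic_form n (\<iota> b \<omega>)"
  unfolding periodic_form_def
  by (auto simp: contr_forms Z_VF) (auto simp: contr_def simp flip: list.map(2))

lemma periodic_form_closed:
  "periodic_form n \<omega> \<Longrightarrow> periodic_form n \<theta> \<Longrightarrow> periodic_form n (\<omega> + \<theta>)"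
  "periodic_form n \<omega> \<Longrightarrow> periodic_form n \<theta> \<Longrightarrow> periodic_form n (\<omega> - \<theta>)"
  "periodic_form n \<omega> \<Longrightarrow> const_fun f \<Longrightarrow> periodic_form n (fscale f \<omega>)"
  "periodic_form n \<omega> \<Longrightarrow> periodic_form n (T p q \<omega>)"
  "periodic_form n 0"
  unfolding periodic_form_def
  by (auto simp: add_forms diff_forms fscale_forms const_mem const_fun_def bicomponent_forms bicomponent_Z
      zero_forms periodic_closed periodic_zero)
     (auto simp: fscale_def periodic_closed periodic_const const_fun_intros const_fun_def)

lemma periodic_form_sum: "(\<And>i. i \<in> S \<Longrightarrow> periodic_form n (f i)) \<Longrightarrow> periodic_form n (sum f S)"
proof (induction S rule: infinite_finite_induct)
  case (insert i S)
  show ?case unfolding sum.insert[OF insert.hyps] by (intro periodic_form_closed insert.IH insert.prems) auto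
qed (simp_all only: sum.infinite sum.empty periodic_form_closed not_False_eq_True)

lemma const_fun_B: "b \<in> idx \<Longrightarrow> c \<in> idx \<Longrightarrow> const_fun (- B [Z b, Z c])"
  "b \<in> idx \<Longrightarrow> c \<in> idx \<Longrightarrow> const_fun (- B' [Z b, Z c])"
proof -
  assume bc: "b \<in> idx" "c \<in> idx"
  then have "set [b, c] \<subseteq> idx" by auto
  then have "const_fun (B (map Z [b, c]))" "const_fun (B' (map Z [b, c]))"
    using B_props(1) B'_props(1) unfolding const_form_def by blast+
  then show "const_fun (- B [Z b, Z c])" "const_fun (- B' [Z b, Z c])"
    by (auto intro: const_fun_intros)
qed

lemma contr_lie_bracket:
  assumes w: "\<omega> \<in> forms A (Suc n)" and b: "b \<in> idx" and c: "c \<in> idx"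
  shows "contr (lie_bracket (Z b) (Z c)) \<omega> =
    fscale (- B [Z b, Z c]) (\<iota> (k, False) \<omega>) + fscale (- B' [Z b, Z c]) (\<iota> (k, True) \<omega>)"
proof -
  have zk: "Z (k, e) \<in> VF" for e by (rule Z_VF[OF k_idx])
  have m: "- B [Z b, Z c] \<in> A" "- B' [Z b, Z c] \<in> A"
    by (intro uminus_mem form_range[OF B_forms] form_range[OF B'_forms])+
  show ?thesis
    unfolding lie_bracket_Z[OF b c] contr_add_vf[OF w VF_mult[OF zk m(1)] VF_mult[OF zk m(2)]]
      contr_mult_vf[OF w zk m(1)] contr_mult_vf[OF w zk m(2)] ..
qed

text \<open>Symmetrization: the left-invariant form whose values on the frame are the means of those of \<open>\<omega>\<close>.\<close>

primrec av :: "nat \<Rightarrow> 'm form \<Rightarrow> 'm form" where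
  "av 0 \<omega> = (\<lambda>Xs. if Xs = [] then (\<lambda>_. I (\<omega> [])) else 0)"
| "av (Suc n) \<omega> = (\<lambda>Xs. case Xs of [] \<Rightarrow> 0
     | X # Ys \<Rightarrow> if X \<in> VF then \<Sum>b\<in>idx. E b [X] * av n (\<iota> b \<omega>) Ys else 0)"

lemma contr_av:
  assumes "X \<in> VF" shows "contr X (av (Suc n) \<omega>) = (\<Sum>b\<in>idx. fscale (E b [X]) (av n (\<iota> b \<omega>)))"
  by (intro ext) (use assms in \<open>simp add: contr_apply fun_sum_apply fscale_def\<close>)

lemma contr_Z_av:
  assumes c: "c \<in> idx" shows "\<iota> c (av (Suc n) \<omega>) = av n (\<iota> c \<omega>)"
proof -
  have "\<iota> c (av (Suc n) \<omega>) = (\<Sum>b\<in>idx. if b = c then av n (\<iota> c \<omega>) else 0)"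
    unfolding contr_av[OF Z_VF[OF c]]
    by (rule sum.cong[OF refl]) (use c in \<open>auto simp: E_Z fscale_def fun_eq_iff\<close>)
  also have "\<dots> = av n (\<iota> c \<omega>)" using c by (subst sum.delta) auto
  finally show ?thesis .
qed

lemma av_add: "av n (\<omega> + \<theta>) = av n \<omega> + av n \<theta>"
proof (induction n arbitrary: \<omega> \<theta>)
  case 0
  have "I (\<lambda>x. f x + g x) = I f + I g" for f g using I_add[of f g] by (simp add: plus_fun_def)
  then show ?case by (intro ext) (simp add: I_add)
next
  case (Suc n)
  show ?case
  proof (intro ext)
    fix Xs x show "av (Suc n) (\<omega> + \<theta>) Xs x = (av (Suc n) \<omega> + av (Suc n) \<theta>) Xs x"
      by (cases Xs) (simp_all add: Suc fun_sum_apply distrib_left sum.distrib del: sum_constant)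
  qed
qed

lemma av_cscale: "av n (cscale c \<omega>) = cscale c (av n \<omega>)"
proof (induction n arbitrary: \<omega>)
  case 0
  show ?case by (rule ext) (simp add: I_cmult cscale_def fun_eq_iff)
next
  case (Suc n)
  show ?case
  proof (intro ext)
    fix Xs x show "av (Suc n) (cscale c \<omega>) Xs x = cscale c (av (Suc n) \<omega>) Xs x"
    proof (cases Xs)
      case (Cons X Ys)
      have "(\<Sum>b\<in>idx. E b [X] x * cscale c (av n (\<iota> b \<omega>)) Ys x) = c * (\<Sum>b\<in>idx. E b [X] x * av n (\<iota> b \<omega>) Ys x)"
        unfolding sum_distrib_left by (rule sum.cong) (simp_all add: cscale_def)
      then show ?thesis
        by (simp add: Cons Suc fun_sum_apply del: sum_constant) (simp add: cscale_def Cons fun_sum_apply)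
    qed (simp add: cscale_def)
  qed
qed

lemma av_uminus: "av n (- \<omega>) = - av n \<omega>"
  using av_cscale[of n "-1" \<omega>] by (simp add: cscale_def fun_Compl_def)

lemma av_diff: "av n (\<omega> - \<theta>) = av n \<omega> - av n \<theta>"
  using av_add[of n \<omega> "- \<theta>"] unfolding av_uminus by simp

lemma av_zero: "av n 0 = 0"
  using av_cscale[of n 0 0] by (simp add: cscale_def)

lemma av_sum: "av n (sum f S) = (\<Sum>i\<in>S. av n (f i))"
proof (induction S rule: infinite_finite_induct)
  case (insert i S)
  show ?case unfolding sum.insert[OF insert.hyps] av_add insert.IH ..
qed (simp_all only: sum.infinite sum.empty av_zero not_False_eq_True)

lemma av_fscale_const: "const_fun f \<Longrightarrow> av n (fscale f \<omega>) = fscale f (av n \<omega>)"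
  by (auto simp: const_fun_def av_cscale simp flip: cscale_eq_fscale)

lemma av_forms: "\<omega> \<in> forms A n \<Longrightarrow> av n \<omega> \<in> forms A n"
proof (induction n arbitrary: \<omega>)
  case 0
  then show ?case by (simp add: forms_0_iff const_mem)
next
  case (Suc n)
  note w = Suc.prems
  have f: "av n (\<iota> b \<omega>) \<in> forms A n" if "b \<in> idx" for b
    by (intro Suc.IH contr_forms[OF w] Z_VF that)
  have Em: "E b [X] \<in> A" if "b \<in> idx" for b X by (rule form_range[OF E_forms[OF that]])
  show ?case
  proof (rule forms_SucI)
    show "contr X (av (Suc n) \<omega>) = 0" if "X \<notin> VF" for X
      using that by (simp add: contr_def fun_eq_iff)
    show "contr X (av (Suc n) \<omega>) \<in> forms A n" if "X \<in> VF" for X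
      unfolding contr_av[OF that] by (intro sum_forms fscale_forms f Em)
    show "contr (X + Y) (av (Suc n) \<omega>) = contr X (av (Suc n) \<omega>) + contr Y (av (Suc n) \<omega>)"
      if "X \<in> VF" "Y \<in> VF" for X Y
    proof -
      have "E b [X + Y] = E b [X] + E b [Y]" if "b \<in> idx" for b
        using form_add[OF E_forms[OF that], of "[X]" 0 X Y] \<open>X \<in> VF\<close> \<open>Y \<in> VF\<close> by simp
      then have "fscale (E b [X + Y]) (av n (\<iota> b \<omega>)) = fscale (E b [X]) (av n (\<iota> b \<omega>)) + fscale (E b [Y]) (av n (\<iota> b \<omega>))"
        if "b \<in> idx" for b using that by (intro ext) (simp add: fscale_def algebra_simps)
      then have "(\<Sum>b\<in>idx. fscale (E b [X + Y]) (av n (\<iota> b \<omega>))) =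
          (\<Sum>b\<in>idx. fscale (E b [X]) (av n (\<iota> b \<omega>)) + fscale (E b [Y]) (av n (\<iota> b \<omega>)))"
        by (rule sum.cong[OF refl])
      then show ?thesis
        unfolding contr_av[OF that(1)] contr_av[OF that(2)] contr_av[OF VF_add[OF that]] by (simp only: sum.distrib)
    qed
    show "contr (vf_mult f X) (av (Suc n) \<omega>) = fscale f (contr X (av (Suc n) \<omega>))"
      if "X \<in> VF" "f \<in> A" for X f
    proof -
      have e: "E b [vf_mult f X] = f * E b [X]" if "b \<in> idx" for b
        using form_mult[OF E_forms[OF that], of "[X]" 0 X f] \<open>X \<in> VF\<close> \<open>f \<in> A\<close> by simp
      show ?thesis
        unfolding contr_av[OF that(1)] contr_av[OF VF_mult[OF that]]
        by (intro ext) (auto simp: fun_sum_apply fscale_def e sum_distrib_left mult_ac simp del: sum_constant intro!: sum.cong)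
    qed
    show "contr X (contr X (av (Suc n) \<omega>)) = 0" if X: "X \<in> VF" for X
    proof (cases n)
      case 0
      have "contr X (av (Suc n) \<omega>) \<in> forms A 0"
        unfolding contr_av[OF X] using f Em 0 by (intro sum_forms fscale_forms) auto
      then show ?thesis by (rule contr_Z_zero)
    next
      case (Suc m)
      then have w': "\<omega> \<in> forms A (Suc (Suc m))" using w by simp
      let ?t = "\<lambda>b c. fscale (E b [X]) (fscale (E c [X]) (av m (\<iota> c (\<iota> b \<omega>))))"
      have anti: "?t c b = - ?t b c" if "b \<in> idx" "c \<in> idx" for b c
        unfolding contr_anticomm[OF w' Z_VF[OF that(1)] Z_VF[OF that(2)]] av_uminus
        by (intro ext) (simp add: fscale_def mult_ac)
      have e: "contr X (contr X (av (Suc n) \<omega>)) = (\<Sum>b\<in>idx. \<Sum>c\<in>idx. ?t b c)"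
        unfolding contr_av[OF X] contr_sum contr_fscale Suc
        by (intro ext) (simp only: fun_sum_apply fscale_def sum_distrib_left)
      \<comment> \<open>The summand is antisymmetric in its two indices, because the contractions
        anticommute and averaging is linear; interchanging the sums shows that the total equals its
        own negative.\<close>
      have s: "(\<Sum>b\<in>idx. \<Sum>c\<in>idx. ?t b c) = - (\<Sum>b\<in>idx. \<Sum>c\<in>idx. ?t b c)"
      proof -
        have "(\<Sum>b\<in>idx. \<Sum>c\<in>idx. ?t b c) = (\<Sum>c\<in>idx. \<Sum>b\<in>idx. ?t b c)" by (rule sum.swap)
        also have "\<dots> = (\<Sum>c\<in>idx. \<Sum>b\<in>idx. - ?t c b)"
          by (intro sum.cong[OF refl] anti) assumption+
        finally show ?thesis by (simp only: sum_negf)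
      qed
      have zero_if: "z = 0" if "z = - z" for z :: complex
        using arg_cong[OF that, of Re] arg_cong[OF that, of Im] by (intro complex_eqI) simp_all
      have "contr X (contr X (av (Suc n) \<omega>)) = - contr X (contr X (av (Suc n) \<omega>))"
        unfolding e by (rule s)
      then have "contr X (contr X (av (Suc n) \<omega>)) Xs x = - (contr X (contr X (av (Suc n) \<omega>)) Xs x)" for Xs x
        unfolding uminus_apply[symmetric] by (rule arg_cong)
      then have "contr X (contr X (av (Suc n) \<omega>)) Xs x = 0" for Xs x
        by (rule zero_if)
      then show ?thesis by (simp add: fun_eq_iff)
    qed
  qed simp
qed

lemma av_Z:
  assumes "set bs \<subseteq> idx" "length bs = n"
  shows "av n \<omega> (map Z bs) = (\<lambda>_. I (\<omega> (map Z bs)))"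
  using assms
proof (induction bs arbitrary: n \<omega>)
  case (Cons b bs)
  then obtain m where m: "n = Suc m" "length bs = m" by auto
  have "av n \<omega> (map Z (b # bs)) = \<iota> b (av (Suc m) \<omega>) (map Z bs)" by (simp only: contr_def m list.map)
  also have "\<dots> = av m (\<iota> b \<omega>) (map Z bs)" using contr_Z_av[of b m \<omega>] Cons.prems by simp
  also have "\<dots> = (\<lambda>_. I (\<omega> (map Z (b # bs))))" using Cons.IH[of m "\<iota> b \<omega>"] Cons.prems m by (simp add: contr_def)
  finally show ?case .
qed simp

lemma av_const_form: "\<omega> \<in> forms A n \<Longrightarrow> const_form n (av n \<omega>)"
  unfolding const_form_def
proof (intro conjI allI impI av_forms)
  fix bs assume w: "\<omega> \<in> forms A n" and bs: "set bs \<subseteq> idx"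
  show "const_fun (av n \<omega> (map Z bs))"
    using av_Z[OF bs, of n \<omega>] form_outside[OF av_forms[OF w], of "map Z bs"]
    by (cases "length bs = n") (simp_all add: const_fun_intros)
qed

lemma av_of_const: "const_form n \<omega> \<Longrightarrow> av n \<omega> = \<omega>"
proof (rule forms_eqI)
  assume w: "const_form n \<omega>"
  then show "\<omega> \<in> forms A n" by (rule const_form_forms)
  then show "av n \<omega> \<in> forms A n" by (rule av_forms)
  fix bs assume bs: "set bs \<subseteq> idx" "length bs = n"
  then obtain c where "\<omega> (map Z bs) = (\<lambda>_. c)" using w unfolding const_form_def const_fun_def by blast
  then show "av n \<omega> (map Z bs) = \<omega> (map Z bs)" by (simp add: av_Z[OF bs] I_const)
qed

lemma av_bicomponent: "\<omega> \<in> forms A n \<Longrightarrow> av n (T p q \<omega>) = T p q (av n \<omega>)"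
proof (rule forms_eqI[of _ n])
  assume w: "\<omega> \<in> forms A n"
  show "av n (T p q \<omega>) \<in> forms A n" "T p q (av n \<omega>) \<in> forms A n"
    by (intro av_forms bicomponent_forms w)+
  fix bs assume bs: "set bs \<subseteq> idx" "length bs = n"
  show "av n (T p q \<omega>) (map Z bs) = T p q (av n \<omega>) (map Z bs)"
    unfolding av_Z[OF bs] bicomponent_Z[OF w bs(1)] bicomponent_Z[OF av_forms[OF w] bs(1)]
    by (simp add: I_zero)
qed

text \<open>In degree 0 both sides vanish, the left one because derivatives have mean 0. In higher
  degree a contraction adds only a bracket term, whose coefficients are constants and can be taken
  out of the mean.\<close>

lemma av_lie_deriv:
  assumes "periodic_form n \<omega>" "b \<in> idx"
  shows "periodic_form n (lie_deriv (Z b) \<omega>)" "av n (lie_deriv (Z b) \<omega>) = lie_deriv (Z b) (av n \<omega>)"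
proof -
  have ZV: "Z b \<in> VF" by (rule Z_VF[OF assms(2)])
  have "periodic_form n (lie_deriv (Z b) \<omega>) \<and> av n (lie_deriv (Z b) \<omega>) = lie_deriv (Z b) (av n \<omega>)"
    using assms(1)
  proof (induction n arbitrary: \<omega>)
    case 0
    then have w: "\<omega> \<in> forms A 0" and p: "periodic (\<omega> (map Z []))"
      unfolding periodic_form_def by (metis empty_set empty_subsetI)+
    have nil: "lie_deriv (Z b) \<theta> [] = Z b (\<theta> [])" for \<theta> by (simp add: lie_deriv_def)
    have lf: "lie_deriv (Z b) \<omega> \<in> forms A 0" by (rule lie_deriv_forms[OF w ZV])
    have "periodic (lie_deriv (Z b) \<omega> (map Z bs))" for bs
      using lf p by (cases bs) (simp_all add: forms_0_iff nil periodic_Z[OF _ assms(2)] periodic_zero)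
    then have "periodic_form 0 (lie_deriv (Z b) \<omega>)" using lf by (simp add: periodic_form_def)
    moreover have "av 0 (lie_deriv (Z b) \<omega>) = lie_deriv (Z b) (av 0 \<omega>)"
    proof
      fix Xs
      have "lie_deriv (Z b) (av 0 \<omega>) \<in> forms A 0" by (intro lie_deriv_forms av_forms w ZV)
      then show "av 0 (lie_deriv (Z b) \<omega>) Xs = lie_deriv (Z b) (av 0 \<omega>) Xs"
        using p by (cases Xs) (simp_all add: nil forms_0_iff I_periodic_Z[OF _ assms(2)] vf_const[OF ZV])
    qed
    ultimately show ?case by blast
  next
    case (Suc n)
    note w = periodic_form_forms[OF Suc.prems]
    have c: "\<iota> c (lie_deriv (Z b) \<omega>) = lie_deriv (Z b) (\<iota> c \<omega>)
        - (fscale (- B [Z b, Z c]) (\<iota> (k, False) \<omega>) + fscale (- B' [Z b, Z c]) (\<iota> (k, True) \<omega>))"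
      if "c \<in> idx" "\<omega> \<in> forms A (Suc n)" for c \<omega>
      unfolding contr_lie_deriv[OF that(2) ZV Z_VF[OF that(1)]] contr_lie_bracket[OF that(2) assms(2) that(1)] ..
    have lf: "lie_deriv (Z b) \<omega> \<in> forms A (Suc n)" by (rule lie_deriv_forms[OF w ZV])
    have pc: "periodic_form n (\<iota> c (lie_deriv (Z b) \<omega>))" if "c \<in> idx" for c
      unfolding c[OF that w]
      by (intro periodic_form_closed Suc.IH[THEN conjunct1] periodic_form_contr[OF Suc.prems] const_fun_B assms k_idx that)
    have "periodic (lie_deriv (Z b) \<omega> (map Z bs))" if bs: "set bs \<subseteq> idx" for bs
    proof (cases bs)
      case Nil
      then show ?thesis using form_Suc_Nil[OF lf] by (simp add: periodic_const const_fun_intros)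
    next
      case (Cons c cs)
      then have "periodic (\<iota> c (lie_deriv (Z b) \<omega>) (map Z cs))"
        using pc[of c] bs unfolding periodic_form_def by auto
      then show ?thesis by (simp add: Cons contr_def)
    qed
    then have 1: "periodic_form (Suc n) (lie_deriv (Z b) \<omega>)" using lf by (simp add: periodic_form_def)
    have "av (Suc n) (lie_deriv (Z b) \<omega>) = lie_deriv (Z b) (av (Suc n) \<omega>)"
    proof (rule forms_eq_contr)
      show "av (Suc n) (lie_deriv (Z b) \<omega>) \<in> forms A (Suc n)" "lie_deriv (Z b) (av (Suc n) \<omega>) \<in> forms A (Suc n)"
        by (intro av_forms lf lie_deriv_forms w ZV)+
      fix c' assume c': "c' \<in> idx"
      show "\<iota> c' (av (Suc n) (lie_deriv (Z b) \<omega>)) = \<iota> c' (lie_deriv (Z b) (av (Suc n) \<omega>))"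
        unfolding contr_Z_av[OF c'] c[OF c' w] c[OF c' av_forms[OF w]] av_diff av_add contr_Z_av[OF k_idx]
          av_fscale_const[OF const_fun_B(1)[OF assms(2) c']] av_fscale_const[OF const_fun_B(2)[OF assms(2) c']]
          Suc.IH[OF periodic_form_contr[OF Suc.prems c'], THEN conjunct2] ..
    qed
    with 1 show ?case by blast
  qed
  then show "periodic_form n (lie_deriv (Z b) \<omega>)" "av n (lie_deriv (Z b) \<omega>) = lie_deriv (Z b) (av n \<omega>)" by auto
qed

text \<open>Cartan's formula splits each contraction with a frame field into a Lie derivative,
  covered by \<open>av_lie_deriv\<close>, and the exterior derivative of a form of lower
  degree.\<close>

lemma av_ext_d:
  assumes "periodic_form n \<omega>"
  shows "periodic_form (Suc n) (d \<omega>)" "av (Suc n) (d \<omega>) = d (av n \<omega>)"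
proof -
  have "periodic_form (Suc n) (d \<omega>) \<and> av (Suc n) (d \<omega>) = d (av n \<omega>)"
    using assms
  proof (induction n arbitrary: \<omega>)
    case (0 \<omega>)
    note w = periodic_form_forms[OF 0]
    have z: "contr X \<theta> = 0" if "\<theta> \<in> forms A 0" for \<theta> X by (rule contr_Z_zero[OF that])
    have c: "\<iota> b (d \<theta>) = lie_deriv (Z b) \<theta>" if "b \<in> idx" "\<theta> \<in> forms A 0" for b \<theta>
      by (simp add: contr_ext_d[OF that(2) Z_VF[OF that(1)]] z[OF that(2)] ext_d_zero)
    have df: "d \<omega> \<in> forms A (Suc 0)" by (rule ext_d_forms[OF w])
    have "periodic (d \<omega> (map Z bs))" if bs: "set bs \<subseteq> idx" for bs
    proof (cases bs)
      case Nil
      then show ?thesis by (simp add: ext_d_Nil periodic_const const_fun_intros)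
    next
      case (Cons b cs)
      then have "b \<in> idx" "set cs \<subseteq> idx" using bs by auto
      then have "periodic (\<iota> b (d \<omega>) (map Z cs))"
        using av_lie_deriv(1)[OF 0 \<open>b \<in> idx\<close>] unfolding c[OF \<open>b \<in> idx\<close> w] periodic_form_def by blast
      then show ?thesis by (simp add: Cons contr_def)
    qed
    then have 1: "periodic_form (Suc 0) (d \<omega>)" using df by (simp add: periodic_form_def)
    have "av (Suc 0) (d \<omega>) = d (av 0 \<omega>)"
    proof (rule forms_eq_contr)
      show "av (Suc 0) (d \<omega>) \<in> forms A (Suc 0)" "d (av 0 \<omega>) \<in> forms A (Suc 0)"
        by (intro av_forms df ext_d_forms w)+
      fix b assume b: "b \<in> idx"
      show "\<iota> b (av (Suc 0) (d \<omega>)) = \<iota> b (d (av 0 \<omega>))"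
        unfolding contr_Z_av[OF b] c[OF b w] c[OF b av_forms[OF w]] by (rule av_lie_deriv(2)[OF 0 b])
    qed
    with 1 show ?case by blast
  next
    case (Suc n \<omega>)
    note w = periodic_form_forms[OF Suc.prems]
    have df: "d \<omega> \<in> forms A (Suc (Suc n))" by (rule ext_d_forms[OF w])
    note c = contr_ext_d[OF w Z_VF] and c' = contr_ext_d[OF av_forms[OF w] Z_VF]
    have pc: "periodic_form (Suc n) (\<iota> b (d \<omega>))" if "b \<in> idx" for b
      unfolding c[OF that]
      by (intro periodic_form_closed av_lie_deriv(1) Suc.IH[THEN conjunct1] periodic_form_contr[OF Suc.prems] Suc.prems that)
    have "periodic (d \<omega> (map Z bs))" if bs: "set bs \<subseteq> idx" for bs
    proof (cases bs)
      case Nil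
      then show ?thesis by (simp add: ext_d_Nil periodic_const const_fun_intros)
    next
      case (Cons b cs)
      then have "periodic (\<iota> b (d \<omega>) (map Z cs))"
        using pc[of b] bs unfolding periodic_form_def by auto
      then show ?thesis by (simp add: Cons contr_def)
    qed
    then have 1: "periodic_form (Suc (Suc n)) (d \<omega>)" using df by (simp add: periodic_form_def)
    have "av (Suc (Suc n)) (d \<omega>) = d (av (Suc n) \<omega>)"
    proof (rule forms_eq_contr)
      show "av (Suc (Suc n)) (d \<omega>) \<in> forms A (Suc (Suc n))" "d (av (Suc n) \<omega>) \<in> forms A (Suc (Suc n))"
        by (intro av_forms df ext_d_forms w)+
      fix b assume b: "b \<in> idx"
      show "\<iota> b (av (Suc (Suc n)) (d \<omega>)) = \<iota> b (d (av (Suc n) \<omega>))"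
        unfolding contr_Z_av[OF b] c[OF b] c'[OF b] av_diff av_lie_deriv(2)[OF Suc.prems b]
          Suc.IH[OF periodic_form_contr[OF Suc.prems b], THEN conjunct2] ..
    qed
    with 1 show ?case by blast
  qed
  then show "periodic_form (Suc n) (d \<omega>)" "av (Suc n) (d \<omega>) = d (av n \<omega>)" by auto
qed

lemma av_del:
  assumes "periodic_form n \<omega>"
  shows "periodic_form (Suc n) (del A J \<omega>)" "av (Suc n) (del A J \<omega>) = del A J (av n \<omega>)"
    and "periodic_form (Suc n) (delbar A J \<omega>)" "av (Suc n) (delbar A J \<omega>) = delbar A J (av n \<omega>)"
proof -
  note w = periodic_form_forms[OF assms]
  have t: "av (Suc n) (T p' q' (d (T p q \<omega>))) = T p' q' (d (T p q (av n \<omega>)))" for p q p' q'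
    by (simp only: av_bicomponent[OF ext_d_forms[OF bicomponent_forms[OF w]]]
        av_ext_d(2)[OF periodic_form_closed(4)[OF assms]] av_bicomponent[OF w])
  show "periodic_form (Suc n) (del A J \<omega>)" "periodic_form (Suc n) (delbar A J \<omega>)"
    unfolding del_eq[OF w] by (intro periodic_form_sum periodic_form_closed av_ext_d(1) assms)+
  show "av (Suc n) (del A J \<omega>) = del A J (av n \<omega>)" "av (Suc n) (delbar A J \<omega>) = delbar A J (av n \<omega>)"
    unfolding del_eq[OF w] del_eq[OF av_forms[OF w]] av_sum t by (rule refl)+
qed

theorem av_del_delbar:
  assumes "periodic_form n \<omega>"
  shows "av (Suc (Suc n)) (del A J (delbar A J \<omega>)) = \<Psi> \<and>\<^sub>w \<iota> (k, True) (\<iota> (k, False) (av n \<omega>))"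
  unfolding av_del(2)[OF av_del(3)[OF assms]] av_del(4)[OF assms]
  by (rule del_delbar_const_form[OF av_const_form[OF periodic_form_forms[OF assms]]])

text \<open>The substitute for Stokes' theorem: the two directions spanning the derived algebra are central.\<close>

lemma I_del_delbar_central:
  assumes "periodic_form n \<omega>" "set bs \<subseteq> idx"
  shows "I (del A J \<omega> (map Z ((k, False) # (k, True) # bs))) = 0"
    "I (delbar A J \<omega> (map Z ((k, False) # (k, True) # bs))) = 0"
proof -
  let ?L = "(k, False) # (k, True) # bs"
  note w = periodic_form_forms[OF assms(1)]
  have L: "set ?L \<subseteq> idx" using assms(2) k by auto
  have zk: "Z (k, e) \<in> VF" for e by (rule Z_VF[OF k_idx])
  let ?\<nu> = "av n \<omega>"
  have \<nu>: "const_form n ?\<nu>" by (rule av_const_form[OF w])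
  note \<nu>f = const_form_forms[OF \<nu>]
  obtain m where m: "\<iota> (k, False) ?\<nu> \<in> forms A m"
    using contr_forms_cases[OF \<nu>f zk[of False]] zero_forms by metis
  \<comment> \<open>Each term of \<open>del_const_form\<close> already contains a contraction with
    one of the two directions, and the other factors do not involve index k; contracting with both
    directions repeats one of them.\<close>
  have "\<iota> (k, True) (\<iota> (k, False) (del A J ?\<nu>)) = 0" "\<iota> (k, True) (\<iota> (k, False) (delbar A J ?\<nu>)) = 0"
    using type_forms[THEN const_form_forms, THEN grade_sign_2]
    unfolding del_const_form[OF \<nu>]
    by (simp_all add: contr_wedge contr_types contr_anyform(1)[OF \<nu>f zk]
        contr_anticomm[OF \<nu>f zk[of False] zk[of True]] contr_anyform(1)[OF m zk])
  then have z: "del A J ?\<nu> (map Z ?L) = 0" "delbar A J ?\<nu> (map Z ?L) = 0"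
    by (simp_all add: contr_def fun_eq_iff)
  show "I (del A J \<omega> (map Z ?L)) = 0"
  proof (cases "length ?L = Suc n")
    case True
    have "(\<lambda>_ :: 'm. I (del A J \<omega> (map Z ?L))) = 0"
      using z(1) unfolding av_del(2)[OF assms(1), symmetric] av_Z[OF L True] .
    then show ?thesis by (simp add: fun_eq_iff)
  next
    case False
    then have "del A J \<omega> (map Z ?L) = 0" using form_outside[OF del_forms[OF w]] by simp
    then show ?thesis by (simp only: I_zero)
  qed
  show "I (delbar A J \<omega> (map Z ?L)) = 0"
  proof (cases "length ?L = Suc n")
    case True
    have "(\<lambda>_ :: 'm. I (delbar A J \<omega> (map Z ?L))) = 0"
      using z(2) unfolding av_del(4)[OF assms(1), symmetric] av_Z[OF L True] .
    then show ?thesis by (simp add: fun_eq_iff)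
  next
    case False
    then have "delbar A J \<omega> (map Z ?L) = 0" using form_outside[OF delbar_forms[OF w]] by simp
    then show ?thesis by (simp only: I_zero)
  qed
qed

end

section \<open>The Massey product\<close>

context frame
begin

lemma bicomponent_frame_monomial:
  assumes "set bs \<subseteq> idx"
  shows "T x y (frame_monomial bs) =
    (if x = int (unbarred bs) \<and> x + y = int (length bs) then frame_monomial bs else 0)"
proof (rule forms_eqI)
  note w = frame_monomial_forms[OF assms]
  show "T x y (frame_monomial bs) \<in> forms A (length bs)" by (rule bicomponent_forms[OF w])
  show "(if x = int (unbarred bs) \<and> x + y = int (length bs) then frame_monomial bs else 0) \<in> forms A (length bs)"
    using w zero_forms by auto
  fix cs assume cs: "set cs \<subseteq> idx" "length cs = length bs"
  have "unbarred cs = unbarred bs" if "frame_monomial bs (map Z cs) \<noteq> 0"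
    using frame_monomial_support[OF assms cs(1) that] by (simp add: unbarred_mset)
  then show "T x y (frame_monomial bs) (map Z cs) =
      (if x = int (unbarred bs) \<and> x + y = int (length bs) then frame_monomial bs else 0) (map Z cs)"
    unfolding bicomponent_Z[OF w cs(1)] using cs(2) by auto
qed

lemma \<Psi>_support:
  assumes "set R \<subseteq> idx" "\<Psi> (map Z R) \<noteq> 0" shows "set R \<subseteq> {1..k - 1} \<times> UNIV"
proof
  fix b assume b: "b \<in> set R"
  obtain j e where je: "b = (j, e)" by (cases b)
  have "j \<noteq> k"
  proof
    assume "j = k"
    then obtain us vs where R: "R = us @ (k, e) # vs" using b je by (meson split_list)
    have us: "set (map Z us) \<subseteq> VF" using assms(1) R by (intro map_Z_VF) auto
    have "\<Psi> (map Z R) = (- 1) ^ length (map Z us) * \<Psi> (Z (k, e) # map Z us @ map Z vs)"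
      using form_move_front[OF const_form_forms[OF \<Psi>_const_form] us Z_VF[OF k_idx[of e]], of "map Z vs"]
      unfolding R by (simp only: map_append list.map)
    also have "\<Psi> (Z (k, e) # map Z us @ map Z vs) = contr (Z (k, e)) \<Psi> (map Z us @ map Z vs)"
      by (simp only: contr_apply)
    also have "\<dots> = 0" unfolding contr_\<Psi> by simp
    finally show False using assms(2) by (simp only: mult_zero_right)
  qed
  then show "b \<in> {1..k - 1} \<times> UNIV" using b assms(1) je by force
qed

end

context nil_frame
begin

lemma const_form_biforms:
  assumes "const_form n \<omega>" "int n = x + y" "T x y \<omega> = \<omega>"
  shows "\<omega> \<in> biforms A J (invariant_forms A G H) x y"
proof -
  have "nat (x + y) = n" using assms(2) by linarith
  then show ?thesis using const_form_invariant[OF assms(1)] assms(3) by (simp add: biforms_def)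
qed

lemma monomial_cocycle:
  assumes a: "set a \<subseteq> idx" "length a = x + y" "unbarred a = x" and closed: "d (frame_monomial a) = 0"
  shows "frame_monomial a \<in> bott_chern_cocycles A J (invariant_forms A G H) (int x) (int y)"
proof -
  note w = frame_monomial_forms[OF a(1)]
  have "d (T u v (frame_monomial a)) = 0" for u v
    unfolding bicomponent_frame_monomial[OF a(1)] using closed ext_d_zero by auto
  then have "del A J (frame_monomial a) = 0" "delbar A J (frame_monomial a) = 0"
    unfolding del_eq[OF w] by (simp_all add: bicomponent_zero)
  moreover have "frame_monomial a \<in> biforms A J (invariant_forms A G H) (int x) (int y)"
    by (rule const_form_biforms[OF const_form_wedge_list[OF a(1)]])
      (use a in \<open>simp_all add: bicomponent_frame_monomial\<close>)
  ultimately show ?thesis by (simp add: bott_chern_cocycles_def)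
qed

theorem nonvanishing_massey:
  fixes a b g :: "(nat \<times> bool) list" and p q r s :: nat and c :: complex
  defines "\<alpha> \<equiv> frame_monomial a" and "\<beta> \<equiv> frame_monomial b" and "\<gamma> \<equiv> cscale c (frame_monomial g)"
    and "\<eta>kk \<equiv> E (k, False) \<and>\<^sub>w E (k, True)"
  assumes a: "set a \<subseteq> idx" "length a = p + q" "unbarred a = p"
    and b: "set b \<subseteq> idx" "length b = r + s" "unbarred b = r"
    and g: "set g \<subseteq> idx" "int (length g) = int p + int r - 2 + (int q + int s - 2)"
      "int (unbarred g) = int p + int r - 2"
    and c: "c \<noteq> 0"
    and harm_\<alpha>: "bott_chern_harmonic A J k \<omega>\<^sub>0 (p + q) \<alpha>"
    and harm_\<beta>: "bott_chern_harmonic A J k \<omega>\<^sub>0 (r + s) \<beta>"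
    and \<alpha>\<beta>: "\<alpha> \<and>\<^sub>w \<beta> \<noteq> 0"
    and prim: "cscale ((- 1) ^ (p + q)) (\<alpha> \<and>\<^sub>w \<beta>) = del A J (delbar A J (\<eta>kk \<and>\<^sub>w \<gamma>))"
    and prim': "del A J (delbar A J (\<eta>kk \<and>\<^sub>w \<gamma>)) = del A J (delbar A J \<eta>kk) \<and>\<^sub>w \<gamma>"
    and \<gamma>\<beta>: "\<gamma> \<and>\<^sub>w \<beta> \<noteq> 0"
    and uniq: "\<forall>\<phi>\<in>biforms A J (invariant_forms A G (carrier G)) (int p + int r - 2) (int q + int s - 2).
           del A J (delbar A J \<eta>kk) \<and>\<^sub>w \<phi> \<noteq> 0 \<and>
           del A J (delbar A J \<eta>kk) \<and>\<^sub>w \<phi> \<in> form.span {\<alpha> \<and>\<^sub>w \<beta>} \<longrightarrow> (\<exists>z. \<phi> = cscale z \<gamma>)"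
  shows "nonvanishing_ABC_massey A J (invariant_forms A G \<Gamma>) (p, q) (r, s) (r, s) \<alpha> \<beta> \<beta>"
proof -
  let ?\<kappa> = "(k, False)" and ?\<kappa>' = "(k, True)"
  have cs0: "cscale z 0 = 0" for z :: complex by (simp add: cscale_def)
  have csinv: "cscale z (cscale z' \<omega>) = cscale (z * z') \<omega>" "cscale 1 \<omega> = \<omega>" for z z' and \<omega> :: "'m form"
    by (simp_all add: cscale_def fun_eq_iff)
  have cs_nz: "cscale z \<omega> \<noteq> 0 \<longleftrightarrow> z \<noteq> 0 \<and> \<omega> \<noteq> 0" for z and \<omega> :: "'m form"
    by (auto simp: cscale_def fun_eq_iff)
  have sgn: "(- 1 :: complex) ^ n \<noteq> 0" for n by simp
  note \<eta> = del_delbar_\<eta>kk[folded \<eta>kk_def]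
  have ab_d: "distinct (a @ b)" and ab_i: "set (a @ b) \<subseteq> idx"
  proof -
    show i: "set (a @ b) \<subseteq> idx" using a b by simp
    have "frame_monomial (a @ b) \<noteq> 0" using \<alpha>\<beta> by (simp add: \<alpha>_def \<beta>_def wedge_list_append)
    then show "distinct (a @ b)" using frame_monomial_nonzero[OF i] by blast
  qed
  have gb_d: "distinct (g @ b)"
  proof -
    have i: "set (g @ b) \<subseteq> idx" using g b by simp
    have "frame_monomial (g @ b) \<noteq> 0" using \<gamma>\<beta> c by (auto simp: \<gamma>_def \<beta>_def wedge_list_append wedge_cscale_left cs0)
    then show ?thesis using frame_monomial_nonzero[OF i] by blast
  qed
  let ?U = "?\<kappa> # ?\<kappa>' # g"
  have U_i: "set ?U \<subseteq> idx" using g k by auto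
  have f0: "\<eta>kk \<and>\<^sub>w \<gamma> = cscale c (frame_monomial ?U)"
    by (simp add: \<eta>kk_def \<gamma>_def wedge_cscale_right wedge_list_Cons wedge_assoc)
  have nz: "\<Psi> \<and>\<^sub>w \<gamma> \<noteq> 0"
    using prim \<alpha>\<beta> unfolding prim' \<eta> by (metis cs_nz sgn)
  have U_d: "distinct ?U"
  proof -
    have "frame_monomial ?U \<noteq> 0"
    proof
      assume "frame_monomial ?U = 0"
      then have "\<eta>kk \<and>\<^sub>w \<gamma> = 0" by (simp only: f0 cs0)
      then show False using nz prim' unfolding \<eta> by (simp only: delbar_zero del_zero)
    qed
    then show ?thesis using frame_monomial_nonzero[OF U_i] by blast
  qed
  have \<Psi>\<gamma>: "\<Psi> \<and>\<^sub>w \<gamma> = cscale ((- 1) ^ (p + q)) (\<alpha> \<and>\<^sub>w \<beta>)" using prim prim' \<eta> by simp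

  text \<open>The index set of \<open>\<gamma>\<close> is contained in that of \<open>\<alpha>\<close>, and the (2,2)-form is nonzero on the
    complement \<open>R\<close> of it in the index set of \<open>\<alpha> \<and> \<beta>\<close>.\<close>
  obtain R where R: "distinct R" "\<Psi> (map Z R) \<noteq> 0" "set R = (set a \<union> set b) - set g" and ga: "set g \<subseteq> set a"
  proof -
    have "(\<alpha> \<and>\<^sub>w \<beta>) (map Z (a @ b)) = 1"
      using frame_monomial_self[OF ab_i ab_d] by (simp add: \<alpha>_def \<beta>_def wedge_list_append)
    then have "(\<Psi> \<and>\<^sub>w \<gamma>) (map Z (a @ b)) \<noteq> 0"
      unfolding \<Psi>\<gamma> by (auto simp: cscale_def fun_eq_iff)
    then obtain S where S: "\<Psi> (nths (map Z (a @ b)) S) \<noteq> 0" "\<gamma> (nths (map Z (a @ b)) (- S)) \<noteq> 0"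
      by (rule wedge_nonzeroE)
    define R where "R = nths (a @ b) S"
    define h where "h = nths (a @ b) (- S)"
    have i: "set R \<subseteq> idx" "set h \<subseteq> idx" unfolding R_def h_def by (intro set_nths_idx ab_i)+
    have "frame_monomial g (map Z h) \<noteq> 0"
      using S(2) c unfolding nths_map h_def[symmetric] by (auto simp: \<gamma>_def cscale_def fun_eq_iff)
    then have mh: "mset h = mset g" by (rule frame_monomial_support[OF g(1) i(2)])
    have m: "mset R + mset g = mset (a @ b)" using mset_nths_split[of "a @ b" S] mh by (simp add: R_def h_def)
    then have "mset (R @ g) = mset (a @ b)" by simp
    then have Rg: "distinct (R @ g)" "set (R @ g) = set (a @ b)"
      using ab_d by (metis mset_eq_imp_distinct_iff, metis set_mset_mset)
    show ?thesis
    proof (rule that)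
      show "distinct R" using Rg by simp
      show "\<Psi> (map Z R) \<noteq> 0" using S(1) unfolding nths_map R_def .
      show "set R = (set a \<union> set b) - set g" using Rg by auto
      show "set g \<subseteq> set a" using Rg(2) gb_d by auto
    qed
  qed
  \<comment> \<open>The indices in R avoid k because contractions of \<Psi> with the directions of
    index k vanish, those of g because the product of g with both forms of index k is
    nonzero.\<close>
  have low: "set (a @ b) \<subseteq> {1..k - 1} \<times> UNIV"
  proof -
    have "set R \<subseteq> {1..k - 1} \<times> UNIV" using R ab_i by (intro \<Psi>_support) auto
    moreover have "set g \<subseteq> {1..k - 1} \<times> UNIV"
    proof
      fix x assume x: "x \<in> set g"
      obtain j e where je: "x = (j, e)" by (cases x)
      have "j \<noteq> k" using U_d x je by (cases e) auto
      then show "x \<in> {1..k - 1} \<times> UNIV" using x g(1) je by force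
    qed
    ultimately show ?thesis using R(3) by auto
  qed
  \<comment> \<open>Otherwise R would consist of indices of \<beta>, where harmonicity forces \<Psi>
    to vanish.\<close>
  have a_g: "\<not> set a \<subseteq> set g"
  proof
    assume "set a \<subseteq> set g"
    then have "set R \<subseteq> set b" using R(3) by auto
    then have "\<Psi> (map Z R) = 0"
      using low ab_d harm_\<beta> R(1) b by (intro harmonic_\<Psi>_zero[of b]) (auto simp: \<beta>_def)
    then show False using R(2) by blast
  qed
  \<comment> \<open>The same argument with the harmonicity of \<alpha>, since R would then consist
    of indices of \<alpha>.\<close>
  have b_ne: "b \<noteq> []"
  proof
    assume "b = []"
    then have "set R \<subseteq> set a" using R(3) by auto
    then have "\<Psi> (map Z R) = 0"
      using low ab_d harm_\<alpha> R(1) a by (intro harmonic_\<Psi>_zero[of a]) (auto simp: \<alpha>_def)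
    then show False using R(2) by blast
  qed
  have \<beta>\<beta>: "\<beta> \<and>\<^sub>w \<beta> = 0"
  proof -
    have "\<not> distinct (b @ b)" using b_ne by (cases b) auto
    then have "frame_monomial (b @ b) = 0" using frame_monomial_nonzero[of "b @ b"] b by auto
    then show ?thesis by (simp add: \<beta>_def wedge_list_append)
  qed
  have \<alpha>_c: "const_form (p + q) \<alpha>" and \<beta>_c: "const_form (r + s) \<beta>"
    using const_form_wedge_list[OF a(1)] const_form_wedge_list[OF b(1)] a b by (simp_all add: \<alpha>_def \<beta>_def)
  have \<gamma>_c: "const_form (length g) \<gamma>"
    unfolding \<gamma>_def by (intro const_form_intros const_form_wedge_list g)
  let ?\<Lambda> = "biforms A J (invariant_forms A G (carrier G)) (int p + int r - 2) (int q + int s - 2)"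
  have \<gamma>_\<Lambda>: "\<gamma> \<in> ?\<Lambda>"
    by (rule const_form_biforms[OF \<gamma>_c])
      (use g in \<open>simp_all add: \<gamma>_def bicomponent_cscale bicomponent_frame_monomial\<close>)
  \<comment> \<open>Uniqueness up to a constant becomes uniqueness once the product with \<Psi> is
    prescribed: comparing the products shows that the constant is 1.\<close>
  have unique: "\<phi> = \<gamma>" if \<phi>: "\<phi> \<in> ?\<Lambda>" and eq: "\<Psi> \<and>\<^sub>w \<phi> = \<Psi> \<and>\<^sub>w \<gamma>" for \<phi>
  proof -
    have "\<Psi> \<and>\<^sub>w \<phi> \<in> form.span {\<alpha> \<and>\<^sub>w \<beta>}"
      unfolding eq \<Psi>\<gamma> by (intro form.span_scale form.span_base) simp
    moreover have "\<Psi> \<and>\<^sub>w \<phi> \<noteq> 0" unfolding eq by (rule nz)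
    ultimately obtain z where z: "\<phi> = cscale z \<gamma>"
      using bspec[OF uniq \<phi>] unfolding \<eta> by blast
    have "cscale (z - 1) (\<Psi> \<and>\<^sub>w \<gamma>) = \<Psi> \<and>\<^sub>w \<phi> - \<Psi> \<and>\<^sub>w \<gamma>"
      unfolding z wedge_cscale_right by (simp add: cscale_def fun_eq_iff algebra_simps)
    then have "cscale (z - 1) (\<Psi> \<and>\<^sub>w \<gamma>) = 0" using eq by simp
    then have "z = 1" using nz cs_nz by auto
    then show ?thesis using z csinv by simp
  qed

  \<comment> \<open>The component of the mean along both directions of index k. It drops one from
    each of p + r - 1 and q + s - 1, so it lands in the space to which the uniqueness hypothesis
    refers; forms of the bidegree of a primitive have total degree
    \<open>length g + 2\<close>.\<close>
  define \<Phi> where "\<Phi> = (\<lambda>w. \<iota> ?\<kappa>' (\<iota> ?\<kappa> (av (length g + 2) w)))"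
  have \<Phi>: "\<Phi> w \<in> ?\<Lambda>" "\<Psi> \<and>\<^sub>w \<Phi> w = av (Suc (Suc (length g + 2))) (del A J (delbar A J w))"
    "const_form (length g) (\<Phi> w)" "\<Phi> w (map Z g) = (\<lambda>_. I (w (map Z ?U)))" "periodic_form (length g + 2) w"
    if w: "w \<in> biforms A J (invariant_forms A G \<Gamma>) (int p + int r - 1) (int q + int s - 1)" for w
  proof -
    have n: "nat (int p + int r - 1 + (int q + int s - 1)) = length g + 2" using g(2) by linarith
    have "w \<in> invariant_forms A G \<Gamma> (length g + 2)" using w unfolding biforms_def n by blast
    then show pw: "periodic_form (length g + 2) w" by (rule invariant_periodic)
    note wf = periodic_form_forms[OF pw]
    have cw: "const_form (Suc (Suc (length g))) (av (length g + 2) w)" using av_const_form[OF wf] by simp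
    show c\<Phi>: "const_form (length g) (\<Phi> w)"
      unfolding \<Phi>_def by (intro const_form_contr cw k_idx)
    show "\<Psi> \<and>\<^sub>w \<Phi> w = av (Suc (Suc (length g + 2))) (del A J (delbar A J w))"
      unfolding \<Phi>_def av_del_delbar[OF pw] ..
    have "\<Phi> w (map Z g) = av (length g + 2) w (map Z ?U)" by (simp add: \<Phi>_def contr_def)
    also have "\<dots> = (\<lambda>_. I (w (map Z ?U)))" by (rule av_Z[OF U_i]) simp
    finally show "\<Phi> w (map Z g) = (\<lambda>_. I (w (map Z ?U)))" .
    have kk: "k \<in> {1..k}" using k by simp
    have T: "T (int p + int r - 1) (int q + int s - 1) (av (length g + 2) w) = av (length g + 2) w"
    proof -
      have "T (int p + int r - 1) (int q + int s - 1) w = w" using w unfolding biforms_def by blast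
      then show ?thesis unfolding av_bicomponent[OF wf, symmetric] by (rule arg_cong)
    qed
    have "T (int p + int r - 2) (int q + int s - 2) (\<Phi> w) = \<Phi> w"
    proof -
      note awf = const_form_forms[OF cw]
      have "\<iota> ?\<kappa>' (\<iota> ?\<kappa> (T (int p + int r - 1) (int q + int s - 1) (av (length g + 2) w))) =
          T (int p + int r - 1 - 1) (int q + int s - 1 - 1) (\<iota> ?\<kappa>' (\<iota> ?\<kappa> (av (length g + 2) w)))"
        unfolding contr_bicomponent_Z(1)[OF awf kk] contr_bicomponent_Z(2)[OF contr_forms[OF awf Z_VF[OF k_idx]] kk] ..
      then show ?thesis unfolding T \<Phi>_def by simp
    qed
    then show "\<Phi> w \<in> ?\<Lambda>" by (intro const_form_biforms[OF c\<Phi>]) (use g in auto)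
  qed
  have \<gamma>g: "\<gamma> (map Z g) = (\<lambda>_. c)"
    using frame_monomial_self[OF g(1)] U_d by (simp add: \<gamma>_def cscale_def)
  \<comment> \<open>The value is the same for every primitive f: its mean has the component \<gamma>
    by uniqueness. Hence the final contradiction does not depend on the chosen primitives.\<close>
  have I_f: "I (f (map Z ?U)) = c"
    if f: "f \<in> biforms A J (invariant_forms A G \<Gamma>) (int p + int r - 1) (int q + int s - 1)"
      and eq: "\<alpha> \<and>\<^sub>w \<beta> = cscale ((- 1) ^ (p + q)) (del A J (delbar A J f))" for f
  proof -
    have "del A J (delbar A J f) = cscale ((- 1) ^ (p + q)) (\<alpha> \<and>\<^sub>w \<beta>)"
      unfolding eq csinv by (simp add: csinv flip: power_add mult_2)
    also have "\<dots> = \<Psi> \<and>\<^sub>w \<gamma>" by (rule \<Psi>\<gamma>[symmetric])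
    finally have "\<Psi> \<and>\<^sub>w \<Phi> f = av (4 + length g) (\<Psi> \<and>\<^sub>w \<gamma>)" using \<Phi>(2)[OF f] by (simp add: eval_nat_numeral)
    also have "\<dots> = \<Psi> \<and>\<^sub>w \<gamma>" by (intro av_of_const const_form_wedge \<Psi>_const_form \<gamma>_c)
    finally have "\<Phi> f = \<gamma>" by (rule unique[OF \<Phi>(1)[OF f]])
    then have "(\<lambda>_ :: 'm. I (f (map Z ?U))) = (\<lambda>_. c)" using \<Phi>(4)[OF f] \<gamma>g by simp
    then show ?thesis by (simp add: fun_eq_iff)
  qed
  have I_y: "I (y (map Z ?U)) = 0"
    if "y \<in> aeppli_cocycles A J (invariant_forms A G \<Gamma>) (int p + int r - 1) (int q + int s - 1)" for y
  proof -
    have y: "y \<in> biforms A J (invariant_forms A G \<Gamma>) (int p + int r - 1) (int q + int s - 1)"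
      and dd: "del A J (delbar A J y) = 0" using that by (auto simp: aeppli_cocycles_def)
    have "\<Psi> \<and>\<^sub>w \<Phi> y = 0" unfolding \<Phi>(2)[OF y] dd by (rule av_zero)
    \<comment> \<open>The product of \<open>\<Phi> y\<close> with \<Psi> is 0, so uniqueness says
      nothing about \<open>\<Phi> y\<close> directly. Adding \<gamma> gives a form with nonzero
      product in the span.\<close>
    then have 1: "\<Psi> \<and>\<^sub>w (\<Phi> y + \<gamma>) = \<Psi> \<and>\<^sub>w \<gamma>" by (simp only: wedge_add_right add_0)
    have "\<Phi> y + \<gamma> \<in> ?\<Lambda>"
    proof (rule const_form_biforms)
      show "const_form (length g) (\<Phi> y + \<gamma>)" by (intro const_form_intros \<Phi>(3) y \<gamma>_c)
      show "T (int p + int r - 2) (int q + int s - 2) (\<Phi> y + \<gamma>) = \<Phi> y + \<gamma>"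
        using \<Phi>(1)[OF y] \<gamma>_\<Lambda> unfolding biforms_def bicomponent_add by auto
    qed (use g in simp)
    then have "\<Phi> y + \<gamma> = \<gamma>" using unique 1 by blast
    then have "\<Phi> y = 0" by (simp only: add_cancel_left_left)
    then have "(\<lambda>_ :: 'm. I (y (map Z ?U))) = 0" using \<Phi>(4)[OF y] by simp
    then show ?thesis by (simp add: fun_eq_iff)
  qed

  let ?Q = "?\<kappa> # ?\<kappa>' # (g @ b)"
  have Q: "set (?U @ b) \<subseteq> idx" "distinct (?U @ b)"
  proof -
    show "set (?U @ b) \<subseteq> idx" using U_i b by simp
    have "(k, e) \<notin> set b" for e using low k by auto
    then show "distinct (?U @ b)" using U_d gb_d by auto
  qed
  \<comment> \<open>A nonzero term would place all indices of \<alpha> in Q. They are neither k nor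
    indices of \<beta>, so they would all be indices of \<gamma>, which \<open>a_g\<close>
    excludes.\<close>
  have \<alpha>_Q: "(\<alpha> \<and>\<^sub>w x) (map Z ?Q) = 0" for x
  proof (rule ccontr)
    assume "(\<alpha> \<and>\<^sub>w x) (map Z ?Q) \<noteq> 0"
    then obtain S where "\<alpha> (nths (map Z ?Q) S) \<noteq> 0" by (rule wedge_nonzeroE)
    then have "mset (nths ?Q S) = mset a"
      unfolding \<alpha>_def using Q(1) by (intro frame_monomial_support a set_nths_idx) (simp_all only: nths_map append_Cons not_False_eq_True)
    then have "set a = set (nths ?Q S)" by (metis set_mset_mset)
    then have "set a \<subseteq> set ?Q" using set_nths_subset[of ?Q S] by simp
    moreover have "(k, e) \<notin> set a" for e using low k by auto
    ultimately have "set a \<subseteq> set g \<union> set b" by auto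
    then show False using a_g ab_d by auto
  qed
  \<comment> \<open>The monomial \<beta> is nonzero only on rearrangements of b, so the last block
    of Q goes to \<beta> and the rest to x, without sign.\<close>
  have \<beta>_Q: "(x \<and>\<^sub>w \<beta>) (map Z ?Q) = x (map Z ?U)" for x
  proof -
    have "(x \<and>\<^sub>w \<beta>) (map Z (?U @ b)) = x (map Z ?U) * \<beta> (map Z b)"
    proof (rule wedge_append_right[OF Q])
      fix ws assume "set ws \<subseteq> set (?U @ b)" "\<beta> (map Z ws) \<noteq> 0"
      then have "mset ws = mset b"
        unfolding \<beta>_def using Q(1) by (intro frame_monomial_support b) auto
      then show "set ws = set b" by (metis set_mset_mset)
    qed
    moreover have "\<beta> (map Z b) = 1" unfolding \<beta>_def using ab_d by (intro frame_monomial_self b) simp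
    ultimately show ?thesis by simp
  qed

  show ?thesis
    unfolding nonvanishing_ABC_massey_def prod.case
  proof (intro conjI allI impI)
    show "\<alpha> \<in> bott_chern_cocycles A J (invariant_forms A G \<Gamma>) (int p) (int q)"
      unfolding \<alpha>_def by (rule monomial_cocycle[OF a]) (use harm_\<alpha> in \<open>simp add: bott_chern_harmonic_def \<alpha>_def\<close>)
    show "\<beta> \<in> bott_chern_cocycles A J (invariant_forms A G \<Gamma>) (int r) (int s)"
      unfolding \<beta>_def by (rule monomial_cocycle[OF b]) (use harm_\<beta> in \<open>simp add: bott_chern_harmonic_def \<beta>_def\<close>)
    then show "\<beta> \<in> bott_chern_cocycles A J (invariant_forms A G \<Gamma>) (int r) (int s)" .
    have "\<eta>kk \<and>\<^sub>w \<gamma> \<in> biforms A J (invariant_forms A G \<Gamma>) (int p + int r - 1) (int q + int s - 1)"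
    proof (rule const_form_biforms)
      show "const_form (length ?U) (\<eta>kk \<and>\<^sub>w \<gamma>)"
        unfolding f0 by (intro const_form_intros const_form_wedge_list U_i)
      have "int (unbarred ?U) = int p + int r - 1" using g by (simp add: unbarred_def)
      then show "T (int p + int r - 1) (int q + int s - 1) (\<eta>kk \<and>\<^sub>w \<gamma>) = \<eta>kk \<and>\<^sub>w \<gamma>"
        unfolding f0 bicomponent_cscale bicomponent_frame_monomial[OF U_i] using g by simp
    qed (use g in simp)
    \<comment> \<open>As \<beta> has positive degree, its square is 0 and 0 serves as the primitive
      of the second product.\<close>
    moreover have "0 \<in> biforms A J (invariant_forms A G \<Gamma>) (int r + int r - 1) (int s + int s - 1)"
      using const_form_invariant[OF const_form_intros(1)] by (simp add: biforms_def bicomponent_zero)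
    moreover have "\<alpha> \<and>\<^sub>w \<beta> = cscale ((- 1) ^ (p + q)) (del A J (delbar A J (\<eta>kk \<and>\<^sub>w \<gamma>)))"
      unfolding prim[symmetric] csinv by (simp add: csinv flip: power_add mult_2)
    moreover have "\<beta> \<and>\<^sub>w \<beta> = cscale ((- 1) ^ (r + s)) (del A J (delbar A J 0))"
      by (simp only: \<beta>\<beta> delbar_zero del_zero cs0)
    ultimately show "\<exists>f h. massey_primitives A J (invariant_forms A G \<Gamma>) (p, q) (r, s) (r, s) \<alpha> \<beta> \<beta> f h"
      unfolding massey_primitives_def prod.case by blast
  next
    fix f h
    assume prims: "massey_primitives A J (invariant_forms A G \<Gamma>) (p, q) (r, s) (r, s) \<alpha> \<beta> \<beta> f h"
    let ?m = "cscale ((- 1) ^ (p + q)) (\<alpha> \<and>\<^sub>w h) - cscale ((- 1) ^ (r + s)) (f \<and>\<^sub>w \<beta>)"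
    let ?P = "int p + int r + int r - 1" and ?R = "int q + int s + int s - 1"
    show "aeppli_class A J (invariant_forms A G \<Gamma>) ?P ?R ?m
       \<notin> massey_indeterminacy A J (invariant_forms A G \<Gamma>) (p, q) (r, s) (r, s) \<alpha> \<beta>"
    proof
      assume "aeppli_class A J (invariant_forms A G \<Gamma>) ?P ?R ?m
         \<in> massey_indeterminacy A J (invariant_forms A G \<Gamma>) (p, q) (r, s) (r, s) \<alpha> \<beta>"
      then obtain x y where cls: "aeppli_class A J (invariant_forms A G \<Gamma>) ?P ?R ?m =
          aeppli_class A J (invariant_forms A G \<Gamma>) ?P ?R (\<alpha> \<and>\<^sub>w x + \<beta> \<and>\<^sub>w y)"
        and y: "y \<in> aeppli_cocycles A J (invariant_forms A G \<Gamma>) (int p + int r - 1) (int q + int s - 1)"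
        unfolding massey_indeterminacy_def prod.case by blast
      have z: "0 \<in> biforms A J (invariant_forms A G \<Gamma>) u v" for u v
        using const_form_invariant[OF const_form_intros(1)] by (simp add: biforms_def bicomponent_zero)
      \<comment> \<open>A class contains its representative, with both correction terms 0; so
        equality of the two classes presents the representative as an element of the other
        coset.\<close>
      have "?m = ?m + del A J 0 + delbar A J 0" by (simp only: del_zero delbar_zero add_0_right)
      then have "?m \<in> aeppli_class A J (invariant_forms A G \<Gamma>) ?P ?R ?m"
        unfolding aeppli_class_def using z by blast
      then obtain \<mu> \<nu> where m: "?m = \<alpha> \<and>\<^sub>w x + \<beta> \<and>\<^sub>w y + del A J \<mu> + delbar A J \<nu>"
        and \<mu>: "\<mu> \<in> biforms A J (invariant_forms A G \<Gamma>) (?P - 1) ?R"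
        and \<nu>: "\<nu> \<in> biforms A J (invariant_forms A G \<Gamma>) ?P (?R - 1)"
        unfolding cls unfolding aeppli_class_def by blast
      have f: "f \<in> biforms A J (invariant_forms A G \<Gamma>) (int p + int r - 1) (int q + int s - 1)"
        "\<alpha> \<and>\<^sub>w \<beta> = cscale ((- 1) ^ (p + q)) (del A J (delbar A J f))"
        using prims by (auto simp: massey_primitives_def)
      have yb: "y \<in> biforms A J (invariant_forms A G \<Gamma>) (int p + int r - 1) (int q + int s - 1)"
        using y by (simp add: aeppli_cocycles_def)
      have gby: "set (g @ b) \<subseteq> idx" using g b by simp
      have "periodic_form (nat (?P - 1 + ?R)) \<mu>" "periodic_form (nat (?P + (?R - 1))) \<nu>"
        using \<mu> \<nu> by (auto simp: biforms_def intro: invariant_periodic)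
      then have 0: "I (del A J \<mu> (map Z ?Q)) = 0" "I (delbar A J \<nu> (map Z ?Q)) = 0"
        using I_del_delbar_central[OF _ gby] by blast+
      \<comment> \<open>Moves \<beta> to the right, where \<open>\<beta>_Q\<close> applies; the sign
        does not matter as the mean of y on U is 0.\<close>
      have comm: "\<beta> \<and>\<^sub>w y = cscale ((- 1) ^ ((r + s) * (length g + 2))) (y \<and>\<^sub>w \<beta>)"
        by (rule wedge_commute_sign[OF grade_sign_form[OF const_form_forms[OF \<beta>_c]]
              grade_sign_form[OF periodic_form_forms[OF \<Phi>(5)[OF yb]]]])
      have I_cs: "I (cscale z w Xs) = z * I (w Xs)" for z w Xs by (simp add: cscale_def I_cmult)
      \<comment> \<open>The term with h is a multiple of \<alpha> and vanishes on Q for every h;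
        only the primitive f contributes.\<close>
      have "I (?m (map Z ?Q)) = - ((- 1) ^ (r + s) * c)"
        using I_f[OF f] by (simp only: minus_apply I_diff I_cs \<alpha>_Q \<beta>_Q I_zero mult_zero_right diff_0)
      moreover have "I (?m (map Z ?Q)) = 0"
        unfolding m comm using I_y[OF y] 0
        by (simp only: plus_fun_apply I_add I_cs \<alpha>_Q \<beta>_Q I_zero mult_zero_right add_0)
      ultimately show False using c by simp
    qed
  qed
qed

end

section \<open>The function algebra of a Lie group\<close>

locale smooth_lie_group =
  fixes G :: "('g::{t2_space,second_countable_topology}) monoid"
    and \<A> :: "('g, 'e::euclidean_space) atlas"
  assumes lie: "lie_group G \<A>"
begin

abbreviation "A \<equiv> smooth_functions \<A>"
abbreviation gmult (infixl "\<cdot>" 70) where "x \<cdot> y \<equiv> x \<otimes>\<^bsub>G\<^esub> y"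
abbreviation ginv where "ginv x \<equiv> inv\<^bsub>G\<^esub> x"

lemma grp: "group G" and carr: "carrier G = UNIV"
  and cont_mult: "continuous_on UNIV (\<lambda>(a, b). a \<cdot> b)"
  using lie by (auto simp: lie_group_def)

lemma atlas: "smooth_atlas \<A>"
  and mult_smooth: "\<forall>(U, \<phi>)\<in>\<A>. \<forall>(V, \<psi>)\<in>\<A>. \<forall>(W, \<xi>)\<in>\<A>.
        smooth_on (\<lambda>(x, y). \<xi> (inv_into U \<phi> x \<otimes>\<^bsub>G\<^esub> inv_into V \<psi> y))
          {(x, y). x \<in> \<phi> ` U \<and> y \<in> \<psi> ` V \<and> inv_into U \<phi> x \<otimes>\<^bsub>G\<^esub> inv_into V \<psi> y \<in> W}"
  using lie unfolding lie_group_def by blast+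

lemma gsimps [simp]: "\<one>\<^bsub>G\<^esub> \<cdot> x = x" "x \<cdot> \<one>\<^bsub>G\<^esub> = x" "ginv x \<cdot> x = \<one>\<^bsub>G\<^esub>" "x \<cdot> ginv x = \<one>\<^bsub>G\<^esub>"
  "ginv (ginv x) = x" "ginv \<one>\<^bsub>G\<^esub> = \<one>\<^bsub>G\<^esub>"
  and gassoc: "x \<cdot> y \<cdot> w = x \<cdot> (y \<cdot> w)"
proof -
  interpret group G by (rule grp)
  have c: "w \<in> carrier G" for w using carr by simp
  show "\<one>\<^bsub>G\<^esub> \<cdot> x = x" "x \<cdot> \<one>\<^bsub>G\<^esub> = x" "ginv x \<cdot> x = \<one>\<^bsub>G\<^esub>" "x \<cdot> ginv x = \<one>\<^bsub>G\<^esub>"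
    "ginv (ginv x) = x" "ginv \<one>\<^bsub>G\<^esub> = \<one>\<^bsub>G\<^esub>"
    by (simp_all only: l_one[OF c] r_one[OF c] l_inv[OF c] r_inv[OF c] inv_inv[OF c] inv_one)
  show "x \<cdot> y \<cdot> w = x \<cdot> (y \<cdot> w)" by (rule m_assoc[OF c c c])
qed

lemma gcancel [simp]: "ginv a \<cdot> (a \<cdot> x) = x" "a \<cdot> (ginv a \<cdot> x) = x"
  by (simp_all add: gassoc[symmetric])

lemma chartD:
  assumes "(U, \<phi>) \<in> \<A>"
  shows "open U" "open (\<phi> ` U)" "homeomorphism U (\<phi> ` U) \<phi> (inv_into U \<phi>)"
    "\<And>x. x \<in> U \<Longrightarrow> inv_into U \<phi> (\<phi> x) = x" "\<And>u. u \<in> \<phi> ` U \<Longrightarrow> \<phi> (inv_into U \<phi> u) = u"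
    "\<And>u. u \<in> \<phi> ` U \<Longrightarrow> inv_into U \<phi> u \<in> U"
    "continuous_on U \<phi>" "continuous_on (\<phi> ` U) (inv_into U \<phi>)"
proof -
  have "open U \<and> open (\<phi> ` U) \<and> homeomorphism U (\<phi> ` U) \<phi> (inv_into U \<phi>)"
  proof -
    have "\<forall>(U, \<phi>)\<in>\<A>. open U \<and> open (\<phi> ` U) \<and> homeomorphism U (\<phi> ` U) \<phi> (inv_into U \<phi>)"
      using atlas unfolding smooth_atlas_def by (elim conjE)
    from bspec[OF this assms] show ?thesis by simp
  qed
  then show "open U" "open (\<phi> ` U)" and h: "homeomorphism U (\<phi> ` U) \<phi> (inv_into U \<phi>)" by auto
  show "\<And>x. x \<in> U \<Longrightarrow> inv_into U \<phi> (\<phi> x) = x" using h by (auto simp: homeomorphism_def)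
  show "\<And>u. u \<in> \<phi> ` U \<Longrightarrow> \<phi> (inv_into U \<phi> u) = u" by (rule f_inv_into_f)
  show "\<And>u. u \<in> \<phi> ` U \<Longrightarrow> inv_into U \<phi> u \<in> U" by (rule inv_into_into)
  show "continuous_on U \<phi>" "continuous_on (\<phi> ` U) (inv_into U \<phi>)" using h by (auto simp: homeomorphism_def)
qed

lemma chart_ex: obtains U \<phi> where "(U, \<phi>) \<in> \<A>" "x \<in> U"
proof -
  have "(\<Union>(U, \<phi>)\<in>\<A>. U) = UNIV" using atlas unfolding smooth_atlas_def by (elim conjE)
  then have "x \<in> (\<Union>P\<in>\<A>. fst P)" by (simp add: case_prod_unfold)
  then obtain P where "P \<in> \<A>" "x \<in> fst P" by (rule UN_E)
  then show ?thesis using that[of "fst P" "snd P"] by simp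
qed

lemma chart_image_open:
  assumes "(U, \<phi>) \<in> \<A>" "open T" shows "open (\<phi> ` (U \<inter> T))"
proof -
  have "\<phi> ` (U \<inter> T) = \<phi> ` U \<inter> inv_into U \<phi> -` T"
  proof (intro subset_antisym subsetI)
    fix u assume "u \<in> \<phi> ` (U \<inter> T)"
    then show "u \<in> \<phi> ` U \<inter> inv_into U \<phi> -` T" using chartD(4)[OF assms(1)] by auto
  next
    fix u assume u: "u \<in> \<phi> ` U \<inter> inv_into U \<phi> -` T"
    then have "inv_into U \<phi> u \<in> U \<inter> T" "u = \<phi> (inv_into U \<phi> u)" using chartD(5,6)[OF assms(1)] by auto
    then show "u \<in> \<phi> ` (U \<inter> T)" by (rule rev_image_eqI)
  qed
  then show ?thesis using continuous_open_preimage[OF chartD(8,2)[OF assms(1)] assms(2)] by simp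
qed

lemma transition_smooth:
  assumes "(U, \<phi>) \<in> \<A>" "(V, \<psi>) \<in> \<A>"
  shows "smooth_on (\<psi> \<circ> inv_into U \<phi>) (\<phi> ` (U \<inter> V))"
proof -
  have "\<forall>(U, \<phi>)\<in>\<A>. \<forall>(V, \<psi>)\<in>\<A>. smooth_on (\<psi> \<circ> inv_into U \<phi>) (\<phi> ` (U \<inter> V))"
    using atlas unfolding smooth_atlas_def by (elim conjE)
  from bspec[OF this assms(1)] have "\<forall>(V, \<psi>)\<in>\<A>. smooth_on (\<psi> \<circ> inv_into U \<phi>) (\<phi> ` (U \<inter> V))"
    by simp
  from bspec[OF this assms(2)] show ?thesis by simp
qed

lemma A_chart: "f \<in> A \<Longrightarrow> (U, \<phi>) \<in> \<A> \<Longrightarrow> smooth_on (f \<circ> inv_into U \<phi>) (\<phi> ` U)"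
  unfolding smooth_functions_def mem_Collect_eq by (drule (1) bspec) simp

lemma A_I: "(\<And>U \<phi>. (U, \<phi>) \<in> \<A> \<Longrightarrow> smooth_on (f \<circ> inv_into U \<phi>) (\<phi> ` U)) \<Longrightarrow> f \<in> A"
  unfolding smooth_functions_def mem_Collect_eq by (rule ballI) (simp add: case_prod_unfold)

text \<open>Smoothness is demanded in all charts of the atlas, but near a given point one chart
  suffices, since the transition maps are smooth.\<close>

lemma A_localI:
  assumes "\<And>x. \<exists>U \<phi> T. (U, \<phi>) \<in> \<A> \<and> x \<in> U \<and> open T \<and> \<phi> x \<in> T \<and> T \<subseteq> \<phi> ` U \<and> smooth_on (f \<circ> inv_into U \<phi>) T"
  shows "f \<in> A"
proof -
  have "smooth_on (f \<circ> inv_into V \<psi>) (\<psi> ` V)" if V: "(V, \<psi>) \<in> \<A>" for V \<psi>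
  proof (rule smooth_on_local)
    fix v assume v: "v \<in> \<psi> ` V"
    define x where "x = inv_into V \<psi> v"
    have x: "x \<in> V" "\<psi> x = v" using chartD(5,6)[OF V v] by (simp_all add: x_def)
    obtain U \<phi> T where U: "(U, \<phi>) \<in> \<A>" "x \<in> U" and T: "open T" "\<phi> x \<in> T" "T \<subseteq> \<phi> ` U"
      and s: "smooth_on (f \<circ> inv_into U \<phi>) T" using assms[of x] by blast
    define N where "N = U \<inter> \<phi> -` T"
    have N: "open N" "x \<in> N"
      using continuous_open_preimage[OF chartD(7,1)[OF U(1)] T(1)] U T by (auto simp: N_def)
    let ?T = "\<psi> ` (V \<inter> N)"
    have oT: "open ?T" by (rule chart_image_open[OF V N(1)])
    have tr: "smooth_on (\<phi> \<circ> inv_into V \<psi>) ?T"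
    proof (rule smooth_on_subset[OF transition_smooth[OF V U(1)]])
      show "?T \<subseteq> \<psi> ` (V \<inter> U)" unfolding N_def by blast
    qed
    have im: "(\<phi> \<circ> inv_into V \<psi>) ` ?T \<subseteq> T"
    proof
      fix u assume "u \<in> (\<phi> \<circ> inv_into V \<psi>) ` ?T"
      then obtain y where "y \<in> V \<inter> N" "u = (\<phi> \<circ> inv_into V \<psi>) (\<psi> y)" by blast
      then show "u \<in> T" using chartD(4)[OF V] by (simp add: N_def)
    qed
    have "smooth_on (f \<circ> inv_into V \<psi>) ?T"
    proof (rule smooth_on_cong[OF oT _ smooth_on_compose[OF oT T(1) im tr s]])
      fix u assume "u \<in> ?T"
      then obtain y where "y \<in> V \<inter> N" "u = \<psi> y" by blast
      then show "(f \<circ> inv_into U \<phi>) ((\<phi> \<circ> inv_into V \<psi>) u) = (f \<circ> inv_into V \<psi>) u"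
        using chartD(4)[OF V] chartD(4)[OF U(1)] by (simp add: N_def)
    qed
    moreover have "v \<in> ?T" using x N by blast
    ultimately show "\<exists>T. open T \<and> v \<in> T \<and> smooth_on (f \<circ> inv_into V \<psi>) T" using oT by blast
  qed
  then show ?thesis by (rule A_I)
qed

lemma A_algebra: "function_algebra A"
proof
  fix f g assume f: "f \<in> A"
  show "(\<lambda>x. cnj (f x)) \<in> A"
  proof (rule A_I)
    fix U \<phi> assume U: "(U, \<phi>) \<in> \<A>"
    from smooth_on_compose_linear[OF chartD(2)[OF U] bounded_linear_cnj A_chart[OF f U]]
    show "smooth_on ((\<lambda>x. cnj (f x)) \<circ> inv_into U \<phi>) (\<phi> ` U)" by (simp add: o_def)
  qed
  assume g: "g \<in> A"
  show "f + g \<in> A"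
  proof (rule A_I)
    fix U \<phi> assume U: "(U, \<phi>) \<in> \<A>"
    from smooth_on_add[OF chartD(2)[OF U] A_chart[OF f U] A_chart[OF g U]]
    show "smooth_on ((f + g) \<circ> inv_into U \<phi>) (\<phi> ` U)" by (simp add: o_def)
  qed
  show "f * g \<in> A"
  proof (rule A_I)
    fix U \<phi> assume U: "(U, \<phi>) \<in> \<A>"
    from smooth_on_bilinear[OF chartD(2)[OF U] bounded_bilinear_mult A_chart[OF f U] A_chart[OF g U]]
    show "smooth_on ((f * g) \<circ> inv_into U \<phi>) (\<phi> ` U)" by (simp add: o_def)
  qed
next
  show "(\<lambda>_. c) \<in> A" for c
  proof (rule A_I)
    fix U \<phi> assume U: "(U, \<phi>) \<in> \<A>"
    from smooth_on_const[OF chartD(2)[OF U]]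
    show "smooth_on ((\<lambda>_. c) \<circ> inv_into U \<phi>) (\<phi> ` U)" by (simp add: o_def)
  qed
qed

sublocale function_algebra A by (rule A_algebra)

lemma A_continuous: "f \<in> A \<Longrightarrow> continuous_on UNIV f"
proof -
  assume f: "f \<in> A"
  have "isCont f x" for x
  proof -
    obtain U \<phi> where U: "(U, \<phi>) \<in> \<A>" "x \<in> U" by (rule chart_ex)
    have "continuous_on U (\<lambda>y. (f \<circ> inv_into U \<phi>) (\<phi> y))"
      by (rule continuous_on_compose2[OF smooth_on_continuous[OF A_chart[OF f U(1)]] chartD(7)[OF U(1)]]) auto
    then have "continuous_on U f" by (rule continuous_on_eq) (simp add: chartD(4)[OF U(1)])
    then show ?thesis using chartD(1)[OF U(1)] U(2) continuous_on_eq_continuous_at by blast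
  qed
  then show ?thesis by (simp add: continuous_at_imp_continuous_on)
qed

definition extend0 :: "'g set \<Rightarrow> ('g \<Rightarrow> 'e) \<Rightarrow> ('e \<Rightarrow> complex) \<Rightarrow> 'g \<Rightarrow> complex" where
  "extend0 U \<phi> h = (\<lambda>x. if x \<in> U then h (\<phi> x) else 0)"

text \<open>Inside the chart, h is smooth on \<open>O'\<close> and 0 off the closed ball. Outside
  the chart, the only danger are points that the support might approach, and the support is
  closed.\<close>

lemma extend0_A:
  assumes U: "(U, \<phi>) \<in> \<A>" and O: "open O'" "cball z r \<subseteq> O'" "O' \<subseteq> \<phi> ` U" and h: "smooth_on h O'"
    and out: "\<And>u. u \<notin> cball z r \<Longrightarrow> h u = 0"
  shows "extend0 U \<phi> h \<in> A"
proof (rule A_localI)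
  fix x
  show "\<exists>V \<psi> T. (V, \<psi>) \<in> \<A> \<and> x \<in> V \<and> open T \<and> \<psi> x \<in> T \<and> T \<subseteq> \<psi> ` V \<and> smooth_on (extend0 U \<phi> h \<circ> inv_into V \<psi>) T"
  proof (cases "x \<in> U")
    case True
    show ?thesis
    proof (cases "\<phi> x \<in> O'")
      case O'x: True
      have "smooth_on (extend0 U \<phi> h \<circ> inv_into U \<phi>) O'"
        by (rule smooth_on_cong[OF O(1) _ h]) (use O(3) chartD(5,6)[OF U] in \<open>auto simp: extend0_def\<close>)
      then show ?thesis using U True O O'x by blast
    next
      case False
      let ?T = "\<phi> ` U - cball z r"
      have T: "open ?T" using chartD(2)[OF U] by (intro open_Diff) auto
      have "smooth_on (extend0 U \<phi> h \<circ> inv_into U \<phi>) ?T"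
      proof (rule smooth_on_cong[OF T _ smooth_on_const[OF T, of 0]])
        fix u assume "u \<in> ?T"
        then have "u \<in> \<phi> ` U" "h u = 0" using out by auto
        then show "0 = (extend0 U \<phi> h \<circ> inv_into U \<phi>) u" using chartD(5,6)[OF U] by (simp add: extend0_def)
      qed
      moreover have "\<phi> x \<in> ?T" using True False O(2) by auto
      ultimately show ?thesis using U True T by blast
    qed
  next
    case False
    \<comment> \<open>A compact set in a Hausdorff space is closed, so its complement is a
      neighbourhood of x on which the extension is 0.\<close>
    let ?K = "inv_into U \<phi> ` cball z r"
    have "compact ?K"
      using O by (intro compact_continuous_image continuous_on_subset[OF chartD(8)[OF U]]) auto
    then have K: "closed ?K" by (rule compact_imp_closed)
    have xK: "x \<notin> ?K" using False O chartD(6)[OF U] by auto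
    obtain V \<psi> where V: "(V, \<psi>) \<in> \<A>" "x \<in> V" by (rule chart_ex)
    let ?T = "\<psi> ` (V \<inter> - ?K)"
    have T: "open ?T" using K by (intro chart_image_open[OF V(1)]) auto
    have "smooth_on (extend0 U \<phi> h \<circ> inv_into V \<psi>) ?T"
    proof (rule smooth_on_cong[OF T _ smooth_on_const[OF T, of 0]])
      fix u assume "u \<in> ?T"
      then obtain y where y: "u = \<psi> y" "y \<in> V" "y \<notin> ?K" by blast
      have "h (\<phi> y) = 0" if "y \<in> U"
      proof (rule out)
        show "\<phi> y \<notin> cball z r" using y(3) chartD(4)[OF U that] by (metis image_eqI)
      qed
      then show "0 = (extend0 U \<phi> h \<circ> inv_into V \<psi>) u" using y chartD(4)[OF V(1)] by (auto simp: extend0_def)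
    qed
    then show ?thesis using V T xK by blast
  qed
qed

lemma mult_chart_smooth:
  assumes U: "(U, \<phi>) \<in> \<A>" and V: "(V, \<psi>) \<in> \<A>" and W: "(W, \<xi>) \<in> \<A>" and f: "f \<in> A"
  defines "D \<equiv> {(x, y). x \<in> \<phi> ` U \<and> y \<in> \<psi> ` V \<and> inv_into U \<phi> x \<cdot> inv_into V \<psi> y \<in> W}"
  shows "open D" "smooth_on (\<lambda>(x, y). f (inv_into U \<phi> x \<cdot> inv_into V \<psi> y)) D"
proof -
  let ?m = "\<lambda>p. inv_into U \<phi> (fst p) \<cdot> inv_into V \<psi> (snd p)"
  have D: "D = (\<phi> ` U \<times> \<psi> ` V) \<inter> ?m -` W" by (auto simp: D_def)
  have "continuous_on (\<phi> ` U \<times> \<psi> ` V) (\<lambda>p. (inv_into U \<phi> (fst p), inv_into V \<psi> (snd p)))"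
    by (intro continuous_intros continuous_on_compose2[OF chartD(8)[OF U]] continuous_on_compose2[OF chartD(8)[OF V]]) auto
  from continuous_on_compose2[OF cont_mult this subset_UNIV]
  have "continuous_on (\<phi> ` U \<times> \<psi> ` V) ?m" by (simp add: case_prod_unfold)
  then show o: "open D" unfolding D
    by (rule continuous_open_preimage) (intro open_Times chartD(2)[OF U] chartD(2)[OF V] chartD(1)[OF W])+
  have "smooth_on (\<lambda>(x, y). \<xi> (inv_into U \<phi> x \<cdot> inv_into V \<psi> y)) D"
    using bspec[OF bspec[OF bspec[OF mult_smooth U, simplified] V, simplified] W] unfolding D_def by simp
  then have s: "smooth_on (\<lambda>p. \<xi> (?m p)) D" by (simp add: case_prod_unfold)
  have "smooth_on (\<lambda>p. (f \<circ> inv_into W \<xi>) (\<xi> (?m p))) D"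
    by (rule smooth_on_compose[OF o chartD(2)[OF W] _ s A_chart[OF f W]]) (auto simp: D)
  then show "smooth_on (\<lambda>(x, y). f (inv_into U \<phi> x \<cdot> inv_into V \<psi> y)) D"
    by (rule smooth_on_cong[OF o, rotated]) (auto simp: D chartD(4)[OF W])
qed

lemma smooth_on_fix_fst:
  fixes H :: "'a::euclidean_space \<times> 'b::euclidean_space \<Rightarrow> complex"
  assumes "open D" "smooth_on H D" shows "smooth_on (\<lambda>y. H (x, y)) {y. (x, y) \<in> D}" "open {y. (x, y) \<in> D}"
proof -
  have "open ((\<lambda>y. (x, y)) -` D)" by (intro open_vimage assms continuous_intros)
  then show o: "open {y. (x, y) \<in> D}" by (simp add: vimage_def)
  show "smooth_on (\<lambda>y. H (x, y)) {y. (x, y) \<in> D}"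
    by (rule smooth_on_compose[OF o assms(1) _ smooth_on_Pair[OF o smooth_on_const[OF o] smooth_on_bounded_linear[OF o bounded_linear_ident]] assms(2)]) auto
qed

lemma smooth_on_fix_snd:
  fixes H :: "'a::euclidean_space \<times> 'b::euclidean_space \<Rightarrow> complex"
  assumes "open D" "smooth_on H D" shows "smooth_on (\<lambda>x. H (x, y)) {x. (x, y) \<in> D}" "open {x. (x, y) \<in> D}"
proof -
  have "open ((\<lambda>x. (x, y)) -` D)" by (intro open_vimage assms continuous_intros)
  then show o: "open {x. (x, y) \<in> D}" by (simp add: vimage_def)
  show "smooth_on (\<lambda>x. H (x, y)) {x. (x, y) \<in> D}"
    by (rule smooth_on_compose[OF o assms(1) _ smooth_on_Pair[OF o smooth_on_bounded_linear[OF o bounded_linear_ident] smooth_on_const[OF o]] assms(2)]) auto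
qed

text \<open>Freeze the first variable of the smooth map that multiplication is in charts.\<close>

lemma A_translate: "f \<in> A \<Longrightarrow> (\<lambda>y. f (a \<cdot> y)) \<in> A"
proof (rule A_localI)
  fix x assume f: "f \<in> A"
  obtain U \<phi> where U: "(U, \<phi>) \<in> \<A>" "a \<in> U" by (rule chart_ex)
  obtain V \<psi> where V: "(V, \<psi>) \<in> \<A>" "x \<in> V" by (rule chart_ex)
  obtain W \<xi> where W: "(W, \<xi>) \<in> \<A>" "a \<cdot> x \<in> W" by (rule chart_ex)
  note m = mult_chart_smooth[OF U(1) V(1) W(1) f]
  let ?D = "{(x, y). x \<in> \<phi> ` U \<and> y \<in> \<psi> ` V \<and> inv_into U \<phi> x \<cdot> inv_into V \<psi> y \<in> W}"
  let ?T = "{y. (\<phi> a, y) \<in> ?D}"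
  have s: "smooth_on ((\<lambda>y. f (a \<cdot> y)) \<circ> inv_into V \<psi>) ?T"
    using smooth_on_fix_fst(1)[OF m, of "\<phi> a"] chartD(4)[OF U] by (simp add: o_def)
  have i: "\<psi> x \<in> ?T" using U V W chartD(4)[OF U] chartD(4)[OF V] by simp
  have t: "?T \<subseteq> \<psi> ` V" by auto
  show "\<exists>V \<psi> T. (V, \<psi>) \<in> \<A> \<and> x \<in> V \<and> open T \<and> \<psi> x \<in> T \<and> T \<subseteq> \<psi> ` V \<and>
      smooth_on ((\<lambda>y. f (a \<cdot> y)) \<circ> inv_into V \<psi>) T"
    by (rule exI[of _ V], rule exI[of _ \<psi>], rule exI[of _ ?T]) (intro conjI V smooth_on_fix_fst(2)[OF m] i t s)
qed

lemma A_translate_iff: "(\<lambda>y. f (a \<cdot> y)) \<in> A \<longleftrightarrow> f \<in> A"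
  using A_translate[of f a] A_translate[of "\<lambda>y. f (a \<cdot> y)" "ginv a"] by auto

lemma translate_VF:
  assumes X: "X \<in> VF" shows "vf_translate G a X \<in> VF"
proof -
  have 1: "X (\<lambda>y. f (a \<cdot> y) + g (a \<cdot> y)) = X (\<lambda>y. f (a \<cdot> y)) + X (\<lambda>y. g (a \<cdot> y))" if "f \<in> A" "g \<in> A" for f g
    using vf_add[OF X A_translate[OF that(1)] A_translate[OF that(2)], of a a] by (simp add: plus_fun_def)
  have 2: "X (\<lambda>y. f (a \<cdot> y) * g (a \<cdot> y)) = (\<lambda>y. f (a \<cdot> y)) * X (\<lambda>y. g (a \<cdot> y)) + (\<lambda>y. g (a \<cdot> y)) * X (\<lambda>y. f (a \<cdot> y))"
    if "f \<in> A" "g \<in> A" for f g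
    using vf_times[OF X A_translate[OF that(1)] A_translate[OF that(2)], of a a] by (simp add: times_fun_def)
  have 0: "vf_translate G a X f = (\<lambda>x. X (\<lambda>y. f (a \<cdot> y)) (ginv a \<cdot> x))" for f
    by (simp add: vf_translate_def)
  show ?thesis
    unfolding vector_fields_def mem_Collect_eq
  proof (intro conjI ballI allI impI)
    fix f g c assume f: "f \<in> A"
    show "vf_translate G a X f \<in> A" unfolding 0 by (rule A_translate[OF vf_range[OF X]])
    show "vf_translate G a X (\<lambda>x. c * f x) = (\<lambda>x. c * vf_translate G a X f x)"
      unfolding 0 vf_cmult[OF X A_translate[OF f]] ..
    assume g: "g \<in> A"
    show "vf_translate G a X (f + g) = vf_translate G a X f + vf_translate G a X g"
      unfolding 0 by (intro ext) (simp add: 1[OF f g])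
    show "vf_translate G a X (f * g) = f * vf_translate G a X g + g * vf_translate G a X f"
      unfolding 0 by (intro ext) (simp add: 2[OF f g])
  next
    fix f assume "f \<notin> A"
    then have "(\<lambda>y. f (a \<cdot> y)) \<notin> A" by (simp only: A_translate_iff not_False_eq_True)
    then show "vf_translate G a X f = 0" unfolding 0 vf_outside[OF X \<open>(\<lambda>y. f (a \<cdot> y)) \<notin> A\<close>] by (simp add: fun_eq_iff)
  qed
qed

end

section \<open>Amenability of nilpotent groups\<close>

context group
begin

text \<open>The uniform measure on the list \<open>ns\<close> is almost invariant under right translation by the elements of \<open>C\<close>.\<close>

definition almost_invariant :: "'a set \<Rightarrow> real \<Rightarrow> 'a list \<Rightarrow> bool" where
  "almost_invariant C \<epsilon> ns \<longleftrightarrow> (\<forall>c\<in>C. \<forall>F :: 'a \<Rightarrow> real. (\<forall>x. \<bar>F x\<bar> \<le> 1) \<longrightarrow>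
     \<bar>(\<Sum>n\<leftarrow>ns. F (n \<otimes> c)) - (\<Sum>n\<leftarrow>ns. F n)\<bar> \<le> \<epsilon> * length ns)"

text \<open>A Reiter condition for finite subsets of S. The almost invariant lists may leave S, and
  repetitions in a list count as weights, so that products of lists need no injectivity.\<close>

definition right_amenable :: "'a set \<Rightarrow> bool" where
  "right_amenable S \<longleftrightarrow> (\<forall>C \<epsilon>. finite C \<longrightarrow> C \<subseteq> S \<longrightarrow> 0 < \<epsilon> \<longrightarrow>
     (\<exists>ns. ns \<noteq> [] \<and> set ns \<subseteq> carrier G \<and> almost_invariant C \<epsilon> ns))"

lemma almost_invariantD:
  "almost_invariant C \<epsilon> ns \<Longrightarrow> c \<in> C \<Longrightarrow> (\<And>x. \<bar>F x\<bar> \<le> 1) \<Longrightarrow>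
    \<bar>(\<Sum>n\<leftarrow>ns. F (n \<otimes> c)) - (\<Sum>n\<leftarrow>ns. F n)\<bar> \<le> \<epsilon> * length ns"
  unfolding almost_invariant_def by blast

lemma almost_invariantI:
  fixes \<epsilon> :: real
  assumes "\<And>c F. c \<in> C \<Longrightarrow> (\<And>x. \<bar>F x :: real\<bar> \<le> 1) \<Longrightarrow>
    \<bar>(\<Sum>n\<leftarrow>ns. F (n \<otimes> c)) - (\<Sum>n\<leftarrow>ns. F n)\<bar> \<le> \<epsilon> * length ns"
  shows "almost_invariant C \<epsilon> ns"
  unfolding almost_invariant_def by (intro ballI allI impI assms) auto

lemma almost_invariant_mono:
  assumes "almost_invariant C \<epsilon> ns" "C' \<subseteq> C" "\<epsilon> \<le> \<epsilon>'"
  shows "almost_invariant C' \<epsilon>' ns"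
proof (rule almost_invariantI)
  fix c and F :: "'a \<Rightarrow> real" assume "c \<in> C'" "\<And>x. \<bar>F x\<bar> \<le> (1 :: real)"
  then have "\<bar>(\<Sum>n\<leftarrow>ns. F (n \<otimes> c)) - (\<Sum>n\<leftarrow>ns. F n)\<bar> \<le> \<epsilon> * length ns"
    using assms(2) by (intro almost_invariantD[OF assms(1)]) auto
  also have "\<dots> \<le> \<epsilon>' * length ns" using assms(3) by (intro mult_right_mono) auto
  finally show "\<bar>(\<Sum>n\<leftarrow>ns. F (n \<otimes> c)) - (\<Sum>n\<leftarrow>ns. F n)\<bar> \<le> \<epsilon>' * length ns" .
qed

lemma sum_list_cong': "(\<And>n. n \<in> set ns \<Longrightarrow> f n = g n) \<Longrightarrow> (\<Sum>n\<leftarrow>ns. f n) = (\<Sum>n\<leftarrow>ns. g n)"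
  by (induction ns) auto

text \<open>The constant K grows with the word length: translating by a product costs the sum of the
  costs, applied to F and to a translate of F, and inverting costs nothing because the same
  difference is read backwards.\<close>

lemma almost_invariant_generate:
  assumes "S \<subseteq> carrier G" "c \<in> generate G S"
  shows "\<exists>C K. finite C \<and> C \<subseteq> S \<and> 0 \<le> K \<and>
    (\<forall>ns \<epsilon>. set ns \<subseteq> carrier G \<longrightarrow> 0 < \<epsilon> \<longrightarrow> almost_invariant C \<epsilon> ns \<longrightarrow> almost_invariant {c} (K * \<epsilon>) ns)"
  using assms(2)
proof (induction rule: generate.induct)
  case one
  have "almost_invariant {\<one>} (0 * \<epsilon>) ns" if "set ns \<subseteq> carrier G" for ns \<epsilon>
  proof (rule almost_invariantI)
    fix c and F :: "'a \<Rightarrow> real" assume "c \<in> {\<one>}"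
    then have "(\<Sum>n\<leftarrow>ns. F (n \<otimes> c)) = (\<Sum>n\<leftarrow>ns. F n)"
      using that by (intro sum_list_cong') auto
    then show "\<bar>(\<Sum>n\<leftarrow>ns. F (n \<otimes> c)) - (\<Sum>n\<leftarrow>ns. F n)\<bar> \<le> 0 * \<epsilon> * length ns" by simp
  qed
  then show ?case by (intro exI[of _ "{}"] exI[of _ 0]) auto
next
  case (incl h)
  then show ?case by (intro exI[of _ "{h}"] exI[of _ 1]) auto
next
  case (inv h)
  have h: "h \<in> carrier G" using inv assms(1) by auto
  have "almost_invariant {inv h} (1 * \<epsilon>) ns" if ns: "set ns \<subseteq> carrier G" and ai: "almost_invariant {h} \<epsilon> ns" for ns \<epsilon>
  proof (rule almost_invariantI)
    fix c and F :: "'a \<Rightarrow> real" assume c: "c \<in> {inv h}" and F: "\<And>x. \<bar>F x\<bar> \<le> (1 :: real)"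
    have "\<bar>(\<Sum>n\<leftarrow>ns. F ((n \<otimes> h) \<otimes> inv h)) - (\<Sum>n\<leftarrow>ns. F (n \<otimes> inv h))\<bar> \<le> \<epsilon> * length ns"
      by (rule almost_invariantD[OF ai, of h "\<lambda>x. F (x \<otimes> inv h)"]) (use F in auto)
    moreover have "(\<Sum>n\<leftarrow>ns. F ((n \<otimes> h) \<otimes> inv h)) = (\<Sum>n\<leftarrow>ns. F n)"
      using ns h by (intro sum_list_cong') (auto simp: m_assoc)
    ultimately show "\<bar>(\<Sum>n\<leftarrow>ns. F (n \<otimes> c)) - (\<Sum>n\<leftarrow>ns. F n)\<bar> \<le> 1 * \<epsilon> * length ns"
      using c by simp
  qed
  then show ?case using inv by (intro exI[of _ "{h}"] exI[of _ 1]) auto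
next
  case (eng h1 h2)
  obtain C1 K1 where 1: "finite C1" "C1 \<subseteq> S" "0 \<le> K1"
    "\<And>ns \<epsilon>. set ns \<subseteq> carrier G \<Longrightarrow> 0 < \<epsilon> \<Longrightarrow> almost_invariant C1 \<epsilon> ns \<Longrightarrow> almost_invariant {h1} (K1 * \<epsilon>) ns"
    using eng.IH(1) by blast
  obtain C2 K2 where 2: "finite C2" "C2 \<subseteq> S" "0 \<le> K2"
    "\<And>ns \<epsilon>. set ns \<subseteq> carrier G \<Longrightarrow> 0 < \<epsilon> \<Longrightarrow> almost_invariant C2 \<epsilon> ns \<Longrightarrow> almost_invariant {h2} (K2 * \<epsilon>) ns"
    using eng.IH(2) by blast
  have h: "h1 \<in> carrier G" "h2 \<in> carrier G"
    using eng.hyps generate_in_carrier[OF assms(1)] by auto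
  have "almost_invariant {h1 \<otimes> h2} ((K1 + K2) * \<epsilon>) ns"
    if ns: "set ns \<subseteq> carrier G" and \<epsilon>: "0 < \<epsilon>" and ai: "almost_invariant (C1 \<union> C2) \<epsilon> ns" for ns \<epsilon>
  proof (rule almost_invariantI)
    fix c and F :: "'a \<Rightarrow> real" assume c: "c \<in> {h1 \<otimes> h2}" and F: "\<And>x. \<bar>F x\<bar> \<le> (1 :: real)"
    have a: "almost_invariant {h1} (K1 * \<epsilon>) ns" "almost_invariant {h2} (K2 * \<epsilon>) ns"
      using 1(4)[OF ns \<epsilon>] 2(4)[OF ns \<epsilon>] almost_invariant_mono[OF ai] by auto
    have "\<bar>(\<Sum>n\<leftarrow>ns. F ((n \<otimes> h1) \<otimes> h2)) - (\<Sum>n\<leftarrow>ns. F (n \<otimes> h2))\<bar> \<le> K1 * \<epsilon> * length ns"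
      by (rule almost_invariantD[OF a(1), of h1 "\<lambda>x. F (x \<otimes> h2)"]) (use F in auto)
    moreover have "\<bar>(\<Sum>n\<leftarrow>ns. F (n \<otimes> h2)) - (\<Sum>n\<leftarrow>ns. F n)\<bar> \<le> K2 * \<epsilon> * length ns"
      by (rule almost_invariantD[OF a(2), of h2 F]) (use F in auto)
    moreover have "(\<Sum>n\<leftarrow>ns. F ((n \<otimes> h1) \<otimes> h2)) = (\<Sum>n\<leftarrow>ns. F (n \<otimes> c))"
      using ns h c by (intro sum_list_cong') (auto simp: m_assoc)
    ultimately show "\<bar>(\<Sum>n\<leftarrow>ns. F (n \<otimes> c)) - (\<Sum>n\<leftarrow>ns. F n)\<bar> \<le> (K1 + K2) * \<epsilon> * length ns"
      by (simp add: algebra_simps)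
  qed
  then show ?case using 1 2 by (intro exI[of _ "C1 \<union> C2"] exI[of _ "K1 + K2"]) auto
qed

lemma right_amenable_generate:
  assumes S: "S \<subseteq> carrier G" and am: "right_amenable S" shows "right_amenable (generate G S)"
  unfolding right_amenable_def
proof (intro allI impI)
  fix C' :: "'a set" and \<epsilon> :: real assume C': "finite C'" "C' \<subseteq> generate G S" and \<epsilon>: "0 < \<epsilon>"
  have "\<exists>C K. finite C \<and> C \<subseteq> S \<and> 0 \<le> K \<and>
    (\<forall>ns \<epsilon>. set ns \<subseteq> carrier G \<longrightarrow> 0 < \<epsilon> \<longrightarrow> almost_invariant C \<epsilon> ns \<longrightarrow> almost_invariant C' (K * \<epsilon>) ns)"
    using C'
  proof (induction rule: finite_induct)
    case empty
    show ?case by (intro exI[of _ "{}"] exI[of _ 0]) (auto simp: almost_invariant_def)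
  next
    case (insert c C')
    then obtain C1 K1 where 1: "finite C1" "C1 \<subseteq> S" "0 \<le> K1"
      "\<And>ns \<epsilon>. set ns \<subseteq> carrier G \<Longrightarrow> 0 < \<epsilon> \<Longrightarrow> almost_invariant C1 \<epsilon> ns \<Longrightarrow> almost_invariant C' (K1 * \<epsilon>) ns"
      by blast
    have "c \<in> generate G S" using insert by auto
    from almost_invariant_generate[OF S this] obtain C2 K2 where 2: "finite C2" "C2 \<subseteq> S" "0 \<le> K2"
      "\<And>ns \<epsilon>. set ns \<subseteq> carrier G \<Longrightarrow> 0 < \<epsilon> \<Longrightarrow> almost_invariant C2 \<epsilon> ns \<Longrightarrow> almost_invariant {c} (K2 * \<epsilon>) ns"
      by blast
    have "almost_invariant (insert c C') (max K1 K2 * \<epsilon>) ns"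
      if ns: "set ns \<subseteq> carrier G" and \<epsilon>: "0 < \<epsilon>" and ai: "almost_invariant (C1 \<union> C2) \<epsilon> ns" for ns \<epsilon>
    proof -
      have "almost_invariant C' (K1 * \<epsilon>) ns" "almost_invariant {c} (K2 * \<epsilon>) ns"
        using 1(4)[OF ns \<epsilon>] 2(4)[OF ns \<epsilon>] almost_invariant_mono[OF ai] by auto
      then have "almost_invariant C' (max K1 K2 * \<epsilon>) ns" "almost_invariant {c} (max K1 K2 * \<epsilon>) ns"
        using \<epsilon> almost_invariant_mono[OF _ order_refl] by (auto intro: mult_right_mono)
      then show ?thesis unfolding almost_invariant_def by blast
    qed
    then show ?case using 1 2 by (intro exI[of _ "C1 \<union> C2"] exI[of _ "max K1 K2"]) auto
  qed
  then obtain C K where C: "finite C" "C \<subseteq> S" "0 \<le> K"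
    "\<And>ns \<epsilon>. set ns \<subseteq> carrier G \<Longrightarrow> 0 < \<epsilon> \<Longrightarrow> almost_invariant C \<epsilon> ns \<Longrightarrow> almost_invariant C' (K * \<epsilon>) ns"
    by blast
  \<comment> \<open>The summand 1 covers the case K = 0.\<close>
  have e: "0 < \<epsilon> / (K + 1)" using \<epsilon> C(3) by simp
  obtain ns where ns: "ns \<noteq> []" "set ns \<subseteq> carrier G" "almost_invariant C (\<epsilon> / (K + 1)) ns"
    using am C(1,2) e unfolding right_amenable_def by blast
  have "K * (\<epsilon> / (K + 1)) \<le> \<epsilon>" using C(3) \<epsilon> by (simp add: field_simps)
  then have "almost_invariant C' \<epsilon> ns" using almost_invariant_mono[OF C(4)[OF ns(2) e ns(3)]] by blast
  then show "\<exists>ns. ns \<noteq> [] \<and> set ns \<subseteq> carrier G \<and> almost_invariant C' \<epsilon> ns" using ns by blast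
qed

lemma right_amenable_mono: "right_amenable S \<Longrightarrow> T \<subseteq> S \<Longrightarrow> right_amenable T"
  unfolding right_amenable_def by blast

text \<open>Take a list almost invariant under the conjugates of C by powers of g, and translate it
  by the first L powers of g. For c in K, moving c past a power of g on its right-hand side of the
  product turns it into such a conjugate. For g itself the sum over the powers telescopes, and only
  two of the L blocks remain.\<close>

lemma right_amenable_insert:
  assumes K: "K \<subseteq> carrier G" "right_amenable K" and g: "g \<in> carrier G"
    and norm: "\<And>x. x \<in> K \<Longrightarrow> g \<otimes> x \<otimes> inv g \<in> K"
  shows "right_amenable (insert g K)"
  unfolding right_amenable_def
proof (intro allI impI)
  fix C :: "'a set" and \<epsilon> :: real assume C: "finite C" "C \<subseteq> insert g K" and \<epsilon>: "0 < \<epsilon>"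
  let ?conj = "\<lambda>a c. g [^] a \<otimes> c \<otimes> inv (g [^] (a :: nat))"
  have pw: "g [^] a \<in> carrier G" for a :: nat using g by simp
  have cK: "?conj a x \<in> K" if "x \<in> K" for a x
    using that
  proof (induction a)
    case 0
    then show ?case using K(1) by auto
  next
    case (Suc a)
    then have x: "x \<in> carrier G" using K(1) by auto
    have "?conj (Suc a) x = g \<otimes> (?conj a x) \<otimes> inv g"
      unfolding nat_pow_Suc2[OF g] using g pw[of a] x by (simp add: inv_mult_group m_assoc)
    then show ?case using norm Suc by simp
  qed
  \<comment> \<open>The two remaining blocks cost at most \<open>2 * length ns\<close>, to be
    compared with \<epsilon> times the total length \<open>L * length ns\<close>.\<close>
  obtain L :: nat where L: "2 / \<epsilon> < L" using reals_Archimedean2 by blast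
  have L0: "0 < L" using L \<epsilon> by (metis divide_pos_pos of_nat_0_less_iff order_less_trans zero_less_numeral)
  have L2: "2 \<le> \<epsilon> * L" using L \<epsilon> by (simp add: field_simps)
  define C1 where "C1 = (\<lambda>(a, c). ?conj a c) ` ({..<L} \<times> (C \<inter> K))"
  have "finite C1" "C1 \<subseteq> K" using C(1) cK by (auto simp: C1_def)
  then obtain ns where ns: "ns \<noteq> []" "set ns \<subseteq> carrier G" "almost_invariant C1 \<epsilon> ns"
    using K(2) \<epsilon> unfolding right_amenable_def by blast
  define ms where "ms = concat (map (\<lambda>a. map (\<lambda>n. n \<otimes> g [^] a) ns) [0..<L])"
  have sum_ms: "(\<Sum>n\<leftarrow>ms. F n) = (\<Sum>a<L. \<Sum>n\<leftarrow>ns. F (n \<otimes> g [^] a))" for F :: "'a \<Rightarrow> real"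
    unfolding ms_def by (induction L) (auto simp: o_def lessThan_Suc add.commute)
  have len: "length ms = L * length ns"
    unfolding ms_def by (simp add: length_concat o_def sum_list_triv)
  have "almost_invariant C \<epsilon> ms"
  proof (rule almost_invariantI)
    fix c and F :: "'a \<Rightarrow> real" assume c: "c \<in> C" and F: "\<And>x. \<bar>F x\<bar> \<le> (1 :: real)"
    show "\<bar>(\<Sum>n\<leftarrow>ms. F (n \<otimes> c)) - (\<Sum>n\<leftarrow>ms. F n)\<bar> \<le> \<epsilon> * length ms"
    proof (cases "c \<in> K")
      case True
      have "\<bar>(\<Sum>n\<leftarrow>ns. F (n \<otimes> g [^] a \<otimes> c)) - (\<Sum>n\<leftarrow>ns. F (n \<otimes> g [^] a))\<bar> \<le> \<epsilon> * length ns" if "a < L" for a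
      proof -
        have cc: "c \<in> carrier G" using True K(1) by auto
        have "?conj a c \<in> C1" using c True that by (auto simp: C1_def)
        from almost_invariantD[OF ns(3) this, of "\<lambda>x. F (x \<otimes> g [^] a)"] F
        have "\<bar>(\<Sum>n\<leftarrow>ns. F (n \<otimes> ?conj a c \<otimes> g [^] a)) - (\<Sum>n\<leftarrow>ns. F (n \<otimes> g [^] a))\<bar> \<le> \<epsilon> * length ns" by blast
        moreover have "n \<otimes> ?conj a c \<otimes> g [^] a = n \<otimes> g [^] a \<otimes> c" if "n \<in> carrier G" for n
          using that cc pw[of a] by (simp add: m_assoc)
        then have "(\<Sum>n\<leftarrow>ns. F (n \<otimes> ?conj a c \<otimes> g [^] a)) = (\<Sum>n\<leftarrow>ns. F (n \<otimes> g [^] a \<otimes> c))"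
          using ns(2) by (intro sum_list_cong') auto
        ultimately show ?thesis by simp
      qed
      then have "\<bar>\<Sum>a<L. (\<Sum>n\<leftarrow>ns. F (n \<otimes> g [^] a \<otimes> c)) - (\<Sum>n\<leftarrow>ns. F (n \<otimes> g [^] a))\<bar> \<le> (\<Sum>a<L. \<epsilon> * length ns)"
        by (intro order_trans[OF sum_abs] sum_mono) auto
      then show ?thesis by (simp add: sum_ms[of F] sum_ms[of "\<lambda>n. F (n \<otimes> c)"] len sum_subtractf mult_ac)
    next
      case False
      then have cg: "c = g" using c C(2) by auto
      have "(\<Sum>n\<leftarrow>ms. F (n \<otimes> c)) = (\<Sum>a<L. \<Sum>n\<leftarrow>ns. F (n \<otimes> g [^] Suc a))"
        unfolding cg sum_ms[of "\<lambda>n. F (n \<otimes> g)"]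
        using ns(2) g pw by (intro sum.cong sum_list_cong' refl) (auto simp: m_assoc subset_iff)
      then have "(\<Sum>n\<leftarrow>ms. F (n \<otimes> c)) - (\<Sum>n\<leftarrow>ms. F n) =
          (\<Sum>n\<leftarrow>ns. F (n \<otimes> g [^] L)) - (\<Sum>n\<leftarrow>ns. F (n \<otimes> g [^] (0 :: nat)))"
        unfolding sum_ms[of F] using sum_lessThan_telescope[of "\<lambda>a. \<Sum>n\<leftarrow>ns. F (n \<otimes> g [^] a)" L]
        by (simp add: sum_subtractf)
      moreover have bnd: "\<bar>\<Sum>n\<leftarrow>ns. F (h n)\<bar> \<le> length ns" for h
        using F by (induction ns) (auto intro: order_trans[OF abs_triangle_ineq] add_mono)
      note bnd[of "\<lambda>n. n \<otimes> g [^] L"] bnd[of "\<lambda>n. n \<otimes> g [^] (0 :: nat)"]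
      ultimately have "\<bar>(\<Sum>n\<leftarrow>ms. F (n \<otimes> c)) - (\<Sum>n\<leftarrow>ms. F n)\<bar> \<le> 2 * length ns" by linarith
      also have "\<dots> \<le> \<epsilon> * L * length ns" using mult_right_mono[OF L2, of "real (length ns)"] by simp
      finally show ?thesis by (simp add: len mult_ac)
    qed
  qed
  moreover have "set ms \<subseteq> carrier G" using ns(2) pw by (auto simp: ms_def)
  moreover have "ms \<noteq> []"
    using L0 ns(1) len by (metis length_0_conv mult_is_0 not_less_zero)
  ultimately show "\<exists>ns. ns \<noteq> [] \<and> set ns \<subseteq> carrier G \<and> almost_invariant C \<epsilon> ns" by blast
qed

lemma lower_central_series_carrier: "lower_central_series G n \<subseteq> carrier G"
proof (induction n)
  case (Suc n)
  have "{a \<otimes> b \<otimes> inv a \<otimes> inv b | a b. a \<in> lower_central_series G n \<and> b \<in> carrier G} \<subseteq> carrier G"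
    using Suc by auto
  then show ?case unfolding lower_central_series.simps using generate_in_carrier by blast
qed simp

text \<open>Only finite subsets matter, so the generators can be adjoined to the next term N one at
  a time. Conjugation preserves any subgroup containing N: the conjugate of x by g is the commutator
  of g and x, an element of N, times x.\<close>

lemma right_amenable_lower_central_series:
  assumes "right_amenable (lower_central_series G (Suc n))"
  shows "right_amenable (lower_central_series G n)"
proof -
  let ?N = "lower_central_series G (Suc n)"
  note cN = lower_central_series_carrier[of "Suc n"] and cn = lower_central_series_carrier[of n]
  have gen: "right_amenable (generate G (?N \<union> C))" if "finite C" "C \<subseteq> lower_central_series G n" for C
    using that
  proof (induction rule: finite_induct)
    case empty
    then show ?case using right_amenable_generate[OF cN assms] by simp
  next
    case (insert g C)
    let ?K = "generate G (?N \<union> C)"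
    have sub: "?N \<union> C \<subseteq> carrier G" using cN cn insert.prems by blast
    have K: "?K \<subseteq> carrier G" using generate_in_carrier[OF sub] by blast
    have Ksub: "subgroup ?K G" by (rule generate_is_subgroup[OF sub])
    have g: "g \<in> carrier G" "g \<in> lower_central_series G n" using insert.prems cn by auto
    have "right_amenable (insert g ?K)"
    proof (rule right_amenable_insert[OF K _ g(1)])
      show "right_amenable ?K" using insert by auto
      fix x assume x: "x \<in> ?K"
      then have xc: "x \<in> carrier G" using K by auto
      have "g \<otimes> x \<otimes> inv g \<otimes> inv x \<in> ?N"
        unfolding lower_central_series.simps(2) using g xc by (intro generate.incl) blast
      then have "g \<otimes> x \<otimes> inv g \<otimes> inv x \<in> ?K" by (intro generate.incl) simp
      then have "g \<otimes> x \<otimes> inv g \<otimes> inv x \<otimes> x \<in> ?K" using x by (rule subgroup.m_closed[OF Ksub])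
      moreover have "g \<otimes> x \<otimes> inv g \<otimes> inv x \<otimes> x = g \<otimes> x \<otimes> inv g" using g(1) xc by (simp add: m_assoc)
      ultimately show "g \<otimes> x \<otimes> inv g \<in> ?K" by simp
    qed
    then have "right_amenable (generate G (insert g ?K))" using K g by (intro right_amenable_generate) auto
    moreover have "generate G (?N \<union> insert g C) \<subseteq> generate G (insert g ?K)"
      by (rule mono_generate) (auto intro: generate.incl)
    ultimately show ?case by (rule right_amenable_mono)
  qed
  show ?thesis
    unfolding right_amenable_def
  proof (intro allI impI)
    fix C :: "'a set" and \<epsilon> :: real assume C: "finite C" "C \<subseteq> lower_central_series G n" "0 < \<epsilon>"
    have "C \<subseteq> generate G (?N \<union> C)" by (auto intro: generate.incl)
    then show "\<exists>ns. ns \<noteq> [] \<and> set ns \<subseteq> carrier G \<and> almost_invariant C \<epsilon> ns"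
      using gen[OF C(1,2)] C unfolding right_amenable_def by blast
  qed
qed

text \<open>Climb the lower central series from the trivial group, for which the list consisting of
  the unit is exactly invariant.\<close>

theorem right_amenable_nilpotent:
  assumes "nilpotent_group G" shows "right_amenable (carrier G)"
proof -
  obtain n where n: "lower_central_series G n = {\<one>}" using assms by (auto simp: nilpotent_group_def)
  have "right_amenable {\<one>}"
    unfolding right_amenable_def by (intro allI impI exI[of _ "[\<one>]"]) (auto simp: almost_invariant_def)
  then have "right_amenable (lower_central_series G (n - i))" if "i \<le> n" for i
    using that
  proof (induction i)
    case (Suc i)
    then have "Suc (n - Suc i) = n - i" by simp
    then show ?case using Suc right_amenable_lower_central_series[of "n - Suc i"] by simp
  qed (simp add: n)
  from this[of n] show ?thesis by simp
qed

text \<open>A lower bound valid at all points survives averaging over an almost invariant list,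
  whereas the mean of each single difference becomes small because \<open>F i\<close> is
  bounded.\<close>

theorem nilpotent_no_coboundary:
  assumes nil: "nilpotent_group G" and I: "finite I" and g: "\<And>i. i \<in> I \<Longrightarrow> g i \<in> carrier G"
    and F: "\<And>i x. i \<in> I \<Longrightarrow> \<bar>F i x\<bar> \<le> (M :: real)" and \<delta>: "0 < \<delta>"
  shows "\<exists>x\<in>carrier G. (\<Sum>i\<in>I. F i (x \<otimes> g i) - F i x) < \<delta>"
proof (rule ccontr)
  assume "\<not> ?thesis"
  then have ge: "\<delta> \<le> (\<Sum>i\<in>I. F i (x \<otimes> g i) - F i x)" if "x \<in> carrier G" for x using that by force
  define M' where "M' = max M 1"
  have M': "0 < M'" "\<bar>F i x\<bar> \<le> M'" if "i \<in> I" for i x using F[OF that, of x] by (auto simp: M'_def)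
  \<comment> \<open>Chosen so that \<open>card I\<close> errors of size M' \<epsilon> add up to less
    than \<delta>. Taking M' at least 1 and adding 1 to the cardinality keeps the denominator
    positive.\<close>
  define \<epsilon> where "\<epsilon> = \<delta> / (2 * M' * (card I + 1))"
  have M0: "0 < M'" by (simp add: M'_def)
  have \<epsilon>: "0 < \<epsilon>" using \<delta> M0 by (simp add: \<epsilon>_def)
  obtain ns where ns: "ns \<noteq> []" "set ns \<subseteq> carrier G" "almost_invariant (g ` I) \<epsilon> ns"
    using right_amenable_nilpotent[OF nil] I g \<epsilon> unfolding right_amenable_def by (metis finite_imageI image_subsetI)
  have b: "(\<Sum>n\<leftarrow>ns. F i (n \<otimes> g i) - F i n) \<le> M' * \<epsilon> * length ns" if i: "i \<in> I" for i
  proof -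
    have "\<bar>F i x / M'\<bar> \<le> 1" for x using M'(2)[OF i, of x] M0 by (simp add: abs_div)
    from almost_invariantD[OF ns(3) imageI[OF i], of "\<lambda>x. F i x / M'", OF this]
    have "(\<Sum>n\<leftarrow>ns. F i (n \<otimes> g i) / M') - (\<Sum>n\<leftarrow>ns. F i n / M') \<le> \<epsilon> * length ns" by linarith
    moreover have "(\<Sum>n\<leftarrow>ns. F i (n \<otimes> g i) / M') - (\<Sum>n\<leftarrow>ns. F i n / M') = (\<Sum>n\<leftarrow>ns. F i (n \<otimes> g i) - F i n) / M'"
      by (induction ns) (auto simp: field_simps add_divide_distrib diff_divide_distrib)
    ultimately show ?thesis using M0 by (simp add: field_simps)
  qed
  have "\<delta> * length ns = (\<Sum>n\<leftarrow>ns. \<delta>)" by (simp add: sum_list_triv)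
  also have "\<dots> \<le> (\<Sum>n\<leftarrow>ns. \<Sum>i\<in>I. F i (n \<otimes> g i) - F i n)"
    using ge ns(2) by (intro sum_list_mono) auto
  also have "\<dots> = (\<Sum>i\<in>I. \<Sum>n\<leftarrow>ns. F i (n \<otimes> g i) - F i n)"
    by (induction ns) (auto simp: sum.distrib)
  also have "\<dots> \<le> (\<Sum>i\<in>I. M' * \<epsilon> * length ns)" by (intro sum_mono b)
  also have "\<dots> = card I * (M' * \<epsilon>) * length ns" by simp
  also have "\<dots> < \<delta> * length ns"
  proof (rule mult_strict_right_mono)
    have "M' * (\<delta> / (2 * M' * x)) = \<delta> / (2 * x)" if "0 < x" for x
      using M0 that by (simp add: field_simps)
    then have "M' * \<epsilon> = \<delta> / (2 * (card I + 1))" by (simp add: \<epsilon>_def)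
    then have "card I * (M' * \<epsilon>) = \<delta> * (card I / (2 * (card I + 1)))" by simp
    also have "\<dots> < \<delta> * 1" using \<delta> by (intro mult_strict_left_mono) (auto simp: field_simps)
    finally show "card I * (M' * \<epsilon>) < \<delta>" by simp
  qed (use ns(1) in simp)
  finally show False by simp
qed

end

section \<open>Left-invariant vector fields\<close>

locale based_lie_group = smooth_lie_group G \<A>
  for G :: "('g::{t2_space,second_countable_topology}) monoid" and \<A> :: "('g, 'e::euclidean_space) atlas" +
  fixes U0 :: "'g set" and \<phi>0 :: "'g \<Rightarrow> 'e" and \<rho> :: real
  assumes chart0: "(U0, \<phi>0) \<in> \<A>" and one_U0: "\<one>\<^bsub>G\<^esub> \<in> U0" and \<rho>: "0 < \<rho>"
    and ball_U0: "ball (\<phi>0 \<one>\<^bsub>G\<^esub>) \<rho> \<subseteq> \<phi>0 ` U0"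
begin

abbreviation "e0 \<equiv> \<phi>0 \<one>\<^bsub>G\<^esub>"
abbreviation "inv0 \<equiv> inv_into U0 \<phi>0"
abbreviation "bmp \<equiv> bump e0 (\<rho> / 2)"

lemma e0_mem: "e0 \<in> \<phi>0 ` U0" using one_U0 by blast

lemma inv0_e0 [simp]: "inv0 e0 = \<one>\<^bsub>G\<^esub>" by (rule chartD(4)[OF chart0 one_U0])

definition D :: "('g \<Rightarrow> complex) \<Rightarrow> 'e \<Rightarrow> 'e \<Rightarrow> complex" where
  "D f u = frechet_derivative (f \<circ> inv0) (at u)"

lemma D_works:
  assumes "f \<in> A" "u \<in> \<phi>0 ` U0" shows "((f \<circ> inv0) has_derivative D f u) (at u)"
  unfolding D_def by (rule smooth_on_has_derivative[OF A_chart[OF assms(1) chart0] assms(2)])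

lemma D_unique: "((f \<circ> inv0) has_derivative f') (at u) \<Longrightarrow> D f u = f'"
  unfolding D_def using frechet_derivative_at by metis

lemma D_add: "f \<in> A \<Longrightarrow> g \<in> A \<Longrightarrow> u \<in> \<phi>0 ` U0 \<Longrightarrow> D (f + g) u v = D f u v + D g u v"
proof -
  assume a: "f \<in> A" "g \<in> A" "u \<in> \<phi>0 ` U0"
  have "((f + g) \<circ> inv0) = (\<lambda>x. (f \<circ> inv0) x + (g \<circ> inv0) x)" by (auto simp: fun_eq_iff)
  then have "D (f + g) u = (\<lambda>v. D f u v + D g u v)"
    using has_derivative_add[OF D_works[OF a(1,3)] D_works[OF a(2,3)]] by (intro D_unique) simp
  then show ?thesis by (rule fun_cong)
qed

lemma D_cmult: "f \<in> A \<Longrightarrow> u \<in> \<phi>0 ` U0 \<Longrightarrow> D (\<lambda>x. c * f x) u v = c * D f u v"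
proof -
  assume a: "f \<in> A" "u \<in> \<phi>0 ` U0"
  have "((\<lambda>x. c * f x) \<circ> inv0) = (\<lambda>x. c * (f \<circ> inv0) x)" by (auto simp: fun_eq_iff)
  then have "D (\<lambda>x. c * f x) u = (\<lambda>v. c * D f u v)"
    using has_derivative_mult_right[OF D_works[OF a]] by (intro D_unique) simp
  then show ?thesis by (rule fun_cong)
qed

lemma D_times: "f \<in> A \<Longrightarrow> g \<in> A \<Longrightarrow> u \<in> \<phi>0 ` U0 \<Longrightarrow>
  D (f * g) u v = f (inv0 u) * D g u v + g (inv0 u) * D f u v"
proof -
  assume a: "f \<in> A" "g \<in> A" "u \<in> \<phi>0 ` U0"
  have "((f * g) \<circ> inv0) = (\<lambda>x. (f \<circ> inv0) x * (g \<circ> inv0) x)" by (auto simp: fun_eq_iff)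
  then have "D (f * g) u = (\<lambda>v. (f \<circ> inv0) u * D g u v + D f u v * (g \<circ> inv0) u)"
    using has_derivative_mult[OF D_works[OF a(1,3)] D_works[OF a(2,3)]] by (intro D_unique) simp
  then show ?thesis by (auto simp: mult.commute dest: fun_cong)
qed

text \<open>The bump has half the radius, so that its closed support lies inside the open ball on
  which w is smooth.\<close>

lemma bump_extend:
  assumes "smooth_on w (ball e0 \<rho>)"
  shows "extend0 U0 \<phi>0 (\<lambda>u. bmp u * w u) \<in> A"
proof (rule extend0_A[OF chart0 open_ball _ ball_U0])
  show "cball e0 (\<rho> / 2) \<subseteq> ball e0 \<rho>" using \<rho> by auto
  show "smooth_on (\<lambda>u. bmp u * w u) (ball e0 \<rho>)"
    by (intro smooth_on_bilinear[OF open_ball bounded_bilinear_mult] bump_smooth assms open_ball)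
  show "bmp u * w u = 0" if "u \<notin> cball e0 (\<rho> / 2)" for u
    using that \<rho> bump_outside[of "\<rho> / 2" e0 u] by simp
qed

lemma smooth_D: "f \<in> A \<Longrightarrow> smooth_on (\<lambda>u. D f u v) (ball e0 \<rho>)"
  unfolding D_def by (rule smooth_on_subset[OF smooth_on_derivative[OF A_chart[OF _ chart0]] ball_U0])

text \<open>The partial derivative in direction b with weight w, cut off so as to be a derivation on
  the whole group.\<close>

definition coord_field :: "('e \<Rightarrow> complex) \<Rightarrow> 'e \<Rightarrow> 'g vf" where
  "coord_field w b f = (if f \<in> A then extend0 U0 \<phi>0 (\<lambda>u. bmp u * (w u * D f u b)) else 0)"

lemma coord_field_VF:
  assumes w: "smooth_on w (ball e0 \<rho>)" shows "coord_field w b \<in> VF"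
proof -
  have img: "x \<in> U0 \<Longrightarrow> \<phi>0 x \<in> \<phi>0 ` U0" for x by blast
  show ?thesis
    unfolding vector_fields_def mem_Collect_eq
  proof (intro conjI ballI allI impI)
    fix f g c assume f: "f \<in> A"
    show "coord_field w b f \<in> A"
      unfolding coord_field_def using f
      by (simp add: bump_extend smooth_on_bilinear[OF open_ball bounded_bilinear_mult w smooth_D])
    show "coord_field w b (\<lambda>x. c * f x) = (\<lambda>x. c * coord_field w b f x)"
      by (rule ext) (simp add: coord_field_def f cmult_mem extend0_def D_cmult)
    assume g: "g \<in> A"
    show "coord_field w b (f + g) = coord_field w b f + coord_field w b g"
      by (rule ext) (simp add: coord_field_def f g add_mem extend0_def D_add algebra_simps)
    show "coord_field w b (f * g) = f * coord_field w b g + g * coord_field w b f"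
      by (rule ext) (simp add: coord_field_def f g mult_mem extend0_def D_times chartD(4)[OF chart0] algebra_simps)
  qed (simp add: coord_field_def)
qed

definition cutoff :: "'g \<Rightarrow> complex" where
  "cutoff = extend0 U0 \<phi>0 (\<lambda>u. bmp u * 1)"

definition cutoff_coord :: "'e \<Rightarrow> 'g \<Rightarrow> complex" where
  "cutoff_coord b = extend0 U0 \<phi>0 (\<lambda>u. bmp u * complex_of_real (u \<bullet> b))"

lemma smooth_inner: "smooth_on (\<lambda>u. complex_of_real (u \<bullet> b)) (ball e0 \<rho>)"
  by (intro smooth_on_compose_linear[OF open_ball bounded_linear_of_real] smooth_on_bounded_linear[OF open_ball bounded_linear_inner_left])

lemma cutoff_A: "cutoff \<in> A" and cutoff_coord_A: "cutoff_coord b \<in> A"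
  unfolding cutoff_def cutoff_coord_def by (intro bump_extend smooth_on_const open_ball smooth_inner)+

lemma cutoff_one: "cutoff \<one>\<^bsub>G\<^esub> \<noteq> 0"
  using one_U0 \<rho> bump_center[of "\<rho> / 2"] by (simp add: cutoff_def extend0_def)

text \<open>Derivations are first-order operators: by Hadamard's lemma at p, \<open>f - f p\<close>
  is locally a sum of products of coordinate differences with smooth functions. Apply X and use that
  the coordinate differences vanish at p.\<close>

lemma VF_expand_point:
  assumes X: "X \<in> VF" and f: "f \<in> A" and p: "p \<in> U0" "bmp (\<phi>0 p) \<noteq> 0"
  shows "cutoff p * cutoff p * X f p =
    (\<Sum>b\<in>Basis. (X (cutoff_coord b) p - complex_of_real (\<phi>0 p \<bullet> b) * X cutoff p) * (cutoff p * D f (\<phi>0 p) b))"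
proof -
  let ?q = "\<phi>0 p"
  have q: "?q \<in> ball e0 \<rho>"
  proof -
    have "dist e0 ?q < \<rho> / 2" using bump_outside[of "\<rho> / 2" e0 ?q] p(2) \<rho> by force
    then show ?thesis using \<rho> by simp
  qed
  have F: "smooth_on (f \<circ> inv0) (ball e0 \<rho>)" by (rule smooth_on_subset[OF A_chart[OF f chart0] ball_U0])
  obtain g where g: "\<And>b. smooth_on (g b) (ball e0 \<rho>)" "\<And>b. g b ?q = D f ?q b"
    "\<And>x. x \<in> ball e0 \<rho> \<Longrightarrow> (f \<circ> inv0) x - (f \<circ> inv0) ?q = (\<Sum>b\<in>Basis. complex_of_real ((x - ?q) \<bullet> b) * g b x)"
    using hadamard[OF open_ball convex_ball q F] unfolding D_def by blast
  define G' where "G' = (\<lambda>b. extend0 U0 \<phi>0 (\<lambda>u. bmp u * g b u))"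
  have G'A: "G' b \<in> A" for b unfolding G'_def by (rule bump_extend[OF g(1)])
  define c where "c = f p"
  define lin where "lin = (\<lambda>b. cutoff_coord b - (\<lambda>x. complex_of_real (?q \<bullet> b) * cutoff x))"
  have linA: "lin b \<in> A" for b unfolding lin_def by (intro diff_mem cutoff_coord_A cmult_mem cutoff_A)
  have fc: "f - (\<lambda>_. c) \<in> A" by (intro diff_mem f const_mem)
  \<comment> \<open>Each factor on the right carries its own cutoff to be a function on the whole
    group, hence the square of the cutoff on the left; off the support of the bump both sides are
    0.\<close>
  have eq: "cutoff * cutoff * (f - (\<lambda>_. c)) = (\<Sum>b\<in>Basis. lin b * G' b)"
  proof
    fix y
    show "(cutoff * cutoff * (f - (\<lambda>_. c))) y = (\<Sum>b\<in>Basis. lin b * G' b) y"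
    proof (cases "y \<in> U0 \<and> bmp (\<phi>0 y) \<noteq> 0")
      case True
      then have "dist e0 (\<phi>0 y) < \<rho> / 2" using bump_outside[of "\<rho> / 2" e0 "\<phi>0 y"] \<rho> by force
      then have "\<phi>0 y \<in> ball e0 \<rho>" using \<rho> by simp
      from g(3)[OF this] have "f y - c = (\<Sum>b\<in>Basis. complex_of_real ((\<phi>0 y - ?q) \<bullet> b) * g b (\<phi>0 y))"
        using True p(1) by (simp add: c_def chartD(4)[OF chart0])
      then have "bmp (\<phi>0 y) * bmp (\<phi>0 y) * (f y - c) =
          (\<Sum>b\<in>Basis. bmp (\<phi>0 y) * complex_of_real ((\<phi>0 y - ?q) \<bullet> b) * (bmp (\<phi>0 y) * g b (\<phi>0 y)))"
        by (simp add: sum_distrib_left mult_ac)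
      then show ?thesis using True
        by (simp add: fun_sum_apply lin_def cutoff_def cutoff_coord_def G'_def extend0_def inner_diff_left algebra_simps)
    next
      case False
      then have "cutoff y = 0" "G' b y = 0" for b by (auto simp: cutoff_def G'_def extend0_def)
      then show ?thesis by (simp add: fun_sum_apply)
    qed
  qed
  have "X (cutoff * cutoff * (f - (\<lambda>_. c))) p = cutoff p * cutoff p * X f p"
  proof -
    have "X (f - (\<lambda>_. c)) = X f" by (simp only: vf_diff[OF X f const_mem] vf_const[OF X] diff_zero)
    then show ?thesis
      by (simp only: vf_times[OF X mult_mem[OF cutoff_A cutoff_A] fc] plus_fun_apply times_fun_apply minus_apply) (simp add: c_def)
  qed
  moreover have "X (\<Sum>b\<in>Basis. lin b * G' b) p =
      (\<Sum>b\<in>Basis. (X (cutoff_coord b) p - complex_of_real (?q \<bullet> b) * X cutoff p) * (cutoff p * D f ?q b))"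
  proof -
    have 1: "lin b p = 0" for b
      using p by (simp add: lin_def cutoff_coord_def cutoff_def extend0_def)
    have 2: "G' b p = cutoff p * D f ?q b" for b
      using p by (simp add: G'_def cutoff_def extend0_def g(2))
    have 3: "X (lin b) p = X (cutoff_coord b) p - complex_of_real (?q \<bullet> b) * X cutoff p" for b
      by (simp only: lin_def vf_diff[OF X cutoff_coord_A cmult_mem[OF cutoff_A]] vf_cmult[OF X cutoff_A] minus_apply)
    have "X (lin b * G' b) p = X (lin b) p * G' b p" for b
      by (simp only: vf_times[OF X linA G'A] plus_fun_apply times_fun_apply 1) (simp add: mult.commute)
    then show ?thesis
      by (simp only: vf_sum[OF X mult_mem[OF linA G'A]] fun_sum_apply 2 3)
  qed
  ultimately show ?thesis using eq by simp
qed

lemma VF_expand_one: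
  assumes X: "X \<in> VF"
  obtains v where "\<And>f. f \<in> A \<Longrightarrow> X f \<one>\<^bsub>G\<^esub> = (\<Sum>b\<in>Basis. v b * D f e0 b)"
proof -
  let ?c = "cutoff \<one>\<^bsub>G\<^esub>"
  define v where "v = (\<lambda>b. (X (cutoff_coord b) \<one>\<^bsub>G\<^esub> - complex_of_real (e0 \<bullet> b) * X cutoff \<one>\<^bsub>G\<^esub>) / ?c)"
  have nz: "bmp e0 \<noteq> 0" using bump_center[of "\<rho> / 2" e0] \<rho> by simp
  have "X f \<one>\<^bsub>G\<^esub> = (\<Sum>b\<in>Basis. v b * D f e0 b)" if f: "f \<in> A" for f
  proof -
    have "?c * ?c * X f \<one>\<^bsub>G\<^esub> = ?c * ?c * (\<Sum>b\<in>Basis. v b * D f e0 b)"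
      unfolding VF_expand_point[OF X f one_U0 nz] sum_distrib_left
      using cutoff_one by (intro sum.cong) (simp_all add: v_def)
    then show ?thesis using cutoff_one by simp
  qed
  then show ?thesis by (rule that)
qed

text \<open>Linearity over functions implies locality: a multiple of X by a function nonzero at 1 is
  a combination of coordinate fields whose coefficients are derivatives along X, and these vanish at
  1.\<close>

lemma one_form_pointwise:
  assumes w: "\<omega> \<in> forms A 1" and X: "X \<in> VF" and zero: "\<And>f. f \<in> A \<Longrightarrow> X f \<one>\<^bsub>G\<^esub> = 0"
  shows "\<omega> [X] \<one>\<^bsub>G\<^esub> = 0"
proof -
  let ?Y = "\<lambda>b. coord_field (\<lambda>_. 1) b" and ?Y' = "\<lambda>b. coord_field (\<lambda>u. complex_of_real (u \<bullet> b)) b"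
  have Y: "?Y b \<in> VF" "?Y' b \<in> VF" for b
    by (intro coord_field_VF smooth_on_const open_ball smooth_inner)+
  have XA: "X g \<in> A" for g by (rule vf_range[OF X])
  have cc: "cutoff * cutoff \<in> A" by (intro mult_mem cutoff_A)
  \<comment> \<open>In \<open>VF_expand_point\<close> the coordinate of p multiplies
    \<open>X cutoff\<close>. As p varies, this factor is absorbed into the weight of the second
    family of fields, and the coefficients that remain are of the form \<open>X g\<close>.\<close>
  have eq: "vf_mult (cutoff * cutoff) X =
      (\<Sum>b\<in>Basis. vf_mult (X (cutoff_coord b)) (?Y b)) - (\<Sum>b\<in>Basis. vf_mult (X cutoff) (?Y' b))"
  proof (intro ext)
    fix f p
    show "vf_mult (cutoff * cutoff) X f p =
      ((\<Sum>b\<in>Basis. vf_mult (X (cutoff_coord b)) (?Y b)) - (\<Sum>b\<in>Basis. vf_mult (X cutoff) (?Y' b))) f p"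
    proof (cases "f \<in> A \<and> p \<in> U0 \<and> bmp (\<phi>0 p) \<noteq> 0")
      case True
      then have f: "f \<in> A" and p: "p \<in> U0" "bmp (\<phi>0 p) \<noteq> 0" by auto
      have "vf_mult (cutoff * cutoff) X f p = cutoff p * cutoff p * X f p" by (simp add: vf_mult_def)
      also have "\<dots> = (\<Sum>b\<in>Basis. X (cutoff_coord b) p * ?Y b f p) - (\<Sum>b\<in>Basis. X cutoff p * ?Y' b f p)"
        unfolding VF_expand_point[OF X f p] sum_subtractf[symmetric] using f p
        by (intro sum.cong) (simp_all add: coord_field_def cutoff_def extend0_def algebra_simps)
      finally show ?thesis by (simp add: vf_mult_def fun_sum_apply)
    next
      case False
      then have "f \<notin> A \<or> cutoff p = 0" by (auto simp: cutoff_def extend0_def)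
      moreover have "?Y b f p = 0" "?Y' b f p = 0" for b using False by (auto simp: coord_field_def extend0_def)
      ultimately show ?thesis by (auto simp: vf_mult_def fun_sum_apply vf_outside[OF X])
    qed
  qed
  have S: "(\<Sum>b\<in>Basis. vf_mult (X (cutoff_coord b)) (?Y b)) \<in> VF" "(\<Sum>b\<in>Basis. vf_mult (X cutoff) (?Y' b)) \<in> VF"
    by (intro VF_sum VF_mult XA Y)+
  have "contr (vf_mult (cutoff * cutoff) X) \<omega> = fscale (cutoff * cutoff) (contr X \<omega>)"
    by (rule contr_anyform(3)[OF w X cc])
  moreover have "contr (vf_mult (cutoff * cutoff) X) \<omega> =
      (\<Sum>b\<in>Basis. fscale (X (cutoff_coord b)) (contr (?Y b) \<omega>)) - (\<Sum>b\<in>Basis. fscale (X cutoff) (contr (?Y' b) \<omega>))"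
    unfolding eq diff_conv_add_uminus contr_anyform(2)[OF w S(1) VF_uminus[OF S(2)]] contr_uminus_vf[OF w S(2)]
    by (simp only: contr_sum_vf[OF w finite_Basis] XA Y)
  ultimately have "fscale (cutoff * cutoff) (contr X \<omega>) [] \<one>\<^bsub>G\<^esub> =
     ((\<Sum>b\<in>Basis. fscale (X (cutoff_coord b)) (contr (?Y b) \<omega>)) - (\<Sum>b\<in>Basis. fscale (X cutoff) (contr (?Y' b) \<omega>))) [] \<one>\<^bsub>G\<^esub>"
    by simp
  also have "\<dots> = 0"
    by (simp add: fun_sum_apply fscale_def zero cutoff_A cutoff_coord_A)
  finally show ?thesis using cutoff_one by (simp add: fscale_def contr_def)
qed

section \<open>Left-invariant fields generated by tangent vectors at the unit\<close>

definition left_field :: "'e \<Rightarrow> 'g vf" where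
  "left_field v f = (if f \<in> A then (\<lambda>x. D (\<lambda>y. f (x \<cdot> y)) e0 v) else 0)"

text \<open>Exhibits a left-invariant derivative as a partial derivative of the smooth two-variable
  map H. Both its smoothness and the uniform difference quotients below are read off H.\<close>

lemma chart_pair:
  assumes V: "(V, \<psi>) \<in> \<A>" and f: "f \<in> A"
  defines "P \<equiv> {(s, u). s \<in> \<psi> ` V \<and> u \<in> \<phi>0 ` U0 \<and> inv_into V \<psi> s \<cdot> inv0 u \<in> V}"
    and "H \<equiv> (\<lambda>(s, u). f (inv_into V \<psi> s \<cdot> inv0 u))"
  shows "open P" "smooth_on H P" "\<And>x. x \<in> V \<Longrightarrow> (\<psi> x, e0) \<in> P"
    "\<And>s. (s, e0) \<in> P \<Longrightarrow> left_field v f (inv_into V \<psi> s) = frechet_derivative H (at (s, e0)) (0, v)"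
proof -
  show o: "open P" and s: "smooth_on H P"
    unfolding P_def H_def by (rule mult_chart_smooth[OF V chart0 V f])+
  show "(\<psi> x, e0) \<in> P" if "x \<in> V" for x using that chartD(4)[OF V that] e0_mem by (simp add: P_def)
  fix s assume s1: "(s, e0) \<in> P"
  have "((\<lambda>u. (s, u)) has_derivative (\<lambda>w. (0, w))) (at e0)" by (auto intro!: derivative_eq_intros)
  from diff_chain_at[OF this smooth_on_has_derivative[OF s s1]]
  have "((\<lambda>u. H (s, u)) has_derivative (\<lambda>w. frechet_derivative H (at (s, e0)) (0, w))) (at e0)"
    by (simp add: o_def)
  then have "(((\<lambda>y. f (inv_into V \<psi> s \<cdot> y)) \<circ> inv0) has_derivative (\<lambda>w. frechet_derivative H (at (s, e0)) (0, w))) (at e0)"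
    by (simp add: H_def o_def)
  from D_unique[OF this] show "left_field v f (inv_into V \<psi> s) = frechet_derivative H (at (s, e0)) (0, v)"
    by (simp add: left_field_def f)
qed

lemma left_field_A: "left_field v f \<in> A"
proof (cases "f \<in> A")
  case f: True
  show ?thesis
  proof (rule A_localI)
    fix x
    obtain V \<psi> where V: "(V, \<psi>) \<in> \<A>" "x \<in> V" by (rule chart_ex)
    let ?P = "{(s, u). s \<in> \<psi> ` V \<and> u \<in> \<phi>0 ` U0 \<and> inv_into V \<psi> s \<cdot> inv0 u \<in> V}"
    let ?H = "\<lambda>(s, u). f (inv_into V \<psi> s \<cdot> inv0 u)"
    note P = chart_pair[OF V(1) f]
    let ?T = "{s. (s, e0) \<in> ?P}"
    note sm1 = smooth_on_fix_snd(1)[OF P(1) smooth_on_derivative[OF P(2), of "(0, v)"], of e0]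
    note sm2 = smooth_on_fix_snd(2)[OF P(1,2), of e0]
    have "smooth_on (left_field v f \<circ> inv_into V \<psi>) ?T"
    proof (rule smooth_on_cong[OF sm2 _ sm1])
      fix s assume "s \<in> ?T"
      then have "(s, e0) \<in> ?P" by (simp only: mem_Collect_eq)
      from P(4)[OF this] show "frechet_derivative ?H (at (s, e0)) (0, v) = (left_field v f \<circ> inv_into V \<psi>) s" by simp
    qed
    moreover have "\<psi> x \<in> ?T" using P(3)[OF V(2)] by blast
    moreover have "?T \<subseteq> \<psi> ` V" by auto
    ultimately show "\<exists>V \<psi> T. (V, \<psi>) \<in> \<A> \<and> x \<in> V \<and> open T \<and> \<psi> x \<in> T \<and> T \<subseteq> \<psi> ` V \<and> smooth_on (left_field v f \<circ> inv_into V \<psi>) T"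
      using V sm2 by (intro exI[of _ V] exI[of _ \<psi>] exI[of _ ?T] conjI)
  qed
qed (simp add: left_field_def zero_mem)

lemma left_field_VF: "left_field v \<in> VF"
  unfolding vector_fields_def mem_Collect_eq
proof (intro conjI ballI allI impI)
  fix f g c assume f: "f \<in> A"
  show "left_field v f \<in> A" by (rule left_field_A)
  show "left_field v (\<lambda>x. c * f x) = (\<lambda>x. c * left_field v f x)"
    by (rule ext) (simp add: left_field_def f cmult_mem D_cmult[OF A_translate[OF f] e0_mem])
  assume g: "g \<in> A"
  have p: "(\<lambda>y. (f + g) (x \<cdot> y)) = (\<lambda>y. f (x \<cdot> y)) + (\<lambda>y. g (x \<cdot> y))" "(\<lambda>y. (f * g) (x \<cdot> y)) = (\<lambda>y. f (x \<cdot> y)) * (\<lambda>y. g (x \<cdot> y))" for x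
    by (auto simp: fun_eq_iff)
  show "left_field v (f + g) = left_field v f + left_field v g"
  proof
    fix x show "left_field v (f + g) x = (left_field v f + left_field v g) x"
      using D_add[OF A_translate[OF f, of x] A_translate[OF g, of x] e0_mem]
      unfolding left_field_def p using f g add_mem[OF f g] by simp
  qed
  show "left_field v (f * g) = f * left_field v g + g * left_field v f"
  proof
    fix x show "left_field v (f * g) x = (f * left_field v g + g * left_field v f) x"
      using D_times[OF A_translate[OF f, of x] A_translate[OF g, of x] e0_mem]
      unfolding left_field_def p using f g mult_mem[OF f g] by simp
  qed
qed (simp add: left_field_def)

lemma left_field_invariant: "vf_translate G a (left_field v) = left_field v"
proof
  fix f
  show "vf_translate G a (left_field v) f = left_field v f"
  proof (cases "f \<in> A")
    case True
    then show ?thesis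
      by (simp add: vf_translate_def left_field_def A_translate_iff gassoc[symmetric] fun_eq_iff)
  next
    case False
    then show ?thesis by (simp add: vf_translate_def left_field_def A_translate_iff)
  qed
qed

lemma left_field_one: "f \<in> A \<Longrightarrow> left_field v f \<one>\<^bsub>G\<^esub> = D f e0 v"
  by (simp add: left_field_def)

end

section \<open>An invariant mean on a compact quotient\<close>

text \<open>Purely algebraic: w is independent of a basis of S, so the values 1 at w and 0 on that
  basis extend linearly to the whole space.\<close>

lemma (in vector_space) separating_functional:
  assumes S: "subspace S" and w: "w \<notin> S"
  obtains \<phi> where "\<And>x y. \<phi> (x + y) = \<phi> x + \<phi> y" "\<And>c x. \<phi> (scale c x) = c * \<phi> x" "\<phi> w = 1" "\<And>x. x \<in> S \<Longrightarrow> \<phi> x = 0"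
proof -
  interpret p: vector_space_pair scale "(*) :: 'a \<Rightarrow> 'a \<Rightarrow> 'a" by standard (auto simp: algebra_simps)
  obtain B where B: "B \<subseteq> S" "independent B" "S \<subseteq> span B" by (rule maximal_independent_subset)
  have "span B \<subseteq> S" by (rule span_minimal[OF B(1) S])
  then have wB: "w \<notin> span B" using w by blast
  then have "independent (insert w B)" by (rule independent_insertI[OF _ B(2)])
  from p.linear_independent_extend[OF this, of "\<lambda>x. if x = w then 1 else 0"]
  obtain g where g: "Vector_Spaces.linear scale (*) g" "\<And>x. x \<in> insert w B \<Longrightarrow> g x = (if x = w then 1 else 0)" by blast
  interpret g: Vector_Spaces.linear scale "(*) :: 'a \<Rightarrow> 'a \<Rightarrow> 'a" g by (rule g(1))
  have "g x = 0" if "x \<in> S" for x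
  proof -
    have "x \<in> span B" using that B(3) by blast
    moreover have "g y = 0" if "y \<in> B" for y
    proof -
      have "y \<noteq> w" using wB span_base that by blast
      then show ?thesis using g(2)[of y] that by simp
    qed
    ultimately show ?thesis by (rule p.linear_eq_0_on_span[OF g(1), rotated])
  qed
  moreover have "g w = 1" using g(2)[of w] by simp
  ultimately show ?thesis using that[of g] g.add g.scale by blast
qed

context based_lie_group begin

text \<open>Uniformity in x near \<open>x1\<close> comes from the continuity of the partial
  derivative of H in both variables, combined with the mean value inequality along the coordinate
  line.\<close>

lemma difference_quotient_local:
  assumes f: "f \<in> A" and \<epsilon>: "0 < \<epsilon>"
  shows "\<exists>N \<delta>. open N \<and> x1 \<in> N \<and> 0 < \<delta> \<and> (\<forall>x\<in>N. \<forall>t. 0 < t \<and> t < \<delta> \<longrightarrow>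
    cmod ((f (x \<cdot> inv0 (e0 + t *\<^sub>R v)) - f x) / complex_of_real t - left_field v f x) \<le> \<epsilon>)"
proof -
  obtain V \<psi> where V: "(V, \<psi>) \<in> \<A>" "x1 \<in> V" by (rule chart_ex)
  let ?P = "{(s, u). s \<in> \<psi> ` V \<and> u \<in> \<phi>0 ` U0 \<and> inv_into V \<psi> s \<cdot> inv0 u \<in> V}"
  let ?H = "\<lambda>(s, u). f (inv_into V \<psi> s \<cdot> inv0 u)"
  define P H where "P = ?P" and "H = ?H"
  note cp = chart_pair[OF V(1) f, folded P_def H_def]
  define H' where "H' = (\<lambda>p. frechet_derivative H (at p) (0, v))"
  let ?p1 = "(\<psi> x1, e0)"
  have p1: "?p1 \<in> P" by (rule cp(3)[OF V(2)])
  have cont: "continuous_on P H'"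
    unfolding H'_def by (intro smooth_on_continuous smooth_on_derivative cp(2))
  then have "isCont H' ?p1" using cp(1) p1 by (simp add: continuous_on_eq_continuous_at)
  then obtain r1 where r1: "0 < r1" "\<And>p. dist p ?p1 < r1 \<Longrightarrow> dist (H' p) (H' ?p1) < \<epsilon> / 2"
    unfolding continuous_at_eps_delta using \<epsilon> half_gt_zero by metis
  obtain r2 where r2: "0 < r2" "ball ?p1 r2 \<subseteq> P" using cp(1) p1 open_contains_ball by blast
  define r where "r = min r1 r2"
  have r: "0 < r" using r1 r2 by (simp add: r_def)
  have rP: "p \<in> P" and rH: "dist (H' p) (H' ?p1) < \<epsilon> / 2" if "dist p ?p1 < r" for p
    using that r1(2)[of p] subsetD[OF r2(2), of p] by (simp_all add: r_def dist_commute)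
  define N where "N = V \<inter> \<psi> -` ball (\<psi> x1) (r / 2)"
  have N: "open N" "x1 \<in> N"
    using continuous_open_preimage[OF chartD(7,1)[OF V(1)] open_ball] V r by (auto simp: N_def)
  \<comment> \<open>Keeps the second coordinate within r/2 of the base point, as N does for the
    first; adding 1 to the norm allows v = 0.\<close>
  define \<delta> where "\<delta> = r / (2 * (norm v + 1))"
  have nv: "0 < norm v + 1" by (simp add: add_nonneg_pos)
  have \<delta>: "0 < \<delta>" using r nv by (simp add: \<delta>_def)
  have "cmod ((f (x \<cdot> inv0 (e0 + t *\<^sub>R v)) - f x) / complex_of_real t - left_field v f x) \<le> \<epsilon>"
    if x: "x \<in> N" and t: "0 < t" "t < \<delta>" for x t
  proof -
    define s where "s = \<psi> x"
    have xs: "inv_into V \<psi> s = x" using x chartD(4)[OF V(1)] by (simp add: s_def N_def)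
    have near: "dist (s, e0 + \<tau> *\<^sub>R v) ?p1 < r" if "0 \<le> \<tau>" "\<tau> \<le> t" for \<tau>
    proof -
      have "\<tau> * norm v \<le> t * (norm v + 1)" using that t by (intro mult_mono) auto
      also have "\<dots> < \<delta> * (norm v + 1)" using t nv by (intro mult_strict_right_mono) auto
      also have "\<dots> = r / 2" using nv by (simp add: \<delta>_def field_simps)
      finally have "\<tau> * norm v < r / 2" .
      moreover have "dist s (\<psi> x1) < r / 2" using x by (simp add: N_def s_def dist_commute)
      moreover have "dist (s, e0 + \<tau> *\<^sub>R v) ?p1 \<le> dist s (\<psi> x1) + dist (e0 + \<tau> *\<^sub>R v) e0"
        unfolding dist_Pair_Pair by (rule sqrt_sum_squares_le_sum) auto
      ultimately show ?thesis using that by (simp add: dist_norm)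
    qed
    \<comment> \<open>Subtracting the linear part leaves a function whose derivative is a difference
      of two values of H' near \<open>?p1\<close>, hence at most \<epsilon>.\<close>
    define \<kappa> where "\<kappa> = (\<lambda>\<tau>. H (s, e0 + \<tau> *\<^sub>R v) - \<tau> *\<^sub>R H' (s, e0))"
    have "norm (\<kappa> t - \<kappa> 0) \<le> \<epsilon> * norm (t - 0)"
    proof (rule differentiable_bound[of "{0..t}" \<kappa> "\<lambda>\<tau> h. h *\<^sub>R (H' (s, e0 + \<tau> *\<^sub>R v) - H' (s, e0))"])
      fix \<tau> assume \<tau>: "\<tau> \<in> {0..t}"
      then have n: "dist (s, e0 + \<tau> *\<^sub>R v) ?p1 < r" using near by simp
      have n0: "dist (s, e0) ?p1 < r" using near[of 0] t by simp
      have d: "((\<lambda>\<tau>. (s, e0 + \<tau> *\<^sub>R v)) has_derivative (\<lambda>h. (0, h *\<^sub>R v))) (at \<tau>)"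
        by (auto intro!: derivative_eq_intros)
      have hd: "(H has_derivative frechet_derivative H (at (s, e0 + \<tau> *\<^sub>R v))) (at (s, e0 + \<tau> *\<^sub>R v))"
        by (rule smooth_on_has_derivative[OF cp(2) rP[OF n]])
      from has_derivative_linear[OF hd]
      have "frechet_derivative H (at (s, e0 + \<tau> *\<^sub>R v)) (h *\<^sub>R (0, v)) = h *\<^sub>R H' (s, e0 + \<tau> *\<^sub>R v)" for h
        unfolding H'_def by (rule linear_cmul)
      then have "((\<lambda>\<tau>. H (s, e0 + \<tau> *\<^sub>R v)) has_derivative (\<lambda>h. h *\<^sub>R H' (s, e0 + \<tau> *\<^sub>R v))) (at \<tau>)"
        using diff_chain_at[OF d hd] by (simp add: o_def)
      then have "(\<kappa> has_derivative (\<lambda>h. h *\<^sub>R H' (s, e0 + \<tau> *\<^sub>R v) - h *\<^sub>R H' (s, e0))) (at \<tau>)"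
        unfolding \<kappa>_def by (intro has_derivative_diff has_derivative_scaleR_left has_derivative_ident)
      then show "(\<kappa> has_derivative (\<lambda>h. h *\<^sub>R (H' (s, e0 + \<tau> *\<^sub>R v) - H' (s, e0)))) (at \<tau> within {0..t})"
        by (simp add: scaleR_diff_right has_derivative_at_withinI)
      have "dist (H' (s, e0 + \<tau> *\<^sub>R v)) (H' (s, e0)) \<le> dist (H' (s, e0 + \<tau> *\<^sub>R v)) (H' ?p1) + dist (H' (s, e0)) (H' ?p1)"
        by (rule dist_triangle2)
      then have "norm (H' (s, e0 + \<tau> *\<^sub>R v) - H' (s, e0)) \<le> \<epsilon>"
        using rH[OF n] rH[OF n0] by (simp add: dist_norm)
      then show "onorm (\<lambda>h. h *\<^sub>R (H' (s, e0 + \<tau> *\<^sub>R v) - H' (s, e0))) \<le> \<epsilon>"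
        by (intro onorm_le) (simp, metis abs_ge_zero mult.commute mult_left_mono)
    qed (use t in auto)
    moreover have "left_field v f x = H' (s, e0)"
      using cp(4)[OF rP, of s v] near[of 0] t xs by (simp add: H'_def)
    then have "\<kappa> t - \<kappa> 0 = f (x \<cdot> inv0 (e0 + t *\<^sub>R v)) - f x - complex_of_real t * left_field v f x"
      by (simp add: \<kappa>_def H_def xs scaleR_conv_of_real)
    moreover have "(f (x \<cdot> inv0 (e0 + t *\<^sub>R v)) - f x) / complex_of_real t - left_field v f x =
      (f (x \<cdot> inv0 (e0 + t *\<^sub>R v)) - f x - complex_of_real t * left_field v f x) / complex_of_real t"
      using t by (simp add: field_simps)
    ultimately show ?thesis using t by (simp add: norm_divide field_simps)
  qed
  then show ?thesis using N \<delta> by blast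
qed

end

section \<open>Compactness of the quotient and the mean\<close>

locale based_nilmanifold = based_lie_group G \<A> U0 \<phi>0 \<rho>
  for G :: "('g::{t2_space,second_countable_topology}) monoid" and \<A> :: "('g, 'e::euclidean_space) atlas"
    and U0 :: "'g set" and \<phi>0 :: "'g \<Rightarrow> 'e" and \<rho> :: real +
  fixes \<Gamma> :: "'g set"
  assumes nilpotent: "nilpotent_group G" and lattice: "lattice_subgroup G \<Gamma>"
begin

lemma Gamma: "subgroup \<Gamma> G" using lattice by (simp add: lattice_subgroup_def)

lemma Gamma_one: "\<one>\<^bsub>G\<^esub> \<in> \<Gamma>" and Gamma_mult: "a \<in> \<Gamma> \<Longrightarrow> b \<in> \<Gamma> \<Longrightarrow> a \<cdot> b \<in> \<Gamma>"
  and Gamma_inv: "a \<in> \<Gamma> \<Longrightarrow> ginv a \<in> \<Gamma>"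
  using Gamma by (auto simp: subgroup_def)

lemma rcoset_eq: "C \<in> rcosets\<^bsub>G\<^esub> \<Gamma> \<Longrightarrow> x \<in> C \<Longrightarrow> C = (\<lambda>a. a \<cdot> x) ` \<Gamma>"
proof -
  assume "C \<in> rcosets\<^bsub>G\<^esub> \<Gamma>" "x \<in> C"
  then obtain y b where C: "C = (\<lambda>a. a \<cdot> y) ` \<Gamma>" and b: "b \<in> \<Gamma>" "x = b \<cdot> y"
    by (auto simp: RCOSETS_def r_coset_def)
  have "(\<lambda>a. a \<cdot> y) ` \<Gamma> = (\<lambda>a. a \<cdot> x) ` \<Gamma>"
  proof (intro subset_antisym image_subsetI)
    fix a assume a: "a \<in> \<Gamma>"
    show "a \<cdot> x \<in> (\<lambda>a. a \<cdot> y) ` \<Gamma>"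
      by (rule image_eqI[of _ _ "a \<cdot> b"]) (simp_all add: b gassoc Gamma_mult a)
    show "a \<cdot> y \<in> (\<lambda>a. a \<cdot> x) ` \<Gamma>"
      by (rule image_eqI[of _ _ "a \<cdot> ginv b"]) (simp_all add: b gassoc Gamma_mult Gamma_inv a)
  qed
  then show ?thesis using C by simp
qed

lemma rcosetI: "(\<lambda>a. a \<cdot> x) ` \<Gamma> \<in> rcosets\<^bsub>G\<^esub> \<Gamma>" "x \<in> (\<lambda>a. a \<cdot> x) ` \<Gamma>"
proof -
  have "(\<lambda>a. a \<cdot> x) ` \<Gamma> = \<Gamma> #>\<^bsub>G\<^esub> x" by (auto simp: r_coset_def)
  then show "(\<lambda>a. a \<cdot> x) ` \<Gamma> \<in> rcosets\<^bsub>G\<^esub> \<Gamma>" using carr by (auto simp: RCOSETS_def)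
  show "x \<in> (\<lambda>a. a \<cdot> x) ` \<Gamma>" using image_eqI[of x "\<lambda>a. a \<cdot> x" "\<one>\<^bsub>G\<^esub>"] Gamma_one by simp
qed

text \<open>The topology is given through \<open>topology\<close>, so the predicate has to be shown
  to be one; for intersections this uses that cosets through a common point coincide.\<close>

lemma openin_quotient: "openin (quotient_topology G \<Gamma>) S \<longleftrightarrow> S \<subseteq> rcosets\<^bsub>G\<^esub> \<Gamma> \<and> open (\<Union>S)"
proof -
  have "istopology (\<lambda>V. V \<subseteq> rcosets\<^bsub>G\<^esub> \<Gamma> \<and> open (\<Union>V))"
    unfolding istopology_def
  proof (intro conjI allI impI)
    fix S T assume S: "S \<subseteq> rcosets\<^bsub>G\<^esub> \<Gamma> \<and> open (\<Union>S)" and T: "T \<subseteq> rcosets\<^bsub>G\<^esub> \<Gamma> \<and> open (\<Union>T)"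
    then show "S \<inter> T \<subseteq> rcosets\<^bsub>G\<^esub> \<Gamma>" by blast
    have "\<Union>(S \<inter> T) = \<Union>S \<inter> \<Union>T"
    proof (intro subset_antisym subsetI)
      fix x assume "x \<in> \<Union>S \<inter> \<Union>T"
      then obtain C C' where C: "C \<in> S" "x \<in> C" "C' \<in> T" "x \<in> C'" by blast
      have "C = C'" using rcoset_eq[of C x] rcoset_eq[of C' x] S T C by blast
      then show "x \<in> \<Union>(S \<inter> T)" using C by blast
    qed blast
    then show "open (\<Union>(S \<inter> T))" using S T by (simp add: open_Int)
  next
    fix K assume K: "\<forall>V\<in>K. V \<subseteq> rcosets\<^bsub>G\<^esub> \<Gamma> \<and> open (\<Union>V)"
    then show "\<Union>K \<subseteq> rcosets\<^bsub>G\<^esub> \<Gamma>" by blast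
    have "\<Union>(\<Union>K) = (\<Union>V\<in>K. \<Union>V)" by blast
    then show "open (\<Union>(\<Union>K))" using K by (simp add: open_UN)
  qed
  then show ?thesis unfolding quotient_topology_def by (simp add: topology_inverse')
qed

text \<open>A local bound that is invariant under the lattice descends to open sets of cosets, and
  compactness of the quotient selects one bound. The relation R is abstract because boundedness and
  uniform differentiability are both obtained this way.\<close>

lemma compact_uniform:
  fixes R :: "'g \<Rightarrow> real \<Rightarrow> bool"
  assumes loc: "\<And>x. \<exists>N \<delta>. open N \<and> x \<in> N \<and> 0 < \<delta> \<and> (\<forall>y\<in>N. \<forall>t. 0 < t \<and> t < \<delta> \<longrightarrow> R y t)"
    and inv: "\<And>a y t. a \<in> \<Gamma> \<Longrightarrow> R y t \<Longrightarrow> R (a \<cdot> y) t"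
  obtains \<delta> where "0 < \<delta>" "\<And>y t. 0 < t \<Longrightarrow> t < \<delta> \<Longrightarrow> R y t"
proof -
  \<comment> \<open>The union of all open sets on which the bound 1/(n+1) works: open by
    construction, increasing in n, and stable under the lattice, hence a union of cosets.\<close>
  define W where "W n = \<Union>{N. open N \<and> (\<forall>y\<in>N. \<forall>t. 0 < t \<and> t < 1 / (real n + 1) \<longrightarrow> R y t)}" for n
  have oW: "open (W n)" for n unfolding W_def by (rule open_Union) blast
  have RW: "R y t" if "y \<in> W n" "0 < t" "t < 1 / (real n + 1)" for y t n
    using that unfolding W_def by blast
  have invW: "a \<cdot> y \<in> W n" if a: "a \<in> \<Gamma>" and y: "y \<in> W n" for a y n
  proof -
    have "continuous_on UNIV (\<lambda>x. (ginv a, x))" by (intro continuous_intros)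
    from continuous_on_compose2[OF cont_mult this subset_UNIV] have "continuous_on UNIV (\<lambda>x. ginv a \<cdot> x)" by simp
    then have "open ((\<lambda>x. ginv a \<cdot> x) -` W n)" by (rule open_vimage[OF oW])
    moreover have "R z t" if "z \<in> (\<lambda>x. ginv a \<cdot> x) -` W n" "0 < t \<and> t < 1 / (real n + 1)" for z t
      using inv[OF a RW[of "ginv a \<cdot> z" n t]] that by simp
    moreover have "a \<cdot> y \<in> (\<lambda>x. ginv a \<cdot> x) -` W n" using y by simp
    ultimately show ?thesis unfolding W_def[of n] by blast
  qed
  define V where "V n = {C \<in> rcosets\<^bsub>G\<^esub> \<Gamma>. C \<subseteq> W n}" for n
  have UV: "\<Union>(V n) = W n" for n
  proof (intro subset_antisym subsetI)
    fix x assume x: "x \<in> W n"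
    have "(\<lambda>a. a \<cdot> x) ` \<Gamma> \<in> V n" unfolding V_def using rcosetI(1)[of x] invW[OF _ x] by blast
    then show "x \<in> \<Union>(V n)" using rcosetI(2)[of x] by blast
  qed (auto simp: V_def)
  have oV: "openin (quotient_topology G \<Gamma>) (V n)" for n
    unfolding openin_quotient UV using oW by (auto simp: V_def)
  have cov: "\<exists>n. x \<in> W n" for x
  proof -
    obtain N \<delta> where N: "open N" "x \<in> N" "0 < \<delta>" "\<forall>y\<in>N. \<forall>t. 0 < t \<and> t < \<delta> \<longrightarrow> R y t" using loc by blast
    obtain n where "inverse (real (Suc n)) < \<delta>" using reals_Archimedean N(3) by blast
    then have "1 / (real n + 1) < \<delta>" by (simp add: inverse_eq_divide add.commute)
    then have "x \<in> W n" unfolding W_def using N by (intro UnionI[of N]) auto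
    then show ?thesis ..
  qed
  have mono: "W n \<subseteq> W m" if "n \<le> m" for n m
  proof -
    have "1 / (real m + 1) \<le> 1 / (real n + 1)" using that by (intro divide_left_mono) auto
    then show ?thesis unfolding W_def by (intro Union_mono) force
  qed
  have top: "topspace (quotient_topology G \<Gamma>) \<subseteq> \<Union>(range V)"
  proof
    fix C assume "C \<in> topspace (quotient_topology G \<Gamma>)"
    then have C: "C \<in> rcosets\<^bsub>G\<^esub> \<Gamma>" unfolding topspace_def using openin_quotient by blast
    then obtain y where "C = (\<lambda>a. a \<cdot> y) ` \<Gamma>" by (auto simp: RCOSETS_def r_coset_def)
    then have y: "y \<in> C" using rcosetI(2) by simp
    obtain n where "y \<in> W n" using cov by blast
    then have "C \<subseteq> W n" using rcoset_eq[OF C y] invW by auto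
    then show "C \<in> \<Union>(range V)" using C by (auto simp: V_def)
  qed
  have "compact_space (quotient_topology G \<Gamma>)" using lattice by (simp add: lattice_subgroup_def)
  then obtain F where F: "finite F" "F \<subseteq> range V" "topspace (quotient_topology G \<Gamma>) \<subseteq> \<Union>F"
    using oV top unfolding compact_space_alt by (metis (mono_tags, lifting) rangeE)
  then obtain K where K: "finite K" "F = V ` K" by (meson finite_subset_image)
  define m where "m = Max (insert 0 K)"
  have "y \<in> W m" for y
  proof -
    let ?C = "(\<lambda>a. a \<cdot> y) ` \<Gamma>"
    obtain n where "y \<in> W n" using cov by blast
    then have "?C \<in> V n" unfolding V_def using rcosetI(1)[of y] invW by blast
    then have "?C \<in> topspace (quotient_topology G \<Gamma>)" using oV openin_subset by blast
    then obtain l where l: "l \<in> K" "?C \<in> V l" using F(3) K(2) by blast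
    then have "y \<in> W l" using rcosetI(2)[of y] by (auto simp: V_def)
    moreover have "l \<le> m" unfolding m_def using K(1) l(1) by (intro Max_ge) auto
    ultimately show ?thesis using mono by blast
  qed
  then show ?thesis using RW[of _ m] by (intro that[of "1 / (real m + 1)"]) auto
qed

definition periodic :: "('g \<Rightarrow> complex) set" where
  "periodic = {f \<in> A. \<forall>a\<in>\<Gamma>. \<forall>x. f (a \<cdot> x) = f x}"

lemma periodicD: "f \<in> periodic \<Longrightarrow> f \<in> A" "f \<in> periodic \<Longrightarrow> a \<in> \<Gamma> \<Longrightarrow> f (a \<cdot> x) = f x"
  by (auto simp: periodic_def)

lemma left_field_periodic: "f \<in> periodic \<Longrightarrow> a \<in> \<Gamma> \<Longrightarrow> left_field v f (a \<cdot> x) = left_field v f x"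
  by (simp add: left_field_def periodicD gassoc)

text \<open>Boundedness is brought into the shape of \<open>compact_uniform\<close> by reading t as
  the reciprocal of a bound.\<close>

lemma periodic_bounded:
  assumes f: "f \<in> periodic" obtains M where "\<And>y. cmod (f y) \<le> M"
proof -
  have "\<exists>N \<delta>. open N \<and> x \<in> N \<and> 0 < \<delta> \<and> (\<forall>y\<in>N. \<forall>t. 0 < t \<and> t < \<delta> \<longrightarrow> cmod (f y) * t \<le> 1)" for x
  proof -
    have "open (f -` ball 0 (cmod (f x) + 1))"
      by (intro open_vimage open_ball A_continuous periodicD f)
    moreover have "cmod (f y) * t \<le> 1"
      if "y \<in> f -` ball 0 (cmod (f x) + 1)" "0 < t \<and> t < 1 / (cmod (f x) + 1)" for y t
    proof -
      have "cmod (f y) * t \<le> (cmod (f x) + 1) * (1 / (cmod (f x) + 1))" using that by (intro mult_mono) auto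
      also have "\<dots> = 1"
      proof -
        have "cmod (f x) + 1 \<noteq> 0" using norm_ge_zero[of "f x"] by linarith
        then show ?thesis by simp
      qed
      finally show ?thesis .
    qed
    ultimately show ?thesis
      by (intro exI[of _ "f -` ball 0 (cmod (f x) + 1)"] exI[of _ "1 / (cmod (f x) + 1)"])
        (auto simp: add_nonneg_pos)
  qed
  then obtain \<delta> where \<delta>: "0 < \<delta>" "\<And>y t. 0 < t \<Longrightarrow> t < \<delta> \<Longrightarrow> cmod (f y) * t \<le> 1"
    by (rule compact_uniform) (auto simp: periodicD[OF f])
  have "cmod (f y) \<le> 2 / \<delta>" for y using \<delta>(2)[of "\<delta> / 2" y] \<delta>(1) by (simp add: field_simps)
  then show ?thesis by (rule that)
qed

text \<open>This replaces the invariance of an integral over the compact quotient.\<close>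

lemma one_not_divergence:
  assumes F: "\<And>b. b \<in> Basis \<Longrightarrow> F b \<in> periodic"
  shows "(\<Sum>b\<in>Basis. left_field b (F b)) \<noteq> (1 :: 'g \<Rightarrow> complex)"
proof
  assume one: "(\<Sum>b\<in>Basis. left_field b (F b)) = (1 :: 'g \<Rightarrow> complex)"
  \<comment> \<open>An error of 1/(2n) in each of the n basis directions costs 1/2 in total, which
    leaves 1/2 of the assumed value 1.\<close>
  define n where "n = real DIM('e)"
  have n: "0 < n" by (simp add: n_def)
  have "\<exists>\<delta>>0. \<forall>y t. 0 < t \<and> t < \<delta> \<longrightarrow>
      cmod ((F b (y \<cdot> inv0 (e0 + t *\<^sub>R b)) - F b y) / complex_of_real t - left_field b (F b) y) \<le> 1 / (2 * n)"
    if b: "b \<in> Basis" for b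
  proof -
    have "0 < 1 / (2 * n)" using n by simp
    note dq = difference_quotient_local[OF periodicD(1)[OF F[OF b]] this]
    show ?thesis
      by (rule compact_uniform[OF dq[where v = b]]) (auto simp: gassoc left_field_periodic[OF F[OF b]] periodicD(2)[OF F[OF b]])
  qed
  then obtain \<delta> where \<delta>: "\<And>b. b \<in> Basis \<Longrightarrow> 0 < \<delta> b" "\<And>b y t. b \<in> Basis \<Longrightarrow> 0 < t \<Longrightarrow> t < \<delta> b \<Longrightarrow>
      cmod ((F b (y \<cdot> inv0 (e0 + t *\<^sub>R b)) - F b y) / complex_of_real t - left_field b (F b) y) \<le> 1 / (2 * n)"
    by metis
  \<comment> \<open>One step size for all basis directions; halving the minimum makes it strictly
    smaller than each bound.\<close>
  define t where "t = Min (\<delta> ` Basis) / 2"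
  have m: "0 < Min (\<delta> ` Basis)" using \<delta>(1) by (subst Min_gr_iff) auto
  have t: "0 < t" "\<And>b. b \<in> Basis \<Longrightarrow> t < \<delta> b"
  proof -
    show "0 < t" using m by (simp add: t_def)
    fix b :: 'e assume "b \<in> Basis"
    then have "Min (\<delta> ` Basis) \<le> \<delta> b" by (intro Min_le) auto
    then show "t < \<delta> b" using m unfolding t_def by linarith
  qed
  let ?g = "\<lambda>b. inv0 (e0 + t *\<^sub>R b)"
  have lower: "Re (left_field b (F b) y) - 1 / (2 * n) \<le> (Re (F b (y \<cdot> ?g b)) - Re (F b y)) / t" if b: "b \<in> Basis" for b y
  proof -
    let ?z = "(F b (y \<cdot> ?g b) - F b y) / complex_of_real t - left_field b (F b) y"
    have "\<bar>Re ?z\<bar> \<le> 1 / (2 * n)" using \<delta>(2)[OF b t(1) t(2)[OF b], of y] abs_Re_le_cmod order_trans by blast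
    moreover have "Re ?z = (Re (F b (y \<cdot> ?g b)) - Re (F b y)) / t - Re (left_field b (F b) y)" by simp
    ultimately show ?thesis by linarith
  qed
  have sum: "t / 2 \<le> (\<Sum>b\<in>Basis. Re (F b (y \<cdot> ?g b)) - Re (F b y))" for y
  proof -
    have "(\<Sum>b\<in>Basis. Re (left_field b (F b) y)) = Re ((\<Sum>b\<in>Basis. left_field b (F b)) y)"
      by (simp add: fun_sum_apply)
    also have "\<dots> = 1" by (simp add: one)
    finally have "1 - 1 / 2 = (\<Sum>b\<in>(Basis :: 'e set). Re (left_field b (F b) y) - 1 / (2 * n))"
      using n by (simp add: sum_subtractf) (simp add: n_def)
    also have "\<dots> \<le> (\<Sum>b\<in>Basis. (Re (F b (y \<cdot> ?g b)) - Re (F b y)) / t)" by (intro sum_mono lower)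
    finally show ?thesis using t(1) by (simp add: sum_divide_distrib[symmetric] field_simps)
  qed
  have "\<exists>M. \<forall>y. cmod (F b y) \<le> M" if "b \<in> Basis" for b using periodic_bounded[OF F[OF that]] by metis
  then obtain M where M: "\<And>b y. b \<in> Basis \<Longrightarrow> cmod (F b y) \<le> M b" by metis
  define M' where "M' = Max (M ` Basis)"
  have M': "\<bar>Re (F b y)\<bar> \<le> M'" if "b \<in> Basis" for b y
  proof -
    have "M b \<le> M'" unfolding M'_def using that by (intro Max_ge) auto
    then show ?thesis using abs_Re_le_cmod[of "F b y"] M[OF that, of y] by linarith
  qed
  \<comment> \<open>Left-invariant fields generate right translations, so the differences are of the
    form for which right amenability rules out a uniform positive lower bound.\<close>
  have "\<exists>x\<in>carrier G. (\<Sum>b\<in>Basis. Re (F b (x \<cdot> ?g b)) - Re (F b x)) < t / 2"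
    by (rule group.nilpotent_no_coboundary[OF grp nilpotent finite_Basis _ M']) (use t carr in auto)
  then show False using sum by (meson not_le)
qed

text \<open>The sums of derivatives of periodic functions along the basis fields form a subspace
  that does not contain 1; the mean is a functional that is 0 on this subspace and 1 at 1.\<close>

lemma invariant_mean:
  obtains I :: "('g \<Rightarrow> complex) \<Rightarrow> complex"
  where "\<And>f g. I (f + g) = I f + I g" "\<And>c f. I (\<lambda>x. c * f x) = c * I f" "\<And>c. I (\<lambda>_. c) = c"
    "\<And>b f. b \<in> Basis \<Longrightarrow> f \<in> periodic \<Longrightarrow> I (left_field b f) = 0"
proof -
  let ?sc = "\<lambda>(c :: complex) (f :: 'g \<Rightarrow> complex) x. c * f x"
  interpret fn: vector_space ?sc by standard (auto simp: fun_eq_iff algebra_simps)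
  let ?S = "{\<Sum>b\<in>Basis. left_field b (F b) | F. \<forall>b\<in>Basis. F b \<in> periodic}"
  have per: "f + g \<in> periodic" "(\<lambda>x. c * f x) \<in> periodic"
    if "f \<in> periodic" "g \<in> periodic" for f g c
    using that by (auto simp: periodic_def add_mem cmult_mem)
  have p0: "(\<lambda>_. 0) \<in> periodic" by (simp add: periodic_def zero_mem)
  have l0: "left_field b (\<lambda>_. 0) = 0" for b by (rule vf_const[OF left_field_VF])
  have sub: "fn.subspace ?S"
  proof (rule fn.subspaceI)
    show "0 \<in> ?S" using p0 by (intro CollectI exI[of _ "\<lambda>_ _. 0"]) (simp only: l0 sum.neutral_const ball_triv simp_thms)
    fix x y c assume "x \<in> ?S"
    then obtain F where F: "x = (\<Sum>b\<in>Basis. left_field b (F b))" "\<forall>b\<in>Basis. F b \<in> periodic" by blast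
    have "?sc c x = (\<Sum>b\<in>Basis. left_field b (\<lambda>z. c * F b z))"
    proof -
      have "left_field b (\<lambda>z. c * F b z) = ?sc c (left_field b (F b))" if "b \<in> Basis" for b
        using F(2) that by (intro vf_cmult[OF left_field_VF] periodicD(1)) auto
      then have "(\<Sum>b\<in>Basis. left_field b (\<lambda>z. c * F b z)) = (\<Sum>b\<in>Basis. ?sc c (left_field b (F b)))" by (intro sum.cong) auto
      then show ?thesis unfolding F(1) fn.scale_sum_right[symmetric] by simp
    qed
    then show "?sc c x \<in> ?S" using F(2) per(2) by (intro CollectI exI[of _ "\<lambda>b z. c * F b z"]) auto
    assume "y \<in> ?S"
    then obtain F' where F': "y = (\<Sum>b\<in>Basis. left_field b (F' b))" "\<forall>b\<in>Basis. F' b \<in> periodic" by blast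
    have "x + y = (\<Sum>b\<in>Basis. left_field b (F b + F' b))"
    proof -
      have "left_field b (F b + F' b) = left_field b (F b) + left_field b (F' b)" if "b \<in> Basis" for b
        using F(2) F'(2) that by (intro vf_add[OF left_field_VF] periodicD(1)) auto
      then have "(\<Sum>b\<in>Basis. left_field b (F b + F' b)) = (\<Sum>b\<in>Basis. left_field b (F b) + left_field b (F' b))" by (intro sum.cong) auto
      then show ?thesis unfolding F(1) F'(1) sum.distrib by (rule sym)
    qed
    then show "x + y \<in> ?S" using F(2) F'(2) per(1) by (intro CollectI exI[of _ "\<lambda>b. F b + F' b"]) auto
  qed
  have n1: "(1 :: 'g \<Rightarrow> complex) \<notin> ?S"
  proof
    assume "(1 :: 'g \<Rightarrow> complex) \<in> ?S"
    then obtain F where F: "1 = (\<Sum>b\<in>Basis. left_field b (F b))" "\<forall>b\<in>Basis. F b \<in> periodic" by blast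
    from one_not_divergence[of F] F(2) F(1)[symmetric] show False by blast
  qed
  obtain I where I: "\<And>x y. I (x + y) = I x + I y" "\<And>c x. I (?sc c x) = c * I x" "I 1 = 1" "\<And>x. x \<in> ?S \<Longrightarrow> I x = 0"
    by (rule fn.separating_functional[OF sub n1]) (rule that)
  have "I (\<lambda>_. c) = c" for c using I(2)[of c 1] I(3) by simp
  moreover have "I (left_field b f) = 0" if b: "b \<in> Basis" and f: "f \<in> periodic" for b f
  \<comment> \<open>A single derivative belongs to the subspace through the family that is 0 in all
    other directions.\<close>
  proof (rule I(4), intro CollectI exI[of _ "\<lambda>b'. if b' = b then f else (\<lambda>_. 0)"] conjI)
    have "(\<Sum>b'\<in>Basis. left_field b' (if b' = b then f else (\<lambda>_. 0))) = (\<Sum>b'\<in>Basis. if b' = b then left_field b f else 0)"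
      using l0 by (intro sum.cong) auto
    also have "\<dots> = left_field b f" using b by (subst sum.delta) auto
    finally show "left_field b f = (\<Sum>b'\<in>Basis. left_field b' (if b' = b then f else (\<lambda>_. 0)))" by (rule sym)
  qed (use f p0 in auto)
  ultimately show ?thesis by (rule that[OF I(1,2)])
qed

end

section \<open>The dual frame\<close>

text \<open>The independent rows are as many as the columns, so they span all functions supported on
  C; expanding the unit vectors in the rows gives a left inverse, and this is then also a right
  inverse.\<close>

lemma ex_inverse_matrix:
  fixes M :: "'b \<Rightarrow> 'c \<Rightarrow> 'a::field"
  assumes fin: "finite B" "finite C" and card: "card B = card C"
    and rows: "\<And>z. (\<And>c. c \<in> C \<Longrightarrow> (\<Sum>b\<in>B. z b * M b c) = 0) \<Longrightarrow> (\<And>b. b \<in> B \<Longrightarrow> z b = 0)"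
  obtains w where "\<And>b b'. b \<in> B \<Longrightarrow> b' \<in> B \<Longrightarrow> (\<Sum>c\<in>C. M b c * w b' c) = (if b = b' then 1 else 0)"
    and "\<And>c c'. c \<in> C \<Longrightarrow> c' \<in> C \<Longrightarrow> (\<Sum>b\<in>B. w b c * M b c') = (if c = c' then 1 else 0)"
proof -
  let ?sc = "\<lambda>(a :: 'a) (f :: 'c \<Rightarrow> 'a) x. a * f x"
  interpret fn: vector_space ?sc by standard (auto simp: fun_eq_iff algebra_simps)
  define r where "r = (\<lambda>b c. if c \<in> C then M b c else 0)"
  define \<delta> where "\<delta> = (\<lambda>(c :: 'c) c'. if c' = c then 1 else (0 :: 'a))"
  have inj: "inj_on r B"
  proof (rule inj_onI, rule ccontr)
    fix b b' assume b: "b \<in> B" "b' \<in> B" "r b = r b'" "b \<noteq> b'"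
    have "(\<Sum>x\<in>B. (if x = b then 1 else if x = b' then - 1 else 0) * M x c) = 0" if c: "c \<in> C" for c
    proof -
      have "(\<Sum>x\<in>B. (if x = b then 1 else if x = b' then - 1 else 0) * M x c) =
          (\<Sum>x\<in>B. (if x = b then M b c else 0) + (if x = b' then - M b' c else 0))"
        using b(4) by (intro sum.cong) auto
      also have "\<dots> = M b c - M b' c" using b(1,2) fin(1) by (simp add: sum.distrib)
      also have "\<dots> = 0" using fun_cong[OF b(3), of c] c by (simp add: r_def)
      finally show ?thesis .
    qed
    from rows[OF this b(1)] show False by simp
  qed
  have ind: "fn.independent (r ` B)"
  proof (rule fn.independent_if_scalars_zero)
    fix f x assume 0: "(\<Sum>x\<in>r ` B. ?sc (f x) x) = 0" and x: "x \<in> r ` B"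
    have "(\<Sum>b\<in>B. f (r b) * M b c) = 0" if c: "c \<in> C" for c
    proof -
      have "(\<Sum>b\<in>B. f (r b) * r b c) = (\<Sum>b\<in>B. ?sc (f (r b)) (r b)) c" by (simp only: fun_sum_apply)
      also have "(\<Sum>b\<in>B. ?sc (f (r b)) (r b)) = 0" using 0 by (simp only: sum.reindex[OF inj] o_def)
      finally show ?thesis using c by (simp add: r_def)
    qed
    then show "f x = 0" using rows[of "\<lambda>b. f (r b)"] x by blast
  qed (use fin in simp)
  have dspan: "f \<in> fn.span (\<delta> ` C)" if "\<And>c. c \<notin> C \<Longrightarrow> f c = 0" for f
  proof -
    have "f = (\<Sum>c\<in>C. ?sc (f c) (\<delta> c))"
    proof
      fix x
      have "(\<Sum>c\<in>C. ?sc (f c) (\<delta> c)) x = (\<Sum>c\<in>C. if x = c then f c else 0)"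
        unfolding fun_sum_apply by (intro sum.cong) (auto simp: \<delta>_def)
      also have "\<dots> = f x" using that fin(2) by (cases "x \<in> C") simp_all
      finally show "f x = (\<Sum>c\<in>C. ?sc (f c) (\<delta> c)) x" by (rule sym)
    qed
    moreover have "(\<Sum>c\<in>C. ?sc (f c) (\<delta> c)) \<in> fn.span (\<delta> ` C)"
      by (intro fn.span_sum fn.span_scale fn.span_base) auto
    ultimately show ?thesis by simp
  qed
  \<comment> \<open>Otherwise adjoining the unit vector to the rows gives more independent vectors
    than there are elements spanning the functions supported on C.\<close>
  have "\<delta> c \<in> fn.span (r ` B)" if c: "c \<in> C" for c
  proof (rule ccontr)
    assume n: "\<delta> c \<notin> fn.span (r ` B)"
    then have "\<delta> c \<notin> r ` B" using fn.span_base by blast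
    then have "card (insert (\<delta> c) (r ` B)) = Suc (card B)" using fin(1) inj by (simp add: card_image)
    moreover have "\<delta> c \<in> fn.span (\<delta> ` C)" "r b \<in> fn.span (\<delta> ` C)" for b
      using c by (intro fn.span_base imageI, simp) (rule dspan, simp add: r_def)
    then have "insert (\<delta> c) (r ` B) \<subseteq> fn.span (\<delta> ` C)" by blast
    then have "card (insert (\<delta> c) (r ` B)) \<le> card (\<delta> ` C)"
      using fn.independent_span_bound[OF _ fn.independent_insertI[OF n ind]] fin(2) by blast
    moreover have "card (\<delta> ` C) \<le> card C" by (rule card_image_le[OF fin(2)])
    ultimately show False using card by simp
  qed
  then have "\<exists>u. \<delta> c = (\<Sum>x\<in>r ` B. ?sc (u x) x)" if "c \<in> C" for c
    using that fn.span_finite[of "r ` B"] fin(1) by auto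
  then obtain u where u: "\<And>c. c \<in> C \<Longrightarrow> \<delta> c = (\<Sum>x\<in>r ` B. ?sc (u c x) x)" by metis
  define w where "w = (\<lambda>b c. u c (r b))"
  have left: "(\<Sum>b\<in>B. w b c * M b c') = (if c = c' then 1 else 0)" if c: "c \<in> C" "c' \<in> C" for c c'
  proof -
    have "(\<Sum>b\<in>B. w b c * r b c') = \<delta> c c'"
      unfolding u[OF c(1)] sum.reindex[OF inj] o_def fun_sum_apply w_def ..
    then show ?thesis using c by (auto simp: r_def \<delta>_def)
  qed
  have "(\<Sum>c\<in>C. M b c * w b' c) = (if b = b' then 1 else 0)" if b: "b \<in> B" "b' \<in> B" for b b'
  proof -
    \<comment> \<open>With the left inverse w at hand, the product of M w - 1 with M is 0; every row
      of M w - 1 is thus a relation among the rows of M, hence 0.\<close>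
    have "(\<Sum>x\<in>B. ((\<Sum>c\<in>C. M b c * w x c) - (if b = x then 1 else 0)) * M x c') = 0" if c': "c' \<in> C" for c'
    proof -
      have "(\<Sum>x\<in>B. (\<Sum>c\<in>C. M b c * w x c) * M x c') = (\<Sum>c\<in>C. M b c * (\<Sum>x\<in>B. w x c * M x c'))"
        unfolding sum_distrib_left sum_distrib_right by (subst sum.swap) (simp add: mult.assoc)
      also have "\<dots> = (\<Sum>c\<in>C. if c = c' then M b c' else 0)" using left c' by (intro sum.cong) auto
      also have "\<dots> = M b c'" using c' fin(2) by simp
      moreover have "(\<Sum>x\<in>B. (if b = x then 1 else 0) * M x c') = (\<Sum>x\<in>B. if b = x then M x c' else 0)"
        by (intro sum.cong) auto
      then have "(\<Sum>x\<in>B. (if b = x then 1 else 0) * M x c') = M b c'" using b(1) fin(1) by simp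
      ultimately show ?thesis by (simp only: left_diff_distrib sum_subtractf diff_self)
    qed
    from rows[OF this b(2)] show ?thesis by simp
  qed
  then show ?thesis using left by (rule that)
qed

lemma (in function_algebra) form_sum_vf:
  assumes w: "\<omega> \<in> forms A n" and "finite I" "\<And>i. i \<in> I \<Longrightarrow> X i \<in> VF"
  shows "\<omega> [\<Sum>i\<in>I. vf_mult (\<lambda>_. z i) (X i)] x = (\<Sum>i\<in>I. z i * \<omega> [X i] x)"
proof -
  have "contr (\<Sum>i\<in>I. vf_mult (\<lambda>_. z i) (X i)) \<omega> [] x = (\<Sum>i\<in>I. fscale (\<lambda>_. z i) (contr (X i) \<omega>)) [] x"
    by (subst contr_sum_vf[OF w assms(2) const_mem assms(3)]) auto
  then show ?thesis by (simp add: contr_def fscale_def fun_sum_apply)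
qed

lemma (in function_algebra) form_diff_vf:
  assumes w: "\<omega> \<in> forms A n" and X: "X \<in> VF" and Y: "Y \<in> VF"
  shows "\<omega> [X - Y] x = \<omega> [X] x - \<omega> [Y] x"
proof -
  have "contr (X + - Y) \<omega> [] x = (contr X \<omega> - contr Y \<omega>) [] x"
    by (simp only: contr_anyform(2)[OF w X VF_uminus[OF Y]] contr_uminus_vf[OF w Y] diff_conv_add_uminus)
  then show ?thesis by (simp add: contr_def)
qed

lemma (in function_algebra) form_mult_vf:
  "\<omega> \<in> forms A n \<Longrightarrow> X \<in> VF \<Longrightarrow> f \<in> A \<Longrightarrow> \<omega> [vf_mult f X] x = f x * \<omega> [X] x"
  using contr_anyform(3)[of \<omega> n X f] by (simp add: contr_def fscale_def fun_eq_iff)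

lemma (in smooth_lie_group) translate_conj: "vf_conj (vf_translate G a X) = vf_translate G a (vf_conj X)"
  by (simp add: vf_conj_def vf_translate_def)

section \<open>The frame dual to an invariant coframe\<close>

locale invariant_coframe = based_nilmanifold G \<A> U0 \<phi>0 \<rho> \<Gamma>
  for G :: "('g::{t2_space,second_countable_topology}) monoid" and \<A> :: "('g, 'e::euclidean_space) atlas"
    and U0 :: "'g set" and \<phi>0 :: "'g \<Rightarrow> 'e" and \<rho> :: real and \<Gamma> :: "'g set" +
  fixes J :: "'g vf \<Rightarrow> 'g vf" and \<eta> :: "nat \<Rightarrow> 'g form" and k :: nat
  assumes dim: "DIM('e) = 2 * k" and J_inv: "invariant_complex_structure (smooth_functions \<A>) G J"
    and \<eta>_mem: "j \<in> {1..k} \<Longrightarrow> \<eta> j \<in> biforms (smooth_functions \<A>) J (invariant_forms (smooth_functions \<A>) G (carrier G)) 1 0"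
    and \<eta>_inj: "inj_on \<eta> {1..k}" and \<eta>_indep: "\<not> form.dependent (\<eta> ` {1..k})"
begin

sublocale complex_algebra A J
  by unfold_locales (use J_inv in \<open>simp add: invariant_complex_structure_def\<close>)

definition E :: "nat \<times> bool \<Rightarrow> 'g form" where
  "E = (\<lambda>(j, e). if e then form_conj (\<eta> j) else \<eta> j)"

lemma E_simps [simp]: "E (j, False) = \<eta> j" "E (j, True) = form_conj (\<eta> j)"
  by (simp_all add: E_def)

abbreviation "idx \<equiv> {1..k} \<times> (UNIV :: bool set)"

lemma \<eta>_forms: "j \<in> {1..k} \<Longrightarrow> \<eta> j \<in> forms A 1"
  using \<eta>_mem[of j] by (simp add: biforms_def invariant_forms_def)

lemma E_form: "b \<in> idx \<Longrightarrow> E b \<in> forms A 1"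
  using \<eta>_forms form_conj_forms by (cases b; cases "snd b") auto

lemma conj_E: "form_conj (E (j, e)) = E (j, \<not> e)"
  by (cases e) (simp_all add: form_conj_def o_def)

lemma E_not: "E (j, \<not> e) [X] x = cnj (E (j, e) [vf_conj X] x)"
  unfolding conj_E[symmetric] by (simp add: form_conj_def)

lemma E_invariant:
  assumes b: "b \<in> idx" and X: "X \<in> VF"
  shows "E b [vf_translate G a X] = (\<lambda>x. E b [X] (ginv a \<cdot> x))"
proof -
  have n: "\<eta> j [vf_translate G a Y] = (\<lambda>x. \<eta> j [Y] (ginv a \<cdot> x))" if j: "j \<in> {1..k}" and Y: "Y \<in> VF" for j Y
  proof -
    have "\<eta> j \<in> invariant_forms A G (carrier G) 1" using \<eta>_mem[OF j] by (simp add: biforms_def)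
    then have "\<forall>Xs. set Xs \<subseteq> VF \<longrightarrow> \<eta> j (map (vf_translate G a) Xs) = (\<lambda>x. \<eta> j Xs (ginv a \<cdot> x))"
      using carr by (simp add: invariant_forms_def)
    from this[rule_format, of "[Y]"] Y show ?thesis by simp
  qed
  show ?thesis
  proof (cases b)
    case (Pair j e)
    then have j: "j \<in> {1..k}" using b by simp
    show ?thesis
    proof (cases e)
      case True
      then show ?thesis using Pair n[OF j VF_conj[OF X]] by (simp add: form_conj_def translate_conj)
    next
      case False
      then show ?thesis using Pair n[OF j X] by simp
    qed
  qed
qed

text \<open>A form of type (1,0) depends only on the (1,0)-part of its argument, and J acts on that
  part as \<i>; the barred case is the conjugate.\<close>

lemma E_J:
  assumes X: "X \<in> VF" and j: "j \<in> {1..k}"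
  shows "E (j, e) [J X] = (\<lambda>x. (if e then - \<i> else \<i>) * E (j, e) [X] x)"
proof -
  have p: "\<eta> j [Y] = \<eta> j [proj10 J Y]" if Y: "Y \<in> VF" for Y
  proof -
    have "{S. S \<subseteq> {..<Suc 0} \<and> int (card S) = 1} = {{0}}" by (auto simp: subset_singleton_iff lessThan_Suc)
    then have "T 1 0 (\<eta> j) [Y] = \<eta> j [proj10 J Y]" using Y by (simp add: bicomponent_def)
    moreover have "T 1 0 (\<eta> j) = \<eta> j" using \<eta>_mem[OF j] by (simp add: biforms_def)
    ultimately show ?thesis by simp
  qed
  have n: "\<eta> j [J Y] x = \<i> * \<eta> j [Y] x" if Y: "Y \<in> VF" for Y x
  proof -
    have "proj10 J (J Y) = vf_mult (\<lambda>_. \<i>) (proj10 J Y)"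
      by (simp add: proj10_def vf_mult_def J_J[OF Y] fun_eq_iff field_simps)
    then show ?thesis using p[OF Y] p[OF J_VF[OF Y]] form_mult_vf[OF \<eta>_forms[OF j] proj10_VF[OF Y] const_mem] by simp
  qed
  show ?thesis
  proof (cases e)
    case True
    have "form_conj (\<eta> j) [J X] x = - \<i> * form_conj (\<eta> j) [X] x" for x
      using n[OF VF_conj[OF X], of x] by (simp add: form_conj_def J_conj[OF X, symmetric])
    then show ?thesis using True by auto
  qed (auto simp: n[OF X])
qed

text \<open>The matrix of the coframe with respect to the basis of left-invariant fields; by
  invariance its entries do not depend on the point, so the unit is as good as any.\<close>

definition coeff :: "nat \<times> bool \<Rightarrow> 'e \<Rightarrow> complex" where
  "coeff b c = E b [left_field c] \<one>\<^bsub>G\<^esub>"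

lemma E_left_field:
  assumes b: "b \<in> idx" shows "E b [left_field c] = (\<lambda>_. coeff b c)"
proof
  fix x
  show "E b [left_field c] x = coeff b c"
    using fun_cong[OF E_invariant[OF b left_field_VF, of x c], of x] by (simp add: left_field_invariant coeff_def)
qed

text \<open>X and the corresponding combination of left-invariant fields agree at the unit as
  derivations, so \<open>one_form_pointwise\<close> applies to their difference.\<close>

lemma form_value_one:
  assumes w: "\<omega> \<in> forms A 1" and X: "X \<in> VF"
    and v: "\<And>f. f \<in> A \<Longrightarrow> X f \<one>\<^bsub>G\<^esub> = (\<Sum>b\<in>Basis. v b * D f e0 b)"
  shows "\<omega> [X] \<one>\<^bsub>G\<^esub> = (\<Sum>b\<in>Basis. v b * \<omega> [left_field b] \<one>\<^bsub>G\<^esub>)"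
proof -
  let ?S = "\<Sum>b\<in>Basis. vf_mult (\<lambda>_. v b) (left_field b)"
  have S: "?S \<in> VF" by (intro VF_sum VF_mult left_field_VF const_mem)
  have "\<omega> [X - ?S] \<one>\<^bsub>G\<^esub> = 0"
  proof (rule one_form_pointwise[OF w VF_diff[OF X S]])
    fix f assume f: "f \<in> A"
    have "?S f \<one>\<^bsub>G\<^esub> = (\<Sum>b\<in>Basis. v b * D f e0 b)"
      by (simp add: fun_sum_apply vf_mult_def left_field_one[OF f])
    then show "(X - ?S) f \<one>\<^bsub>G\<^esub> = 0" using v[OF f] by simp
  qed
  then show ?thesis
    by (simp only: form_diff_vf[OF w X S] form_sum_vf[OF w finite_Basis left_field_VF] right_minus_eq)
qed

text \<open>A relation on the left-invariant fields holds at the unit for all fields by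
  \<open>form_value_one\<close>, and everywhere by translation. It then splits into an unbarred and
  a barred relation, both of which contradict the independence of \<eta> unless trivial.\<close>

lemma coframe_independent:
  assumes zero: "\<And>c. c \<in> Basis \<Longrightarrow> (\<Sum>b\<in>idx. z b * coeff b c) = 0" and b0: "b0 \<in> idx"
  shows "z b0 = 0"
proof -
  define \<Omega> where "\<Omega> = (\<Sum>b\<in>idx. cscale (z b) (E b))"
  have \<Omega>: "\<Omega> \<in> forms A 1" unfolding \<Omega>_def by (intro sum_forms cscale_forms E_form)
  have \<Omega>x: "\<Omega> [X] x = (\<Sum>b\<in>idx. z b * E b [X] x)" for X x
    unfolding \<Omega>_def by (simp only: fun_sum_apply cscale_def)
  have one: "\<Omega> [X] \<one>\<^bsub>G\<^esub> = 0" if X: "X \<in> VF" for X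
  proof -
    obtain v where v: "\<And>f. f \<in> A \<Longrightarrow> X f \<one>\<^bsub>G\<^esub> = (\<Sum>b\<in>Basis. v b * D f e0 b)" using VF_expand_one[OF X] by blast
    have "\<Omega> [left_field c] \<one>\<^bsub>G\<^esub> = 0" if "c \<in> Basis" for c
      using zero[OF that] by (simp only: \<Omega>x coeff_def)
    moreover have "\<Omega> [X] \<one>\<^bsub>G\<^esub> = (\<Sum>b\<in>Basis. v b * \<Omega> [left_field b] \<one>\<^bsub>G\<^esub>)"
      by (rule form_value_one[OF \<Omega> X v])
    ultimately show ?thesis by simp
  qed
  have all: "(\<Sum>b\<in>idx. z b * E b [X] x) = 0" if X: "X \<in> VF" for X x
  proof -
    have "(\<Sum>b\<in>idx. z b * E b [vf_translate G (ginv x) X] \<one>\<^bsub>G\<^esub>) = 0"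
      using one[OF translate_VF[OF X]] unfolding \<Omega>x .
    moreover have "E b [vf_translate G (ginv x) X] \<one>\<^bsub>G\<^esub> = E b [X] x" if "b \<in> idx" for b
      by (simp add: E_invariant[OF that X])
    ultimately show ?thesis by simp
  qed
  have split: "(\<Sum>b\<in>idx. h b) = (\<Sum>j\<in>{1..k}. h (j, False)) + (\<Sum>j\<in>{1..k}. h (j, True))" for h :: "nat \<times> bool \<Rightarrow> complex"
  proof -
    have "(\<Sum>j\<in>{1..k}. \<Sum>e\<in>UNIV. h (j, e)) = (\<Sum>b\<in>idx. h b)"
      unfolding sum.cartesian_product by (simp only: case_prod_eta)
    then show ?thesis by (simp add: UNIV_bool sum.distrib add.commute)
  qed
  \<comment> \<open>Replacing X by J X multiplies the unbarred part by \<i> and the barred part by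
    -\<i>, so the vanishing of both combinations separates the two parts.\<close>
  have sep: "(\<Sum>j\<in>{1..k}. z (j, e) * E (j, e) [X] x) = 0" if X: "X \<in> VF" for X x e
  proof -
    let ?S = "\<lambda>e. \<Sum>j\<in>{1..k}. z (j, e) * E (j, e) [X] x"
    have 1: "?S False + ?S True = 0" using all[OF X, of x] unfolding split .
    have "(\<Sum>j\<in>{1..k}. z (j, e) * E (j, e) [J X] x) = (if e then - \<i> else \<i>) * ?S e" for e
      unfolding sum_distrib_left using E_J[OF X] by (intro sum.cong) (auto simp: mult_ac)
    then have 2: "\<i> * ?S False + - \<i> * ?S True = 0"
      using all[OF J_VF[OF X], of x] unfolding split by (simp only: if_True if_False)
    have "a = 0 \<and> b = 0" if "a + b = 0" "\<i> * a + - \<i> * b = 0" for a b :: complex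
      using that by (auto simp: add_eq_0_iff)
    from this[OF 1 2] show ?thesis by (cases e) (simp_all only: simp_thms)
  qed
  have indep: "\<mu> j = 0" if \<mu>: "\<And>X x. X \<in> VF \<Longrightarrow> (\<Sum>j\<in>{1..k}. \<mu> j * \<eta> j [X] x) = 0" and j: "j \<in> {1..k}" for \<mu> j
  proof -
    have "(\<Sum>j\<in>{1..k}. cscale (\<mu> j) (\<eta> j)) = 0"
    proof (intro ext)
      fix Xs x
      show "(\<Sum>j\<in>{1..k}. cscale (\<mu> j) (\<eta> j)) Xs x = 0 Xs x"
      proof (cases "set Xs \<subseteq> VF \<and> length Xs = 1")
        case True
        then obtain X where "Xs = [X]" "X \<in> VF" by (cases Xs) auto
        then show ?thesis using \<mu>[of X x] by (simp add: fun_sum_apply cscale_def)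
      next
        case False
        then have "\<eta> j Xs = 0" if "j \<in> {1..k}" for j using form_outside[OF \<eta>_forms[OF that]] by blast
        then show ?thesis by (simp add: fun_sum_apply cscale_def)
      qed
    qed
    then have "(\<Sum>v\<in>\<eta> ` {1..k}. cscale (\<mu> (inv_into {1..k} \<eta> v)) v) = 0"
      unfolding sum.reindex[OF \<eta>_inj] using inv_into_f_f[OF \<eta>_inj] by (simp del: atLeastAtMost_iff cong: sum.cong)
    from form.independentD[OF \<eta>_indep _ order_refl this, of "\<eta> j"] j show ?thesis
      using inv_into_f_f[OF \<eta>_inj j] by auto
  qed
  obtain j0 e0 where b: "b0 = (j0, e0)" "j0 \<in> {1..k}" using b0 by (cases b0) auto
  show ?thesis
  proof (cases e0)
    case True
    have "cnj (z (j0, True)) = 0"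
    proof (rule indep[OF _ b(2)])
      fix X x assume X: "X \<in> VF"
      have eq: "(\<Sum>j\<in>{1..k}. cnj (z (j, True)) * \<eta> j [X] x) = cnj (\<Sum>j\<in>{1..k}. z (j, True) * E (j, True) [vf_conj X] x)"
        by (simp add: form_conj_def)
      show "(\<Sum>j\<in>{1..k}. cnj (z (j, True)) * \<eta> j [X] x) = 0"
        unfolding eq sep[OF VF_conj[OF X]] by (rule complex_cnj_zero)
    qed
    then show ?thesis using True b by simp
  next
    case False
    have "z (j0, False) = 0" by (rule indep[OF _ b(2)]) (use sep[of _ False] in simp)
    then show ?thesis using False b by simp
  qed
qed

lemma ex_dual:
  obtains w where "\<And>b b'. b \<in> idx \<Longrightarrow> b' \<in> idx \<Longrightarrow> (\<Sum>c\<in>Basis. coeff b c * w b' c) = (if b = b' then 1 else 0)"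
    and "\<And>c c'. c \<in> Basis \<Longrightarrow> c' \<in> Basis \<Longrightarrow> (\<Sum>b\<in>idx. w b c * coeff b c') = (if c = c' then 1 else 0)"
proof (rule ex_inverse_matrix[of idx "Basis :: 'e set" coeff])
  show "card idx = DIM('e)" using dim by (simp add: card_cartesian_product)
qed (use coframe_independent that in auto)

context
  fixes w :: "nat \<times> bool \<Rightarrow> 'e \<Rightarrow> complex"
  assumes right: "\<And>b b'. b \<in> idx \<Longrightarrow> b' \<in> idx \<Longrightarrow> (\<Sum>c\<in>Basis. coeff b c * w b' c) = (if b = b' then 1 else 0)"
    and left: "\<And>c c'. c \<in> Basis \<Longrightarrow> c' \<in> Basis \<Longrightarrow> (\<Sum>b\<in>idx. w b c * coeff b c') = (if c = c' then 1 else 0)"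
begin

definition Z :: "nat \<times> bool \<Rightarrow> 'g vf" where
  "Z b = (\<Sum>c\<in>Basis. vf_mult (\<lambda>_. w b c) (left_field c))"

lemma Z_apply: "Z b f x = (\<Sum>c\<in>Basis. w b c * left_field c f x)"
  by (simp add: Z_def fun_sum_apply vf_mult_def)

lemma Z_VF: "Z b \<in> VF"
  unfolding Z_def by (intro VF_sum VF_mult left_field_VF const_mem)

lemma Z_invariant: "vf_translate G a (Z b) = Z b"
proof (intro ext)
  fix f x
  have "left_field c (\<lambda>y. f (a \<cdot> y)) (ginv a \<cdot> x) = left_field c f x" for c
    using left_field_invariant[of a c] by (simp add: vf_translate_def fun_eq_iff)
  then show "vf_translate G a (Z b) f x = Z b f x" unfolding vf_translate_def Z_apply by simp
qed

lemma E_Z: "b \<in> idx \<Longrightarrow> b' \<in> idx \<Longrightarrow> E b [Z b'] x = (if b = b' then 1 else 0)"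
  using right[of b b'] unfolding Z_def
  by (simp only: form_sum_vf[OF E_form finite_Basis left_field_VF] E_left_field mult.commute)

text \<open>At the unit a derivation is a combination of directional derivatives, and the left
  inverse of the coefficient matrix rewrites these in terms of Z. Left invariance carries the
  identity to the other points.\<close>

lemma expand:
  assumes X: "X \<in> VF" shows "X = (\<Sum>b\<in>idx. vf_mult (E b [X]) (Z b))"
proof -
  have one: "Y f \<one>\<^bsub>G\<^esub> = (\<Sum>b\<in>idx. E b [Y] \<one>\<^bsub>G\<^esub> * Z b f \<one>\<^bsub>G\<^esub>)" if Y: "Y \<in> VF" and f: "f \<in> A" for Y f
  proof -
    obtain v where v: "\<And>f. f \<in> A \<Longrightarrow> Y f \<one>\<^bsub>G\<^esub> = (\<Sum>b\<in>Basis. v b * D f e0 b)" using VF_expand_one[OF Y] by blast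
    have 1: "E b [Y] \<one>\<^bsub>G\<^esub> = (\<Sum>c'\<in>Basis. v c' * coeff b c')" if b: "b \<in> idx" for b
      using form_value_one[OF E_form[OF b] Y v] by (simp add: coeff_def)
    have "(\<Sum>b\<in>idx. E b [Y] \<one>\<^bsub>G\<^esub> * Z b f \<one>\<^bsub>G\<^esub>) =
        (\<Sum>b\<in>idx. \<Sum>c'\<in>Basis. \<Sum>c\<in>Basis. v c' * coeff b c' * (w b c * D f e0 c))"
      by (intro sum.cong refl) (simp only: 1 Z_apply left_field_one[OF f] sum_product)
    also have "\<dots> = (\<Sum>c'\<in>Basis. \<Sum>b\<in>idx. \<Sum>c\<in>Basis. v c' * coeff b c' * (w b c * D f e0 c))"
      by (rule sum.swap)
    also have "\<dots> = (\<Sum>c'\<in>Basis. \<Sum>c\<in>Basis. \<Sum>b\<in>idx. v c' * coeff b c' * (w b c * D f e0 c))"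
      by (rule sum.cong[OF refl]) (rule sum.swap)
    also have "\<dots> = (\<Sum>c'\<in>Basis. \<Sum>c\<in>Basis. (v c' * D f e0 c) * (\<Sum>b\<in>idx. w b c * coeff b c'))"
      unfolding sum_distrib_left by (intro sum.cong refl) (simp only: mult_ac)
    also have "\<dots> = (\<Sum>c'\<in>Basis. \<Sum>c\<in>Basis. if c = c' then v c' * D f e0 c' else 0)"
      by (intro sum.cong refl, simp only: left) auto
    also have "\<dots> = (\<Sum>c'\<in>Basis. v c' * D f e0 c')"
      by (intro sum.cong refl) simp
    finally show ?thesis using v[OF f] by simp
  qed
  show ?thesis
  proof (intro ext)
    fix f p
    show "X f p = (\<Sum>b\<in>idx. vf_mult (E b [X]) (Z b)) f p"
    proof (cases "f \<in> A")
      case True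
      \<comment> \<open>Translating both the field and the function moves the point p to the unit,
        while Z is unchanged.\<close>
      let ?Y = "vf_translate G (ginv p) X" and ?f = "\<lambda>y. f (p \<cdot> y)"
      have t: "vf_translate G (ginv p) W ?f \<one>\<^bsub>G\<^esub> = W f p" for W by (simp add: vf_translate_def)
      have Zt: "Z b ?f \<one>\<^bsub>G\<^esub> = Z b f p" for b using t[of "Z b"] by (simp only: Z_invariant)
      have Et: "E b [?Y] \<one>\<^bsub>G\<^esub> = E b [X] p" if "b \<in> idx" for b by (simp add: E_invariant[OF that X])
      have "?Y ?f \<one>\<^bsub>G\<^esub> = (\<Sum>b\<in>idx. E b [?Y] \<one>\<^bsub>G\<^esub> * Z b ?f \<one>\<^bsub>G\<^esub>)"
        by (rule one[OF translate_VF[OF X] A_translate[OF True]])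
      then have "X f p = (\<Sum>b\<in>idx. E b [?Y] \<one>\<^bsub>G\<^esub> * Z b ?f \<one>\<^bsub>G\<^esub>)" by (simp only: t)
      also have "\<dots> = (\<Sum>b\<in>idx. E b [X] p * Z b f p)" by (intro sum.cong refl) (simp only: Zt Et)
      finally show ?thesis by (simp only: fun_sum_apply vf_mult_def times_fun_apply)
    next
      case False
      then show ?thesis by (simp add: fun_sum_apply vf_mult_def vf_outside[OF X] vf_outside[OF Z_VF])
    qed
  qed
qed

text \<open>A field is recognized by its values under the coframe; this converts the action of J and
  of conjugation on coframe values into their action on Z.\<close>

lemma eq_multiple_Z:
  assumes X: "X \<in> VF" and b0: "b0 \<in> idx" and E: "\<And>b x. b \<in> idx \<Longrightarrow> E b [X] x = (if b = b0 then z else 0)"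
  shows "X = vf_mult (\<lambda>_. z) (Z b0)"
proof (intro ext)
  fix f p
  have "X f p = (\<Sum>b\<in>idx. vf_mult (E b [X]) (Z b)) f p" using expand[OF X] by simp
  also have "\<dots> = (\<Sum>b\<in>idx. if b = b0 then z * Z b0 f p else 0)"
    unfolding fun_sum_apply vf_mult_def by (intro sum.cong) (auto simp: E)
  also have "\<dots> = z * Z b0 f p" using b0 by (subst sum.delta) auto
  finally show "X f p = vf_mult (\<lambda>_. z) (Z b0) f p" by (simp add: vf_mult_def)
qed

lemma J_Z: "j \<in> {1..k} \<Longrightarrow> J (Z (j, e)) = vf_mult (\<lambda>_. if e then - \<i> else \<i>) (Z (j, e))"
proof (rule eq_multiple_Z[OF J_VF[OF Z_VF]])
  fix b x assume "j \<in> {1..k}" and b: "b \<in> idx"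
  then have bj: "fst b \<in> {1..k}" "(j, e) \<in> idx" by auto
  have "E b [J (Z (j, e))] x = (if snd b then - \<i> else \<i>) * E b [Z (j, e)] x"
    using E_J[OF Z_VF bj(1), of "snd b"] by simp
  also have "\<dots> = (if b = (j, e) then if e then - \<i> else \<i> else 0)"
    unfolding E_Z[OF b bj(2)] by auto
  finally show "E b [J (Z (j, e))] x = (if b = (j, e) then if e then - \<i> else \<i> else 0)" .
qed simp

lemma conj_Z: assumes j: "j \<in> {1..k}" shows "vf_conj (Z (j, e)) = Z (j, \<not> e)"
proof -
  have "E b [vf_conj (Z (j, e))] x = (if b = (j, \<not> e) then 1 else 0)" if b: "b \<in> idx" for b x
  proof (cases b)
    case (Pair l f)
    have "E (l, f) [vf_conj (Z (j, e))] x = cnj (E (l, \<not> f) [Z (j, e)] x)"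
      using E_not[of l f "Z (j, e)" x] by simp
    then show ?thesis using b j unfolding Pair by (cases e; cases f; simp add: E_Z del: E_simps)
  qed
  then have "vf_conj (Z (j, e)) = vf_mult (\<lambda>_. 1) (Z (j, \<not> e))"
    using j by (intro eq_multiple_Z VF_conj Z_VF) auto
  also have "\<dots> = Z (j, \<not> e)" by (simp add: vf_mult_def fun_eq_iff)
  finally show ?thesis .
qed

lemma mean_Z:
  assumes I: "\<And>f g. I (f + g) = I f + (I g :: complex)" "\<And>c f. I (\<lambda>x. c * f x) = c * I f" "\<And>c. I (\<lambda>_. c) = c"
    "\<And>b f. b \<in> Basis \<Longrightarrow> f \<in> periodic \<Longrightarrow> I (left_field b f) = 0"
    and f: "f \<in> periodic"
  shows "I (Z b f) = 0"
proof -
  have s: "I (\<Sum>c\<in>B. h c) = (\<Sum>c\<in>B. I (h c))" if "finite B" for B :: "'e set" and h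
    using that
  proof (induction rule: finite_induct)
    case empty
    show ?case using I(3)[of 0] by simp
  next
    case (insert x F)
    show ?case unfolding sum.insert[OF insert.hyps] I(1) insert.IH ..
  qed
  have "Z b f = (\<Sum>c\<in>Basis. (\<lambda>x. w b c * left_field c f x))"
    by (intro ext) (simp only: Z_apply fun_sum_apply)
  then have "I (Z b f) = (\<Sum>c\<in>Basis. I (\<lambda>x. w b c * left_field c f x))" using s[OF finite_Basis] by simp
  also have "\<dots> = 0" by (intro sum.neutral ballI) (simp only: I(2) I(4)[OF _ f] mult_zero_right)
  finally show ?thesis .
qed

end

lemma ex_nil_frame:
  assumes k: "1 \<le> k" and lower: "\<And>j. j \<in> {1..k - 1} \<Longrightarrow> ext_d A (\<eta> j) = 0"
    and top: "ext_d A (\<eta> k) \<in> form.span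
           ({\<eta> j \<and>\<^sub>w \<eta> l | j l. j \<in> {1..k - 1} \<and> l \<in> {1..k - 1}} \<union>
            {\<eta> j \<and>\<^sub>w form_conj (\<eta> l) | j l. j \<in> {1..k - 1} \<and> l \<in> {1..k - 1}})"
  shows "\<exists>Z I. nil_frame A J k E Z G \<Gamma> I"
proof -
  obtain w where w: "\<And>b b'. b \<in> idx \<Longrightarrow> b' \<in> idx \<Longrightarrow> (\<Sum>c\<in>Basis. coeff b c * w b' c) = (if b = b' then 1 else 0)"
    "\<And>c c'. c \<in> Basis \<Longrightarrow> c' \<in> Basis \<Longrightarrow> (\<Sum>b\<in>idx. w b c * coeff b c') = (if c = c' then 1 else 0)"
    by (rule ex_dual) (rule that)
  obtain I :: "('g \<Rightarrow> complex) \<Rightarrow> complex" where I: "\<And>f g. I (f + g) = I f + I g" "\<And>c f. I (\<lambda>x. c * f x) = c * I f"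
    "\<And>c. I (\<lambda>_. c) = c" "\<And>b f. b \<in> Basis \<Longrightarrow> f \<in> periodic \<Longrightarrow> I (left_field b f) = 0"
    by (rule invariant_mean) (rule that)
  note [simp del] = E_simps
  have "nil_frame A J k E (Z w) G \<Gamma> I"
  proof (intro nil_frame.intro nil_frame_axioms.intro hermitian_frame.intro hermitian_frame_axioms.intro
      frame.intro frame_axioms.intro)
    show "complex_algebra A J" by (rule complex_algebra_axioms)
    show "1 \<le> k" by (rule k)
    show "E b \<in> forms A 1" if "b \<in> idx" for b by (rule E_form[OF that])
    show "Z w b \<in> VF" for b by (rule Z_VF[OF w])
    show "X = (\<Sum>b\<in>idx. vf_mult (E b [X]) (Z w b))" if "X \<in> VF" for X by (rule expand[OF w that])
    show "J (Z w (j, e)) = vf_mult (\<lambda>_. if e then - \<i> else \<i>) (Z w (j, e))" if "j \<in> {1..k}" for j e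
      by (rule J_Z[OF w that])
    show "vf_conj (Z w (j, e)) = Z w (j, \<not> e)" if "j \<in> {1..k}" for j e by (rule conj_Z[OF w that])
    show "form_conj (E (j, e)) = E (j, \<not> e)" for j e by (rule conj_E)
    show "E (j, e) [J X] = (\<lambda>x. (if e then - \<i> else \<i>) * E (j, e) [X] x)" if "X \<in> VF" "j \<in> {1..k}" for X j e
      by (rule E_J[OF that])
    show "group G" "carrier G = UNIV" "subgroup \<Gamma> G" by (rule grp carr Gamma)+
    show "E b [vf_translate G a X] = (\<lambda>x. E b [X] (ginv a \<cdot> x))" if "b \<in> idx" "X \<in> VF" for b X a
      by (rule E_invariant[OF that])
    show "vf_translate G a X \<in> VF" if "X \<in> VF" for X a by (rule translate_VF[OF that])
    show "vf_translate G a (Z w b) = Z w b" for a b by (rule Z_invariant[OF w])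
    show "I (f + g) = I f + I g" "I (\<lambda>x. c * f x) = c * I f" "I (\<lambda>_. c) = c" for f g c by (rule I)+
    show "E b [Z w c] = (if b = c then 1 else 0)" if "b \<in> idx" "c \<in> idx" for b c
      by (rule ext, simp only: E_Z[OF w that]) simp
    show "I (Z w b f) = 0" if "f \<in> A" "\<And>a x. a \<in> \<Gamma> \<Longrightarrow> f (a \<cdot> x) = f x" for b f
      by (rule mean_Z[OF w I]) (use that in \<open>auto simp: periodic_def\<close>)
    show "ext_d A (E (j, False)) = 0" if "j \<in> {1..k - 1}" for j using lower[OF that] by (simp only: E_simps)
    show "ext_d A (E (k, False)) \<in> form.span
      ({E (j, False) \<and>\<^sub>w E (l, False) | j l. j \<in> {1..k - 1} \<and> l \<in> {1..k - 1}} \<union>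
       {E (j, False) \<and>\<^sub>w E (l, True) | j l. j \<in> {1..k - 1} \<and> l \<in> {1..k - 1}})"
      using top by (simp only: E_simps)
  qed
  then show ?thesis by blast
qed

end

theorem theorem4p5:
  fixes G :: "'g::{t2_space,second_countable_topology} monoid"
    and \<A> :: "('g, 'e::euclidean_space) atlas"
    and \<Gamma> :: "'g set"
    and J :: "'g vf \<Rightarrow> 'g vf"
    and \<eta> :: "nat \<Rightarrow> 'g form"
    and k p q r s :: nat
    and "is" js ls ms ts vs :: "nat list"
    and c :: complex
    and A :: "('g \<Rightarrow> complex) set"
    and \<Lambda> :: "int \<Rightarrow> int \<Rightarrow> 'g form set"
    and \<alpha> \<beta> \<gamma> \<eta>kk :: "'g form"
  defines "A \<equiv> smooth_functions \<A>"
    and "\<Lambda> \<equiv> biforms A J (invariant_forms A G (carrier G))"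
    and "\<alpha> \<equiv> eta_monomial \<eta> is js"
    and "\<beta> \<equiv> eta_monomial \<eta> ls ms"
    and "\<gamma> \<equiv> cscale c (eta_monomial \<eta> ts vs)"
    and "\<eta>kk \<equiv> \<eta> k \<and>\<^sub>w form_conj (\<eta> k)"
  assumes "nilmanifold G \<A> \<Gamma>"
    and "DIM('e) = 2 * k"
    and "invariant_complex_structure A G J"
    and "inj_on \<eta> {1..k}" and "\<not> form.dependent (\<eta> ` {1..k})" and "form.span (\<eta> ` {1..k}) = \<Lambda> 1 0"
    and "\<forall>j\<in>{1..k - 1}. ext_d A (\<eta> j) = 0"
    and "ext_d A (\<eta> k) \<in> form.span
           ({\<eta> j \<and>\<^sub>w \<eta> l | j l. j \<in> {1..k - 1} \<and> l \<in> {1..k - 1}} \<union>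
            {\<eta> j \<and>\<^sub>w form_conj (\<eta> l) | j l. j \<in> {1..k - 1} \<and> l \<in> {1..k - 1}})"
    and "set is \<subseteq> {1..k}" and "length is = p" and "set js \<subseteq> {1..k}" and "length js = q"
    and "set ls \<subseteq> {1..k}" and "length ls = r" and "set ms \<subseteq> {1..k}" and "length ms = s"
    and "set ts \<subseteq> {1..k}" and "int (length ts) = int p + int r - 2"
    and "set vs \<subseteq> {1..k}" and "int (length vs) = int q + int s - 2"
    and "c \<noteq> 0"
    and "bott_chern_harmonic A J k (fundamental_form k \<eta>) (p + q) \<alpha>"
    and "bott_chern_harmonic A J k (fundamental_form k \<eta>) (r + s) \<beta>"
    and "\<alpha> \<and>\<^sub>w \<beta> \<noteq> 0"
    and "cscale ((- 1) ^ (p + q)) (\<alpha> \<and>\<^sub>w \<beta>) = del A J (delbar A J (\<eta>kk \<and>\<^sub>w \<gamma>))"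
    and "del A J (delbar A J (\<eta>kk \<and>\<^sub>w \<gamma>)) = del A J (delbar A J \<eta>kk) \<and>\<^sub>w \<gamma>"
    and "\<gamma> \<and>\<^sub>w \<beta> \<noteq> 0"
    and "\<forall>\<phi>\<in>\<Lambda> (int p + int r - 2) (int q + int s - 2).
           del A J (delbar A J \<eta>kk) \<and>\<^sub>w \<phi> \<noteq> 0 \<and>
           del A J (delbar A J \<eta>kk) \<and>\<^sub>w \<phi> \<in> form.span {\<alpha> \<and>\<^sub>w \<beta>} \<longrightarrow>
           (\<exists>z. \<phi> = cscale z \<gamma>)"
  shows "nonvanishing_ABC_massey A J (invariant_forms A G \<Gamma>) (p, q) (r, s) (r, s) \<alpha> \<beta> \<beta>"
proof -
  note A_def = assms(1) and \<Lambda>_def = assms(2)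
  note nil = assms(7) and dim = assms(8) and J = assms(9) and inj = assms(10) and indep = assms(11)
    and span = assms(12) and lower = assms(13) and top = assms(14) and is_js = assms(15-18)
    and ls_ms = assms(19-22) and ts_vs = assms(23-26) and c = assms(27) and harm = assms(28,29)
    and nz = assms(30) and prim = assms(31,32) and \<gamma>\<beta> = assms(33) and uniq = assms(34)
  interpret smooth_lie_group G \<A>
    using nil by unfold_locales (simp add: nilmanifold_def)
  obtain U0 \<phi>0 where U0: "(U0, \<phi>0) \<in> \<A>" "\<one>\<^bsub>G\<^esub> \<in> U0" by (rule chart_ex)
  obtain \<rho> where \<rho>: "0 < \<rho>" "ball (\<phi>0 \<one>\<^bsub>G\<^esub>) \<rho> \<subseteq> \<phi>0 ` U0"
    using chartD(2)[OF U0(1)] U0(2) by (meson imageI open_contains_ball)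
  interpret invariant_coframe G \<A> U0 \<phi>0 \<rho> \<Gamma> J \<eta> k
  proof unfold_locales
    show "\<eta> j \<in> biforms (smooth_functions \<A>) J (invariant_forms (smooth_functions \<A>) G (carrier G)) 1 0" if "j \<in> {1..k}" for j
      using form.span_base[of "\<eta> j" "\<eta> ` {1..k}"] that unfolding span \<Lambda>_def A_def by blast
  qed (use nil U0 \<rho> dim J inj indep in \<open>simp_all only: nilmanifold_def A_def simp_thms\<close>)
  \<comment> \<open>For k = 0 all index lists are empty, so p = r = 0 and the length of
    \<open>ts\<close> would be -2.\<close>
  have k: "1 \<le> k"
  proof (rule ccontr)
    assume "\<not> 1 \<le> k"
    then have "is = []" "ls = []" "ts = []" using is_js(1) ls_ms(1) ts_vs(1) by simp_all
    then show False using is_js(2) ls_ms(2) ts_vs(2) by simp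
  qed
  obtain Z I where nf: "nil_frame (smooth_functions \<A>) J k E Z G \<Gamma> I"
    using ex_nil_frame[OF k] lower top unfolding A_def by blast
  \<comment> \<open>Unbarred indices come before barred ones, as in the monomials of the statement,
    so the two kinds of monomials coincide without a sign.\<close>
  define enc where "enc = (\<lambda>is js. map (\<lambda>i. (i, False)) is @ map (\<lambda>j. (j :: nat, True)) js)"
  have mono: "eta_monomial \<eta> is js = wedge_list (map E (enc is js))" for "is" js
    by (simp add: eta_monomial_def enc_def o_def)
  have enc_idx: "set is \<subseteq> {1..k} \<Longrightarrow> set js \<subseteq> {1..k} \<Longrightarrow> set (enc is js) \<subseteq> {1..k} \<times> UNIV" for "is" js
    unfolding enc_def by auto
  have enc_len: "length (enc is js) = length is + length js" "unbarred (enc is js) = length is" for "is" js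
    by (simp_all add: enc_def unbarred_def o_def)
  have fr: "frame (smooth_functions \<A>) J k E Z"
    by (rule hermitian_frame.axioms(1)[OF nil_frame.axioms(1)[OF nf]])
  have fund: "frame.\<omega>\<^sub>0 k E = fundamental_form k \<eta>" unfolding frame.\<omega>\<^sub>0_def[OF fr] by simp
  note defs = assms(1-6)
  note mass = nil_frame.nonvanishing_massey[OF nf, of "enc is js" p q "enc ls ms" r s "enc ts vs" c, folded mono, unfolded fund E_simps]
  show ?thesis
    unfolding defs
  proof (rule mass)
    show "set (enc is js) \<subseteq> {1..k} \<times> UNIV" "set (enc ls ms) \<subseteq> {1..k} \<times> UNIV" "set (enc ts vs) \<subseteq> {1..k} \<times> UNIV"
      using is_js ls_ms ts_vs by (intro enc_idx; simp only:)+
    show "length (enc is js) = p + q" "unbarred (enc is js) = p" "length (enc ls ms) = r + s" "unbarred (enc ls ms) = r"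
      "int (length (enc ts vs)) = int p + int r - 2 + (int q + int s - 2)" "int (unbarred (enc ts vs)) = int p + int r - 2"
      using is_js ls_ms ts_vs by (simp_all only: enc_len of_nat_add)
    show "c \<noteq> 0" by (rule c)
  qed (fact harm[unfolded defs] nz[unfolded defs] prim[unfolded defs] \<gamma>\<beta>[unfolded defs] uniq[unfolded defs])+
qed

end
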